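(* There exist two numerical constants $C,C'>0$ such that the following holds for every biased linear bandit problem (as described in the context) and every horizon $T\ge 2$. The regret $R_T$ of the Fair Phased Elimination algorithm run with $\delta=T^{-1}$ satisfies $$R_T \le C\left(\kappa_{*}^{1/3}T^{2/3}\log(T)^{1/3} + (d\vee \kappa_{*})\log(T) + d^2 + d\,\kappa_{*}^{-1/3}T^{1/3}\log(kT)\log(T)^{-1/3}\right),$$ and moreover $$R_T\le C'\kappa_{*}^{1/3}T^{2/3}\log(T)^{1/3}\qquad\text{whenever}\qquad T\ge \frac{\left((d\vee \kappa_* )^{3/2}\log(T)\right)\vee d^3}{\sqrt{\kappa_*}}\ \vee\ \frac{(d\log(kT))^{3}}{(\kappa_*\log(T))^{2}}.$$
   Context: **Problem (biased linear bandit).** $\mathcal X\subset\mathbb R^d$ is a finite set of $k=|\mathcal X|$ distinct actions; each $x\in\mathcal X$ has a known sensitive attribute (group) $z_x\in\{-1,1\}$. Write $a_x=\binom{x}{z_x}\in\mathbb R^{d+1}$. Both groups are nonempty and $\{a_x:x\in\mathcal X\}$ spans $\mathbb R^{d+1}$. The unknown parameter is $\theta^*=\binom{\gamma^*}{\omega^*}$ with $\gamma^*\in\mathbb R^d$, $\omega^*\in\mathbb R$, and $\max_{x\in\mathcal X}|x^\top\gamma^*|\le 1$. At each round $t\le T$ the player chooses $x_t\in\mathcal X$ and observes $y_t=x_t^\top\gamma^*+z_{x_t}\omega^*+\xi_t$, with $\xi_t$ i.i.d. $\mathcal N(0,1)$. The regret is $R_T=\mathbb E\big[\sum_{t\le T}(x^*-x_t)^\top\gamma^*\big]$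 with $x^*\in\arg\max_{x\in\mathcal X}x^\top\gamma^*$. **Notation.** $u\vee v=\max(u,v)$, $u\wedge v=\min(u,v)$; $M^+$ is a generalized inverse of $M$; $e_{d+1}$ is the last canonical basis vector of $\mathbb R^{d+1}$. For $\mu:\mathcal X\to[0,\infty)$ let $V(\mu)=\sum_x\mu(x)a_xa_x^\top$. $\mathcal M_{e_{d+1}}^{\mathcal X}$ (resp. $\mathcal P_{e_{d+1}}^{\mathcal X}$) is the set of functions $\mu:\mathcal X\to[0,\infty)$ (resp. probability measures on $\mathcal X$) with $e_{d+1}\in\mathrm{Range}(V(\mu))$. The minimal variance of the bias estimator is $\kappa_*=\min_{\pi\in\mathcal P_{e_{d+1}}^{\mathcal X}}e_{d+1}^\top V(\pi)^+e_{d+1}$. For a vector $\Delta\in(0,\infty)^{\mathcal X}$, a $\Delta$-optimal design is a minimizer of $\sum_x\mu(x)\Delta_x$ over $\mu\in\mathcal M_{e_{d+1}}^{\mathcal X}$ with $e_{d+1}^\top V(\mu)^+e_{d+1}\le1$, and $\kappa(\Delta)$ is the minimal value. **Fair Phased Elimination algorithm** (inputs $\delta,T,\mathcal X$). Set $\epsilon_l=2^{2-l}$, $\mathcal X_1^{(z)}=\{x:z_x=z\}$ for $z=\pm1$, $\widehat{z^*_1}=0$ (best group not yet identified), $\widehat\Delta^1_x=2$ for all $x$. For $l=1,2,\dots$, until $T$ rounds have been played, put by default $\widehat{z^*_{l+1}}=\widehat{z^*_l}$, $\widehat\Delta^{l+1}=\widehat\Delta^l$, and: 1. For each $z\in\{-1,1\}$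 with $z\ne-\widehat{z^*_l}$: let $\pi_l^{(z)}$ be a probability measure on $\mathcal X_l^{(z)}$, with support of size at most $(d+1)(d+2)/2$, minimizing $\max_{x\in\mathcal X_l^{(z)}}a_x^\top V(\pi)^+a_x$ among probability measures $\pi$ on $\mathcal X_l^{(z)}$ such that $a_x\in\mathrm{Range}(V(\pi))$ for all $x\in\mathcal X_l^{(z)}$. Let $\mu_l^{(z)}(x)=\big\lceil\frac{2(d+1)\pi_l^{(z)}(x)}{\epsilon_l^2}\log\frac{kl(l+1)}{\delta}\big\rceil$. If at least $\sum_x\mu_l^{(z)}(x)$ rounds remain, sample each $x\in\mathcal X_l^{(z)}$ exactly $\mu_l^{(z)}(x)$ times, compute from these samples only the least-squares estimator $\widehat\theta_l^{(z)}=V(\mu_l^{(z)})^+\sum_t y_ta_{x_t}$, and set $\mathcal X_{l+1}^{(z)}=\{x\in\mathcal X_l^{(z)}:\max_{x'\in\mathcal X_l^{(z)}}(a_{x'}-a_x)^\top\widehat\theta_l^{(z)}\le3\epsilon_l\}$. Otherwise, spend all remaining rounds on the empirically best action in $\mathcal X_l^{(z)}$. 2. If $\widehat{z^*_l}=0$: compute a $\widehat\Delta^l$-optimal design $\widehat\mu_l$ with support of size at most $d+1$, and $\kappa(\widehat\Delta^l)$. (a) (Recovery) If $\epsilon_l\le(\kappa(\widehat\Delta^l)\log(T)/T)^{1/3}$, sample the empirically best action in $\mathcal X_{l+1}^{(-1)}\cup\mathcal X_{l+1}^{(1)}$ for all remaining rounds. (b) Otherwise let $\mu_l^{(0)}(x)=\big\lceil\frac{2\widehat\mu_l(x)}{\epsilon_l^2}\log\frac{l(l+1)}{\delta}\big\rceil$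 for $x\in\mathcal X$. If fewer than $\sum_x\mu_l^{(0)}(x)$ rounds remain, spend all of them on the empirically best action in $\mathcal X_{l+1}^{(-1)}\cup\mathcal X_{l+1}^{(1)}$. Otherwise sample each $x\in\mathcal X$ exactly $\mu_l^{(0)}(x)$ times, and from these samples only compute $\widehat\omega_l^{(0)}=e_{d+1}^\top V(\mu_l^{(0)})^+\sum_ty_ta_{x_t}$. For $x\in\mathcal X_{l+1}^{(-1)}\cup\mathcal X_{l+1}^{(1)}$ let $\widehat m_{l,x}=a_x^\top\widehat\theta_l^{(z_x)}-z_x\widehat\omega_l^{(0)}$ and set $\widehat\Delta_x^{l+1}=2\wedge\big(\max_{x'\in\mathcal X_{l+1}^{(-1)}\cup\mathcal X_{l+1}^{(1)}}\widehat m_{l,x'}-\widehat m_{l,x}+4\epsilon_l\big)$. If for some $z\in\{-1,1\}$, $\max_{x\in\mathcal X_{l+1}^{(z)}}\widehat m_{l,x}-2\epsilon_l\ge\max_{x\in\mathcal X_{l+1}^{(-z)}}\widehat m_{l,x}+2\epsilon_l$, set $\widehat{z^*_{l+1}}=z$. Here "the empirically best action" of a set means an element of that set chosen as a function of past observations; the ranking rule is not specified further. *)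

theory Defs
  imports
    "HOL-Probability.Probability"
    "Jordan_Normal_Form.VS_Connect"
begin

hide_type (open) Finite_Cartesian_Product.vec
hide_const (open) Finite_Cartesian_Product.vec Finite_Cartesian_Product.mat
unbundle no inner_syntax and no vec_syntax

text \<open>
  The dimension \<open>d\<close> is a natural number and vectors are Jordan-Normal-Form vectors, because the
  constants of the theorem have to be uniform in \<open>d\<close>; with type-indexed vectors they could depend
  on the index type. Matrices and vectors are indexed from 0, so the last canonical basis vector of
  the (\<open>d + 1\<close>)-dimensional space is \<open>unit_vec (d + 1) d\<close>.
\<close>

definition mat_range :: "real mat \<Rightarrow> real vec set" where
  "mat_range M = {M *\<^sub>v u | u. u \<in> carrier_vec (dim_col M)}"

text \<open>
  An unspecified generalized inverse. It is only used in expressions of the form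
  \<open>u \<bullet> (ginv V *\<^sub>v v)\<close> with \<open>V\<close> symmetric and \<open>u\<close>, \<open>v\<close> in the range of \<open>V\<close>, whose value does not
  depend on the choice.
\<close>

definition ginv :: "real mat \<Rightarrow> real mat" where
  "ginv M = (SOME G. G \<in> carrier_mat (dim_col M) (dim_row M) \<and> M * G * M = M)"


locale action_set =
  fixes d :: nat and X :: "real vec set" and z :: "real vec \<Rightarrow> int"
begin

definition avec :: "real vec \<Rightarrow> real vec" where
  "avec x = x @\<^sub>v vec 1 (\<lambda>_. real_of_int (z x))"

abbreviation e_last :: "real vec" where
  "e_last \<equiv> unit_vec (d + 1) d"

text \<open>Weight functions on a set \<open>S\<close> of actions are extended by 0 outside \<open>S\<close>.\<close>

definition weights_on :: "real vec set \<Rightarrow> (real vec \<Rightarrow> real) set" where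
  "weights_on S = {\<mu>. (\<forall>x. \<mu> x \<ge> 0) \<and> (\<forall>x. x \<notin> S \<longrightarrow> \<mu> x = 0)}"

definition prob_on :: "real vec set \<Rightarrow> (real vec \<Rightarrow> real) set" where
  "prob_on S = {\<pi> \<in> weights_on S. (\<Sum>x\<in>S. \<pi> x) = 1}"

definition V :: "(real vec \<Rightarrow> real) \<Rightarrow> real mat" where
  "V \<mu> = mat (d + 1) (d + 1) (\<lambda>(i, j). \<Sum>x\<in>X. \<mu> x * (avec x $ i * avec x $ j))"

definition variance :: "(real vec \<Rightarrow> real) \<Rightarrow> real vec \<Rightarrow> real" where
  "variance \<mu> u = u \<bullet> (ginv (V \<mu>) *\<^sub>v u)"

definition M_e :: "(real vec \<Rightarrow> real) set" where
  "M_e = {\<mu> \<in> weights_on X. e_last \<in> mat_range (V \<mu>)}"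

definition P_e :: "(real vec \<Rightarrow> real) set" where
  "P_e = {\<pi> \<in> prob_on X. e_last \<in> mat_range (V \<pi>)}"

definition kappa_star :: real where
  "kappa_star = (INF \<pi>\<in>P_e. variance \<pi> e_last)"

definition cost :: "(real vec \<Rightarrow> real) \<Rightarrow> (real vec \<Rightarrow> real) \<Rightarrow> real" where
  "cost \<Delta> \<mu> = (\<Sum>x\<in>X. \<mu> x * \<Delta> x)"

definition feasible_designs :: "(real vec \<Rightarrow> real) set" where
  "feasible_designs = {\<mu> \<in> M_e. variance \<mu> e_last \<le> 1}"

definition Delta_optimal :: "(real vec \<Rightarrow> real) \<Rightarrow> (real vec \<Rightarrow> real) \<Rightarrow> bool" where
  "Delta_optimal \<Delta> \<mu> \<longleftrightarrow>
     \<mu> \<in> feasible_designs \<and> (\<forall>\<mu>'\<in>feasible_designs. cost \<Delta> \<mu> \<le> cost \<Delta> \<mu>')"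

definition kappa :: "(real vec \<Rightarrow> real) \<Rightarrow> real" where
  "kappa \<Delta> = (INF \<mu>\<in>feasible_designs. cost \<Delta> \<mu>)"

definition covering_designs :: "real vec set \<Rightarrow> (real vec \<Rightarrow> real) set" where
  "covering_designs S = {\<pi> \<in> prob_on S. \<forall>x\<in>S. avec x \<in> mat_range (V \<pi>)}"

definition max_variance :: "real vec set \<Rightarrow> (real vec \<Rightarrow> real) \<Rightarrow> real" where
  "max_variance S \<pi> = (MAX x\<in>S. variance \<pi> (avec x))"

definition G_optimal :: "real vec set \<Rightarrow> (real vec \<Rightarrow> real) \<Rightarrow> bool" where
  "G_optimal S \<pi> \<longleftrightarrow>
     \<pi> \<in> covering_designs S \<and>
     (\<forall>\<pi>'\<in>covering_designs S. max_variance S \<pi> \<le> max_variance S \<pi>')"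

end


text \<open>Played actions and their observations, in chronological order.\<close>

type_synonym history = "(real vec \<times> real) list"

text \<open>
  The algorithm leaves several choices open: which optimal designs are used, in which order the two
  groups are processed and the samples of a stage are taken, and which action is ``empirically
  best''. Each of them is an arbitrary function of the past observations (and of the data at hand);
  the theorem quantifies over all of them.
\<close>

record choice_rules =
  first_group :: "history \<Rightarrow> int"
  G_design :: "history \<Rightarrow> real vec set \<Rightarrow> real vec \<Rightarrow> real"
  Delta_design :: "history \<Rightarrow> (real vec \<Rightarrow> real) \<Rightarrow> real vec \<Rightarrow> real"
  schedule :: "history \<Rightarrow> (real vec \<Rightarrow> nat) \<Rightarrow> real vec list"
  best_action :: "history \<Rightarrow> real vec set \<Rightarrow> real vec"

context action_set
begin

definition valid_choices :: "choice_rules \<Rightarrow> bool" where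
  "valid_choices R \<longleftrightarrow>
     (\<forall>h. first_group R h \<in> {-1, 1}) \<and>
     (\<forall>h. \<forall>g\<in>{-1, 1}. \<forall>S. S \<noteq> {} \<and> S \<subseteq> {x\<in>X. z x = g} \<longrightarrow>
        G_optimal S (G_design R h S) \<and>
        card {x. G_design R h S x \<noteq> 0} \<le> (d + 1) * (d + 2) div 2) \<and>
     (\<forall>h. \<forall>\<Delta>\<in>X \<rightarrow>\<^sub>E {0<..}.
        Delta_optimal \<Delta> (Delta_design R h \<Delta>) \<and>
        card {x. Delta_design R h \<Delta> x \<noteq> 0} \<le> d + 1) \<and>
     (\<forall>h \<mu>. (\<forall>x. x \<notin> X \<longrightarrow> \<mu> x = 0) \<longrightarrow> (\<forall>x. count_list (schedule R h \<mu>) x = \<mu> x)) \<and>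
     (\<forall>h S. S \<noteq> {} \<and> S \<subseteq> X \<longrightarrow> best_action R h S \<in> S)"

text \<open>
  Measurability of the choices in the observed rewards, for each of the finitely many sequences
  \<open>as\<close> of played actions. Without it the expected regret would not be meaningful.
\<close>

definition measurable_choices :: "choice_rules \<Rightarrow> bool" where
  "measurable_choices R \<longleftrightarrow> (\<forall>as. set as \<subseteq> X \<longrightarrow>
     (let P = Pi\<^sub>M {..<length as} (\<lambda>_. borel :: real measure);
          H = (\<lambda>y. zip as (map y [0..<length as]))
      in (\<lambda>y. first_group R (H y)) \<in> P \<rightarrow>\<^sub>M count_space UNIV \<and>
         (\<forall>S\<subseteq>X. \<forall>x\<in>X. (\<lambda>y. G_design R (H y) S x) \<in> borel_measurable P) \<and>
         (\<forall>x\<in>X. (\<lambda>(y, \<Delta>). Delta_design R (H y) \<Delta> x) \<in>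
            borel_measurable (P \<Otimes>\<^sub>M Pi\<^sub>M X (\<lambda>_. restrict_space borel {0<..}))) \<and>
         (\<forall>\<mu>. (\<lambda>y. schedule R (H y) \<mu>) \<in> P \<rightarrow>\<^sub>M count_space UNIV) \<and>
         (\<forall>S\<subseteq>X. (\<lambda>y. best_action R (H y) S) \<in> P \<rightarrow>\<^sub>M count_space UNIV)))"

end

text \<open>
  \<open>active g\<close> is the current set of remaining actions of group \<open>g\<close>, \<open>theta g\<close> the last
  estimator computed for group \<open>g\<close>, and \<open>best_group = 0\<close> means that the best group is not yet
  identified.
\<close>

record fpe_state =
  hist :: history
  active :: "int \<Rightarrow> real vec set"
  theta :: "int \<Rightarrow> real vec"
  best_group :: int
  gaps :: "real vec \<Rightarrow> real"

text \<open>
  \<open>pull t x\<close> is the observation produced if \<open>x\<close> is played in round \<open>t\<close>, rounds being numbered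
  \<open>0, \<dots>, T - 1\<close>. The algorithm accesses it only through the rounds it actually plays.
\<close>

locale fair_phased_elimination = action_set d X z
  for d :: nat and X :: "real vec set" and z :: "real vec \<Rightarrow> int" +
  fixes \<delta> :: real and T :: nat and R :: choice_rules and pull :: "nat \<Rightarrow> real vec \<Rightarrow> real"
begin

definition eps :: "nat \<Rightarrow> real" where
  "eps l = 2 powr (2 - real l)"

definition sample :: "history \<Rightarrow> real vec list \<Rightarrow> history" where
  "sample h xs = foldl (\<lambda>h x. h @ [(x, pull (length h) x)]) h xs"

definition spend_all :: "history \<Rightarrow> real vec \<Rightarrow> history" where
  "spend_all h x = sample h (replicate (T - length h) x)"

definition least_squares :: "(real vec \<Rightarrow> nat) \<Rightarrow> history \<Rightarrow> real vec" where
  "least_squares \<mu> obs =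
     ginv (V (\<lambda>x. real (\<mu> x))) *\<^sub>v vec (d + 1) (\<lambda>i. \<Sum>(x, y)\<leftarrow>obs. y * avec x $ i)"

definition group_counts :: "nat \<Rightarrow> (real vec \<Rightarrow> real) \<Rightarrow> real vec \<Rightarrow> nat" where
  "group_counts l \<pi> x = nat \<lceil>2 * real (d + 1) * \<pi> x / (eps l)\<^sup>2
      * ln (real (card X) * real l * real (l + 1) / \<delta>)\<rceil>"

definition bias_counts :: "nat \<Rightarrow> (real vec \<Rightarrow> real) \<Rightarrow> real vec \<Rightarrow> nat" where
  "bias_counts l \<mu> x = nat \<lceil>2 * \<mu> x / (eps l)\<^sup>2 * ln (real l * real (l + 1) / \<delta>)\<rceil>"

definition group_step :: "nat \<Rightarrow> int \<Rightarrow> fpe_state \<Rightarrow> fpe_state" where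
  "group_step l g s =
     (let h = hist s; S = active s g; \<mu> = group_counts l (G_design R h S)
      in if length h + (\<Sum>x\<in>S. \<mu> x) \<le> T
         then let h' = sample h (schedule R h \<mu>);
                  \<theta> = least_squares \<mu> (drop (length h) h')
              in s\<lparr>hist := h',
                   theta := (theta s)(g := \<theta>),
                   active := (active s)(g :=
                     {x\<in>S. (MAX x'\<in>S. (avec x' - avec x) \<bullet> \<theta>) \<le> 3 * eps l})\<rparr>
         else s\<lparr>hist := spend_all h (best_action R h S)\<rparr>)"

definition bias_step :: "nat \<Rightarrow> fpe_state \<Rightarrow> fpe_state" where
  "bias_step l s =
     (let h = hist s; A = active s; S = A (-1) \<union> A 1; \<Delta> = gaps s;
          \<mu> = bias_counts l (Delta_design R h \<Delta>)
      in if eps l \<le> (kappa \<Delta> * ln (real T) / real T) powr (1/3) \<or>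
            length h + (\<Sum>x\<in>X. \<mu> x) > T
         then s\<lparr>hist := spend_all h (best_action R h S)\<rparr>
         else let h' = sample h (schedule R h \<mu>);
                  \<omega> = e_last \<bullet> least_squares \<mu> (drop (length h) h');
                  m = (\<lambda>x. avec x \<bullet> theta s (z x) - real_of_int (z x) * \<omega>);
                  best = (\<lambda>g. MAX x\<in>A g. m x);
                  leads = (\<lambda>g. best g - 2 * eps l \<ge> best (-g) + 2 * eps l)
              in s\<lparr>hist := h',
                   gaps := (\<lambda>x\<in>X. if x \<in> S
                     then min 2 ((MAX x'\<in>S. m x') - m x + 4 * eps l) else \<Delta> x),
                   best_group := (if leads 1 then 1 else if leads (-1) then -1 else 0)\<rparr>)"

definition phase :: "nat \<Rightarrow> fpe_state \<Rightarrow> fpe_state" where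
  "phase l s =
     (if length (hist s) \<ge> T then s
      else let g = first_group R (hist s);
               s' = fold (group_step l) (filter (\<lambda>g'. g' \<noteq> - best_group s) [g, -g]) s
           in if best_group s \<noteq> 0 \<or> length (hist s') \<ge> T then s' else bias_step l s')"

definition init :: fpe_state where
  "init = \<lparr>hist = [], active = (\<lambda>g. {x\<in>X. z x = g}), theta = (\<lambda>_. 0\<^sub>v (d + 1)),
           best_group = 0, gaps = (\<lambda>x\<in>X. 2)\<rparr>"

primrec run :: "nat \<Rightarrow> fpe_state" where
  "run 0 = init"
| "run (Suc n) = phase (Suc n) (run n)"

text \<open>Every phase started before the horizon plays at least one round, so \<open>T\<close> phases exhaust it.\<close>

definition action :: "nat \<Rightarrow> real vec" where
  "action t = fst (hist (run T) ! t)"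

end


locale biased_bandit = action_set d X z
  for d :: nat and X :: "real vec set" and z :: "real vec \<Rightarrow> int" +
  fixes \<gamma> :: "real vec"
  assumes finite_X: "finite X"
    and X_dim: "X \<subseteq> carrier_vec d"
    and groups: "\<And>x. x \<in> X \<Longrightarrow> z x \<in> {-1, 1}"
    and groups_nonempty: "\<exists>x\<in>X. z x = -1" "\<exists>x\<in>X. z x = 1"
    and spanning:
      "LinearCombinations.module.span class_ring (module_vec TYPE(real) (d + 1)) (avec ` X) =
       carrier_vec (d + 1)"
    and gamma_dim: "\<gamma> \<in> carrier_vec d"
    and gamma_bound: "(MAX x\<in>X. \<bar>x \<bullet> \<gamma>\<bar>) \<le> 1"

definition reward :: "(real vec \<Rightarrow> int) \<Rightarrow> real vec \<Rightarrow> real \<Rightarrow> (nat \<Rightarrow> real) \<Rightarrow> nat \<Rightarrow> real vec \<Rightarrow> real"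
  where "reward z \<gamma> \<omega> \<xi> t x = x \<bullet> \<gamma> + real_of_int (z x) * \<omega> + \<xi> t"

text \<open>
  The choices being functions of the past, the run is a function of the noise, and the regret is an
  integral over the canonical space of \<open>T\<close> independent standard normal variables.
\<close>

definition noise :: "nat \<Rightarrow> (nat \<Rightarrow> real) measure" where
  "noise T = Pi\<^sub>M {..<T} (\<lambda>_. density lborel (\<lambda>x. ennreal (std_normal_density x)))"

definition regret ::
  "nat \<Rightarrow> real vec set \<Rightarrow> (real vec \<Rightarrow> int) \<Rightarrow> real vec \<Rightarrow> real \<Rightarrow> real \<Rightarrow> nat \<Rightarrow> choice_rules \<Rightarrow> real"
  where
  "regret d X z \<gamma> \<omega> \<delta> T R =
     (LINT \<xi>|noise T. (\<Sum>t<T. (MAX x\<in>X. x \<bullet> \<gamma>)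
        - fair_phased_elimination.action d X z \<delta> T R (reward z \<gamma> \<omega> \<xi>) t \<bullet> \<gamma>))"

end

theory Submission
  imports Defs
begin

text \<open>
  Why the bounds hold. Up to an event of probability \<open>4 / T\<close>, on which the regret is at most
  \<open>2 T\<close>, every least-squares estimate computed in phase \<open>l\<close> is within \<open>eps l\<close> of its target.
  The remaining argument is deterministic: on a run with accurate estimates, the regret of each stage
  is added up. The lemmas \<open>failure_prob\<close>, \<open>accurate_outside_failure\<close> and \<open>accurate_run_regret\<close>
  carry these three facts, and \<open>regret_le\<close> puts them together.

  Designs. For a weighted Gram matrix \<open>V\<close>, the statement that \<open>u\<close> is in the range of \<open>V\<close> and
  \<open>u \<bullet> V\<^sup>+ u \<le> c\<close> means that \<open>(u \<bullet> v)\<^sup>2 \<le> c * (v \<bullet> V v)\<close> for all \<open>v\<close>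
  (\<open>gram_variance_iff\<close>). The right-hand side is monotone and homogeneous in the weights, so it
  survives the rounding of a design to integer sample sizes, and the choice of the generalized inverse
  disappears. The theorem of Kiefer and Wolfowitz in the form needed here, that some design has all
  variances at most \<open>n\<close> in dimension \<open>n\<close>, comes from maximising the absolute determinant of the
  Gram matrix over the simplex.

  Concentration. The error of an estimate is \<open>\<Sum>t<T. c t * \<xi> t\<close>, where \<open>c t\<close> depends only on the
  noise before round \<open>t\<close>, and \<open>\<Sum>t<T. (c t)\<^sup>2\<close> is the variance of the design, which is bounded for
  all observations. The exponential martingale of such a sum gives the Gaussian tail
  (\<open>two_sided_tail\<close>), although the sampled actions and their number are random. For this the state
  before a stage has to be a causal and measurable function of the noise (\<open>causal_run\<close>,
  \<open>meas_run\<close>).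

  Regret of accurate runs. A remaining action in phase \<open>l\<close> has a gap of order \<open>eps l\<close>, so the two
  group stages of phase \<open>l\<close> cost order \<open>d\<^sup>2 * eps l + d * log (k T) / eps l\<close>. Both terms form
  geometric sums over the phases. The first sum is of order \<open>d\<^sup>2\<close>; the second one is dominated by its
  last term, hence of order \<open>sqrt (d * T * log (k T))\<close>, since a completed stage of phase \<open>l\<close> has played
  at least \<open>d * log (k T) / (eps l)\<^sup>2\<close> of the \<open>T\<close> rounds, up to a constant factor. The bias stage of
  phase \<open>l\<close> costs order
  \<open>d + log T * \<kappa> (\<Delta> + eps l) / (eps l)\<^sup>2\<close>, where \<open>\<Delta>\<close> are the true gaps: the estimated gaps of
  the algorithm and \<open>\<Delta> + eps l\<close> agree up to constant factors, and \<open>\<kappa>\<close> is monotone and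
  homogeneous. Halving \<open>e\<close> at most halves \<open>\<kappa> (\<Delta> + e)\<close>, so \<open>\<kappa> (\<Delta> + e) / e\<^sup>2\<close> at least doubles from
  one phase to the next and all bias stages together cost as much as the last one. The recovery rule
  allows a bias stage only while \<open>\<kappa> * log T / T < e\<^sup>3\<close>, which together with \<open>\<kappa> \<le> const * \<kappa>\<^sub>*\<close> bounds this
  cost by the main term \<open>(\<kappa>\<^sub>* * T\<^sup>2 * log T) powr (1/3)\<close>. When recovery starts, the remaining actions have
  gaps of order \<open>e \<le> (\<kappa> * log T / T) powr (1/3)\<close>, and \<open>T\<close> rounds cost again the main term.

  Finally \<open>d * T * log (k T)\<close> is the product of the main term and of the last term of the first bound, so
  that \<open>sqrt (d * T * log (k T))\<close> is at most of the order of their sum (\<open>sqrt_term_le\<close>); and the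
  condition on the horizon in the second bound says, after taking cubes, that the main term dominates.
\<close>

section \<open>Weighted Gram matrices\<close>

definition gram :: "nat \<Rightarrow> 'i set \<Rightarrow> ('i \<Rightarrow> real vec) \<Rightarrow> ('i \<Rightarrow> real) \<Rightarrow> real mat" where
  "gram n I b p = mat n n (\<lambda>(i, j). \<Sum>k\<in>I. p k * (b k $ i * b k $ j))"

lemma gram_carrier [simp, intro]: "gram n I b p \<in> carrier_mat n n"
  by (simp add: gram_def)

lemma gram_dims [simp]: "dim_row (gram n I b p) = n" "dim_col (gram n I b p) = n"
  by (simp_all add: gram_def)

lemma gram_mult_index:
  assumes "v \<in> carrier_vec n" "i < n" "\<And>k. k \<in> I \<Longrightarrow> b k \<in> carrier_vec n"
  shows "(gram n I b p *\<^sub>v v) $ i = (\<Sum>k\<in>I. p k * (b k \<bullet> v) * b k $ i)"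
proof -
  have "(gram n I b p *\<^sub>v v) $ i = (\<Sum>j<n. (\<Sum>k\<in>I. p k * (b k $ i * b k $ j)) * v $ j)"
    using assms by (simp add: gram_def scalar_prod_def lessThan_atLeast0)
  also have "\<dots> = (\<Sum>j<n. \<Sum>k\<in>I. p k * b k $ i * (b k $ j * v $ j))"
    by (simp add: sum_distrib_right sum_distrib_left mult_ac)
  also have "\<dots> = (\<Sum>k\<in>I. \<Sum>j<n. p k * b k $ i * (b k $ j * v $ j))"
    by (rule sum.swap)
  also have "\<dots> = (\<Sum>k\<in>I. p k * (b k \<bullet> v) * b k $ i)"
    using assms(1,3)
    by (intro sum.cong refl) (simp add: scalar_prod_def lessThan_atLeast0 sum_distrib_left mult_ac)
  finally show ?thesis .
qed

lemma gram_form: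
  assumes "u \<in> carrier_vec n" "v \<in> carrier_vec n" "\<And>k. k \<in> I \<Longrightarrow> b k \<in> carrier_vec n"
  shows "u \<bullet> (gram n I b p *\<^sub>v v) = (\<Sum>k\<in>I. p k * (b k \<bullet> u) * (b k \<bullet> v))"
proof -
  have "u \<bullet> (gram n I b p *\<^sub>v v) = (\<Sum>i<n. u $ i * (gram n I b p *\<^sub>v v) $ i)"
    by (simp add: scalar_prod_def lessThan_atLeast0)
  also have "\<dots> = (\<Sum>i<n. u $ i * (\<Sum>k\<in>I. p k * (b k \<bullet> v) * b k $ i))"
    using assms(2,3) by (intro sum.cong refl) (simp add: gram_mult_index del: index_mult_mat_vec)
  also have "\<dots> = (\<Sum>i<n. \<Sum>k\<in>I. p k * (b k \<bullet> v) * (b k $ i * u $ i))"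
    by (simp add: sum_distrib_left mult_ac)
  also have "\<dots> = (\<Sum>k\<in>I. \<Sum>i<n. p k * (b k \<bullet> v) * (b k $ i * u $ i))"
    by (rule sum.swap)
  also have "\<dots> = (\<Sum>k\<in>I. p k * (b k \<bullet> u) * (b k \<bullet> v))"
    using assms(1)
    by (intro sum.cong refl) (simp add: scalar_prod_def lessThan_atLeast0 sum_distrib_left mult_ac)
  finally show ?thesis .
qed

lemma gram_sym:
  assumes "u \<in> carrier_vec n" "v \<in> carrier_vec n" "\<And>k. k \<in> I \<Longrightarrow> b k \<in> carrier_vec n"
  shows "u \<bullet> (gram n I b p *\<^sub>v v) = v \<bullet> (gram n I b p *\<^sub>v u)"
  using assms by (simp add: gram_form mult_ac)

lemma vec_eq_of_scalar_prods:
  fixes u w :: "real vec"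
  assumes "u \<in> carrier_vec n" "w \<in> carrier_vec n"
    and "\<And>x. x \<in> carrier_vec n \<Longrightarrow> x \<bullet> u = x \<bullet> w"
  shows "u = w"
proof (rule eq_vecI)
  show "dim_vec u = dim_vec w" using assms by simp
  fix i assume i: "i < dim_vec w"
  then have "unit_vec n i \<bullet> u = unit_vec n i \<bullet> w" using assms by simp
  then show "u $ i = w $ i" using i assms(1,2) by simp
qed

definition outer :: "nat \<Rightarrow> real vec \<Rightarrow> real vec \<Rightarrow> real mat" where
  "outer n u v = mat n n (\<lambda>(i, j). u $ i * v $ j)"

lemma outer_carrier [simp, intro]: "outer n u v \<in> carrier_mat n n"
  by (simp add: outer_def)

lemma outer_mult:
  assumes "u \<in> carrier_vec n" "v \<in> carrier_vec n" "y \<in> carrier_vec n"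
  shows "outer n u v *\<^sub>v y = (v \<bullet> y) \<cdot>\<^sub>v u"
proof (rule eq_vecI)
  show "dim_vec (outer n u v *\<^sub>v y) = dim_vec ((v \<bullet> y) \<cdot>\<^sub>v u)"
    using assms by (simp add: outer_def)
  fix i assume "i < dim_vec ((v \<bullet> y) \<cdot>\<^sub>v u)"
  then show "(outer n u v *\<^sub>v y) $ i = ((v \<bullet> y) \<cdot>\<^sub>v u) $ i"
    using assms by (simp add: outer_def scalar_prod_def sum_distrib_right sum_distrib_left mult_ac)
qed

lemma scalar_prod_self_eq_0:
  fixes r :: "real vec"
  assumes "r \<in> carrier_vec n" "r \<bullet> r = 0" shows "r = 0\<^sub>v n"
proof (rule eq_vecI)
  have "(\<Sum>i<n. r $ i * r $ i) = 0"
    using assms by (simp add: scalar_prod_def lessThan_atLeast0)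
  then have "\<forall>i\<in>{..<n}. r $ i * r $ i = 0"
    by (subst (asm) sum_nonneg_eq_0_iff) auto
  then show "r $ i = 0\<^sub>v n $ i" if "i < dim_vec (0\<^sub>v n)" for i using that by auto
qed (use assms in auto)

lemma vec_add_smult_cancel:
  fixes q b :: "real vec"
  assumes "q \<in> carrier_vec n" "b \<in> carrier_vec n"
  shows "q + x \<cdot>\<^sub>v b + (- x) \<cdot>\<^sub>v b = q"
  using assms by (intro eq_vecI) auto

lemma vec_add_zero_smult:
  fixes q b :: "real vec"
  assumes "q \<in> carrier_vec n" "b \<in> carrier_vec n"
  shows "q + 0 \<cdot>\<^sub>v b = q"
  using assms by (intro eq_vecI) auto

lemma gram_insert_mult:
  assumes "finite I" "k \<notin> I" "b k \<in> carrier_vec n" "\<And>k. k \<in> I \<Longrightarrow> b k \<in> carrier_vec n"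
    and w: "w \<in> carrier_vec n"
  shows "gram n (insert k I) b p *\<^sub>v w = gram n I b p *\<^sub>v w + (p k * (b k \<bullet> w)) \<cdot>\<^sub>v b k"
proof (rule eq_vecI)
  show "dim_vec (gram n (insert k I) b p *\<^sub>v w) =
    dim_vec (gram n I b p *\<^sub>v w + (p k * (b k \<bullet> w)) \<cdot>\<^sub>v b k)" using assms by simp
  fix i assume "i < dim_vec (gram n I b p *\<^sub>v w + (p k * (b k \<bullet> w)) \<cdot>\<^sub>v b k)"
  then have i: "i < n" using assms by simp
  have bk: "b j \<in> carrier_vec n" if "j \<in> insert k I" for j using that assms by auto
  have "(gram n (insert k I) b p *\<^sub>v w) $ i = (\<Sum>k\<in>insert k I. p k * (b k \<bullet> w) * b k $ i)"
    by (rule gram_mult_index[OF w i bk])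
  also have "\<dots> = p k * (b k \<bullet> w) * b k $ i + (\<Sum>k\<in>I. p k * (b k \<bullet> w) * b k $ i)"
    using assms(1,2) by simp
  also have "(\<Sum>k\<in>I. p k * (b k \<bullet> w) * b k $ i) = (gram n I b p *\<^sub>v w) $ i"
    by (rule gram_mult_index[OF w i, symmetric]) (use assms in auto)
  also have "p k * (b k \<bullet> w) * b k $ i + (gram n I b p *\<^sub>v w) $ i =
      (gram n I b p *\<^sub>v w + (p k * (b k \<bullet> w)) \<cdot>\<^sub>v b k) $ i"
    using assms i by simp
  finally show "(gram n (insert k I) b p *\<^sub>v w) $ i =
      (gram n I b p *\<^sub>v w + (p k * (b k \<bullet> w)) \<cdot>\<^sub>v b k) $ i" .
qed

text \<open>
  The generalized inverse is built one summand at a time. Adding \<open>c * a a\<^sup>T\<close> to \<open>V\<close> is a rank-one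
  update: if \<open>a\<close> is in the range of \<open>V\<close>, the formula of Sherman and Morrison applies; otherwise there is
  a vector \<open>v\<close> in the kernel of \<open>V\<close> with \<open>v \<bullet> a = 1\<close>, and the update uses \<open>v\<close> to solve for the
  coefficient of \<open>a\<close>. This avoids spectral theory, and it makes \<open>ginv\<close> meaningful for Gram matrices.
\<close>

lemma gram_ginverse_exists:
  assumes "finite I" "\<And>k. k \<in> I \<Longrightarrow> b k \<in> carrier_vec n" "\<And>k. k \<in> I \<Longrightarrow> 0 \<le> p k"
  shows "\<exists>G\<in>carrier_mat n n. \<forall>w\<in>carrier_vec n.
    gram n I b p *\<^sub>v (G *\<^sub>v (gram n I b p *\<^sub>v w)) = gram n I b p *\<^sub>v w"
  using assms
proof (induction I rule: finite_induct)
  case empty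
  have "gram n {} b p *\<^sub>v w = 0\<^sub>v n" if "w \<in> carrier_vec n" for w
  proof (rule eq_vecI)
    fix i assume "i < dim_vec (0\<^sub>v n)"
    then show "(gram n {} b p *\<^sub>v w) $ i = 0\<^sub>v n $ i"
      using gram_mult_index[of w n i "{}" b p] that by simp
  qed simp
  moreover have "0\<^sub>m n n *\<^sub>v 0\<^sub>v n = (0\<^sub>v n :: real vec)"
    by (intro eq_vecI) auto
  ultimately show ?case by (intro bexI[of _ "0\<^sub>m n n"]) (auto simp del: index_mult_mat_vec)
next
  case (insert k I)
  define V where "V = gram n I b p"
  define W where "W = gram n (insert k I) b p"
  define a where "a = b k"
  define c where "c = p k"
  have a: "a \<in> carrier_vec n" and c0: "0 \<le> c" using insert by (auto simp: a_def c_def)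
  have bI: "\<And>j. j \<in> I \<Longrightarrow> b j \<in> carrier_vec n" using insert by auto
  have V: "V \<in> carrier_mat n n" by (simp add: V_def)
  have Ww: "W *\<^sub>v w = V *\<^sub>v w + (c * (a \<bullet> w)) \<cdot>\<^sub>v a" if "w \<in> carrier_vec n" for w
    unfolding W_def V_def c_def a_def
    by (rule gram_insert_mult) (use insert that in auto)
  have Vsym: "x \<bullet> (V *\<^sub>v y) = y \<bullet> (V *\<^sub>v x)" if "x \<in> carrier_vec n" "y \<in> carrier_vec n" for x y
    unfolding V_def by (rule gram_sym) (use that bI in auto)
  have Vpos: "0 \<le> x \<bullet> (V *\<^sub>v x)" if "x \<in> carrier_vec n" for x
    unfolding V_def using that bI insert.prems
    by (subst gram_form) (auto intro!: sum_nonneg simp: mult.assoc)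
  from insert obtain G where G: "G \<in> carrier_mat n n"
    and VGV: "\<And>w. w \<in> carrier_vec n \<Longrightarrow> V *\<^sub>v (G *\<^sub>v (V *\<^sub>v w)) = V *\<^sub>v w"
    unfolding V_def by (metis insert_iff)
  have Gc: "G *\<^sub>v w \<in> carrier_vec n" if "w \<in> carrier_vec n" for w using that G by auto
  have Vc: "V *\<^sub>v w \<in> carrier_vec n" if "w \<in> carrier_vec n" for w using that V by auto
  have Vadd: "V *\<^sub>v (x + y) = V *\<^sub>v x + V *\<^sub>v y" if "x \<in> carrier_vec n" "y \<in> carrier_vec n" for x y
    using mult_add_distrib_mat_vec[OF V] that by auto
  have Vsc: "V *\<^sub>v (t \<cdot>\<^sub>v x) = t \<cdot>\<^sub>v (V *\<^sub>v x)" if "x \<in> carrier_vec n" for x t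
    using mult_mat_vec[OF V] that by auto
  have Gadd: "G *\<^sub>v (x + y) = G *\<^sub>v x + G *\<^sub>v y" if "x \<in> carrier_vec n" "y \<in> carrier_vec n" for x y
    using mult_add_distrib_mat_vec[OF G] that by auto
  have Gsc: "G *\<^sub>v (t \<cdot>\<^sub>v x) = t \<cdot>\<^sub>v (G *\<^sub>v x)" if "x \<in> carrier_vec n" for x t
    using mult_mat_vec[OF G] that by auto
  have "\<exists>G'\<in>carrier_mat n n. \<forall>w\<in>carrier_vec n. W *\<^sub>v (G' *\<^sub>v (W *\<^sub>v w)) = W *\<^sub>v w"
  proof (cases "V *\<^sub>v (G *\<^sub>v a) = a")
    case True
    define b where "b = G *\<^sub>v a"
    have b: "b \<in> carrier_vec n" and Vb: "V *\<^sub>v b = a" using True a Gc by (auto simp: b_def)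
    define s where "s = a \<bullet> b"
    have s_eq: "s = b \<bullet> (V *\<^sub>v b)" unfolding s_def Vb using a b by (simp add: comm_scalar_prod)
    then have s0: "0 \<le> s" using Vpos[OF b] by simp
    \<comment> \<open>The update of Sherman and Morrison.\<close>
    define G' where "G' = G + outer n ((- c / (1 + c * s)) \<cdot>\<^sub>v b) b"
    have G': "G' \<in> carrier_mat n n" unfolding G'_def using G by auto
    have "W *\<^sub>v (G' *\<^sub>v (W *\<^sub>v w)) = W *\<^sub>v w" if w: "w \<in> carrier_vec n" for w
    proof -
      define r where "r = a \<bullet> w"
      define y where "y = V *\<^sub>v w + (c * r) \<cdot>\<^sub>v a"
      have y: "y \<in> carrier_vec n" unfolding y_def using a w Vc by auto
      have bV: "b \<bullet> (V *\<^sub>v w) = r"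
        using Vsym[OF b w] w a by (simp add: Vb r_def comm_scalar_prod)
      have "b \<bullet> y = r + c * r * s" unfolding y_def
        using a b w Vc[OF w] by (simp add: scalar_prod_add_distrib[of _ n] bV s_def comm_scalar_prod[OF b a])
      then have by': "b \<bullet> y = (1 + c * s) * r" by (simp add: algebra_simps)
      have nz: "1 + c * s \<noteq> 0" using c0 s0 by (smt (verit) mult_nonneg_nonneg)
      have "G' *\<^sub>v y = G *\<^sub>v y + (b \<bullet> y) \<cdot>\<^sub>v ((- c / (1 + c * s)) \<cdot>\<^sub>v b)"
        unfolding G'_def using b y G by (subst add_mult_distrib_mat_vec[of _ n n]) (auto simp: outer_mult)
      also have "G *\<^sub>v y = G *\<^sub>v (V *\<^sub>v w) + (c * r) \<cdot>\<^sub>v b"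
        using Gadd[OF Vc[OF w], of "(c * r) \<cdot>\<^sub>v a"] Gsc[OF a] a by (simp add: y_def b_def)
      also have "(b \<bullet> y) \<cdot>\<^sub>v ((- c / (1 + c * s)) \<cdot>\<^sub>v b) = (- (c * r)) \<cdot>\<^sub>v b"
        unfolding by' smult_smult_assoc using nz by (simp add: mult.commute)
      also have "G *\<^sub>v (V *\<^sub>v w) + (c * r) \<cdot>\<^sub>v b + (- (c * r)) \<cdot>\<^sub>v b = G *\<^sub>v (V *\<^sub>v w)"
        by (rule vec_add_smult_cancel) (use b Gc[OF Vc[OF w]] in auto)
      finally have Gy: "G' *\<^sub>v y = G *\<^sub>v (V *\<^sub>v w)" .
      have "a \<bullet> (G *\<^sub>v (V *\<^sub>v w)) = b \<bullet> (V *\<^sub>v (G *\<^sub>v (V *\<^sub>v w)))"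
        using Vsym[OF b Gc[OF Vc[OF w]]] comm_scalar_prod[OF a Gc[OF Vc[OF w]]] by (simp add: Vb)
      also have "\<dots> = r" using bV VGV w by simp
      finally have "W *\<^sub>v (G *\<^sub>v (V *\<^sub>v w)) = y"
        using Ww[of "G *\<^sub>v (V *\<^sub>v w)"] w Gc Vc VGV by (simp add: y_def)
      then show ?thesis using Ww[OF w] Gy by (simp add: y_def r_def)
    qed
    then show ?thesis using G' by blast
  next
    case False
    define r where "r = a - V *\<^sub>v (G *\<^sub>v a)"
    have r: "r \<in> carrier_vec n" unfolding r_def using a Gc Vc by auto
    define f where "f = r \<bullet> r"
    have f0: "f \<noteq> 0"
    proof
      assume "f = 0"
      then have "r = 0\<^sub>v n" using scalar_prod_self_eq_0 r f_def by auto
      then have "a $ i - (V *\<^sub>v (G *\<^sub>v a)) $ i = 0" if "i < n" for i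
        using that a V G unfolding r_def by (metis carrier_matD(1) dim_mult_mat_vec index_minus_vec(1) index_zero_vec(1))
      then have "V *\<^sub>v (G *\<^sub>v a) = a" using a V by (intro eq_vecI) auto
      then show False using False by simp
    qed
    \<comment> \<open>\<open>r\<close> is the part of \<open>a\<close> outside the range of \<open>V\<close>; correcting it by \<open>G\<^sup>T V r\<close> and scaling gives a vector \<open>v\<close> in the kernel of \<open>V\<close> with \<open>v \<bullet> a = 1\<close>.\<close>
    define u where "u = r - transpose_mat G *\<^sub>v (V *\<^sub>v r)"
    define v where "v = (1 / f) \<cdot>\<^sub>v u"
    have GT: "transpose_mat G *\<^sub>v w \<in> carrier_vec n" if "w \<in> carrier_vec n" for w using that G by auto
    have u: "u \<in> carrier_vec n" unfolding u_def using r GT Vc by auto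
    have v: "v \<in> carrier_vec n" unfolding v_def using u by auto
    have ux: "u \<bullet> x = r \<bullet> x - r \<bullet> (V *\<^sub>v (G *\<^sub>v x))" if x: "x \<in> carrier_vec n" for x
    proof -
      have "(transpose_mat G *\<^sub>v (V *\<^sub>v r)) \<bullet> x = (V *\<^sub>v r) \<bullet> (G *\<^sub>v x)"
        by (rule transpose_vec_mult_scalar[OF G x Vc[OF r]])
      also have "\<dots> = r \<bullet> (V *\<^sub>v (G *\<^sub>v x))"
        using Vsym[OF r Gc[OF x]] comm_scalar_prod[OF Vc[OF r] Gc[OF x]] by simp
      finally show ?thesis unfolding u_def
        using minus_scalar_prod_distrib[OF r GT[OF Vc[OF r]] x] by simp
    qed
    have uV: "u \<bullet> (V *\<^sub>v x) = 0" if "x \<in> carrier_vec n" for x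
      using ux[OF Vc[OF that]] VGV[OF that] by simp
    have "u \<bullet> a = r \<bullet> a - r \<bullet> (V *\<^sub>v (G *\<^sub>v a))" by (rule ux[OF a])
    also have "\<dots> = f" unfolding f_def
      using scalar_prod_minus_distrib[OF r a Vc[OF Gc[OF a]]] by (simp add: r_def)
    finally have "u \<bullet> a = f" .
    then have va: "v \<bullet> a = 1" unfolding v_def using u a f0 by simp
    have vV: "v \<bullet> (V *\<^sub>v x) = 0" if "x \<in> carrier_vec n" for x
      unfolding v_def using uV[OF that] u Vc[OF that] by simp
    have Vv: "V *\<^sub>v v = 0\<^sub>v n"
      by (rule vec_eq_of_scalar_prods[of _ n]) (use vV Vsym v Vc in auto)
    show ?thesis
    proof (cases "c = 0")
      case True
      have "W *\<^sub>v w = V *\<^sub>v w" if "w \<in> carrier_vec n" for w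
        using Ww[OF that] True vec_add_zero_smult[OF Vc[OF that] a] by simp
      then show ?thesis using VGV G Gc Vc by (intro bexI[of _ G]) (auto simp del: index_mult_mat_vec)
    next
      case False
      \<comment> \<open>The update reads the coefficient of \<open>a\<close> off with \<open>v\<close>; the constant \<open>g\<close> makes the result satisfy the equation in the direction \<open>a\<close> as well.\<close>
      define g where "g = a \<bullet> (G *\<^sub>v a) + 1 / c"
      define G' where "G' = G + (outer n v (g \<cdot>\<^sub>v v) + (outer n (G *\<^sub>v a) (- 1 \<cdot>\<^sub>v v)
        + outer n (- 1 \<cdot>\<^sub>v v) (transpose_mat G *\<^sub>v a)))"
      have G': "G' \<in> carrier_mat n n" unfolding G'_def using G by auto
      have "W *\<^sub>v (G' *\<^sub>v (W *\<^sub>v w)) = W *\<^sub>v w" if w: "w \<in> carrier_vec n" for w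
      proof -
        define t where "t = a \<bullet> w"
        define y where "y = V *\<^sub>v w + (c * t) \<cdot>\<^sub>v a"
        have y: "y \<in> carrier_vec n" unfolding y_def using a w Vc by auto
        define q where "q = G *\<^sub>v (V *\<^sub>v w)"
        have q: "q \<in> carrier_vec n" unfolding q_def using w Gc Vc by auto
        have vy: "v \<bullet> y = c * t"
          unfolding y_def using v a w Vc[OF w] by (simp add: scalar_prod_add_distrib[of _ n] vV va)
        have Gy: "G *\<^sub>v y = q + (c * t) \<cdot>\<^sub>v (G *\<^sub>v a)"
          unfolding y_def q_def using a w Vc by (simp add: Gadd Gsc)
        have "(transpose_mat G *\<^sub>v a) \<bullet> y = a \<bullet> (G *\<^sub>v y)"
          by (rule transpose_vec_mult_scalar[OF G y a])
        also have "\<dots> = a \<bullet> q + c * t * (a \<bullet> (G *\<^sub>v a))"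
          unfolding Gy using a q Gc[OF a] by (simp add: scalar_prod_add_distrib[of _ n])
        finally have GTy: "(transpose_mat G *\<^sub>v a) \<bullet> y = a \<bullet> q + c * t * (a \<bullet> (G *\<^sub>v a))" .
        have "G' *\<^sub>v y = G *\<^sub>v y + (((g \<cdot>\<^sub>v v) \<bullet> y) \<cdot>\<^sub>v v + (((- 1 \<cdot>\<^sub>v v) \<bullet> y) \<cdot>\<^sub>v (G *\<^sub>v a)
            + ((transpose_mat G *\<^sub>v a) \<bullet> y) \<cdot>\<^sub>v (- 1 \<cdot>\<^sub>v v)))"
        proof -
          have dist: "(A + B) *\<^sub>v y = A *\<^sub>v y + B *\<^sub>v y"
            if "A \<in> carrier_mat n n" "B \<in> carrier_mat n n" for A B :: "real mat"
            using add_mult_distrib_mat_vec[OF that y] .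
          have c: "g \<cdot>\<^sub>v v \<in> carrier_vec n" "- 1 \<cdot>\<^sub>v v \<in> carrier_vec n" using v by auto
          show ?thesis
            unfolding G'_def
            using y G v c Gc[OF a] GT[OF a]
            by (simp only: dist outer_carrier add_carrier_mat outer_mult)
        qed
        also have "\<dots> = q + (c * t) \<cdot>\<^sub>v (G *\<^sub>v a) + ((g * (c * t)) \<cdot>\<^sub>v v + ((- (c * t)) \<cdot>\<^sub>v (G *\<^sub>v a)
            + (a \<bullet> q + c * t * (a \<bullet> (G *\<^sub>v a))) \<cdot>\<^sub>v (- 1 \<cdot>\<^sub>v v)))"
          using v y vy unfolding GTy Gy by simp
        also have "\<dots> = q + (t - a \<bullet> q) \<cdot>\<^sub>v v"
        proof -
          have "q + x \<cdot>\<^sub>v h + ((g * x) \<cdot>\<^sub>v v + ((- x) \<cdot>\<^sub>v h + e \<cdot>\<^sub>v (- 1 \<cdot>\<^sub>v v)))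
              = q + (g * x - e) \<cdot>\<^sub>v v" if "h \<in> carrier_vec n" for x e h
            using q v that by (intro eq_vecI) (auto simp: algebra_simps)
          moreover have "g * (c * t) - (a \<bullet> q + c * t * (a \<bullet> (G *\<^sub>v a))) = t - a \<bullet> q"
            unfolding g_def using False by (simp add: field_simps)
          ultimately show ?thesis using Gc[OF a] by (simp only:)
        qed
        finally have G'y: "G' *\<^sub>v y = q + (t - a \<bullet> q) \<cdot>\<^sub>v v" .
        have c1: "q + (t - a \<bullet> q) \<cdot>\<^sub>v v \<in> carrier_vec n" using q v by auto
        have e1: "V *\<^sub>v (q + (t - a \<bullet> q) \<cdot>\<^sub>v v) = V *\<^sub>v w"
        proof -
          have "x \<cdot>\<^sub>v 0\<^sub>v n = (0\<^sub>v n :: real vec)" for x by (intro eq_vecI) auto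
          then show ?thesis
            using Vadd[OF q, of "(t - a \<bullet> q) \<cdot>\<^sub>v v"] Vsc[OF v] v Vv VGV[OF w] Vc[OF w]
            by (simp add: q_def)
        qed
        have e2: "a \<bullet> (q + (t - a \<bullet> q) \<cdot>\<^sub>v v) = t"
          using a q v va comm_scalar_prod[OF a v] by (simp add: scalar_prod_add_distrib[of _ n])
        have "W *\<^sub>v (G' *\<^sub>v y) = y"
          unfolding G'y Ww[OF c1] e1 e2 by (simp only: y_def)
        then show ?thesis using Ww[OF w] by (simp add: y_def t_def)
      qed
      then show ?thesis using G' by blast
    qed
  qed
  then show ?case unfolding W_def .
qed

lemma ginv_gram:
  assumes "finite I" "\<And>k. k \<in> I \<Longrightarrow> b k \<in> carrier_vec n" "\<And>k. k \<in> I \<Longrightarrow> 0 \<le> p k"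
  shows "ginv (gram n I b p) \<in> carrier_mat n n"
    and "\<And>w. w \<in> carrier_vec n \<Longrightarrow>
      gram n I b p *\<^sub>v (ginv (gram n I b p) *\<^sub>v (gram n I b p *\<^sub>v w)) = gram n I b p *\<^sub>v w"
proof -
  let ?V = "gram n I b p"
  obtain G where G: "G \<in> carrier_mat n n"
    and VGV: "\<And>w. w \<in> carrier_vec n \<Longrightarrow> ?V *\<^sub>v (G *\<^sub>v (?V *\<^sub>v w)) = ?V *\<^sub>v w"
  proof -
    have "\<exists>G\<in>carrier_mat n n. \<forall>w\<in>carrier_vec n. ?V *\<^sub>v (G *\<^sub>v (?V *\<^sub>v w)) = ?V *\<^sub>v w"
      by (rule gram_ginverse_exists) (use assms in auto)
    then show ?thesis using that by blast
  qed
  have "?V * G * ?V = ?V"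
  proof (rule eq_matI)
    fix i j assume ij: "i < dim_row ?V" "j < dim_col ?V"
    have "(?V * G * ?V) *\<^sub>v unit_vec n j = ?V *\<^sub>v unit_vec n j"
    proof -
      have e: "unit_vec n j \<in> carrier_vec n" and Vn: "?V \<in> carrier_mat n n" and VG: "?V * G \<in> carrier_mat n n"
        by (auto intro: mult_carrier_mat[OF gram_carrier G])
      have "(?V * G * ?V) *\<^sub>v unit_vec n j = (?V * G) *\<^sub>v (?V *\<^sub>v unit_vec n j)"
        by (rule assoc_mult_mat_vec[OF VG Vn e])
      also have "\<dots> = ?V *\<^sub>v (G *\<^sub>v (?V *\<^sub>v unit_vec n j))"
        by (rule assoc_mult_mat_vec[OF Vn G]) (use Vn e in \<open>metis mult_mat_vec_carrier\<close>)
      finally show ?thesis using VGV[OF e] by simp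
    qed
    then have "((?V * G * ?V) *\<^sub>v unit_vec n j) $ i = (?V *\<^sub>v unit_vec n j) $ i" by simp
    moreover have entry: "(A *\<^sub>v unit_vec n j) $ i = A $$ (i, j)" if "A \<in> carrier_mat n n" for A :: "real mat"
      using ij that by simp
    moreover have VGVc: "?V * G * ?V \<in> carrier_mat n n"
      by (intro mult_carrier_mat[of _ n n _ n] gram_carrier G)
    ultimately show "(?V * G * ?V) $$ (i, j) = ?V $$ (i, j)"
      using entry[OF VGVc] entry[OF gram_carrier] by (simp only:)
  qed (use G in auto)
  then have "\<exists>G. G \<in> carrier_mat (dim_col ?V) (dim_row ?V) \<and> ?V * G * ?V = ?V"
    using G by auto
  then have gi: "ginv ?V \<in> carrier_mat (dim_col ?V) (dim_row ?V) \<and> ?V * ginv ?V * ?V = ?V"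
    unfolding ginv_def by (rule someI_ex)
  then show 1: "ginv ?V \<in> carrier_mat n n" by simp
  show "?V *\<^sub>v (ginv ?V *\<^sub>v (?V *\<^sub>v w)) = ?V *\<^sub>v w" if w: "w \<in> carrier_vec n" for w
  proof -
    have V: "?V \<in> carrier_mat n n" by simp
    have VG: "?V * ginv ?V \<in> carrier_mat n n" by (rule mult_carrier_mat[OF V 1])
    have Vw: "?V *\<^sub>v w \<in> carrier_vec n" using V w by (rule mult_mat_vec_carrier)
    have "?V *\<^sub>v (ginv ?V *\<^sub>v (?V *\<^sub>v w)) = (?V * ginv ?V) *\<^sub>v (?V *\<^sub>v w)"
      by (rule assoc_mult_mat_vec[OF V 1 Vw, symmetric])
    also have "\<dots> = (?V * ginv ?V * ?V) *\<^sub>v w"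
      by (rule assoc_mult_mat_vec[OF VG V w, symmetric])
    finally show ?thesis using gi by simp
  qed
qed

lemma weighted_Cauchy_Schwarz:
  fixes f g p :: "'i \<Rightarrow> real"
  assumes "\<And>k. k \<in> I \<Longrightarrow> 0 \<le> p k"
  shows "(\<Sum>k\<in>I. p k * f k * g k)\<^sup>2 \<le> (\<Sum>k\<in>I. p k * (f k)\<^sup>2) * (\<Sum>k\<in>I. p k * (g k)\<^sup>2)"
proof -
  have "(\<Sum>k\<in>I. p k * f k * g k) = (\<Sum>k\<in>I. (sqrt (p k) * f k) * (sqrt (p k) * g k))"
    using assms by (intro sum.cong) (auto simp: algebra_simps)
  also have "\<dots>\<^sup>2 \<le> (\<Sum>k\<in>I. (sqrt (p k) * f k)\<^sup>2) * (\<Sum>k\<in>I. (sqrt (p k) * g k)\<^sup>2)"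
    by (rule Cauchy_Schwarz_ineq_sum)
  also have "\<dots> = (\<Sum>k\<in>I. p k * (f k)\<^sup>2) * (\<Sum>k\<in>I. p k * (g k)\<^sup>2)"
    using assms by (simp add: power_mult_distrib)
  finally show ?thesis .
qed

definition qform :: "'i set \<Rightarrow> ('i \<Rightarrow> real vec) \<Rightarrow> ('i \<Rightarrow> real) \<Rightarrow> real vec \<Rightarrow> real" where
  "qform I b p v = (\<Sum>k\<in>I. p k * (b k \<bullet> v)\<^sup>2)"

text \<open>
  The dual description of the variance, through which all designs are handled below. From left to
  right it is the Cauchy--Schwarz inequality for \<open>u = V w\<close>. From right to left, a component of \<open>u\<close>
  outside the range of \<open>V\<close> would give a vector \<open>v\<close> with \<open>qform I b p v = 0\<close> and \<open>u \<bullet> v \<noteq> 0\<close>; then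
  \<open>v = V\<^sup>+ u\<close> yields the bound.
\<close>

lemma gram_variance_iff:
  assumes fin: "finite I" and b: "\<And>k. k \<in> I \<Longrightarrow> b k \<in> carrier_vec n"
    and p: "\<And>k. k \<in> I \<Longrightarrow> 0 \<le> p k" and u: "u \<in> carrier_vec n" and c: "0 \<le> c"
  shows "u \<in> mat_range (gram n I b p) \<and> u \<bullet> (ginv (gram n I b p) *\<^sub>v u) \<le> c \<longleftrightarrow>
    (\<forall>v\<in>carrier_vec n. (u \<bullet> v)\<^sup>2 \<le> c * qform I b p v)"
proof -
  let ?V = "gram n I b p" and ?G = "ginv (gram n I b p)"
  have G: "?G \<in> carrier_mat n n" by (rule ginv_gram(1)) (use fin b p in auto)
  have VGV: "?V *\<^sub>v (?G *\<^sub>v (?V *\<^sub>v w)) = ?V *\<^sub>v w" if "w \<in> carrier_vec n" for w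
    by (rule ginv_gram(2)) (use fin b p that in auto)
  have Vsym: "x \<bullet> (?V *\<^sub>v y) = y \<bullet> (?V *\<^sub>v x)" if "x \<in> carrier_vec n" "y \<in> carrier_vec n" for x y
    by (rule gram_sym) (use that b in auto)
  have Vc: "?V *\<^sub>v w \<in> carrier_vec n" if "w \<in> carrier_vec n" for w
    using that by (metis gram_carrier mult_mat_vec_carrier)
  have Gc: "?G *\<^sub>v w \<in> carrier_vec n" if "w \<in> carrier_vec n" for w
    using that G by (metis mult_mat_vec_carrier)
  have Q: "w \<bullet> (?V *\<^sub>v w) = qform I b p w" if "w \<in> carrier_vec n" for w
    using that b by (simp add: gram_form qform_def power2_eq_square mult_ac)
  have Q0: "0 \<le> qform I b p w" for w
    unfolding qform_def using p by (auto intro!: sum_nonneg)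
  have var: "(?V *\<^sub>v w) \<bullet> (?G *\<^sub>v (?V *\<^sub>v w)) = qform I b p w" if w: "w \<in> carrier_vec n" for w
  proof -
    have "(?V *\<^sub>v w) \<bullet> (?G *\<^sub>v (?V *\<^sub>v w)) = w \<bullet> (?V *\<^sub>v (?G *\<^sub>v (?V *\<^sub>v w)))"
      using Vsym[OF w Gc[OF Vc[OF w]]] comm_scalar_prod[OF Vc[OF w] Gc[OF Vc[OF w]]] by simp
    then show ?thesis using VGV[OF w] Q[OF w] by simp
  qed
  show ?thesis
  proof (intro iffI ballI conjI)
    fix v :: "real vec" assume v: "v \<in> carrier_vec n"
    assume *: "u \<in> mat_range ?V \<and> u \<bullet> (?G *\<^sub>v u) \<le> c"
    then obtain w where w: "w \<in> carrier_vec n" and u': "u = ?V *\<^sub>v w"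
      by (auto simp: mat_range_def)
    have "u \<bullet> v = (\<Sum>k\<in>I. p k * (b k \<bullet> w) * (b k \<bullet> v))"
      using gram_form[OF v w b, where p = p] comm_scalar_prod[OF u v] by (simp add: u' mult_ac)
    then have "(u \<bullet> v)\<^sup>2 \<le> qform I b p w * qform I b p v"
      unfolding qform_def using weighted_Cauchy_Schwarz[of I p "\<lambda>k. b k \<bullet> w" "\<lambda>k. b k \<bullet> v"] p by simp
    also have "\<dots> \<le> c * qform I b p v"
      using * var[OF w] Q0 by (intro mult_right_mono) (auto simp: u')
    finally show "(u \<bullet> v)\<^sup>2 \<le> c * qform I b p v" .
  next
    assume *: "\<forall>v\<in>carrier_vec n. (u \<bullet> v)\<^sup>2 \<le> c * qform I b p v"
    \<comment> \<open>The part of \<open>u\<close> outside the range of the matrix, and its correction \<open>v\<close> to a vector of the kernel.\<close>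
    define r where "r = u - ?V *\<^sub>v (?G *\<^sub>v u)"
    have r: "r \<in> carrier_vec n" unfolding r_def using u Vc Gc by auto
    define v where "v = r - transpose_mat ?G *\<^sub>v (?V *\<^sub>v r)"
    have GT: "transpose_mat ?G *\<^sub>v w \<in> carrier_vec n" if "w \<in> carrier_vec n" for w
      using that G by (metis mult_mat_vec_carrier transpose_carrier_mat)
    have v: "v \<in> carrier_vec n" unfolding v_def using r GT Vc by auto
    have vx: "v \<bullet> x = r \<bullet> x - r \<bullet> (?V *\<^sub>v (?G *\<^sub>v x))" if x: "x \<in> carrier_vec n" for x
    proof -
      have "(transpose_mat ?G *\<^sub>v (?V *\<^sub>v r)) \<bullet> x = (?V *\<^sub>v r) \<bullet> (?G *\<^sub>v x)"
        by (rule transpose_vec_mult_scalar[OF G x Vc[OF r]])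
      also have "\<dots> = r \<bullet> (?V *\<^sub>v (?G *\<^sub>v x))"
        using Vsym[OF r Gc[OF x]] comm_scalar_prod[OF Vc[OF r] Gc[OF x]] by simp
      finally show ?thesis unfolding v_def
        using minus_scalar_prod_distrib[OF r GT[OF Vc[OF r]] x] by simp
    qed
    have "qform I b p v = 0"
      using Q[OF v] vx[OF Vc[OF v]] VGV[OF v] by simp
    then have "(u \<bullet> v)\<^sup>2 \<le> 0" using * v by fastforce
    then have "v \<bullet> u = 0" using comm_scalar_prod[OF u v] by simp
    then have "r \<bullet> r = 0"
      using vx[OF u] scalar_prod_minus_distrib[OF r u Vc[OF Gc[OF u]]] by (simp add: r_def)
    then have "r = 0\<^sub>v n" using scalar_prod_self_eq_0 r by auto
    then have "u $ i - (?V *\<^sub>v (?G *\<^sub>v u)) $ i = 0" if "i < n" for i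
      using that u unfolding r_def
      by (metis carrier_vecD dim_mult_mat_vec gram_dims(1) index_minus_vec(1) index_zero_vec(1))
    then have uV: "u = ?V *\<^sub>v (?G *\<^sub>v u)" using u by (intro eq_vecI) auto
    then show "u \<in> mat_range ?V"
      unfolding mat_range_def using Gc[OF u] by auto
    let ?w = "?G *\<^sub>v u"
    have w: "?w \<in> carrier_vec n" by (rule Gc[OF u])
    have uw: "u \<bullet> ?w = qform I b p ?w"
      using Q[OF w] uV comm_scalar_prod[OF u w] by simp
    then have "(qform I b p ?w)\<^sup>2 \<le> c * qform I b p ?w" using * w by metis
    then show "u \<bullet> ?w \<le> c"
      unfolding uw using Q0[of ?w] c
      by (cases "qform I b p ?w = 0") (auto simp: power2_eq_square)
  qed
qed

text \<open>
  The two properties of the least-squares estimator of \<open>u \<bullet> \<theta>\<close>: it is unbiased, and the squares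
  of its coefficients add up to \<open>u \<bullet> V\<^sup>+ u\<close>. Both need that \<open>u\<close> is in the range of \<open>V\<close>.
\<close>

lemma ginv_gram_estimator:
  assumes fin: "finite I" and b: "\<And>k. k \<in> I \<Longrightarrow> b k \<in> carrier_vec n"
    and p: "\<And>k. k \<in> I \<Longrightarrow> 0 \<le> p k" and u: "u \<in> mat_range (gram n I b p)"
  shows "\<And>\<theta>. \<theta> \<in> carrier_vec n \<Longrightarrow>
      u \<bullet> (ginv (gram n I b p) *\<^sub>v (gram n I b p *\<^sub>v \<theta>)) = u \<bullet> \<theta>"
    and "(\<Sum>k\<in>I. p k * (u \<bullet> (ginv (gram n I b p) *\<^sub>v b k))\<^sup>2) = u \<bullet> (ginv (gram n I b p) *\<^sub>v u)"
proof -
  let ?V = "gram n I b p" and ?G = "ginv (gram n I b p)"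
  have G: "?G \<in> carrier_mat n n" by (rule ginv_gram(1)) (use fin b p in auto)
  have VGV: "?V *\<^sub>v (?G *\<^sub>v (?V *\<^sub>v w)) = ?V *\<^sub>v w" if "w \<in> carrier_vec n" for w
    by (rule ginv_gram(2)) (use fin b p that in auto)
  have Vsym: "x \<bullet> (?V *\<^sub>v y) = y \<bullet> (?V *\<^sub>v x)" if "x \<in> carrier_vec n" "y \<in> carrier_vec n" for x y
    by (rule gram_sym) (use that b in auto)
  have Vc: "?V *\<^sub>v w \<in> carrier_vec n" if "w \<in> carrier_vec n" for w
    using that by (metis gram_carrier mult_mat_vec_carrier)
  have Gc: "?G *\<^sub>v w \<in> carrier_vec n" if "w \<in> carrier_vec n" for w
    using that G by (metis mult_mat_vec_carrier)
  obtain w where w: "w \<in> carrier_vec n" and u': "u = ?V *\<^sub>v w"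
    using u by (auto simp: mat_range_def)
  have uc: "u \<in> carrier_vec n" unfolding u' by (rule Vc[OF w])
  show 1: "u \<bullet> (?G *\<^sub>v (?V *\<^sub>v \<theta>)) = u \<bullet> \<theta>" if t: "\<theta> \<in> carrier_vec n" for \<theta>
  proof -
    have "u \<bullet> (?G *\<^sub>v (?V *\<^sub>v \<theta>)) = w \<bullet> (?V *\<^sub>v (?G *\<^sub>v (?V *\<^sub>v \<theta>)))"
      using Vsym[OF w Gc[OF Vc[OF t]]] comm_scalar_prod[OF uc Gc[OF Vc[OF t]]] by (simp add: u')
    also have "\<dots> = w \<bullet> (?V *\<^sub>v \<theta>)" using VGV[OF t] by simp
    also have "\<dots> = u \<bullet> \<theta>" using Vsym[OF w t] comm_scalar_prod[OF uc t] by (simp add: u')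
    finally show ?thesis .
  qed
  define y where "y = transpose_mat ?G *\<^sub>v u"
  have y: "y \<in> carrier_vec n" unfolding y_def
    using uc G by (metis mult_mat_vec_carrier transpose_carrier_mat)
  have yx: "y \<bullet> x = u \<bullet> (?G *\<^sub>v x)" if "x \<in> carrier_vec n" for x
    unfolding y_def by (rule transpose_vec_mult_scalar[OF G that uc])
  have "(\<Sum>k\<in>I. p k * (u \<bullet> (?G *\<^sub>v b k))\<^sup>2) = (\<Sum>k\<in>I. p k * (b k \<bullet> y) * (b k \<bullet> y))"
    using b by (intro sum.cong refl) (simp add: yx[symmetric] comm_scalar_prod[OF y] power2_eq_square)
  also have "\<dots> = y \<bullet> (?V *\<^sub>v y)" using gram_form[OF y y b, where p = p] by simp
  also have "\<dots> = u \<bullet> (?G *\<^sub>v (?V *\<^sub>v y))" by (rule yx[OF Vc[OF y]])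
  also have "\<dots> = u \<bullet> y" by (rule 1[OF y])
  also have "\<dots> = u \<bullet> (?G *\<^sub>v u)" using yx[OF uc] comm_scalar_prod[OF uc y] by simp
  finally show "(\<Sum>k\<in>I. p k * (u \<bullet> (?G *\<^sub>v b k))\<^sup>2) = u \<bullet> (?G *\<^sub>v u)" .
qed

section \<open>Designs of small maximal variance\<close>

text \<open>
  The matrix determinant lemma, read off from two factorisations of the bordered matrix with blocks
  \<open>1\<close>, \<open>- u\<close>, \<open>v\<^sup>T\<close>, \<open>1\<close>.
\<close>

lemma det_one_plus_outer:
  assumes u: "u \<in> carrier_vec n" and v: "v \<in> carrier_vec n"
  shows "Determinant.det (1\<^sub>m n + outer n u v) = 1 + v \<bullet> u"
proof -
  define U where "U = mat n 1 (\<lambda>(i, j). u $ i)"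
  define W where "W = mat 1 n (\<lambda>(i, j). v $ j)"
  define D where "D = mat 1 1 (\<lambda>(i, j). 1 + v \<bullet> u)"
  define A where "A = 1\<^sub>m n + outer n u v"
  have U: "U \<in> carrier_mat n 1" and W: "W \<in> carrier_mat 1 n" and D: "D \<in> carrier_mat 1 1"
    and A: "A \<in> carrier_mat n n" by (auto simp: U_def W_def D_def A_def)
  have UW: "U * W = outer n u v"
    by (rule eq_matI) (auto simp: U_def W_def outer_def scalar_prod_def)
  have WU: "W * U = mat 1 1 (\<lambda>(i, j). v \<bullet> u)"
    using u v by (intro eq_matI) (auto simp: U_def W_def scalar_prod_def)
  have nU: "- U \<in> carrier_mat n 1" using U by simp
  have "four_block_mat (1\<^sub>m n) (0\<^sub>m n 1) W (1\<^sub>m 1) * four_block_mat (1\<^sub>m n) (- U) (0\<^sub>m 1 n) D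
    = four_block_mat (1\<^sub>m n * 1\<^sub>m n + 0\<^sub>m n 1 * 0\<^sub>m 1 n) (1\<^sub>m n * (- U) + 0\<^sub>m n 1 * D)
        (W * 1\<^sub>m n + 1\<^sub>m 1 * 0\<^sub>m 1 n) (W * (- U) + 1\<^sub>m 1 * D)"
    by (rule mult_four_block_mat) (use U W D nU in auto)
  also have "W * (- U) + 1\<^sub>m 1 * D = 1\<^sub>m 1"
  proof -
    have "W * (- U) = - (W * U)" using W U by simp
    then show ?thesis unfolding WU using D by (intro eq_matI) (auto simp: D_def)
  qed
  finally have 1: "four_block_mat (1\<^sub>m n) (0\<^sub>m n 1) W (1\<^sub>m 1) * four_block_mat (1\<^sub>m n) (- U) (0\<^sub>m 1 n) D
    = four_block_mat (1\<^sub>m n) (- U) W (1\<^sub>m 1)" using U W D nU by simp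
  have "four_block_mat (1\<^sub>m n) (- U) (0\<^sub>m 1 n) (1\<^sub>m 1) * four_block_mat A (0\<^sub>m n 1) W (1\<^sub>m 1)
    = four_block_mat (1\<^sub>m n * A + (- U) * W) (1\<^sub>m n * 0\<^sub>m n 1 + (- U) * 1\<^sub>m 1)
        (0\<^sub>m 1 n * A + 1\<^sub>m 1 * W) (0\<^sub>m 1 n * 0\<^sub>m n 1 + 1\<^sub>m 1 * 1\<^sub>m 1)"
    by (rule mult_four_block_mat) (use U W A nU in auto)
  also have "1\<^sub>m n * A + (- U) * W = 1\<^sub>m n"
  proof -
    have "(- U) * W = - (U * W)" using W U by simp
    then show ?thesis unfolding UW A_def
      by (intro eq_matI) (auto simp: outer_def)
  qed
  finally have 2: "four_block_mat (1\<^sub>m n) (- U) (0\<^sub>m 1 n) (1\<^sub>m 1) * four_block_mat A (0\<^sub>m n 1) W (1\<^sub>m 1)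
    = four_block_mat (1\<^sub>m n) (- U) W (1\<^sub>m 1)" using U W A nU by simp
  have c: "four_block_mat B1 B2 B3 B4 \<in> carrier_mat (n + 1) (n + 1)"
    if "B1 \<in> carrier_mat n n" "B4 \<in> carrier_mat 1 1" for B1 B2 B3 B4 :: "real mat"
    using that by (rule four_block_carrier_mat)
  have "Determinant.det (four_block_mat (1\<^sub>m n) (- U) W (1\<^sub>m 1)) =
      Determinant.det (four_block_mat (1\<^sub>m n) (0\<^sub>m n 1) W (1\<^sub>m 1)) *
      Determinant.det (four_block_mat (1\<^sub>m n) (- U) (0\<^sub>m 1 n) D)"
    unfolding 1[symmetric] by (rule det_mult[of _ "n + 1"]) (use c D in auto)
  also have "\<dots> = Determinant.det D"
    using det_four_block_mat_upper_right_zero[of "1\<^sub>m n" n "0\<^sub>m n 1" 1 W "1\<^sub>m 1"]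
      det_four_block_mat_lower_left_zero[of "1\<^sub>m n" n "- U" 1 "0\<^sub>m 1 n" D] W D nU by simp
  finally have e1: "Determinant.det (four_block_mat (1\<^sub>m n) (- U) W (1\<^sub>m 1)) = Determinant.det D" .
  have "Determinant.det (four_block_mat (1\<^sub>m n) (- U) W (1\<^sub>m 1)) =
      Determinant.det (four_block_mat (1\<^sub>m n) (- U) (0\<^sub>m 1 n) (1\<^sub>m 1)) *
      Determinant.det (four_block_mat A (0\<^sub>m n 1) W (1\<^sub>m 1))"
    unfolding 2[symmetric] by (rule det_mult[of _ "n + 1"]) (use c A in auto)
  also have "\<dots> = Determinant.det A"
    using det_four_block_mat_upper_right_zero[of A n "0\<^sub>m n 1" 1 W "1\<^sub>m 1"]
      det_four_block_mat_lower_left_zero[of "1\<^sub>m n" n "- U" 1 "0\<^sub>m 1 n" "1\<^sub>m 1"] W A nU by simp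
  finally have "Determinant.det A = Determinant.det D" using e1 by simp
  also have "\<dots> = 1 + v \<bullet> u" using det_single[of D] D by (simp add: D_def)
  finally show ?thesis unfolding A_def .
qed

lemma gram_add_outer:
  assumes I: "finite I" "k \<in> I" and b: "\<And>k. k \<in> I \<Longrightarrow> b k \<in> carrier_vec n"
    and w: "w \<in> carrier_vec n" and Vw: "gram n I b p *\<^sub>v w = b k"
  shows "gram n I b (\<lambda>j. p j + (if j = k then s else 0)) = gram n I b p * (1\<^sub>m n + outer n (s \<cdot>\<^sub>v w) (b k))"
proof -
  let ?V = "gram n I b p"
  have V: "?V \<in> carrier_mat n n" by simp
  have "?V * (1\<^sub>m n + outer n (s \<cdot>\<^sub>v w) (b k)) = ?V * 1\<^sub>m n + ?V * outer n (s \<cdot>\<^sub>v w) (b k)"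
    by (rule mult_add_distrib_mat[OF V]) auto
  also have "?V * outer n (s \<cdot>\<^sub>v w) (b k) = outer n (s \<cdot>\<^sub>v b k) (b k)"
  proof (rule eq_matI)
    fix i j assume "i < dim_row (outer n (s \<cdot>\<^sub>v b k) (b k))" "j < dim_col (outer n (s \<cdot>\<^sub>v b k) (b k))"
    then have ij: "i < n" "j < n" by (auto simp: outer_def)
    have "(?V *\<^sub>v w) $ i = (\<Sum>l<n. ?V $$ (i, l) * w $ l)"
      using ij w by (simp add: scalar_prod_def lessThan_atLeast0)
    then have *: "(\<Sum>l<n. ?V $$ (i, l) * w $ l) = b k $ i" unfolding Vw by simp
    have "(?V * outer n (s \<cdot>\<^sub>v w) (b k)) $$ (i, j) = (\<Sum>l<n. ?V $$ (i, l) * (s * w $ l * b k $ j))"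
      using ij w by (simp add: scalar_prod_def lessThan_atLeast0 outer_def)
    also have "\<dots> = (\<Sum>l<n. ?V $$ (i, l) * w $ l) * (s * b k $ j)"
      by (simp add: sum_distrib_right sum_distrib_left mult_ac)
    also have "\<dots> = outer n (s \<cdot>\<^sub>v b k) (b k) $$ (i, j)"
      unfolding * using ij b[OF I(2)] by (simp add: outer_def)
    finally show "(?V * outer n (s \<cdot>\<^sub>v w) (b k)) $$ (i, j) = outer n (s \<cdot>\<^sub>v b k) (b k) $$ (i, j)" .
  qed (auto simp: outer_def)
  also have "?V * 1\<^sub>m n = ?V" by simp
  also have "?V + outer n (s \<cdot>\<^sub>v b k) (b k) = gram n I b (\<lambda>j. p j + (if j = k then s else 0))"
  proof (rule eq_matI)
    fix i j assume "i < dim_row (gram n I b (\<lambda>j. p j + (if j = k then s else 0)))"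
      "j < dim_col (gram n I b (\<lambda>j. p j + (if j = k then s else 0)))"
    then have ij: "i < n" "j < n" by auto
    have "(\<Sum>l\<in>I. (p l + (if l = k then s else 0)) * (b l $ i * b l $ j)) =
        (\<Sum>l\<in>I. p l * (b l $ i * b l $ j) + (if l = k then s * (b k $ i * b k $ j) else 0))"
      by (intro sum.cong) (auto simp: algebra_simps)
    also have "\<dots> = (\<Sum>l\<in>I. p l * (b l $ i * b l $ j)) + s * (b k $ i * b k $ j)"
      using I by (simp add: sum.distrib)
    finally show "(?V + outer n (s \<cdot>\<^sub>v b k) (b k)) $$ (i, j) =
        gram n I b (\<lambda>j. p j + (if j = k then s else 0)) $$ (i, j)"
      using ij b[OF I(2)] by (simp add: gram_def outer_def)
  qed (auto simp: outer_def)
  finally show ?thesis by simp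
qed

text \<open>
  Comparison of the derivatives of both sides at \<open>s = 0\<close>.
\<close>

lemma le_of_Bernoulli:
  fixes q :: real
  assumes "\<And>s. 0 < s \<Longrightarrow> 1 + s * q \<le> (1 + s) ^ n"
  shows "q \<le> real n"
proof -
  have "((\<lambda>s::real. (1 + s) ^ n) has_real_derivative real n) (at 0)"
    by (auto intro!: derivative_eq_intros)
  then have "((\<lambda>s. ((1 + s) ^ n - 1) / s) \<longlongrightarrow> real n) (at (0::real))"
    by (simp add: has_field_derivative_iff)
  then have "((\<lambda>s. ((1 + s) ^ n - 1) / s) \<longlongrightarrow> real n) (at_right (0::real))"
    by (rule filterlim_mono) (auto simp: at_le)
  moreover have "\<forall>\<^sub>F s in at_right (0::real). q \<le> ((1 + s) ^ n - 1) / s"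
    using eventually_at_right_less[of 0]
    by eventually_elim (use assms in \<open>auto simp: field_simps\<close>)
  ultimately show ?thesis
    by (intro tendsto_lowerbound) auto
qed

definition simplex_on :: "'i set \<Rightarrow> ('i \<Rightarrow> real) set" where
  "simplex_on I = {p. (\<forall>k\<in>I. 0 \<le> p k) \<and> sum p I = 1}"

lemma bounded_weights_subsequence:
  fixes f :: "nat \<Rightarrow> 'i \<Rightarrow> real"
  assumes I: "finite I" and f: "\<And>m k. k \<in> I \<Longrightarrow> 0 \<le> f m k" "\<And>m. sum (f m) I \<le> 1"
  shows "\<exists>r l. strict_mono (r :: nat \<Rightarrow> nat) \<and> (\<forall>k\<in>I. (\<lambda>m. f (r m) k) \<longlonglongrightarrow> l k)"
proof -
  have le: "norm (f m k) \<le> 1" if "k \<in> I" for m k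
  proof -
    have "f m k \<le> sum (f m) I" by (rule member_le_sum) (use that f(1) I in auto)
    then show ?thesis using f(1)[OF that, of m] f(2)[of m] by simp
  qed
  have "\<exists>r::nat \<Rightarrow> nat. strict_mono r \<and> (\<forall>k\<in>J. \<exists>l. (\<lambda>m. f (r m) k) \<longlonglongrightarrow> l)"
    if "finite J" "J \<subseteq> I" for J
    using that
  proof (induction J rule: finite_induct)
    case empty
    show ?case using strict_mono_id by auto
  next
    case (insert k J)
    then obtain r :: "nat \<Rightarrow> nat" where r: "strict_mono r"
      and rl: "\<And>k. k \<in> J \<Longrightarrow> \<exists>l. (\<lambda>m. f (r m) k) \<longlonglongrightarrow> l" by auto
    have "bounded (range (\<lambda>m. f (r m) k))"
      by (rule boundedI[of _ 1]) (use le insert.prems in auto)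
    then obtain l r' where r': "strict_mono (r' :: nat \<Rightarrow> nat)" and l: "((\<lambda>m. f (r m) k) \<circ> r') \<longlonglongrightarrow> l"
      using bounded_imp_convergent_subsequence by blast
    have "\<exists>l. (\<lambda>m. f ((r \<circ> r') m) j) \<longlonglongrightarrow> l" if j: "j \<in> insert k J" for j
    proof (cases "j = k")
      case True
      then show ?thesis using l by (auto simp: o_def)
    next
      case False
      then obtain l' where "(\<lambda>m. f (r m) j) \<longlonglongrightarrow> l'" using j rl by auto
      from LIMSEQ_subseq_LIMSEQ[OF this r'] show ?thesis by (auto simp: o_def)
    qed
    then show ?case using strict_mono_o[OF r r'] by blast
  qed
  from this[OF I order_refl] obtain r :: "nat \<Rightarrow> nat" where r: "strict_mono r"
    and ex: "\<And>k. k \<in> I \<Longrightarrow> \<exists>l. (\<lambda>m. f (r m) k) \<longlonglongrightarrow> l" by auto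
  have "(\<lambda>m. f (r m) k) \<longlonglongrightarrow> (SOME l. (\<lambda>m. f (r m) k) \<longlonglongrightarrow> l)" if "k \<in> I" for k
    using ex[OF that] by (rule someI_ex)
  then have "\<forall>k\<in>I. (\<lambda>m. f (r m) k) \<longlonglongrightarrow> (\<lambda>k. SOME l. (\<lambda>m. f (r m) k) \<longlonglongrightarrow> l) k" by simp
  then show ?thesis using r by (intro exI[of _ r] exI[of _ "\<lambda>k. SOME l. (\<lambda>m. f (r m) k) \<longlonglongrightarrow> l"]) simp
qed

text \<open>
  Compactness of the simplex for an arbitrary finite index set, phrased with sequences because the index
  type carries no topology.
\<close>

lemma attains_max_on_simplex:
  fixes F :: "('i \<Rightarrow> real) \<Rightarrow> real"
  assumes I: "finite I" and ne: "simplex_on I \<noteq> {}"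
    and cont: "\<And>f l. (\<And>k. k \<in> I \<Longrightarrow> (\<lambda>m. f m k) \<longlonglongrightarrow> l k) \<Longrightarrow> (\<lambda>m::nat. F (f m)) \<longlonglongrightarrow> F l"
  shows "\<exists>p\<in>simplex_on I. \<forall>q\<in>simplex_on I. F q \<le> F p"
proof -
  have "compact (F ` simplex_on I)"
    unfolding compact_eq_seq_compact_metric seq_compact_def
  proof (intro allI impI)
    fix g :: "nat \<Rightarrow> real" assume "\<forall>m. g m \<in> F ` simplex_on I"
    then have "\<forall>m. \<exists>p. p \<in> simplex_on I \<and> g m = F p" by blast
    then obtain f where f: "\<And>m. f m \<in> simplex_on I" and g: "\<And>m. g m = F (f m)" by metis
    have f': "\<And>m k. k \<in> I \<Longrightarrow> 0 \<le> f m k" "\<And>m. sum (f m) I \<le> 1"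
      using f by (auto simp: simplex_on_def)
    have "\<exists>r l. strict_mono (r :: nat \<Rightarrow> nat) \<and> (\<forall>k\<in>I. (\<lambda>m. f (r m) k) \<longlonglongrightarrow> l k)"
      by (rule bounded_weights_subsequence) (use I f' in auto)
    then obtain r l where r: "strict_mono (r :: nat \<Rightarrow> nat)" and lim: "\<forall>k\<in>I. (\<lambda>m. f (r m) k) \<longlonglongrightarrow> l k"
      by (elim exE conjE)
    have l: "(\<lambda>m. f (r m) k) \<longlonglongrightarrow> l k" if "k \<in> I" for k using lim that ..
    have "(\<lambda>m. sum (f (r m)) I) \<longlonglongrightarrow> sum l I" by (intro tendsto_sum l)
    moreover have "sum (f (r m)) I = 1" for m using f by (auto simp: simplex_on_def)
    ultimately have "(\<lambda>m::nat. 1) \<longlonglongrightarrow> sum l I" by simp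
    from LIMSEQ_unique[OF this tendsto_const] have "sum l I = 1" .
    moreover have "0 \<le> l k" if "k \<in> I" for k
      by (rule LIMSEQ_le_const[OF l[OF that]]) (use f' that in auto)
    ultimately have "l \<in> simplex_on I" by (auto simp: simplex_on_def)
    moreover have "(g \<circ> r) \<longlonglongrightarrow> F l" unfolding o_def g by (rule cont) (rule l)
    ultimately show "\<exists>l\<in>F ` simplex_on I. \<exists>r. strict_mono r \<and> (g \<circ> r) \<longlonglongrightarrow> l"
      using r by (intro bexI[of _ "F l"] exI[of _ r]) auto
  qed
  moreover have "F ` simplex_on I \<noteq> {}" using ne by simp
  ultimately have "\<exists>y\<in>F ` simplex_on I. \<forall>t\<in>F ` simplex_on I. t \<le> y"
    by (rule compact_attains_sup)
  then show ?thesis by simp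
qed

text \<open>
  A maximiser \<open>p\<close> of \<open>\<bar>det V\<bar>\<close> over the simplex works. Moving weight \<open>s\<close> to the index \<open>k\<close> and
  renormalising multiplies the determinant by \<open>(1 + s * q) / (1 + s)^n\<close> with \<open>q = b k \<bullet> V\<^sup>+ b k\<close>.
  Maximality makes this factor at most \<open>1\<close> for all \<open>s > 0\<close>, hence \<open>q \<le> n\<close>.
\<close>

lemma Kiefer_Wolfowitz_nonsingular:
  assumes I: "finite I" and b: "\<And>k. k \<in> I \<Longrightarrow> b k \<in> carrier_vec n"
    and p0: "p0 \<in> simplex_on I" and det0: "Determinant.det (gram n I b p0) \<noteq> 0"
  shows "\<exists>p\<in>simplex_on I. \<forall>k\<in>I. \<forall>v\<in>carrier_vec n. (b k \<bullet> v)\<^sup>2 \<le> real n * qform I b p v"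
proof -
  let ?F = "\<lambda>p. \<bar>Determinant.det (gram n I b p)\<bar>"
  have cont: "(\<lambda>m::nat. ?F (f m)) \<longlonglongrightarrow> ?F l" if "\<And>k. k \<in> I \<Longrightarrow> (\<lambda>m. f m k) \<longlonglongrightarrow> l k" for f l
  proof -
    have entry: "(\<lambda>m. gram n I b (f m) $$ (i, j)) \<longlonglongrightarrow> gram n I b l $$ (i, j)" if "i < n" "j < n" for i j
      using that \<open>\<And>k. k \<in> I \<Longrightarrow> (\<lambda>m. f m k) \<longlonglongrightarrow> l k\<close>
      by (auto simp: gram_def intro!: tendsto_intros)
    have "(\<lambda>m. \<Sum>\<sigma>\<in>{\<sigma>. \<sigma> permutes {0..<n}}. signof \<sigma> * (\<Prod>i = 0..<n. gram n I b (f m) $$ (i, \<sigma> i)))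
      \<longlonglongrightarrow> (\<Sum>\<sigma>\<in>{\<sigma>. \<sigma> permutes {0..<n}}. signof \<sigma> * (\<Prod>i = 0..<n. gram n I b l $$ (i, \<sigma> i)))"
    proof (intro tendsto_sum tendsto_mult tendsto_const tendsto_prod)
      fix \<sigma> i assume "\<sigma> \<in> {\<sigma>. \<sigma> permutes {0..<n}}" "i \<in> {0..<n}"
      then have "i < n" "\<sigma> i < n" using permutes_in_image[of \<sigma> "{0..<n}" i] by auto
      then show "(\<lambda>m. gram n I b (f m) $$ (i, \<sigma> i)) \<longlonglongrightarrow> gram n I b l $$ (i, \<sigma> i)" by (rule entry)
    qed
    then show ?thesis by (intro tendsto_rabs) (simp add: det_def'[of _ n])
  qed
  have "\<exists>p\<in>simplex_on I. \<forall>q\<in>simplex_on I. ?F q \<le> ?F p"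
  proof (rule attains_max_on_simplex[of I ?F])
    show "simplex_on I \<noteq> {}" using p0 by auto
    show "(\<lambda>m. ?F (f m)) \<longlonglongrightarrow> ?F l" if "\<And>k. k \<in> I \<Longrightarrow> (\<lambda>m. f m k) \<longlonglongrightarrow> l k" for f l
      by (rule cont) (rule that)
  qed (rule I)
  then obtain p where p: "p \<in> simplex_on I" and max0: "\<forall>q\<in>simplex_on I. ?F q \<le> ?F p" ..
  have max: "?F q \<le> ?F p" if "q \<in> simplex_on I" for q using max0 that ..
  have p': "\<And>k. k \<in> I \<Longrightarrow> 0 \<le> p k" "sum p I = 1" using p by (auto simp: simplex_on_def)
  let ?V = "gram n I b p"
  have V: "?V \<in> carrier_mat n n" by simp
  have detV: "Determinant.det ?V \<noteq> 0" using max[OF p0] det0 by auto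
  have "(b k \<bullet> v)\<^sup>2 \<le> real n * qform I b p v" if k: "k \<in> I" and v: "v \<in> carrier_vec n" for k v
  proof -
    obtain B where B: "B \<in> carrier_mat n n" and VB: "?V * B = 1\<^sub>m n"
      using det_non_zero_imp_unit[OF V detV, of "()"] by (auto simp: Units_def ring_mat_def)
    define w where "w = B *\<^sub>v b k"
    have w: "w \<in> carrier_vec n" unfolding w_def using B b[OF k] by (metis mult_mat_vec_carrier)
    have Vw: "?V *\<^sub>v w = b k"
      unfolding w_def using assoc_mult_mat_vec[OF V B b[OF k]] VB b[OF k] by simp
    define q where "q = b k \<bullet> w"
    have qQ: "q = qform I b p w"
      using gram_form[of w n w I b p, OF w w b] comm_scalar_prod[OF b[OF k] w]
      by (simp add: Vw q_def qform_def power2_eq_square mult_ac)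
    have q0: "0 \<le> q" unfolding qQ qform_def using p' by (auto intro!: sum_nonneg)
    \<comment> \<open>The comparison of \<open>p\<close> with the design that has more weight at \<open>k\<close>.\<close>
    have "1 + s * q \<le> (1 + s) ^ n" if s: "0 < s" for s
    proof -
      define p1 where "p1 = (\<lambda>j. p j + (if j = k then s else 0))"
      define p2 where "p2 = (\<lambda>j. 1 / (1 + s) * p1 j)"
      have "sum p1 I = 1 + s" unfolding p1_def using p' I k by (simp add: sum.distrib)
      then have "p2 \<in> simplex_on I"
        unfolding simplex_on_def p2_def using p' s
        by (simp add: sum_distrib_left[symmetric] del: times_divide_eq_left mult_1) (simp add: p1_def)
      then have le: "?F p2 \<le> ?F p" by (rule max)
      have "gram n I b p2 = (1 / (1 + s)) \<cdot>\<^sub>m gram n I b p1"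
        by (rule eq_matI) (auto simp: gram_def p2_def sum_distrib_left mult_ac)
      then have "Determinant.det (gram n I b p2) = (1 / (1 + s)) ^ n * Determinant.det (gram n I b p1)"
        by simp
      also have "gram n I b p1 = ?V * (1\<^sub>m n + outer n (s \<cdot>\<^sub>v w) (b k))"
        unfolding p1_def by (rule gram_add_outer) (use I k b w Vw in auto)
      also have "Determinant.det \<dots> = Determinant.det ?V * Determinant.det (1\<^sub>m n + outer n (s \<cdot>\<^sub>v w) (b k))"
        by (rule det_mult[OF V]) auto
      also have "Determinant.det (1\<^sub>m n + outer n (s \<cdot>\<^sub>v w) (b k)) = 1 + s * q"
        using det_one_plus_outer[of "s \<cdot>\<^sub>v w" n "b k"] w b[OF k] by (simp add: q_def)
      finally have "?F p2 = (1 / (1 + s)) ^ n * (?F p * (1 + s * q))"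
        using s q0 by (simp add: abs_mult)
      then have "(1 / (1 + s)) ^ n * (1 + s * q) * ?F p \<le> 1 * ?F p" using le by (simp add: mult_ac)
      then have "(1 / (1 + s)) ^ n * (1 + s * q) \<le> 1"
        using detV by (subst (asm) mult_le_cancel_right_pos) auto
      then show ?thesis using s by (simp add: power_divide field_simps)
    qed
    then have qn: "q \<le> real n" by (rule le_of_Bernoulli)
    have "b k \<bullet> v = (\<Sum>j\<in>I. p j * (b j \<bullet> w) * (b j \<bullet> v))"
      using gram_form[of v n w I b p, OF v w b] comm_scalar_prod[OF b[OF k] v] by (simp add: Vw mult_ac)
    then have "(b k \<bullet> v)\<^sup>2 \<le> q * qform I b p v"
      unfolding qQ unfolding qform_def
      using weighted_Cauchy_Schwarz[of I p "\<lambda>j. b j \<bullet> w" "\<lambda>j. b j \<bullet> v"] p' by simp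
    also have "\<dots> \<le> real n * qform I b p v"
      using qn p' by (intro mult_right_mono) (auto simp: qform_def intro!: sum_nonneg)
    finally show ?thesis .
  qed
  then show ?thesis by (intro bexI[OF _ p] ballI)
qed

text \<open>
  The vectors of one group need not span the space. Adding the vectors \<open>r * e\<^sub>j\<close> of a scaled basis makes
  the Gram matrix nonsingular; the dual form of the variance bound passes to the limit \<open>r \<rightarrow> 0\<close>, and
  weight that was lost to the added vectors may be put anywhere.
\<close>

lemma Kiefer_Wolfowitz:
  assumes S: "finite S" "S \<noteq> {}" and b: "\<And>k. k \<in> S \<Longrightarrow> b k \<in> carrier_vec n"
  shows "\<exists>p\<in>simplex_on S. \<forall>k\<in>S. \<forall>v\<in>carrier_vec n. (b k \<bullet> v)\<^sup>2 \<le> real n * qform S b p v"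
proof -
  have reg: "\<exists>p. (\<forall>k\<in>S. 0 \<le> p k) \<and> sum p S \<le> 1 \<and>
      (\<forall>k\<in>S. \<forall>v\<in>carrier_vec n. (b k \<bullet> v)\<^sup>2 \<le> real n * (qform S b p v + r\<^sup>2 * (v \<bullet> v)))"
    if r: "0 < r" for r :: real
  proof -
    define I where "I = Inl ` S \<union> Inr ` {..<n}"
    define b' where "b' = case_sum b (\<lambda>j. r \<cdot>\<^sub>v unit_vec n j)"
    have I: "finite I" "I \<noteq> {}" using S by (auto simp: I_def)
    have b': "b' k \<in> carrier_vec n" if "k \<in> I" for k using that b by (auto simp: I_def b'_def)
    have split: "qform I b' p v = qform S b (p \<circ> Inl) v + r\<^sup>2 * (\<Sum>j<n. p (Inr j) * (v $ j)\<^sup>2)"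
      if v: "v \<in> carrier_vec n" for p v
    proof -
      have "qform I b' p v = (\<Sum>k\<in>Inl ` S. p k * (b' k \<bullet> v)\<^sup>2) + (\<Sum>k\<in>Inr ` {..<n}. p k * (b' k \<bullet> v)\<^sup>2)"
        unfolding qform_def I_def using S by (intro sum.union_disjoint) auto
      also have "(\<Sum>k\<in>Inl ` S. p k * (b' k \<bullet> v)\<^sup>2) = qform S b (p \<circ> Inl) v"
        by (simp add: sum.reindex qform_def b'_def)
      also have "(\<Sum>k\<in>Inr ` {..<n}. p k * (b' k \<bullet> v)\<^sup>2) = (\<Sum>j<n. p (Inr j) * (r * v $ j)\<^sup>2)"
        using v by (simp add: sum.reindex b'_def)
      also have "\<dots> = r\<^sup>2 * (\<Sum>j<n. p (Inr j) * (v $ j)\<^sup>2)"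
        by (simp add: sum_distrib_left power_mult_distrib mult_ac)
      finally show ?thesis .
    qed
    define p0 :: "'a + nat \<Rightarrow> real" where "p0 = (\<lambda>_. 1 / card I)"
    have cI: "card I > 0" using I by (simp add: card_gt_0_iff)
    have p0: "p0 \<in> simplex_on I" using I by (simp add: simplex_on_def p0_def)
    have det0: "Determinant.det (gram n I b' p0) \<noteq> 0"
    proof
      assume "Determinant.det (gram n I b' p0) = 0"
      then obtain v where v: "v \<in> carrier_vec n" "v \<noteq> 0\<^sub>v n" "gram n I b' p0 *\<^sub>v v = 0\<^sub>v n"
        using det_0_iff_vec_prod_zero_field[of "gram n I b' p0" n] by auto
      have "qform I b' p0 v = 0"
        using gram_form[of v n v I b' p0, OF v(1) v(1) b'] v
        by (simp add: qform_def power2_eq_square mult_ac)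
      moreover have "0 \<le> qform S b (p0 \<circ> Inl) v"
        unfolding qform_def by (auto intro!: sum_nonneg simp: p0_def)
      ultimately have "r\<^sup>2 * (\<Sum>j<n. p0 (Inr j) * (v $ j)\<^sup>2) \<le> 0"
        using split[OF v(1), of p0] by simp
      then have "(\<Sum>j<n. p0 (Inr j) * (v $ j)\<^sup>2) \<le> 0"
        using r by (simp add: mult_le_0_iff)
      moreover have "0 \<le> (\<Sum>j<n. p0 (Inr j) * (v $ j)\<^sup>2)" by (auto intro!: sum_nonneg simp: p0_def)
      ultimately have "(\<Sum>j<n. p0 (Inr j) * (v $ j)\<^sup>2) = 0" by simp
      then have "\<forall>j\<in>{..<n}. p0 (Inr j) * (v $ j)\<^sup>2 = 0"
        by (subst (asm) sum_nonneg_eq_0_iff) (auto simp: p0_def)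
      then have "v = 0\<^sub>v n" using v(1) cI I by (intro eq_vecI) (auto simp: p0_def)
      then show False using v by simp
    qed
    have "\<exists>p\<in>simplex_on I. \<forall>k\<in>I. \<forall>v\<in>carrier_vec n. (b' k \<bullet> v)\<^sup>2 \<le> real n * qform I b' p v"
      by (rule Kiefer_Wolfowitz_nonsingular[OF I(1) _ p0 det0]) (rule b')
    then obtain p where p: "p \<in> simplex_on I"
      "\<forall>k\<in>I. \<forall>v\<in>carrier_vec n. (b' k \<bullet> v)\<^sup>2 \<le> real n * qform I b' p v" ..
    have pn: "0 \<le> p k" if "k \<in> I" for k using p that by (auto simp: simplex_on_def)
    have "sum p I = sum p (Inl ` S) + sum p (Inr ` {..<n})"
      unfolding I_def using S by (intro sum.union_disjoint) auto
    then have s1: "sum (p \<circ> Inl) S + sum (p \<circ> Inr) {..<n} = 1"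
      using p by (simp add: sum.reindex simplex_on_def)
    have n2: "0 \<le> sum (p \<circ> Inr) {..<n}" using pn by (intro sum_nonneg) (auto simp: I_def)
    have n1: "0 \<le> sum (p \<circ> Inl) S" using pn by (intro sum_nonneg) (auto simp: I_def)
    have "(b k \<bullet> v)\<^sup>2 \<le> real n * (qform S b (p \<circ> Inl) v + r\<^sup>2 * (v \<bullet> v))"
      if k: "k \<in> S" and v: "v \<in> carrier_vec n" for k v
    proof -
      have kbound: "(b k \<bullet> v)\<^sup>2 \<le> real n * qform I b' p v"
      proof -
        have "Inl k \<in> I" using k by (simp add: I_def)
        from bspec[OF bspec[OF p(2) this] v] show ?thesis by (simp add: b'_def)
      qed
      have "(\<Sum>j<n. p (Inr j) * (v $ j)\<^sup>2) \<le> v \<bullet> v"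
      proof -
        have "(\<Sum>j<n. p (Inr j) * (v $ j)\<^sup>2) \<le> (\<Sum>j<n. 1 * (v $ j)\<^sup>2)"
        proof (intro sum_mono mult_right_mono)
          fix j assume "j \<in> {..<n}"
          then have "p (Inr j) \<le> sum (p \<circ> Inr) {..<n}"
            using member_le_sum[of j "{..<n}" "p \<circ> Inr"] pn by (auto simp: I_def)
          then show "p (Inr j) \<le> 1" using s1 n1 by simp
        qed auto
        also have "\<dots> = v \<bullet> v" using v by (simp add: scalar_prod_def lessThan_atLeast0 power2_eq_square)
        finally show ?thesis .
      qed
      then have "r\<^sup>2 * (\<Sum>j<n. p (Inr j) * (v $ j)\<^sup>2) \<le> r\<^sup>2 * (v \<bullet> v)"
        by (rule mult_left_mono) simp
      then have "real n * qform I b' p v \<le> real n * (qform S b (p \<circ> Inl) v + r\<^sup>2 * (v \<bullet> v))"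
        unfolding split[OF v] by (intro mult_left_mono[of "_ + _"]) simp_all
      with kbound show ?thesis by (rule order_trans)
    qed
    moreover have "sum (p \<circ> Inl) S \<le> 1" using s1 n2 by simp
    moreover have "\<forall>k\<in>S. 0 \<le> (p \<circ> Inl) k" using pn by (auto simp: I_def)
    ultimately show ?thesis by (intro exI[of _ "p \<circ> Inl"]) auto
  qed
  have "\<forall>m::nat. \<exists>p. (\<forall>k\<in>S. 0 \<le> p k) \<and> sum p S \<le> 1 \<and>
      (\<forall>k\<in>S. \<forall>v\<in>carrier_vec n. (b k \<bullet> v)\<^sup>2 \<le> real n * (qform S b p v + (inverse (real (Suc m)))\<^sup>2 * (v \<bullet> v)))"
    by (intro allI reg) simp
  from choice[OF this] obtain f where "\<forall>m::nat. (\<forall>k\<in>S. 0 \<le> f m k) \<and> sum (f m) S \<le> 1 \<and>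
      (\<forall>k\<in>S. \<forall>v\<in>carrier_vec n. (b k \<bullet> v)\<^sup>2
        \<le> real n * (qform S b (f m) v + (inverse (real (Suc m)))\<^sup>2 * (v \<bullet> v)))" ..
  then have f: "\<And>m k. k \<in> S \<Longrightarrow> 0 \<le> f m k" "\<And>m. sum (f m) S \<le> 1"
    and fv: "\<And>m k v. k \<in> S \<Longrightarrow> v \<in> carrier_vec n \<Longrightarrow>
      (b k \<bullet> v)\<^sup>2 \<le> real n * (qform S b (f m) v + (inverse (real (Suc m)))\<^sup>2 * (v \<bullet> v))"
    by blast+
  have "\<exists>r l. strict_mono (r :: nat \<Rightarrow> nat) \<and> (\<forall>k\<in>S. (\<lambda>m. f (r m) k) \<longlonglongrightarrow> l k)"
    by (rule bounded_weights_subsequence) (use S f in auto)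
  then obtain r l where r: "strict_mono (r :: nat \<Rightarrow> nat)" and lim0: "\<forall>k\<in>S. (\<lambda>m. f (r m) k) \<longlonglongrightarrow> l k"
    by (elim exE conjE)
  have l: "(\<lambda>m. f (r m) k) \<longlonglongrightarrow> l k" if "k \<in> S" for k using lim0 that ..
  have l0: "0 \<le> l k" if "k \<in> S" for k
    by (rule LIMSEQ_le_const[OF l[OF that]]) (use f that in auto)
  have l1: "sum l S \<le> 1"
    by (rule LIMSEQ_le_const2[OF tendsto_sum[OF l]]) (use f in auto)
  have lim: "(b k \<bullet> v)\<^sup>2 \<le> real n * qform S b l v" if k: "k \<in> S" and v: "v \<in> carrier_vec n" for k v
  proof -
    have inv: "(\<lambda>m. inverse (real (Suc (r m)))) \<longlonglongrightarrow> 0"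
      using LIMSEQ_subseq_LIMSEQ[OF LIMSEQ_inverse_real_of_nat r] by (simp add: o_def)
    have "(\<lambda>m. real n * (qform S b (f (r m)) v + (inverse (real (Suc (r m))))\<^sup>2 * (v \<bullet> v)))
        \<longlonglongrightarrow> real n * (qform S b l v + 0\<^sup>2 * (v \<bullet> v))"
      unfolding qform_def by (intro tendsto_intros l inv)
    then have "(b k \<bullet> v)\<^sup>2 \<le> real n * (qform S b l v + 0\<^sup>2 * (v \<bullet> v))"
      by (rule LIMSEQ_le_const) (use fv[OF k v] in blast)
    then show ?thesis by simp
  qed
  \<comment> \<open>The limit may have total weight below \<open>1\<close>; the rest is put on an arbitrary index.\<close>
  obtain k0 where k0: "k0 \<in> S" using S by auto
  define p where "p = (\<lambda>k. l k + (if k = k0 then 1 - sum l S else 0))"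
  have "sum p S = 1" unfolding p_def using S k0 by (simp add: sum.distrib)
  then have "p \<in> simplex_on S" using l0 l1 by (auto simp: simplex_on_def p_def)
  moreover have "(b k \<bullet> v)\<^sup>2 \<le> real n * qform S b p v" if "k \<in> S" "v \<in> carrier_vec n" for k v
  proof -
    have "qform S b l v \<le> qform S b p v"
      unfolding qform_def p_def using l1 by (intro sum_mono mult_right_mono) auto
    then have "real n * qform S b l v \<le> real n * qform S b p v" by (rule mult_left_mono) simp
    then show ?thesis using lim[OF that] by (rule order_trans[rotated])
  qed
  ultimately show ?thesis by (intro bexI[of _ p] ballI)
qed

section \<open>Designs for biased linear bandits\<close>

context biased_bandit
begin

lemma avec_carrier: "x \<in> X \<Longrightarrow> avec x \<in> carrier_vec (d + 1)"
proof -
  assume "x \<in> X"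
  then have "x \<in> carrier_vec d" using X_dim by blast
  moreover have "vec 1 (\<lambda>_. real_of_int (z x)) \<in> carrier_vec 1" by (rule vec_carrier)
  ultimately show ?thesis unfolding avec_def by (rule append_carrier_vec)
qed

lemma avec_carrier_Suc [simp]: "x \<in> X \<Longrightarrow> avec x \<in> carrier_vec (Suc d)"
  using avec_carrier by simp

lemma avec_last: "x \<in> X \<Longrightarrow> avec x $ d = real_of_int (z x)"
  using X_dim by (auto simp: avec_def)

lemma z_square: "x \<in> X \<Longrightarrow> (real_of_int (z x))\<^sup>2 = 1"
  using groups[of x] by auto

lemma avec_inj: "inj_on avec X"
proof (rule inj_onI)
  fix x y assume xy: "x \<in> X" "y \<in> X" "avec x = avec y"
  have c: "x \<in> carrier_vec d" "y \<in> carrier_vec d" using xy X_dim by auto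
  show "x = y"
  proof (rule eq_vecI)
    fix i assume i: "i < dim_vec y"
    have "avec x $ i = avec y $ i" using xy by simp
    then show "x $ i = y $ i" using i c by (simp add: avec_def)
  qed (use c in auto)
qed

lemma X_nonempty: "X \<noteq> {}" using groups_nonempty by auto

lemma card_X_ge_2: "2 \<le> card X"
proof -
  obtain x y where xy: "x \<in> X" "z x = -1" "y \<in> X" "z y = 1" using groups_nonempty by auto
  then have "x \<noteq> y" by auto
  then have "card {x, y} = 2" by simp
  moreover have "card {x, y} \<le> card X" by (rule card_mono) (use finite_X xy in auto)
  ultimately show ?thesis by simp
qed

lemma dim_pos: "1 \<le> d"
proof (rule ccontr)
  assume "\<not> 1 \<le> d"
  then have d: "d = 0" by simp
  obtain x y where xy: "x \<in> X" "z x = -1" "y \<in> X" "z y = 1" using groups_nonempty by auto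
  then have "x \<in> carrier_vec 0" "y \<in> carrier_vec 0" using X_dim d by auto
  then have "x = y" by (intro eq_vecI) auto
  then show False using xy by simp
qed

abbreviation Q :: "(real vec \<Rightarrow> real) \<Rightarrow> real vec \<Rightarrow> real" where
  "Q \<equiv> qform X avec"

lemma V_eq_gram: "V \<mu> = gram (d + 1) X avec \<mu>"
  by (simp add: V_def gram_def)

lemma Q_mono: "(\<And>x. x \<in> X \<Longrightarrow> \<mu> x \<le> \<nu> x) \<Longrightarrow> Q \<mu> v \<le> Q \<nu> v"
  unfolding qform_def by (intro sum_mono mult_right_mono) auto

lemma Q_scale: "Q (\<lambda>x. c * \<mu> x) v = c * Q \<mu> v"
  by (simp add: qform_def sum_distrib_left mult_ac)

text \<open>
  The form in which variances are bounded from here on; \<open>V_eq_gram\<close> connects it to \<open>gram_variance_iff\<close>.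
\<close>

lemma variance_le_iff:
  assumes "\<And>x. x \<in> X \<Longrightarrow> 0 \<le> \<mu> x" "u \<in> carrier_vec (d + 1)" "0 \<le> c"
  shows "u \<in> mat_range (V \<mu>) \<and> variance \<mu> u \<le> c \<longleftrightarrow>
    (\<forall>v\<in>carrier_vec (d + 1). (u \<bullet> v)\<^sup>2 \<le> c * Q \<mu> v)"
  unfolding variance_def V_eq_gram
  by (rule gram_variance_iff) (use assms finite_X in auto)

lemma variance_nonneg:
  assumes "\<And>x. x \<in> X \<Longrightarrow> 0 \<le> \<mu> x" "u \<in> mat_range (V \<mu>)"
  shows "0 \<le> variance \<mu> u"
proof -
  have "(\<Sum>x\<in>X. \<mu> x * (u \<bullet> (ginv (V \<mu>) *\<^sub>v avec x))\<^sup>2) = variance \<mu> u"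
    unfolding variance_def V_eq_gram
    by (rule ginv_gram_estimator(2)) (use assms finite_X in \<open>auto simp: V_eq_gram\<close>)
  moreover have "0 \<le> (\<Sum>x\<in>X. \<mu> x * (u \<bullet> (ginv (V \<mu>) *\<^sub>v avec x))\<^sup>2)"
    using assms by (intro sum_nonneg) auto
  ultimately show ?thesis by simp
qed

lemma weights_onD: "\<mu> \<in> weights_on S \<Longrightarrow> 0 \<le> \<mu> x" "\<mu> \<in> weights_on S \<Longrightarrow> x \<notin> S \<Longrightarrow> \<mu> x = 0"
  by (auto simp: weights_on_def)

text \<open>
  A G-optimal design does at least as well as the design of Kiefer and Wolfowitz, whose variances are
  at most the dimension \<open>d + 1\<close>.
\<close>

lemma G_optimal_variance:
  assumes S: "S \<noteq> {}" "S \<subseteq> X" and opt: "G_optimal S \<pi>" and x: "x \<in> S"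
    and v: "v \<in> carrier_vec (d + 1)"
  shows "(avec x \<bullet> v)\<^sup>2 \<le> real (d + 1) * Q \<pi> v"
proof -
  have finS: "finite S" using S finite_X finite_subset by blast
  have SX: "y \<in> S \<Longrightarrow> y \<in> X" for y using S by auto
  have "\<exists>p\<in>simplex_on S. \<forall>k\<in>S. \<forall>v\<in>carrier_vec (d + 1).
      (avec k \<bullet> v)\<^sup>2 \<le> real (d + 1) * qform S avec p v"
    by (rule Kiefer_Wolfowitz) (use finS S SX in auto)
  then obtain p where p: "p \<in> simplex_on S"
    and kw: "\<forall>k\<in>S. \<forall>v\<in>carrier_vec (d + 1). (avec k \<bullet> v)\<^sup>2 \<le> real (d + 1) * qform S avec p v" ..
  define \<pi>' where "\<pi>' = (\<lambda>x. if x \<in> S then p x else 0)"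
  have Q': "Q \<pi>' v = qform S avec p v" for v
  proof -
    have "Q \<pi>' v = (\<Sum>x\<in>S. \<pi>' x * (avec x \<bullet> v)\<^sup>2)" unfolding qform_def
      by (rule sum.mono_neutral_right) (use S finite_X in \<open>auto simp: \<pi>'_def\<close>)
    then show ?thesis by (simp add: qform_def \<pi>'_def)
  qed
  have w': "\<pi>' \<in> weights_on S" and pr': "sum \<pi>' S = 1"
    using p by (auto simp: weights_on_def \<pi>'_def simplex_on_def)
  have var': "avec y \<in> mat_range (V \<pi>') \<and> variance \<pi>' (avec y) \<le> real (d + 1)" if y: "y \<in> S" for y
    by (subst variance_le_iff) (use y SX kw w' in \<open>auto simp: Q' weights_onD\<close>)
  have cov: "\<pi>' \<in> covering_designs S"
    unfolding covering_designs_def prob_on_def using w' pr' var' by auto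
  have "max_variance S \<pi> \<le> max_variance S \<pi>'" using opt cov by (auto simp: G_optimal_def)
  also have "\<dots> \<le> real (d + 1)" unfolding max_variance_def
    using finS S var' by (subst Max_le_iff) auto
  finally have "max_variance S \<pi> \<le> real (d + 1)" .
  moreover have "variance \<pi> (avec x) \<le> max_variance S \<pi>"
    unfolding max_variance_def using finS x by (intro Max_ge) auto
  ultimately have "variance \<pi> (avec x) \<le> real (d + 1)" by simp
  moreover have \<pi>: "\<pi> \<in> weights_on S" and "avec x \<in> mat_range (V \<pi>)"
    using opt x by (auto simp: G_optimal_def covering_designs_def prob_on_def)
  ultimately have "avec x \<in> mat_range (V \<pi>) \<and> variance \<pi> (avec x) \<le> real (d + 1)" by simp
  then show ?thesis
    by (subst (asm) variance_le_iff) (use SX x v weights_onD(1)[OF \<pi>] in auto)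
qed

lemma G_optimal_prob: "G_optimal S \<pi> \<Longrightarrow> \<pi> \<in> weights_on S \<and> sum \<pi> S = 1"
  by (auto simp: G_optimal_def covering_designs_def prob_on_def)

lemma feasible_iff:
  "\<mu> \<in> feasible_designs \<longleftrightarrow>
    \<mu> \<in> weights_on X \<and> (\<forall>v\<in>carrier_vec (d + 1). (e_last \<bullet> v)\<^sup>2 \<le> Q \<mu> v)"
proof (cases "\<mu> \<in> weights_on X")
  case True
  then show ?thesis
    using variance_le_iff[of \<mu> e_last 1] weights_onD(1)[OF True] by (auto simp: feasible_designs_def M_e_def)
qed (auto simp: feasible_designs_def M_e_def)

text \<open>
  What the spanning assumption provides: the bias is a linear combination of the mean observations of the
  actions, so that some design identifies it.
\<close>

lemma e_last_combination:
  "\<exists>cf. \<forall>v\<in>carrier_vec (d + 1). e_last \<bullet> v = (\<Sum>x\<in>X. cf x * (avec x \<bullet> v))"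
proof -
  interpret W: vec_space "TYPE(real)" "d + 1" .
  have sub: "avec ` X \<subseteq> carrier_vec (d + 1)" by auto
  have "e_last \<in> W.span (avec ` X)" using spanning by simp
  then have "\<exists>a A. finite A \<and> A \<subseteq> avec ` X \<and> e_last = W.lincomb a A"
    unfolding W.span_def by blast
  then obtain a A where fA: "finite A" and A: "A \<subseteq> avec ` X" and e: "e_last = W.lincomb a A"
    by (elim exE conjE)
  have Ac: "A \<subseteq> carrier_vec (d + 1)" using A sub by blast
  define cf where "cf = (\<lambda>x. if avec x \<in> A then a (avec x) else 0)"
  have "e_last \<bullet> v = (\<Sum>x\<in>X. cf x * (avec x \<bullet> v))" if v: "v \<in> carrier_vec (d + 1)" for v
  proof -
    define N where "N = d + 1"
    have v': "v \<in> carrier_vec N" using v by (simp only: N_def)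
    have "e_last \<bullet> v = (\<Sum>i<N. W.lincomb a A $ i * v $ i)"
      unfolding e using v' by (simp add: scalar_prod_def lessThan_atLeast0)
    also have "\<dots> = (\<Sum>i<N. (\<Sum>y\<in>A. a y * y $ i) * v $ i)"
      using W.lincomb_index[OF _ Ac] by (intro sum.cong) (auto simp: N_def)
    also have "\<dots> = (\<Sum>i<N. \<Sum>y\<in>A. a y * (y $ i * v $ i))"
      by (simp add: sum_distrib_right sum_distrib_left mult_ac)
    also have "\<dots> = (\<Sum>y\<in>A. \<Sum>i<N. a y * (y $ i * v $ i))" by (rule sum.swap)
    also have "\<dots> = (\<Sum>y\<in>A. a y * (y \<bullet> v))"
      using v' by (simp add: scalar_prod_def lessThan_atLeast0 sum_distrib_left)
    also have "\<dots> = (\<Sum>y\<in>avec ` X. if y \<in> A then a y * (y \<bullet> v) else 0)"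
      using A finite_X by (simp add: sum.If_cases Int_absorb1)
    also have "\<dots> = (\<Sum>x\<in>X. if avec x \<in> A then a (avec x) * (avec x \<bullet> v) else 0)"
      by (simp add: sum.reindex[OF avec_inj])
    also have "\<dots> = (\<Sum>x\<in>X. cf x * (avec x \<bullet> v))"
      by (intro sum.cong) (auto simp: cf_def)
    finally show ?thesis .
  qed
  then have "\<forall>v\<in>carrier_vec (d + 1). e_last \<bullet> v = (\<Sum>x\<in>X. cf x * (avec x \<bullet> v))" ..
  then show ?thesis by (intro exI[of _ cf])
qed

text \<open>
  Multiplying a probability design by its variance brings the variance down to \<open>1\<close>. This relates the
  two optimisation problems behind \<open>kappa_star\<close> and \<open>kappa\<close>. The variance is at least \<open>1\<close> because
  the last component of every \<open>avec x\<close> is \<open>1\<close> or \<open>-1\<close>: test the dual bound with \<open>e_last\<close> itself.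
\<close>

lemma scaled_P_e_feasible:
  assumes "\<pi> \<in> P_e"
  shows "(\<lambda>x. variance \<pi> e_last * \<pi> x) \<in> feasible_designs" and "1 \<le> variance \<pi> e_last"
proof -
  have \<pi>: "\<pi> \<in> weights_on X" "sum \<pi> X = 1" and r: "e_last \<in> mat_range (V \<pi>)"
    using assms by (auto simp: P_e_def prob_on_def)
  have pos: "0 \<le> \<pi> x" for x using \<pi> by (simp add: weights_onD)
  have v0: "0 \<le> variance \<pi> e_last" by (rule variance_nonneg) (use pos r in auto)
  have *: "(e_last \<bullet> v)\<^sup>2 \<le> variance \<pi> e_last * Q \<pi> v" if v: "v \<in> carrier_vec (d + 1)" for v
    using variance_le_iff[of \<pi> e_last "variance \<pi> e_last"] pos v0 r v by auto
  show "(\<lambda>x. variance \<pi> e_last * \<pi> x) \<in> feasible_designs"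
    unfolding feasible_iff Q_scale using * \<pi> v0 by (auto simp: weights_on_def)
  have "Q \<pi> e_last = sum \<pi> X"
    unfolding qform_def by (intro sum.cong) (auto simp: avec_last z_square)
  then show "1 \<le> variance \<pi> e_last" using *[of e_last] \<pi> by simp
qed

lemma P_e_nonempty: "P_e \<noteq> {}"
proof -
  obtain cf where l0: "\<forall>v\<in>carrier_vec (d + 1). e_last \<bullet> v = (\<Sum>x\<in>X. cf x * (avec x \<bullet> v))"
    using e_last_combination by (elim exE)
  have l: "e_last \<bullet> v = (\<Sum>x\<in>X. cf x * (avec x \<bullet> v))" if "v \<in> carrier_vec (d + 1)" for v
    using l0 that ..
  define \<pi> where "\<pi> = (\<lambda>x. if x \<in> X then 1 / real (card X) else 0)"
  \<comment> \<open>The uniform design identifies the bias, by the Cauchy--Schwarz inequality for the representation of \<open>e_last\<close>.\<close>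
  define c where "c = (\<Sum>x\<in>X. (cf x)\<^sup>2) * real (card X)"
  have cX: "0 < real (card X)" using card_X_ge_2 by simp
  have c0: "0 \<le> c" unfolding c_def by (intro mult_nonneg_nonneg sum_nonneg) simp_all
  have \<pi>: "\<pi> \<in> prob_on X" using cX by (auto simp: prob_on_def weights_on_def \<pi>_def)
  have "(e_last \<bullet> v)\<^sup>2 \<le> c * Q \<pi> v" if v: "v \<in> carrier_vec (d + 1)" for v
  proof -
    have "(e_last \<bullet> v)\<^sup>2 \<le> (\<Sum>x\<in>X. (cf x)\<^sup>2) * (\<Sum>x\<in>X. (avec x \<bullet> v)\<^sup>2)"
      unfolding l[OF v] by (rule Cauchy_Schwarz_ineq_sum)
    also have "\<dots> = c * Q \<pi> v" unfolding c_def qform_def \<pi>_def using cX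
      by (simp add: sum_distrib_left[symmetric] sum_divide_distrib[symmetric])
    finally show ?thesis .
  qed
  then have "e_last \<in> mat_range (V \<pi>) \<and> variance \<pi> e_last \<le> c"
    by (subst variance_le_iff) (use c0 in \<open>auto simp: \<pi>_def\<close>)
  then show ?thesis using \<pi> by (auto simp: P_e_def)
qed

lemma kappa_star_ge_1: "1 \<le> kappa_star"
  unfolding kappa_star_def
  by (rule cINF_greatest) (use P_e_nonempty scaled_P_e_feasible(2) in auto)

lemma feasible_nonempty: "feasible_designs \<noteq> {}"
  using P_e_nonempty scaled_P_e_feasible(1) by blast

lemma cost_nonneg:
  assumes "\<mu> \<in> feasible_designs" "\<And>x. x \<in> X \<Longrightarrow> 0 \<le> \<Delta> x" shows "0 \<le> cost \<Delta> \<mu>"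
  unfolding cost_def using assms
  by (intro sum_nonneg mult_nonneg_nonneg) (auto simp: feasible_iff weights_onD)

lemma kappa_le_cost:
  assumes "\<mu> \<in> feasible_designs" "\<And>x. x \<in> X \<Longrightarrow> 0 \<le> \<Delta> x" shows "kappa \<Delta> \<le> cost \<Delta> \<mu>"
  unfolding kappa_def
  by (rule cINF_lower[OF bdd_belowI2[where m = 0]]) (use assms cost_nonneg in auto)

lemma kappa_greatest:
  assumes "\<And>\<mu>. \<mu> \<in> feasible_designs \<Longrightarrow> c \<le> cost \<Delta> \<mu>" shows "c \<le> kappa \<Delta>"
  unfolding kappa_def by (rule cINF_greatest[OF feasible_nonempty]) (rule assms)

lemma kappa_nonneg: "(\<And>x. x \<in> X \<Longrightarrow> 0 \<le> \<Delta> x) \<Longrightarrow> 0 \<le> kappa \<Delta>"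
  by (rule kappa_greatest) (rule cost_nonneg)

lemma Delta_optimal_cost:
  assumes "Delta_optimal \<Delta> \<mu>" "\<And>x. x \<in> X \<Longrightarrow> 0 \<le> \<Delta> x"
  shows "cost \<Delta> \<mu> = kappa \<Delta>"
proof (rule antisym)
  show "cost \<Delta> \<mu> \<le> kappa \<Delta>" by (rule kappa_greatest) (use assms in \<open>auto simp: Delta_optimal_def\<close>)
  show "kappa \<Delta> \<le> cost \<Delta> \<mu>" by (rule kappa_le_cost) (use assms in \<open>auto simp: Delta_optimal_def\<close>)
qed

text \<open>
  Monotonicity and homogeneity of \<open>kappa\<close> in one statement: gap vectors that agree up to a constant factor
  have the same \<open>kappa\<close> up to that factor.
\<close>

lemma kappa_scale:
  assumes D: "\<And>x. x \<in> X \<Longrightarrow> 0 \<le> \<Delta> x \<and> \<Delta> x \<le> c * \<Delta>' x" and c: "0 < c"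
  shows "kappa \<Delta> \<le> c * kappa \<Delta>'"
proof -
  have "kappa \<Delta> / c \<le> kappa \<Delta>'"
  proof (rule kappa_greatest)
    fix \<mu> assume \<mu>: "\<mu> \<in> feasible_designs"
    have "kappa \<Delta> \<le> cost \<Delta> \<mu>" by (rule kappa_le_cost[OF \<mu>]) (use D in auto)
    also have "\<dots> \<le> (\<Sum>x\<in>X. \<mu> x * (c * \<Delta>' x))" unfolding cost_def
      using \<mu> D by (intro sum_mono mult_left_mono) (auto simp: feasible_iff weights_onD)
    also have "\<dots> = c * cost \<Delta>' \<mu>" by (simp add: cost_def sum_distrib_left mult_ac)
    finally show "kappa \<Delta> / c \<le> cost \<Delta>' \<mu>" using c by (simp add: field_simps)
  qed
  then show ?thesis using c by (simp add: field_simps)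
qed

lemma kappa_le_kappa_star:
  assumes D: "\<And>x. x \<in> X \<Longrightarrow> 0 \<le> \<Delta> x \<and> \<Delta> x \<le> D" and "0 < D"
  shows "kappa \<Delta> \<le> D * kappa_star"
proof -
  have "kappa \<Delta> / D \<le> kappa_star" unfolding kappa_star_def
  proof (rule cINF_greatest[OF P_e_nonempty])
    fix \<pi> assume \<pi>: "\<pi> \<in> P_e"
    let ?v = "variance \<pi> e_last"
    have p: "sum \<pi> X = 1" "\<And>x. 0 \<le> \<pi> x" using \<pi> by (auto simp: P_e_def prob_on_def weights_onD)
    have v: "1 \<le> ?v" by (rule scaled_P_e_feasible(2)[OF \<pi>])
    have "kappa \<Delta> \<le> cost \<Delta> (\<lambda>x. ?v * \<pi> x)"
      by (rule kappa_le_cost[OF scaled_P_e_feasible(1)[OF \<pi>]]) (use D in auto)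
    also have "\<dots> \<le> (\<Sum>x\<in>X. ?v * \<pi> x * D)" unfolding cost_def
      using D p v by (intro sum_mono mult_left_mono mult_nonneg_nonneg) auto
    also have "\<dots> = ?v * D" using p by (simp add: sum_distrib_left[symmetric] sum_distrib_right[symmetric])
    finally show "kappa \<Delta> / D \<le> ?v" using \<open>0 < D\<close> by (simp add: field_simps)
  qed
  then show ?thesis using \<open>0 < D\<close> by (simp add: field_simps)
qed

text \<open>
  Rounding the sample sizes up can only decrease the variance, since the quadratic form grows with the
  weights.
\<close>

lemma variance_of_scaled_design:
  assumes u: "u \<in> carrier_vec (d + 1)" and \<pi>: "\<And>x. x \<in> X \<Longrightarrow> 0 \<le> \<pi> x"
    and \<mu>: "\<And>x. x \<in> X \<Longrightarrow> s * \<pi> x \<le> \<mu> x" and s: "0 < s" and c: "0 \<le> c"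
    and var: "\<And>v. v \<in> carrier_vec (d + 1) \<Longrightarrow> (u \<bullet> v)\<^sup>2 \<le> c * Q \<pi> v"
  shows "u \<in> mat_range (V \<mu>)" "variance \<mu> u \<le> c / s"
proof -
  have m0: "0 \<le> \<mu> x" if "x \<in> X" for x using \<mu>[OF that] \<pi>[OF that] s by (smt (verit) mult_nonneg_nonneg)
  have "(u \<bullet> v)\<^sup>2 \<le> c / s * Q \<mu> v" if v: "v \<in> carrier_vec (d + 1)" for v
  proof -
    have "c / s * (s * Q \<pi> v) \<le> c / s * Q \<mu> v"
      unfolding Q_scale[symmetric] using c s \<mu> by (intro mult_left_mono Q_mono) auto
    then show ?thesis using var[OF v] s by simp
  qed
  then have "u \<in> mat_range (V \<mu>) \<and> variance \<mu> u \<le> c / s"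
    by (subst variance_le_iff) (use m0 u c s in auto)
  then show "u \<in> mat_range (V \<mu>)" "variance \<mu> u \<le> c / s" by auto
qed

end

section \<open>The run of the algorithm\<close>

lemma sum_list_eq_sum_count:
  fixes f :: "'a \<Rightarrow> real"
  assumes "finite A" "set xs \<subseteq> A"
  shows "(\<Sum>x\<leftarrow>xs. f x) = (\<Sum>x\<in>A. real (count_list xs x) * f x)"
  using assms(2)
proof (induction xs)
  case (Cons y ys)
  have "(\<Sum>x\<in>A. real (count_list (y # ys) x) * f x) =
      (\<Sum>x\<in>A. real (count_list ys x) * f x + (if x = y then f y else 0))"
    by (intro sum.cong) (auto simp: algebra_simps)
  also have "\<dots> = (\<Sum>x\<in>A. real (count_list ys x) * f x) + f y"
    using Cons.prems assms(1) by (simp add: sum.distrib)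
  finally show ?case using Cons by simp
qed simp

lemma sum_nth_eq_sum_count:
  fixes f :: "'a \<Rightarrow> real"
  assumes "finite A" "set xs \<subseteq> A"
  shows "(\<Sum>i<length xs. f (xs ! i)) = (\<Sum>x\<in>A. real (count_list xs x) * f x)"
proof -
  have "(\<Sum>i<length xs. f (xs ! i)) = (\<Sum>x\<leftarrow>xs. f x)"
    by (simp add: sum_list_sum_nth lessThan_atLeast0)
  then show ?thesis using sum_list_eq_sum_count[OF assms] by simp
qed

lemma length_eq_sum_count:
  assumes "finite A" "set xs \<subseteq> A"
  shows "length xs = (\<Sum>x\<in>A. count_list xs x)"
proof -
  have "real (length xs) = real (\<Sum>x\<in>A. count_list xs x)"
    using sum_nth_eq_sum_count[OF assms, of "\<lambda>_. 1"] by simp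
  then show ?thesis by (simp only: of_nat_eq_iff)
qed

text \<open>
  All deterministic properties of the algorithm hold for arbitrary observations; the observations \<open>pull\<close>
  therefore stay a parameter of the interpretation \<open>A\<close>.
\<close>

locale fpe_setting = biased_bandit d X z \<gamma>
  for d :: nat and X :: "real vec set" and z :: "real vec \<Rightarrow> int" and \<gamma> :: "real vec" +
  fixes \<omega> :: real and T :: nat and R :: choice_rules
  assumes T_ge_2: "2 \<le> T" and valid: "valid_choices R"
begin

sublocale A: fair_phased_elimination d X z "1 / real T" T R pull for pull .

definition group_counts :: "nat \<Rightarrow> int \<Rightarrow> fpe_state \<Rightarrow> real vec \<Rightarrow> nat" where
  "group_counts l g s = A.group_counts l (G_design R (hist s) (active s g))"

definition bias_counts :: "nat \<Rightarrow> fpe_state \<Rightarrow> real vec \<Rightarrow> nat" where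
  "bias_counts l s = A.bias_counts l (Delta_design R (hist s) (gaps s))"

text \<open>
  Nonempty active sets and positive gaps are what makes the choice rules of the algorithm applicable.
\<close>

definition wf_state :: "fpe_state \<Rightarrow> bool" where
  "wf_state s \<longleftrightarrow> length (hist s) \<le> T \<and> fst ` set (hist s) \<subseteq> X \<and>
     (\<forall>g\<in>{-1, 1}. active s g \<noteq> {} \<and> active s g \<subseteq> {x\<in>X. z x = g}) \<and>
     best_group s \<in> {-1, 0, 1} \<and> gaps s \<in> X \<rightarrow>\<^sub>E {0<..}"

lemma wf_stateD:
  assumes "wf_state s"
  shows "length (hist s) \<le> T" "fst ` set (hist s) \<subseteq> X"
    "g \<in> {-1, 1} \<Longrightarrow> active s g \<noteq> {}" "g \<in> {-1, 1} \<Longrightarrow> active s g \<subseteq> {x\<in>X. z x = g}"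
    "g \<in> {-1, 1} \<Longrightarrow> active s g \<subseteq> X" "g \<in> {-1, 1} \<Longrightarrow> finite (active s g)"
    "best_group s \<in> {-1, 0, 1}" "gaps s \<in> X \<rightarrow>\<^sub>E {0<..}"
proof -
  show "g \<in> {-1, 1} \<Longrightarrow> active s g \<subseteq> X" using assms by (auto simp: wf_state_def)
  then show "g \<in> {-1, 1} \<Longrightarrow> finite (active s g)" using finite_X finite_subset by blast
qed (use assms in \<open>auto simp: wf_state_def\<close>)

lemma eps_pos: "0 < A.eps l"
  by (simp add: A.eps_def)

lemma eps_Suc: "A.eps l = 2 * A.eps (Suc l)"
proof -
  have "A.eps l = 2 powr (1 + (2 - real (Suc l)))" by (simp add: A.eps_def)
  also have "\<dots> = 2 * A.eps (Suc l)" by (subst powr_add) (simp add: A.eps_def)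
  finally show ?thesis .
qed

lemma eps_1: "A.eps 1 = 2"
  by (simp add: A.eps_def)

lemma eps_le_2: "1 \<le> l \<Longrightarrow> A.eps l \<le> 2"
proof -
  assume "1 \<le> l"
  then have "A.eps l \<le> 2 powr 1" unfolding A.eps_def by (intro powr_mono) auto
  then show ?thesis by simp
qed

lemma first_group: "first_group R h \<in> {-1, 1}"
  using valid by (simp add: valid_choices_def)

lemma G_design_props:
  assumes "wf_state s" "g \<in> {-1, 1}"
  shows "G_optimal (active s g) (G_design R h (active s g))"
    "card {x. G_design R h (active s g) x \<noteq> 0} \<le> (d + 1) * (d + 2) div 2"
proof -
  have "\<forall>h. \<forall>g\<in>{-1, 1}. \<forall>S. S \<noteq> {} \<and> S \<subseteq> {x\<in>X. z x = g} \<longrightarrow>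
      G_optimal S (G_design R h S) \<and>
      card {x. G_design R h S x \<noteq> 0} \<le> (d + 1) * (d + 2) div 2"
    using valid unfolding valid_choices_def by (elim conjE)
  from this[rule_format, OF assms(2), of "active s g" h]
  have "G_optimal (active s g) (G_design R h (active s g)) \<and>
      card {x. G_design R h (active s g) x \<noteq> 0} \<le> (d + 1) * (d + 2) div 2"
    using wf_stateD(3,4)[OF assms] assms(2) by simp
  then show "G_optimal (active s g) (G_design R h (active s g))"
    "card {x. G_design R h (active s g) x \<noteq> 0} \<le> (d + 1) * (d + 2) div 2" by blast+
qed

lemma Delta_design_props:
  assumes "wf_state s"
  shows "Delta_optimal (gaps s) (Delta_design R h (gaps s))"
    "card {x. Delta_design R h (gaps s) x \<noteq> 0} \<le> d + 1"
  using valid wf_stateD(8)[OF assms] by (auto simp: valid_choices_def)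

lemma schedule_props:
  assumes "\<And>x. x \<notin> X \<Longrightarrow> \<mu> x = 0"
  shows "count_list (schedule R h \<mu>) x = \<mu> x" "set (schedule R h \<mu>) \<subseteq> X"
    "length (schedule R h \<mu>) = sum \<mu> X"
proof -
  show 1: "count_list (schedule R h \<mu>) x = \<mu> x" for x
    using valid assms by (auto simp: valid_choices_def)
  show 2: "set (schedule R h \<mu>) \<subseteq> X"
  proof
    fix x assume x: "x \<in> set (schedule R h \<mu>)"
    show "x \<in> X"
    proof (rule ccontr)
      assume "x \<notin> X"
      then have "count_list (schedule R h \<mu>) x = 0" using 1 assms by simp
      then show False using x by (simp add: count_list_0_iff)
    qed
  qed
  show "length (schedule R h \<mu>) = sum \<mu> X"
    using length_eq_sum_count[OF finite_X 2] 1 by simp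
qed

lemma best_action: "S \<noteq> {} \<Longrightarrow> S \<subseteq> X \<Longrightarrow> best_action R h S \<in> S"
  using valid by (auto simp: valid_choices_def)

lemma group_counts_outside:
  assumes "wf_state s" "g \<in> {-1, 1}" "x \<notin> active s g"
  shows "group_counts l g s x = 0"
proof -
  have "G_design R (hist s) (active s g) x = 0"
    using G_optimal_prob[OF G_design_props(1)[OF assms(1,2), of "hist s"]] assms(3)
    by (auto intro: weights_onD(2))
  then show ?thesis by (simp add: group_counts_def A.group_counts_def)
qed

lemma group_counts_sum:
  assumes "wf_state s" "g \<in> {-1, 1}"
  shows "sum (group_counts l g s) X = sum (group_counts l g s) (active s g)"
  by (rule sum.mono_neutral_right)
     (use assms wf_stateD(5)[OF assms] finite_X group_counts_outside in auto)

lemma bias_counts_outside: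
  assumes "wf_state s" "x \<notin> X"
  shows "bias_counts l s x = 0"
proof -
  have "Delta_design R (hist s) (gaps s) x = 0"
    using Delta_design_props(1)[OF assms(1), of "hist s"] assms(2)
    by (auto simp: Delta_optimal_def feasible_iff intro: weights_onD(2))
  then show ?thesis by (simp add: bias_counts_def A.bias_counts_def)
qed

subsection \<open>Sampling\<close>

lemma sample_eq:
  "A.sample p h xs = h @ map (\<lambda>i. (xs ! i, p (length h + i) (xs ! i))) [0..<length xs]"
proof (induction xs rule: rev_induct)
  case (snoc x xs)
  have "A.sample p h (xs @ [x]) = A.sample p h xs @ [(x, p (length (A.sample p h xs)) x)]"
    by (simp add: A.sample_def)
  also have "\<dots> = h @ map (\<lambda>i. ((xs @ [x]) ! i, p (length h + i) ((xs @ [x]) ! i))) [0..<length (xs @ [x])]"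
    unfolding snoc by (simp add: nth_append)
  finally show ?case .
qed (simp add: A.sample_def)

lemma length_sample [simp]: "length (A.sample p h xs) = length h + length xs"
  by (simp add: sample_eq)

lemma drop_sample [simp]:
  "drop (length h) (A.sample p h xs) = map (\<lambda>i. (xs ! i, p (length h + i) (xs ! i))) [0..<length xs]"
  by (simp add: sample_eq)

lemma map_fst_sample [simp]: "map fst (A.sample p h xs) = map fst h @ xs"
  by (simp add: sample_eq o_def map_nth)

lemma fst_set_sample [simp]: "fst ` set (A.sample p h xs) = fst ` set h \<union> set xs"
proof -
  have "set (map fst (A.sample p h xs)) = set (map fst h @ xs)" by (simp only: map_fst_sample)
  then show ?thesis by (simp only: set_map set_append)
qed

lemma length_spend_all: "length h \<le> T \<Longrightarrow> length (A.spend_all p h x) = T"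
  by (simp add: A.spend_all_def)

lemma map_fst_spend_all [simp]:
  "map fst (A.spend_all p h x) = map fst h @ replicate (T - length h) x"
  by (simp add: A.spend_all_def)

lemma fst_set_spend_all: "fst ` set (A.spend_all p h x) \<subseteq> fst ` set h \<union> {x}"
  by (auto simp: A.spend_all_def)

subsection \<open>The two kinds of stages\<close>

definition group_completes :: "nat \<Rightarrow> int \<Rightarrow> fpe_state \<Rightarrow> bool" where
  "group_completes l g s \<longleftrightarrow> length (hist s) + sum (group_counts l g s) (active s g) \<le> T"

definition group_schedule :: "nat \<Rightarrow> int \<Rightarrow> fpe_state \<Rightarrow> real vec list" where
  "group_schedule l g s = schedule R (hist s) (group_counts l g s)"

definition bias_completes :: "nat \<Rightarrow> fpe_state \<Rightarrow> bool" where
  "bias_completes l s \<longleftrightarrow> (kappa (gaps s) * ln (real T) / real T) powr (1/3) < A.eps l \<and>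
     length (hist s) + sum (bias_counts l s) X \<le> T"

definition bias_schedule :: "nat \<Rightarrow> fpe_state \<Rightarrow> real vec list" where
  "bias_schedule l s = schedule R (hist s) (bias_counts l s)"

definition observe :: "(nat \<Rightarrow> real vec \<Rightarrow> real) \<Rightarrow> nat \<Rightarrow> real vec list \<Rightarrow> history" where
  "observe p n xs = map (\<lambda>i. (xs ! i, p (n + i) (xs ! i))) [0..<length xs]"

definition group_estimate :: "(nat \<Rightarrow> real vec \<Rightarrow> real) \<Rightarrow> nat \<Rightarrow> int \<Rightarrow> fpe_state \<Rightarrow> real vec" where
  "group_estimate p l g s = A.least_squares (group_counts l g s)
     (observe p (length (hist s)) (group_schedule l g s))"

definition bias_estimate :: "(nat \<Rightarrow> real vec \<Rightarrow> real) \<Rightarrow> nat \<Rightarrow> fpe_state \<Rightarrow> real" where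
  "bias_estimate p l s = e_last \<bullet> A.least_squares (bias_counts l s)
     (observe p (length (hist s)) (bias_schedule l s))"

definition mean_estimate :: "(nat \<Rightarrow> real vec \<Rightarrow> real) \<Rightarrow> nat \<Rightarrow> fpe_state \<Rightarrow> real vec \<Rightarrow> real" where
  "mean_estimate p l s x = avec x \<bullet> theta s (z x) - real_of_int (z x) * bias_estimate p l s"

definition survivors :: "nat \<Rightarrow> real vec set \<Rightarrow> real vec \<Rightarrow> real vec set" where
  "survivors l S \<theta> = {x\<in>S. (MAX x'\<in>S. (avec x' - avec x) \<bullet> \<theta>) \<le> 3 * A.eps l}"

definition candidates :: "fpe_state \<Rightarrow> real vec set" where
  "candidates s = active s (-1) \<union> active s 1"

definition leads :: "nat \<Rightarrow> fpe_state \<Rightarrow> (real vec \<Rightarrow> real) \<Rightarrow> int \<Rightarrow> bool" where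
  "leads l s m g \<longleftrightarrow> (MAX x\<in>active s g. m x) - 2 * A.eps l \<ge> (MAX x\<in>active s (- g). m x) + 2 * A.eps l"

lemma group_step_complete:
  assumes "group_completes l g s"
  shows "A.group_step p l g s = s\<lparr>hist := A.sample p (hist s) (group_schedule l g s),
     theta := (theta s)(g := group_estimate p l g s),
     active := (active s)(g := survivors l (active s g) (group_estimate p l g s))\<rparr>"
  using assms
  by (simp add: A.group_step_def Let_def group_completes_def group_counts_def group_schedule_def
      group_estimate_def observe_def survivors_def)

lemma group_step_incomplete:
  assumes "\<not> group_completes l g s"
  shows "A.group_step p l g s = s\<lparr>hist := A.spend_all p (hist s) (best_action R (hist s) (active s g))\<rparr>"
  using assms
  by (simp add: A.group_step_def Let_def group_completes_def group_counts_def)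

lemma bias_step_complete:
  assumes "bias_completes l s"
  shows "A.bias_step p l s = s\<lparr>hist := A.sample p (hist s) (bias_schedule l s),
     gaps := (\<lambda>x\<in>X. if x \<in> candidates s
        then min 2 ((MAX x'\<in>candidates s. mean_estimate p l s x') - mean_estimate p l s x + 4 * A.eps l)
        else gaps s x),
     best_group := (if leads l s (mean_estimate p l s) 1 then 1
        else if leads l s (mean_estimate p l s) (-1) then -1 else 0)\<rparr>"
proof -
  have c: "(A.eps l \<le> (kappa (gaps s) * ln (real T) / real T) powr (1/3) \<or>
      length (hist s) + sum (A.bias_counts l (Delta_design R (hist s) (gaps s))) X > T) = False"
    using assms by (auto simp: bias_completes_def bias_counts_def)
  show ?thesis
    by (simp only: A.bias_step_def Let_def c if_False bias_counts_def bias_schedule_def bias_estimate_def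
        candidates_def mean_estimate_def[abs_def] leads_def observe_def drop_sample)
qed

lemma bias_step_incomplete:
  assumes "\<not> bias_completes l s"
  shows "A.bias_step p l s = s\<lparr>hist := A.spend_all p (hist s) (best_action R (hist s) (candidates s))\<rparr>"
proof -
  have c: "(A.eps l \<le> (kappa (gaps s) * ln (real T) / real T) powr (1/3) \<or>
      length (hist s) + sum (A.bias_counts l (Delta_design R (hist s) (gaps s))) X > T) = True"
    using assms by (auto simp: bias_completes_def bias_counts_def)
  show ?thesis by (simp only: A.bias_step_def Let_def c if_True candidates_def)
qed

definition group_phase :: "(nat \<Rightarrow> real vec \<Rightarrow> real) \<Rightarrow> nat \<Rightarrow> fpe_state \<Rightarrow> fpe_state" where
  "group_phase p l s = (let f = first_group R (hist s) in
     if best_group s = 0 then A.group_step p l (- f) (A.group_step p l f s)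
     else A.group_step p l (best_group s) s)"

lemma phase_eq:
  assumes "wf_state s"
  shows "A.phase p l s = (if T \<le> length (hist s) then s
    else if best_group s \<noteq> 0 \<or> T \<le> length (hist (group_phase p l s)) then group_phase p l s
    else A.bias_step p l (group_phase p l s))"
proof -
  have "fold (A.group_step p l) (filter (\<lambda>g'. g' \<noteq> - best_group s)
      [first_group R (hist s), - first_group R (hist s)]) s = group_phase p l s"
    using first_group[of "hist s"] wf_stateD(7)[OF assms] by (auto simp: group_phase_def Let_def)
  then show ?thesis by (simp only: A.phase_def Let_def)
qed

subsection \<open>Invariants that hold for all observations\<close>

text \<open>
  The action with the largest estimate is never eliminated.
\<close>

lemma survivors_nonempty:
  assumes "finite S" "S \<noteq> {}" "S \<subseteq> X" "dim_vec \<theta> = d + 1"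
  shows "survivors l S \<theta> \<noteq> {}"
proof -
  have \<theta>: "\<theta> \<in> carrier_vec (d + 1)" using assms(4) by (intro carrier_vecI)
  obtain x where x: "x \<in> S" and max: "\<forall>x'\<in>S. avec x' \<bullet> \<theta> \<le> avec x \<bullet> \<theta>"
  proof -
    have "Max ((\<lambda>x. avec x \<bullet> \<theta>) ` S) \<in> (\<lambda>x. avec x \<bullet> \<theta>) ` S" using assms by (intro Max_in) auto
    then obtain x where "x \<in> S" "avec x \<bullet> \<theta> = Max ((\<lambda>x. avec x \<bullet> \<theta>) ` S)" by auto
    moreover from this have "\<forall>x'\<in>S. avec x' \<bullet> \<theta> \<le> avec x \<bullet> \<theta>" using assms by auto
    ultimately show ?thesis using that by blast
  qed
  have "(MAX x'\<in>S. (avec x' - avec x) \<bullet> \<theta>) \<le> 0"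
  proof (subst Max_le_iff)
    show "\<forall>a\<in>(\<lambda>x'. (avec x' - avec x) \<bullet> \<theta>) ` S. a \<le> 0"
    proof clarify
      fix x' assume x': "x' \<in> S"
      have "(avec x' - avec x) \<bullet> \<theta> = avec x' \<bullet> \<theta> - avec x \<bullet> \<theta>"
        using x x' assms(3) avec_carrier \<theta> by (intro minus_scalar_prod_distrib) auto
      then show "(avec x' - avec x) \<bullet> \<theta> \<le> 0" using max x' by simp
    qed
  qed (use assms in auto)
  then have "x \<in> survivors l S \<theta>" using x eps_pos[of l] by (auto simp: survivors_def)
  then show ?thesis by blast
qed

lemma dim_least_squares:
  "dim_vec (A.least_squares (\<mu> :: real vec \<Rightarrow> nat) obs) = d + 1"
proof -
  have "ginv (V (\<lambda>x. real (\<mu> x))) \<in> carrier_mat (d + 1) (d + 1)"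
    unfolding V_eq_gram by (rule ginv_gram(1)) (use finite_X in auto)
  then show ?thesis by (simp add: A.least_squares_def)
qed

lemma wf_group_step:
  assumes wf: "wf_state s" and g: "g \<in> {-1, 1}"
  shows "wf_state (A.group_step p l g s)"
proof (cases "group_completes l g s")
  case True
  have out: "group_counts l g s x = 0" if "x \<notin> X" for x
    using group_counts_outside[OF wf g] wf_stateD(5)[OF wf g] that by blast
  have "length (hist s) + length (group_schedule l g s) \<le> T"
    using True schedule_props(3)[of "group_counts l g s", OF out] group_counts_sum[OF wf g]
    by (simp add: group_completes_def group_schedule_def)
  moreover have "set (group_schedule l g s) \<subseteq> X"
    unfolding group_schedule_def by (rule schedule_props(2)) (rule out)
  moreover have "survivors l (active s g) (group_estimate p l g s) \<noteq> {}"
    by (rule survivors_nonempty)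
      (use wf_stateD[OF wf] g in \<open>auto simp: group_estimate_def dim_least_squares\<close>)
  moreover have "survivors l (active s g) (group_estimate p l g s) \<subseteq> active s g"
    by (auto simp: survivors_def)
  ultimately show ?thesis
    unfolding group_step_complete[OF True] using wf g by (auto simp: wf_state_def)
next
  case False
  have "best_action R (hist s) (active s g) \<in> X"
    using best_action[OF wf_stateD(3)[OF wf g] wf_stateD(5)[OF wf g]] wf_stateD(5)[OF wf g] by blast
  then show ?thesis
    unfolding group_step_incomplete[OF False]
    using wf order_trans[OF fst_set_spend_all[of p "hist s" "best_action R (hist s) (active s g)"], of X]
    by (simp add: wf_state_def length_spend_all)
qed

lemma candidates_props:
  assumes "wf_state s"
  shows "candidates s \<noteq> {}" "candidates s \<subseteq> X" "finite (candidates s)"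
proof -
  show 1: "candidates s \<noteq> {}" "candidates s \<subseteq> X"
    using wf_stateD(3,5)[OF assms, of 1] wf_stateD(5)[OF assms, of "-1"] by (auto simp: candidates_def)
  show "finite (candidates s)" by (rule finite_subset[OF 1(2) finite_X])
qed

lemma wf_bias_step:
  assumes wf: "wf_state s"
  shows "wf_state (A.bias_step p l s)"
proof (cases "bias_completes l s")
  case True
  have out: "bias_counts l s x = 0" if "x \<notin> X" for x
    using bias_counts_outside[OF wf that] .
  have "length (hist s) + length (bias_schedule l s) \<le> T"
    using True schedule_props(3)[of "bias_counts l s", OF out]
    by (simp add: bias_completes_def bias_schedule_def)
  moreover have "set (bias_schedule l s) \<subseteq> X"
    unfolding bias_schedule_def by (rule schedule_props(2)) (rule out)
  moreover have "0 < min 2 ((MAX x'\<in>candidates s. m x') - m x + 4 * A.eps l)"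
    if "x \<in> candidates s" for x and m :: "real vec \<Rightarrow> real"
  proof -
    have "m x \<le> (MAX x'\<in>candidates s. m x')"
      using that candidates_props[OF wf] by (intro Max_ge) auto
    then show ?thesis using eps_pos[of l] by simp
  qed
  ultimately show ?thesis
    unfolding bias_step_complete[OF True] using wf
    by (auto simp: wf_state_def PiE_iff)
next
  case False
  have "best_action R (hist s) (candidates s) \<in> X"
    using best_action[OF candidates_props(1,2)[OF wf]] candidates_props(2)[OF wf] by blast
  then show ?thesis
    unfolding bias_step_incomplete[OF False]
    using wf order_trans[OF fst_set_spend_all[of p "hist s" "best_action R (hist s) (candidates s)"], of X]
    by (simp add: wf_state_def length_spend_all)
qed

lemma wf_group_phase: "wf_state s \<Longrightarrow> wf_state (group_phase p l s)"
  using first_group[of "hist s"] wf_stateD(7)[of s] by (auto simp: group_phase_def Let_def intro!: wf_group_step)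

lemma wf_phase: "wf_state s \<Longrightarrow> wf_state (A.phase p l s)"
  by (auto simp: phase_eq intro!: wf_group_phase wf_bias_step)

lemma wf_init: "wf_state A.init"
  using groups_nonempty by (auto simp: wf_state_def A.init_def PiE_iff)

lemma wf_run: "wf_state (A.run p n)"
  by (induction n) (auto intro: wf_init wf_phase)

lemma group_step_fields:
  "map fst (hist (A.group_step p l g s)) = (if group_completes l g s then map fst (hist s) @ group_schedule l g s
     else map fst (hist s) @ replicate (T - length (hist s)) (best_action R (hist s) (active s g)))"
  "active (A.group_step p l g s) g' = (if g' = g \<and> group_completes l g s
     then survivors l (active s g) (group_estimate p l g s) else active s g')"
  "theta (A.group_step p l g s) g' = (if g' = g \<and> group_completes l g s
     then group_estimate p l g s else theta s g')"
  "best_group (A.group_step p l g s) = best_group s" "gaps (A.group_step p l g s) = gaps s"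
  by (cases "group_completes l g s"; simp add: group_step_complete group_step_incomplete)+

section \<open>Estimation errors as predictable sums of the noise\<close>

definition theta_star :: "real vec" where
  "theta_star = \<gamma> @\<^sub>v vec 1 (\<lambda>_. \<omega>)"

abbreviation pull :: "(nat \<Rightarrow> real) \<Rightarrow> nat \<Rightarrow> real vec \<Rightarrow> real" where
  "pull \<equiv> reward z \<gamma> \<omega>"

lemma theta_star_carrier: "theta_star \<in> carrier_vec (d + 1)"
  unfolding theta_star_def by (rule append_carrier_vec[OF gamma_dim]) (rule vec_carrier)

lemma avec_prod_theta_star:
  assumes "x \<in> X" shows "avec x \<bullet> theta_star = x \<bullet> \<gamma> + real_of_int (z x) * \<omega>"
proof -
  have x: "x \<in> carrier_vec d" using assms X_dim by blast
  have "avec x \<bullet> theta_star = x \<bullet> \<gamma> + vec 1 (\<lambda>_. real_of_int (z x)) \<bullet> vec 1 (\<lambda>_. \<omega>)"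
    unfolding avec_def theta_star_def
    by (rule scalar_prod_append[OF x _ gamma_dim]) (rule vec_carrier)+
  then show ?thesis by (simp add: scalar_prod_def)
qed

lemma pull_eq: "x \<in> X \<Longrightarrow> pull \<xi> t x = avec x \<bullet> theta_star + \<xi> t"
  by (simp add: reward_def avec_prod_theta_star)

definition coef :: "(real vec \<Rightarrow> nat) \<Rightarrow> real vec \<Rightarrow> real vec \<Rightarrow> real" where
  "coef \<mu> u x = u \<bullet> (ginv (V (\<lambda>x. real (\<mu> x))) *\<^sub>v avec x)"

lemma ginv_V_carrier: "ginv (V (\<lambda>x. real (\<mu> x))) \<in> carrier_mat (d + 1) (d + 1)"
  unfolding V_eq_gram by (rule ginv_gram(1)) (use finite_X avec_carrier in auto)

text \<open>
  Every linear functional of the estimator is a linear combination of the observations, with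
  coefficients that are fixed once the sample sizes are known.
\<close>

lemma least_squares_prod:
  assumes xs: "set xs \<subseteq> X" and u: "u \<in> carrier_vec (d + 1)"
  shows "u \<bullet> A.least_squares \<mu> (observe p n xs) =
    (\<Sum>i<length xs. p (n + i) (xs ! i) * coef \<mu> u (xs ! i))"
proof -
  define N where "N = d + 1"
  let ?G = "ginv (V (\<lambda>x. real (\<mu> x)))"
  have G: "?G \<in> carrier_mat N N" unfolding N_def by (rule ginv_V_carrier)
  have u: "u \<in> carrier_vec N" using u by (simp add: N_def)
  have a: "avec (xs ! i) \<in> carrier_vec N" if "i < length xs" for i
    unfolding N_def using xs that by (intro avec_carrier) auto
  define y where "y = transpose_mat ?G *\<^sub>v u"
  have y: "y \<in> carrier_vec N" unfolding y_def by (rule mult_mat_vec_carrier[OF _ u]) (use G in simp)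
  have yx: "y \<bullet> x = u \<bullet> (?G *\<^sub>v x)" if "x \<in> carrier_vec N" for x
    unfolding y_def by (rule transpose_vec_mult_scalar[OF G that u])
  define b where "b = vec N (\<lambda>j. \<Sum>(x, y)\<leftarrow>observe p n xs. y * avec x $ j)"
  have b: "b \<in> carrier_vec N" by (simp add: b_def)
  have "u \<bullet> A.least_squares \<mu> (observe p n xs) = u \<bullet> (?G *\<^sub>v b)"
    by (simp only: A.least_squares_def b_def N_def)
  also have "\<dots> = y \<bullet> b" by (rule yx[OF b, symmetric])
  also have "\<dots> = (\<Sum>j<N. y $ j * (\<Sum>i<length xs. p (n + i) (xs ! i) * avec (xs ! i) $ j))"
    by (simp add: b_def scalar_prod_def lessThan_atLeast0 observe_def o_def interv_sum_list_conv_sum_set_nat)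
  also have "\<dots> = (\<Sum>j<N. \<Sum>i<length xs. p (n + i) (xs ! i) * (y $ j * avec (xs ! i) $ j))"
    by (simp add: sum_distrib_left mult_ac)
  also have "\<dots> = (\<Sum>i<length xs. \<Sum>j<N. p (n + i) (xs ! i) * (y $ j * avec (xs ! i) $ j))"
    by (rule sum.swap)
  also have "\<dots> = (\<Sum>i<length xs. p (n + i) (xs ! i) * (y \<bullet> avec (xs ! i)))"
    using carrier_vecD[OF a] by (intro sum.cong refl)
      (simp add: scalar_prod_def lessThan_atLeast0 sum_distrib_left[symmetric])
  also have "\<dots> = (\<Sum>i<length xs. p (n + i) (xs ! i) * coef \<mu> u (xs ! i))"
    using a yx by (intro sum.cong refl) (simp add: coef_def)
  finally show ?thesis .
qed

text \<open>
  Unbiasedness removes the contribution of the parameter, and only the noise of the sampled rounds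
  remains.
\<close>

lemma least_squares_error:
  assumes xs: "set xs \<subseteq> X" and cnt: "\<And>x. x \<in> X \<Longrightarrow> count_list xs x = \<mu> x"
    and u: "u \<in> carrier_vec (d + 1)" "u \<in> mat_range (V (\<lambda>x. real (\<mu> x)))"
  shows "u \<bullet> A.least_squares \<mu> (observe (pull \<xi>) n xs) - u \<bullet> theta_star =
    (\<Sum>i<length xs. coef \<mu> u (xs ! i) * \<xi> (n + i))"
proof -
  let ?V = "V (\<lambda>x. real (\<mu> x))"
  have Gc: "ginv ?V *\<^sub>v w \<in> carrier_vec (d + 1)" if "w \<in> carrier_vec (d + 1)" for w
    by (rule mult_mat_vec_carrier[OF ginv_V_carrier that])
  define y where "y = transpose_mat (ginv ?V) *\<^sub>v u"
  have y: "y \<in> carrier_vec (d + 1)" unfolding y_def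
    by (rule mult_mat_vec_carrier[OF _ u(1)]) (use ginv_V_carrier in simp)
  have yx: "y \<bullet> x = u \<bullet> (ginv ?V *\<^sub>v x)" if "x \<in> carrier_vec (d + 1)" for x
    unfolding y_def by (rule transpose_vec_mult_scalar[OF ginv_V_carrier that u(1)])
  have "(\<Sum>i<length xs. (avec (xs ! i) \<bullet> theta_star) * coef \<mu> u (xs ! i))
      = (\<Sum>x\<in>X. real (count_list xs x) * ((avec x \<bullet> theta_star) * coef \<mu> u x))"
    by (rule sum_nth_eq_sum_count[OF finite_X xs])
  also have "\<dots> = (\<Sum>x\<in>X. real (\<mu> x) * (avec x \<bullet> y) * (avec x \<bullet> theta_star))"
  proof (rule sum.cong[OF refl])
    fix x assume x: "x \<in> X"
    have "coef \<mu> u x = avec x \<bullet> y"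
      unfolding coef_def using yx[OF avec_carrier[OF x]] comm_scalar_prod[OF y avec_carrier[OF x]] by simp
    then show "real (count_list xs x) * ((avec x \<bullet> theta_star) * coef \<mu> u x)
        = real (\<mu> x) * (avec x \<bullet> y) * (avec x \<bullet> theta_star)" by (simp add: cnt[OF x])
  qed
  also have "\<dots> = y \<bullet> (?V *\<^sub>v theta_star)"
    unfolding V_eq_gram by (rule gram_form[OF y theta_star_carrier, symmetric]) (rule avec_carrier)
  also have "\<dots> = u \<bullet> (ginv ?V *\<^sub>v (?V *\<^sub>v theta_star))"
    by (rule yx) (simp add: V_eq_gram mult_mat_vec_carrier[OF gram_carrier theta_star_carrier, simplified])
  also have "\<dots> = u \<bullet> theta_star"
    unfolding V_eq_gram
    by (rule ginv_gram_estimator(1)[OF finite_X])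
       (use avec_carrier u(2) theta_star_carrier in \<open>auto simp: V_eq_gram\<close>)
  finally have "(\<Sum>i<length xs. (avec (xs ! i) \<bullet> theta_star) * coef \<mu> u (xs ! i)) = u \<bullet> theta_star" .
  moreover have "u \<bullet> A.least_squares \<mu> (observe (pull \<xi>) n xs) =
      (\<Sum>i<length xs. (avec (xs ! i) \<bullet> theta_star) * coef \<mu> u (xs ! i)) +
      (\<Sum>i<length xs. coef \<mu> u (xs ! i) * \<xi> (n + i))"
    unfolding least_squares_prod[OF xs u(1)] sum.distrib[symmetric]
    using pull_eq[OF subsetD[OF xs nth_mem]] by (intro sum.cong refl) (simp add: algebra_simps)
  ultimately show ?thesis by simp
qed

lemma sum_coef_square:
  assumes xs: "set xs \<subseteq> X" and cnt: "\<And>x. x \<in> X \<Longrightarrow> count_list xs x = \<mu> x"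
    and u: "u \<in> mat_range (V (\<lambda>x. real (\<mu> x)))"
  shows "(\<Sum>i<length xs. (coef \<mu> u (xs ! i))\<^sup>2) = variance (\<lambda>x. real (\<mu> x)) u"
proof -
  have "(\<Sum>i<length xs. (coef \<mu> u (xs ! i))\<^sup>2) = (\<Sum>x\<in>X. real (count_list xs x) * (coef \<mu> u x)\<^sup>2)"
    by (rule sum_nth_eq_sum_count[OF finite_X xs])
  also have "\<dots> = (\<Sum>x\<in>X. real (\<mu> x) * (u \<bullet> (ginv (V (\<lambda>x. real (\<mu> x))) *\<^sub>v avec x))\<^sup>2)"
    by (intro sum.cong refl) (simp add: cnt coef_def)
  also have "\<dots> = variance (\<lambda>x. real (\<mu> x)) u"
    unfolding variance_def V_eq_gram
    by (rule ginv_gram_estimator(2)[OF finite_X]) (use avec_carrier u in \<open>auto simp: V_eq_gram\<close>)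
  finally show ?thesis .
qed

subsection \<open>Variance of the estimators\<close>

definition group_log :: "nat \<Rightarrow> real" where
  "group_log l = ln (real (card X) * real l * real (l + 1) * real T)"

definition bias_log :: "nat \<Rightarrow> real" where
  "bias_log l = ln (real l * real (l + 1) * real T)"

lemma log_argument_ge:
  assumes "1 \<le> l"
  shows "4 \<le> real l * real (l + 1) * real T"
    "8 \<le> real (card X) * real l * real (l + 1) * real T"
proof -
  have "1 * 2 \<le> l * (l + 1)" using assms by (intro mult_mono) auto
  then have *: "(1 * 2) * 2 \<le> (l * (l + 1)) * T" using T_ge_2 by (rule mult_mono) auto
  from card_X_ge_2 this have "2 * (1 * 2 * 2) \<le> card X * (l * (l + 1) * T)"
    by (rule mult_mono) auto
  with * have "real 4 \<le> real (l * (l + 1) * T)" "real 8 \<le> real (card X * l * (l + 1) * T)"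
    by (simp_all only: of_nat_le_iff mult.assoc)
  then show "4 \<le> real l * real (l + 1) * real T"
    "8 \<le> real (card X) * real l * real (l + 1) * real T" by (simp_all add: algebra_simps)
qed

lemma bias_log_pos: "1 \<le> l \<Longrightarrow> 0 < bias_log l"
  unfolding bias_log_def using log_argument_ge(1)[of l] by (intro ln_gt_zero) simp

lemma group_log_ge_1: "1 \<le> l \<Longrightarrow> 1 \<le> group_log l"
proof -
  assume l: "1 \<le> l"
  have "exp 1 \<le> real (card X) * real l * real (l + 1) * real T"
    using exp_le log_argument_ge(2)[OF l] by linarith
  then show ?thesis unfolding group_log_def using log_argument_ge(2)[OF l]
    by (subst ln_ge_iff) auto
qed

lemma group_counts_eq:
  "group_counts l g s x = nat \<lceil>2 * real (d + 1) * G_design R (hist s) (active s g) x / (A.eps l)\<^sup>2 * group_log l\<rceil>"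
  by (simp add: group_counts_def A.group_counts_def group_log_def mult_ac)

lemma bias_counts_eq:
  "bias_counts l s x = nat \<lceil>2 * Delta_design R (hist s) (gaps s) x / (A.eps l)\<^sup>2 * bias_log l\<rceil>"
  by (simp add: bias_counts_def A.bias_counts_def bias_log_def mult_ac)

text \<open>
  The sample sizes are those for which the Gaussian tail at \<open>eps l\<close> becomes
  \<open>2 / (k * l * (l + 1) * T)\<close>, see \<open>group_failure_prob\<close>.
\<close>

lemma group_variance:
  assumes wf: "wf_state s" and g: "g \<in> {-1, 1}" and l: "1 \<le> l" and x: "x \<in> active s g"
  shows "avec x \<in> mat_range (V (\<lambda>x. real (group_counts l g s x)))"
    "variance (\<lambda>x. real (group_counts l g s x)) (avec x) \<le> (A.eps l)\<^sup>2 / (2 * group_log l)"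
proof -
  let ?\<pi> = "G_design R (hist s) (active s g)"
  define c where "c = 2 * real (d + 1) / (A.eps l)\<^sup>2 * group_log l"
  have c: "0 < c" unfolding c_def using eps_pos[of l] group_log_ge_1[OF l] by simp
  note opt = G_design_props(1)[OF wf g, of "hist s"]
  have xX: "x \<in> X" using x wf_stateD(5)[OF wf g] by blast
  have *: "c * ?\<pi> y \<le> real (group_counts l g s y)" for y
  proof -
    have "c * ?\<pi> y = 2 * real (d + 1) * ?\<pi> y / (A.eps l)\<^sup>2 * group_log l" by (simp add: c_def)
    then show ?thesis unfolding group_counts_eq using real_nat_ceiling_ge by simp
  qed
  note v = variance_of_scaled_design[OF avec_carrier[OF xX], of ?\<pi> c "\<lambda>x. real (group_counts l g s x)" "real (d + 1)"]
  have pos: "0 \<le> ?\<pi> y" for y using G_optimal_prob[OF opt] by (auto intro: weights_onD(1))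
  have var: "(avec x \<bullet> v)\<^sup>2 \<le> real (d + 1) * Q ?\<pi> v" if "v \<in> carrier_vec (d + 1)" for v
    by (rule G_optimal_variance[OF wf_stateD(3,5)[OF wf g] opt x that])
  show "avec x \<in> mat_range (V (\<lambda>x. real (group_counts l g s x)))"
    by (rule v(1)) (use pos * c var in auto)
  have "variance (\<lambda>x. real (group_counts l g s x)) (avec x) \<le> real (d + 1) / c"
    by (rule v(2)) (use pos * c var in auto)
  also have "\<dots> = (A.eps l)\<^sup>2 / (2 * group_log l)"
  proof -
    have key: "D / (2 * D / e\<^sup>2 * L) = e\<^sup>2 / (2 * L)" if "0 < D" "0 < e" "0 < L" for D e L :: real
      using that by (simp add: field_simps)
    show ?thesis unfolding c_def by (rule key) (use eps_pos[of l] group_log_ge_1[OF l] in auto)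
  qed
  finally show "variance (\<lambda>x. real (group_counts l g s x)) (avec x) \<le> (A.eps l)\<^sup>2 / (2 * group_log l)" .
qed

lemma bias_variance:
  assumes wf: "wf_state s" and l: "1 \<le> l"
  shows "e_last \<in> mat_range (V (\<lambda>x. real (bias_counts l s x)))"
    "variance (\<lambda>x. real (bias_counts l s x)) e_last \<le> (A.eps l)\<^sup>2 / (2 * bias_log l)"
proof -
  let ?\<mu> = "Delta_design R (hist s) (gaps s)"
  define c where "c = 2 / (A.eps l)\<^sup>2 * bias_log l"
  have c: "0 < c" unfolding c_def using eps_pos[of l] bias_log_pos[OF l] by simp
  have feas: "?\<mu> \<in> feasible_designs"
    using Delta_design_props(1)[OF wf, of "hist s"] by (simp add: Delta_optimal_def)
  have *: "c * ?\<mu> y \<le> real (bias_counts l s y)" for y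
  proof -
    have "c * ?\<mu> y = 2 * ?\<mu> y / (A.eps l)\<^sup>2 * bias_log l" by (simp add: c_def)
    then show ?thesis unfolding bias_counts_eq using real_nat_ceiling_ge by simp
  qed
  have e: "e_last \<in> carrier_vec (d + 1)" by simp
  note v = variance_of_scaled_design[OF e, of ?\<mu> c "\<lambda>x. real (bias_counts l s x)" 1]
  have pos: "0 \<le> ?\<mu> y" for y using feas by (auto simp: feasible_iff intro: weights_onD(1))
  have var: "(e_last \<bullet> v)\<^sup>2 \<le> 1 * Q ?\<mu> v" if "v \<in> carrier_vec (d + 1)" for v
    using feas that by (simp add: feasible_iff)
  show "e_last \<in> mat_range (V (\<lambda>x. real (bias_counts l s x)))"
    by (rule v(1)) (use pos * c var in auto)
  have "variance (\<lambda>x. real (bias_counts l s x)) e_last \<le> 1 / c"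
    by (rule v(2)) (use pos * c var in auto)
  also have "\<dots> = (A.eps l)\<^sup>2 / (2 * bias_log l)" unfolding c_def by (simp add: field_simps)
  finally show "variance (\<lambda>x. real (bias_counts l s x)) e_last \<le> (A.eps l)\<^sup>2 / (2 * bias_log l)" .
qed

subsection \<open>The states depend only on the observations already made\<close>

definition agree :: "nat \<Rightarrow> (nat \<Rightarrow> real vec \<Rightarrow> real) \<Rightarrow> (nat \<Rightarrow> real vec \<Rightarrow> real) \<Rightarrow> bool" where
  "agree t p p' \<longleftrightarrow> (\<forall>i<t. p i = p' i)"

lemma agree_sym: "agree t p p' \<Longrightarrow> agree t p' p"
  by (simp add: agree_def)

text \<open>
  The length of the history is the clock of the algorithm. Observations that would be made after the end
  of a step cannot influence its result; this makes the random starting round of a stage a stopping time.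
\<close>

definition causal_step :: "((nat \<Rightarrow> real vec \<Rightarrow> real) \<Rightarrow> fpe_state \<Rightarrow> fpe_state) \<Rightarrow> bool" where
  "causal_step st \<longleftrightarrow> (\<forall>p s. length (hist s) \<le> length (hist (st p s))) \<and>
    (\<forall>p p' s t. agree t p p' \<longrightarrow> length (hist (st p s)) \<le> t \<longrightarrow> st p' s = st p s)"

lemma observe_agree:
  assumes "agree t p p'" "n + length xs \<le> t" shows "observe p' n xs = observe p n xs"
  using assms by (auto simp: observe_def agree_def)

lemma sample_agree:
  assumes "agree t p p'" "length h + length xs \<le> t" shows "A.sample p' h xs = A.sample p h xs"
  using assms by (auto simp: sample_eq agree_def)

lemma spend_all_agree:
  assumes "agree t p p'" "length (A.spend_all p h x) \<le> t"
  shows "A.spend_all p' h x = A.spend_all p h x"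
  using assms sample_agree by (simp add: A.spend_all_def)

lemma causal_group_step: "causal_step (\<lambda>p. A.group_step p l g)"
  unfolding causal_step_def
proof (intro conjI allI impI)
  fix p s
  show "length (hist s) \<le> length (hist (A.group_step p l g s))"
    by (cases "group_completes l g s") (simp_all add: group_step_complete group_step_incomplete A.spend_all_def)
next
  fix p p' s t assume a: "agree t p p'" and t: "length (hist (A.group_step p l g s)) \<le> t"
  show "A.group_step p' l g s = A.group_step p l g s"
  proof (cases "group_completes l g s")
    case True
    then have "length (hist s) + length (group_schedule l g s) \<le> t"
      using t by (simp add: group_step_complete)
    with a show ?thesis
      by (simp add: group_step_complete[OF True] sample_agree group_estimate_def observe_agree)
  next
    case False
    then show ?thesis using spend_all_agree[OF a] t by (simp add: group_step_incomplete)
  qed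
qed

lemma causal_bias_step: "causal_step (\<lambda>p. A.bias_step p l)"
  unfolding causal_step_def
proof (intro conjI allI impI)
  fix p s
  show "length (hist s) \<le> length (hist (A.bias_step p l s))"
    by (cases "bias_completes l s") (simp_all add: bias_step_complete bias_step_incomplete A.spend_all_def)
next
  fix p p' s t assume a: "agree t p p'" and t: "length (hist (A.bias_step p l s)) \<le> t"
  show "A.bias_step p' l s = A.bias_step p l s"
  proof (cases "bias_completes l s")
    case True
    then have le: "length (hist s) + length (bias_schedule l s) \<le> t"
      using t by (simp add: bias_step_complete)
    have "mean_estimate p' l s = mean_estimate p l s"
      by (rule ext) (simp add: mean_estimate_def bias_estimate_def observe_agree[OF a le])
    then show ?thesis
      unfolding bias_step_complete[OF True] sample_agree[OF a le] by (simp only:)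
  next
    case False
    then show ?thesis using spend_all_agree[OF a] t by (simp add: bias_step_incomplete)
  qed
qed

lemma causal_stepD:
  assumes "causal_step st"
  shows "length (hist s) \<le> length (hist (st p s))"
    "agree t p p' \<Longrightarrow> length (hist (st p s)) \<le> t \<Longrightarrow> st p' s = st p s"
  using assms unfolding causal_step_def by blast+

lemma causal_id: "causal_step (\<lambda>p s. s)"
  by (simp add: causal_step_def)

text \<open>
  The second step may depend on the initial state \<open>s\<close>: the algorithm fixes the group order at the
  beginning of a phase and uses it after the first group stage.
\<close>

lemma causal_bind:
  assumes "causal_step st1" "\<And>s. causal_step (st2 s)"
  shows "causal_step (\<lambda>p s. st2 s p (st1 p s))"
  unfolding causal_step_def
proof (intro conjI allI impI)
  fix p s show "length (hist s) \<le> length (hist (st2 s p (st1 p s)))"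
    using causal_stepD(1)[OF assms(1), of s p] causal_stepD(1)[OF assms(2), of "st1 p s" s p] by linarith
next
  fix p p' s t assume a: "agree t p p'" and t: "length (hist (st2 s p (st1 p s))) \<le> t"
  have "length (hist (st1 p s)) \<le> t"
    using t causal_stepD(1)[OF assms(2), of "st1 p s" s p] by linarith
  then have "st1 p' s = st1 p s" by (rule causal_stepD(2)[OF assms(1) a])
  then show "st2 s p' (st1 p' s) = st2 s p (st1 p s)"
    using causal_stepD(2)[OF assms(2) a t] by simp
qed

lemma causal_dependent: "(\<And>s. causal_step (st s)) \<Longrightarrow> causal_step (\<lambda>p s. st s p s)"
  by (rule causal_bind[OF causal_id, of st])

lemma causal_if:
  assumes "causal_step st1" "causal_step st2"
  shows "causal_step (\<lambda>p s. if P s then st1 p s else st2 p s)"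
  using assms unfolding causal_step_def by auto

lemma causal_group_phase: "causal_step (\<lambda>p. group_phase p l)"
proof -
  have 1: "causal_step (\<lambda>p s. A.group_step p l f (A.group_step p l f' s))" for f f'
    by (rule causal_bind[OF causal_group_step, of "\<lambda>_ p. A.group_step p l f"]) (rule causal_group_step)
  have "causal_step (\<lambda>p s. if best_group s = 0
      then A.group_step p l (- first_group R (hist s)) (A.group_step p l (first_group R (hist s)) s)
      else A.group_step p l (best_group s) s)"
    by (intro causal_if)
       (rule causal_dependent[of "\<lambda>s p s'. A.group_step p l (- first_group R (hist s))
           (A.group_step p l (first_group R (hist s)) s')"], rule 1,
        rule causal_dependent[of "\<lambda>s p s'. A.group_step p l (best_group s) s'"], rule causal_group_step)
  then show ?thesis unfolding group_phase_def Let_def .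
qed

text \<open>
  The number of rounds played in \<open>n\<close> phases is a stopping time, and the state then reached is
  determined by the observations made until it.
\<close>

lemma causal_run:
  assumes "agree t p p'" "length (hist (A.run p n)) \<le> t"
  shows "A.run p' n = A.run p n"
  using assms(2)
proof (induction n)
  case (Suc n)
  define ph where "ph = (\<lambda>p s. if T \<le> length (hist s) then s
    else if best_group s \<noteq> 0 \<or> T \<le> length (hist (group_phase p (Suc n) s)) then group_phase p (Suc n) s
    else A.bias_step p (Suc n) (group_phase p (Suc n) s))"
  have ph: "A.phase p (Suc n) s = ph p s" if "wf_state s" for p s
    unfolding ph_def by (rule phase_eq[OF that])
  have "causal_step (\<lambda>p s. if T \<le> length (hist s) then s
    else (\<lambda>s0 p s'. if best_group s0 \<noteq> 0 \<or> T \<le> length (hist s') then s' else A.bias_step p (Suc n) s')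
      s p (group_phase p (Suc n) s))"
    by (rule causal_if[OF causal_id causal_bind[OF causal_group_phase]])
       (rule causal_if[OF causal_id causal_bias_step])
  then have c: "causal_step ph" unfolding ph_def by simp
  have run: "A.run p (Suc n) = ph p (A.run p n)" for p
    using ph[OF wf_run] by simp
  have le: "length (hist (ph p (A.run p n))) \<le> t" using Suc.prems unfolding run .
  then have "length (hist (A.run p n)) \<le> t"
    using causal_stepD(1)[OF c, of "A.run p n" p] by linarith
  then have "A.run p' n = A.run p n" by (rule Suc.IH)
  then show ?case unfolding run using causal_stepD(2)[OF c assms(1) le] by simp
qed simp

section \<open>Regret when all estimates are accurate\<close>

definition val :: "real vec \<Rightarrow> real" where "val x = x \<bullet> \<gamma>"

definition best_val :: "int \<Rightarrow> real" where "best_val g = (MAX x\<in>{x\<in>X. z x = g}. val x)"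

text \<open>
  Regret is measured by \<open>gap\<close>, the distance to the best action of both groups; the elimination
  inside a group only controls the distance to \<open>best_val\<close> of that group.
\<close>

definition gap :: "real vec \<Rightarrow> real" where "gap x = (MAX x\<in>X. x \<bullet> \<gamma>) - x \<bullet> \<gamma>"

definition history_regret :: "history \<Rightarrow> real" where
  "history_regret h = (\<Sum>x\<leftarrow>map fst h. gap x)"

lemma group_nonempty: "g \<in> {-1, 1} \<Longrightarrow> {x\<in>X. z x = g} \<noteq> {}"
  using groups_nonempty by auto

lemma finite_group: "finite {x\<in>X. z x = g}"
  using finite_X by simp

lemma val_le_best_val: "x \<in> X \<Longrightarrow> z x = g \<Longrightarrow> val x \<le> best_val g"
  unfolding best_val_def using finite_group by (intro Max_ge) auto

lemma best_val_attained:
  assumes "g \<in> {-1, 1}" obtains x where "x \<in> X" "z x = g" "val x = best_val g"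
proof -
  have "best_val g \<in> val ` {x\<in>X. z x = g}"
    unfolding best_val_def using group_nonempty[OF assms] finite_group by (intro Max_in) auto
  then show ?thesis using that by auto
qed

lemma abs_val_le_1: "x \<in> X \<Longrightarrow> \<bar>val x\<bar> \<le> 1"
proof -
  assume "x \<in> X"
  then have "\<bar>x \<bullet> \<gamma>\<bar> \<le> (MAX x\<in>X. \<bar>x \<bullet> \<gamma>\<bar>)" using finite_X by (intro Max_ge) auto
  then show ?thesis using gamma_bound by (simp add: val_def)
qed

lemma Max_val: "(MAX x\<in>X. x \<bullet> \<gamma>) = max (best_val 1) (best_val (-1))"
proof (rule antisym)
  show "(MAX x\<in>X. x \<bullet> \<gamma>) \<le> max (best_val 1) (best_val (-1))"
  proof (subst Max_le_iff)
    show "\<forall>a\<in>(\<lambda>x. x \<bullet> \<gamma>) ` X. a \<le> max (best_val 1) (best_val (-1))"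
    proof clarify
      fix x assume "x \<in> X"
      then show "x \<bullet> \<gamma> \<le> max (best_val 1) (best_val (-1))"
        using groups[of x] val_le_best_val[of x "z x"] by (auto simp: val_def max_def)
    qed
  qed (use finite_X X_nonempty in auto)
  have "best_val g \<le> (MAX x\<in>X. x \<bullet> \<gamma>)" if g: "g \<in> {-1, 1}" for g
  proof -
    obtain x where x: "x \<in> X" "val x = best_val g" using best_val_attained[OF g] .
    show ?thesis unfolding x(2)[symmetric] val_def using x finite_X by (intro Max_ge) auto
  qed
  then show "max (best_val 1) (best_val (-1)) \<le> (MAX x\<in>X. x \<bullet> \<gamma>)" by simp
qed

lemma gap_eq: "gap x = max (best_val 1) (best_val (-1)) - val x"
  by (simp add: gap_def Max_val val_def)

lemma best_val_le: "g \<in> {-1, 1} \<Longrightarrow> best_val g \<le> 1" "g \<in> {-1, 1} \<Longrightarrow> -1 \<le> best_val g"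
proof -
  assume g: "g \<in> {-1, 1}"
  obtain x where x: "x \<in> X" "val x = best_val g" using best_val_attained[OF g] .
  show "best_val g \<le> 1" "-1 \<le> best_val g" using abs_val_le_1[OF x(1)] x(2) by auto
qed

lemma gap_nonneg: "x \<in> X \<Longrightarrow> 0 \<le> gap x"
  using groups[of x] val_le_best_val[of x "z x"] by (auto simp: gap_eq max_def)

lemma gap_le_2: "x \<in> X \<Longrightarrow> gap x \<le> 2"
  using best_val_le[of 1] best_val_le[of "-1"] abs_val_le_1[of x] by (auto simp: gap_eq)

lemma group_gap_le_gap: "g \<in> {-1, 1} \<Longrightarrow> best_val g - val x \<le> gap x"
  by (auto simp: gap_eq)

lemma avec_prod: "x \<in> X \<Longrightarrow> avec x \<bullet> theta_star = val x + real_of_int (z x) * \<omega>"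
  by (simp add: avec_prod_theta_star val_def)

definition accurate_group :: "(nat \<Rightarrow> real vec \<Rightarrow> real) \<Rightarrow> nat \<Rightarrow> int \<Rightarrow> fpe_state \<Rightarrow> bool" where
  "accurate_group p l g s \<longleftrightarrow> (group_completes l g s \<longrightarrow>
     (\<forall>x\<in>active s g. \<bar>avec x \<bullet> group_estimate p l g s - avec x \<bullet> theta_star\<bar> \<le> A.eps l))"

text \<open>
  The three estimates of a phase are evaluated at the states in which the algorithm computes them: the
  second group stage starts from the state after the first one. Stages that were cut off by the
  horizon impose no condition.
\<close>

definition accurate_phase :: "(nat \<Rightarrow> real vec \<Rightarrow> real) \<Rightarrow> nat \<Rightarrow> fpe_state \<Rightarrow> bool" where
  "accurate_phase p l s \<longleftrightarrow> (if best_group s = 0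
     then accurate_group p l (first_group R (hist s)) s \<and>
       accurate_group p l (- first_group R (hist s)) (A.group_step p l (first_group R (hist s)) s) \<and>
       (length (hist (group_phase p l s)) < T \<longrightarrow> bias_completes l (group_phase p l s) \<longrightarrow>
         \<bar>bias_estimate p l (group_phase p l s) - \<omega>\<bar> \<le> A.eps l)
     else accurate_group p l (best_group s) s)"

subsection \<open>One stage of group exploration\<close>

definition group_inv :: "real \<Rightarrow> int \<Rightarrow> fpe_state \<Rightarrow> bool" where
  "group_inv r g s \<longleftrightarrow> (\<exists>x\<in>active s g. val x = best_val g) \<and> (\<forall>x\<in>active s g. best_val g - val x \<le> r)"

text \<open>
  Differences of two estimates inside a group are correct up to \<open>2 * eps l\<close>, because the bias cancels.
  With the threshold \<open>3 * eps l\<close>, the best action survives, a survivor is within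
  \<open>5 * eps l\<close> of it, and an eliminated action is worse than some other one by at least \<open>eps l\<close>.
\<close>

lemma group_step_survivors:
  assumes wf: "wf_state s" and g: "g \<in> {-1, 1}" and inv: "group_inv r g s"
    and acc: "accurate_group p l g s" and c: "group_completes l g s"
  shows "group_inv (5 * A.eps l) g (A.group_step p l g s)"
    "x \<in> active s g \<Longrightarrow> x \<notin> active (A.group_step p l g s) g \<Longrightarrow> A.eps l \<le> gap x"
proof -
  let ?S = "active s g" and ?\<theta> = "group_estimate p l g s" and ?e = "A.eps l"
  have fin: "finite ?S" and SX: "?S \<subseteq> X" and Sg: "\<And>x. x \<in> ?S \<Longrightarrow> z x = g"
    using wf_stateD(4,5,6)[OF wf g] by auto
  have act: "active (A.group_step p l g s) g = survivors l ?S ?\<theta>"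
    by (simp add: group_step_complete[OF c])
  have \<theta>: "?\<theta> \<in> carrier_vec (d + 1)"
    unfolding group_estimate_def by (rule carrier_vecI) (rule dim_least_squares)
  have diff: "(avec x' - avec x) \<bullet> ?\<theta> = avec x' \<bullet> ?\<theta> - avec x \<bullet> ?\<theta>" if "x \<in> ?S" "x' \<in> ?S" for x x'
    by (rule minus_scalar_prod_distrib[OF avec_carrier avec_carrier \<theta>]) (use that SX in auto)
  have err: "\<bar>avec x \<bullet> ?\<theta> - (val x + real_of_int g * \<omega>)\<bar> \<le> ?e" if "x \<in> ?S" for x
  proof -
    have "\<bar>avec x \<bullet> ?\<theta> - avec x \<bullet> theta_star\<bar> \<le> ?e" using acc c that by (simp add: accurate_group_def)
    then show ?thesis using avec_prod[of x] that SX Sg[OF that] by auto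
  qed
  have close: "\<bar>(avec x' - avec x) \<bullet> ?\<theta> - (val x' - val x)\<bar> \<le> 2 * ?e" if "x \<in> ?S" "x' \<in> ?S" for x x'
    unfolding diff[OF that] using err[OF that(1)] err[OF that(2)] by (simp add: abs_le_iff)
  obtain b where b: "b \<in> ?S" "val b = best_val g" using inv by (auto simp: group_inv_def)
  have surv_iff: "x \<in> survivors l ?S ?\<theta> \<longleftrightarrow> x \<in> ?S \<and> (\<forall>x'\<in>?S. (avec x' - avec x) \<bullet> ?\<theta> \<le> 3 * ?e)" for x
  proof -
    have "(MAX x'\<in>?S. (avec x' - avec x) \<bullet> ?\<theta>) \<le> 3 * ?e \<longleftrightarrow> (\<forall>x'\<in>?S. (avec x' - avec x) \<bullet> ?\<theta> \<le> 3 * ?e)"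
      using fin b(1) by (subst Max_le_iff) auto
    then show ?thesis by (simp add: survivors_def)
  qed
  have val_le: "val x \<le> best_val g" if "x \<in> ?S" for x
    using val_le_best_val[of x g] that SX Sg by auto
  have "b \<in> survivors l ?S ?\<theta>"
    unfolding surv_iff
  proof (intro conjI ballI b(1))
    fix x' assume x': "x' \<in> ?S"
    show "(avec x' - avec b) \<bullet> ?\<theta> \<le> 3 * ?e"
      using close[OF b(1) x'] val_le[OF x'] b(2) eps_pos[of l] by (simp add: abs_le_iff)
  qed
  moreover have "best_val g - val x \<le> 5 * ?e" if "x \<in> survivors l ?S ?\<theta>" for x
  proof -
    have "x \<in> ?S" "(avec b - avec x) \<bullet> ?\<theta> \<le> 3 * ?e" using that b(1) unfolding surv_iff by auto
    then show ?thesis using close[of x b] b by (simp add: abs_le_iff)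
  qed
  ultimately show "group_inv (5 * ?e) g (A.group_step p l g s)"
    unfolding group_inv_def act using b(2) by auto
  assume x: "x \<in> active s g" "x \<notin> active (A.group_step p l g s) g"
  then obtain x' where x': "x' \<in> ?S" "3 * ?e < (avec x' - avec x) \<bullet> ?\<theta>"
    unfolding act surv_iff by (auto simp: not_le)
  have "?e \<le> val x' - val x" using close[OF x(1) x'(1)] x'(2) by (simp add: abs_le_iff)
  also have "\<dots> \<le> gap x" using val_le[OF x'(1)] group_gap_le_gap[OF g, of x] by simp
  finally show "?e \<le> gap x" .
qed

definition group_budget :: "nat \<Rightarrow> real" where
  "group_budget l = 2 * real (d + 1) * group_log l / (A.eps l)\<^sup>2"

definition support_bound :: real where
  "support_bound = real (d + 1) * real (d + 2) / 2"

lemma group_budget_nonneg: "1 \<le> l \<Longrightarrow> 0 \<le> group_budget l"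
  unfolding group_budget_def using group_log_ge_1[of l] by simp

lemma nat_ceiling_le: "0 \<le> x \<Longrightarrow> real (nat \<lceil>x\<rceil>) \<le> x + (if x = 0 then 0 else 1)"
  by (auto simp: of_nat_nat ceiling_correct)

text \<open>
  Rounding up adds at most one sample for each action in the support of the design; this is where the
  bound on the support enters.
\<close>

lemma group_counts_total:
  assumes wf: "wf_state s" and g: "g \<in> {-1, 1}" and l: "1 \<le> l"
  shows "group_budget l \<le> real (sum (group_counts l g s) (active s g))"
    "real (sum (group_counts l g s) (active s g)) \<le> support_bound + group_budget l"
proof -
  let ?\<pi> = "G_design R (hist s) (active s g)" and ?S = "active s g"
  have pr: "sum ?\<pi> ?S = 1" and w: "?\<pi> \<in> weights_on ?S"
    using G_optimal_prob[OF G_design_props(1)[OF wf g]] by auto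
  have fin: "finite ?S" by (rule wf_stateD(6)[OF wf g])
  have cnt: "group_counts l g s x = nat \<lceil>group_budget l * ?\<pi> x\<rceil>" for x
    unfolding group_counts_eq group_budget_def by (simp add: mult_ac)
  have nn: "0 \<le> group_budget l * ?\<pi> x" for x
    using group_budget_nonneg[OF l] weights_onD(1)[OF w] by simp
  have "group_budget l = (\<Sum>x\<in>?S. group_budget l * ?\<pi> x)"
    using pr by (simp add: sum_distrib_left[symmetric])
  also have "\<dots> \<le> (\<Sum>x\<in>?S. real (group_counts l g s x))"
    unfolding cnt by (intro sum_mono real_nat_ceiling_ge)
  finally show "group_budget l \<le> real (sum (group_counts l g s) ?S)" by simp
  have "(\<Sum>x\<in>?S. real (group_counts l g s x)) \<le> (\<Sum>x\<in>?S. group_budget l * ?\<pi> x + (if ?\<pi> x \<noteq> 0 then 1 else 0))"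
  proof (rule sum_mono)
    fix x
    show "real (group_counts l g s x) \<le> group_budget l * ?\<pi> x + (if ?\<pi> x \<noteq> 0 then 1 else 0)"
      unfolding cnt using nat_ceiling_le[OF nn[of x]] by (auto split: if_splits)
  qed
  also have "\<dots> = group_budget l + real (card {x\<in>?S. ?\<pi> x \<noteq> 0})"
    using pr fin by (simp add: sum.distrib sum_distrib_left[symmetric] sum.If_cases Collect_conj_eq)
  also have "real (card {x\<in>?S. ?\<pi> x \<noteq> 0}) \<le> support_bound"
  proof -
    have "{x. ?\<pi> x \<noteq> 0} \<subseteq> ?S" using weights_onD(2)[OF w] by blast
    then have "{x\<in>?S. ?\<pi> x \<noteq> 0} = {x. ?\<pi> x \<noteq> 0}" by blast
    then have "card {x\<in>?S. ?\<pi> x \<noteq> 0} \<le> (d + 1) * (d + 2) div 2"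
      using G_design_props(2)[OF wf g, of "hist s"] by simp
    then have "real (card {x\<in>?S. ?\<pi> x \<noteq> 0}) \<le> real ((d + 1) * (d + 2) div 2)" by simp
    also have "\<dots> \<le> real ((d + 1) * (d + 2)) / 2"
    proof -
      have "N div 2 * 2 \<le> N" for N :: nat by simp
      then have "real (N div 2) \<le> real N / 2" for N :: nat
        by (metis le_divide_eq_numeral1(1) of_nat_le_iff of_nat_mult of_nat_numeral)
      then show ?thesis .
    qed
    finally show ?thesis by (simp add: support_bound_def algebra_simps)
  qed
  finally show "real (sum (group_counts l g s) ?S) \<le> support_bound + group_budget l" by simp
qed

lemma group_completes_budget:
  assumes "wf_state s" "g \<in> {-1, 1}" "1 \<le> l" "group_completes l g s"
  shows "group_budget l \<le> real T"
proof -
  have "sum (group_counts l g s) (active s g) \<le> T" using assms(4) by (simp add: group_completes_def)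
  then have "real (sum (group_counts l g s) (active s g)) \<le> real T" by (simp only: of_nat_le_iff)
  then show ?thesis using group_counts_total(1)[OF assms(1-3)] by simp
qed

lemma history_regret_sample:
  assumes "set xs \<subseteq> X" "\<And>x. x \<in> X \<Longrightarrow> count_list xs x = \<mu> x"
  shows "history_regret (A.sample p h xs) = history_regret h + (\<Sum>x\<in>X. real (\<mu> x) * gap x)"
  using sum_list_eq_sum_count[OF finite_X assms(1), of gap] assms(2)
  by (simp add: history_regret_def)

lemma history_regret_spend_all:
  "history_regret (A.spend_all p h x) = history_regret h + real (T - length h) * gap x"
  unfolding history_regret_def map_fst_spend_all by (simp add: sum_list_replicate)

text \<open>
  The number \<open>26\<close> is the constant in the bound on the gaps of active actions, \<open>phase_inv_gap\<close>. The
  minimum with \<open>T\<close> matters in the last phase, whose budget may exceed the horizon.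
\<close>

definition group_cost :: "nat \<Rightarrow> real" where
  "group_cost l = 26 * A.eps l * (support_bound + min (group_budget l) (real T))"

text \<open>
  A stage that is cut off plays an active action for fewer rounds than the complete stage would take, so
  the same bound holds in both cases.
\<close>

lemma group_step_regret:
  assumes wf: "wf_state s" and g: "g \<in> {-1, 1}" and l: "1 \<le> l"
    and gap: "\<And>x. x \<in> active s g \<Longrightarrow> gap x \<le> 26 * A.eps l"
  shows "history_regret (hist (A.group_step p l g s)) \<le> history_regret (hist s) + group_cost l"
proof (cases "group_completes l g s")
  case True
  have out: "group_counts l g s x = 0" if "x \<notin> X" for x
    using group_counts_outside[OF wf g] wf_stateD(5)[OF wf g] that by blast
  note sch = schedule_props[of "group_counts l g s", OF out]
  have "history_regret (hist (A.group_step p l g s)) =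
      history_regret (hist s) + (\<Sum>x\<in>X. real (group_counts l g s x) * gap x)"
    unfolding group_step_complete[OF True]
    using history_regret_sample[of "group_schedule l g s" "group_counts l g s"] sch(1,2)
    by (simp add: group_schedule_def)
  also have "(\<Sum>x\<in>X. real (group_counts l g s x) * gap x) = (\<Sum>x\<in>active s g. real (group_counts l g s x) * gap x)"
    by (rule sum.mono_neutral_right) (use wf_stateD(5)[OF wf g] finite_X group_counts_outside[OF wf g] in auto)
  also have "\<dots> \<le> (\<Sum>x\<in>active s g. real (group_counts l g s x) * (26 * A.eps l))"
    by (intro sum_mono mult_left_mono gap) auto
  also have "\<dots> = 26 * A.eps l * real (sum (group_counts l g s) (active s g))"
    by (simp add: sum_distrib_left mult_ac)
  also have "\<dots> \<le> group_cost l"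
    unfolding group_cost_def
    using group_counts_total(2)[OF wf g l] group_completes_budget[OF wf g l True] eps_pos[of l]
    by (intro mult_left_mono) auto
  finally show ?thesis by simp
next
  case False
  let ?b = "best_action R (hist s) (active s g)"
  have b: "?b \<in> active s g" by (rule best_action[OF wf_stateD(3,5)[OF wf g]])
  have "T - length (hist s) \<le> sum (group_counts l g s) (active s g)"
    using False by (simp add: group_completes_def)
  then have "real (T - length (hist s)) \<le> real (sum (group_counts l g s) (active s g))"
    by (rule of_nat_mono)
  also have "\<dots> \<le> support_bound + group_budget l" by (rule group_counts_total(2)[OF wf g l])
  finally have "real (T - length (hist s)) \<le> support_bound + group_budget l" .
  then have "real (T - length (hist s)) \<le> support_bound + min (group_budget l) (real T)"
  proof -
    assume 1: "real (T - length (hist s)) \<le> support_bound + group_budget l"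
    have "real (T - length (hist s)) \<le> real T" by simp
    moreover have "0 \<le> support_bound" by (simp add: support_bound_def)
    ultimately have 2: "real (T - length (hist s)) \<le> support_bound + real T" by (rule order_trans[OF _ add_increasing]) simp
    show ?thesis using 1 2 unfolding min_def by (cases "group_budget l \<le> real T") simp_all
  qed
  then have "real (T - length (hist s)) * gap ?b \<le> (support_bound + min (group_budget l) (real T)) * (26 * A.eps l)"
    by (intro mult_mono gap[OF b] gap_nonneg) (use b wf_stateD(5)[OF wf g] in \<open>auto intro: order_trans[rotated]\<close>)
  then show ?thesis
    unfolding group_step_incomplete[OF False]
    by (simp add: history_regret_spend_all group_cost_def mult_ac)
qed

subsection \<open>The potential of the bias exploration\<close>

text \<open>
  A deterministic substitute for \<open>kappa\<close> of the random gap estimates in a phase with accuracy \<open>e\<close>. The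
  constants are those of the invariant \<open>gaps_inv\<close> below.
\<close>

definition potential :: "real \<Rightarrow> real" where
  "potential e = kappa (\<lambda>x. 17 * gap x + 16 * e)"

text \<open>
  This growth condition makes \<open>potential e / e\<^sup>2\<close> at least double when \<open>e\<close> is halved.
\<close>

lemma potential_double: "0 < e \<Longrightarrow> potential (2 * e) \<le> 2 * potential e"
  unfolding potential_def by (rule kappa_scale) (use gap_nonneg in fastforce)+

lemma potential_nonneg: "0 \<le> e \<Longrightarrow> 0 \<le> potential e"
  unfolding potential_def by (rule kappa_nonneg) (use gap_nonneg in fastforce)

lemma potential_le_kappa_star:
  assumes "0 < e" "e \<le> 2" shows "potential e \<le> 66 * kappa_star"
  unfolding potential_def
proof (rule kappa_le_kappa_star)
  fix x assume "x \<in> X"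
  then show "0 \<le> 17 * gap x + 16 * e \<and> 17 * gap x + 16 * e \<le> 66"
    using gap_nonneg[of x] gap_le_2[of x] assms by auto
qed simp

text \<open>
  Estimated gaps of candidates are correct up to an additive error of order \<open>e\<close>. The estimate for an
  eliminated action is frozen, but then the true gap was at least \<open>e\<close> at the time of elimination, so that
  \<open>gap x + 16 * e \<le> 17 * gap x\<close> and the error is multiplicative.
\<close>

definition gaps_inv :: "real \<Rightarrow> fpe_state \<Rightarrow> bool" where
  "gaps_inv e s \<longleftrightarrow> (\<forall>x\<in>X. gap x \<le> gaps s x \<and> e \<le> gaps s x \<and>
     (x \<in> candidates s \<longrightarrow> gaps s x \<le> gap x + 16 * e) \<and> (x \<notin> candidates s \<longrightarrow> gaps s x \<le> 17 * gap x))"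

text \<open>
  By \<open>gaps_inv\<close>, the estimated gaps and \<open>17 * gap x + 16 * e\<close> agree up to the factor \<open>33 = 17 + 16\<close>.
\<close>

lemma gaps_kappa:
  assumes inv: "gaps_inv e s" and e: "0 < e"
  shows "kappa (gaps s) \<le> potential e" "potential e \<le> 33 * kappa (gaps s)"
proof -
  have 1: "0 \<le> gaps s x \<and> gaps s x \<le> 1 * (17 * gap x + 16 * e)" if x: "x \<in> X" for x
  proof -
    have "e \<le> gaps s x" "x \<in> candidates s \<longrightarrow> gaps s x \<le> gap x + 16 * e"
      "x \<notin> candidates s \<longrightarrow> gaps s x \<le> 17 * gap x" using inv x by (auto simp: gaps_inv_def)
    then show ?thesis using gap_nonneg[OF x] e by (cases "x \<in> candidates s") auto
  qed
  from kappa_scale[OF this] show "kappa (gaps s) \<le> potential e" by (simp add: potential_def)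
  have "0 \<le> 17 * gap x + 16 * e \<and> 17 * gap x + 16 * e \<le> 33 * gaps s x" if x: "x \<in> X" for x
    using inv x gap_nonneg[OF x] e by (auto simp: gaps_inv_def)
  from kappa_scale[OF this] show "potential e \<le> 33 * kappa (gaps s)" by (simp add: potential_def)
qed

text \<open>
  The cost of the optimal design is \<open>kappa\<close> of the estimated gaps, which dominate both the true
  gaps and \<open>eps l\<close>. The first bound is for complete stages; the second one controls the number of
  rounds and is needed when the stage is cut off and a single candidate is played instead. Rounding costs
  at most \<open>2\<close> for each of the at most \<open>d + 1\<close> actions in the support.
\<close>

lemma bias_counts_regret:
  assumes wf: "wf_state s" and l: "1 \<le> l" and inv: "gaps_inv (A.eps l) s"
  shows "(\<Sum>x\<in>X. real (bias_counts l s x) * gap x) \<le> 2 * real (d + 1) + 2 * bias_log l * potential (A.eps l) / (A.eps l)\<^sup>2"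
    "A.eps l * real (sum (bias_counts l s) X) \<le> 2 * real (d + 1) + 2 * bias_log l * potential (A.eps l) / (A.eps l)\<^sup>2"
proof -
  let ?\<mu> = "Delta_design R (hist s) (gaps s)" and ?e = "A.eps l"
  define c where "c = 2 * bias_log l / ?e\<^sup>2"
  have c: "0 \<le> c" unfolding c_def using bias_log_pos[OF l] by simp
  have opt: "Delta_optimal (gaps s) ?\<mu>" by (rule Delta_design_props(1)[OF wf])
  have w: "?\<mu> \<in> weights_on X" using opt by (auto simp: Delta_optimal_def feasible_iff)
  have pos: "0 \<le> gaps s x" if "x \<in> X" for x
    using inv that eps_pos[of l] by (force simp: gaps_inv_def)
  have cost: "cost (gaps s) ?\<mu> = kappa (gaps s)" by (rule Delta_optimal_cost[OF opt pos])
  have cnt: "bias_counts l s x = nat \<lceil>c * ?\<mu> x\<rceil>" for x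
    unfolding bias_counts_eq c_def by (simp add: mult_ac)
  have up: "real (bias_counts l s x) \<le> c * ?\<mu> x + (if ?\<mu> x \<noteq> 0 then 1 else 0)" for x
    unfolding cnt using nat_ceiling_le[of "c * ?\<mu> x"] c weights_onD(1)[OF w, of x] by (auto split: if_splits)
  have general: "(\<Sum>x\<in>X. real (bias_counts l s x) * f x) \<le> 2 * real (d + 1) + c * potential ?e"
    if f: "\<And>x. x \<in> X \<Longrightarrow> 0 \<le> f x \<and> f x \<le> 2 \<and> f x \<le> gaps s x" for f
  proof -
    have "(\<Sum>x\<in>X. real (bias_counts l s x) * f x) \<le>
        (\<Sum>x\<in>X. (if ?\<mu> x \<noteq> 0 then 2 else 0) + c * (?\<mu> x * gaps s x))"
    proof (rule sum_mono)
      fix x assume x: "x \<in> X"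
      have "real (bias_counts l s x) * f x \<le> (c * ?\<mu> x + (if ?\<mu> x \<noteq> 0 then 1 else 0)) * f x"
        using up f[OF x] by (intro mult_right_mono) auto
      also have "\<dots> = (if ?\<mu> x \<noteq> 0 then f x else 0) + c * ?\<mu> x * f x" by (simp add: algebra_simps)
      also have "\<dots> \<le> (if ?\<mu> x \<noteq> 0 then 2 else 0) + c * ?\<mu> x * gaps s x"
        using f[OF x] c weights_onD(1)[OF w, of x] by (intro add_mono mult_left_mono mult_nonneg_nonneg) auto
      finally show "real (bias_counts l s x) * f x \<le> (if ?\<mu> x \<noteq> 0 then 2 else 0) + c * (?\<mu> x * gaps s x)"
        by (simp add: mult_ac)
    qed
    also have "\<dots> = 2 * real (card {x\<in>X. ?\<mu> x \<noteq> 0}) + c * cost (gaps s) ?\<mu>"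
      using finite_X by (simp add: sum.distrib sum_distrib_left[symmetric] cost_def sum.If_cases Collect_conj_eq)
    also have "\<dots> \<le> 2 * real (d + 1) + c * potential ?e"
    proof (intro add_mono mult_left_mono c)
      have "{x. ?\<mu> x \<noteq> 0} \<subseteq> X" using weights_onD(2)[OF w] by blast
      then have "{x\<in>X. ?\<mu> x \<noteq> 0} = {x. ?\<mu> x \<noteq> 0}" by blast
      then show "real (card {x\<in>X. ?\<mu> x \<noteq> 0}) \<le> real (d + 1)"
        using Delta_design_props(2)[OF wf, of "hist s"] by simp
      show "cost (gaps s) ?\<mu> \<le> potential ?e" unfolding cost by (rule gaps_kappa(1)[OF inv eps_pos])
    qed simp
    finally show ?thesis .
  qed
  have "(\<Sum>x\<in>X. real (bias_counts l s x) * gap x) \<le> 2 * real (d + 1) + c * potential ?e"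
    by (rule general) (use gap_nonneg gap_le_2 inv in \<open>auto simp: gaps_inv_def\<close>)
  then show "(\<Sum>x\<in>X. real (bias_counts l s x) * gap x) \<le> 2 * real (d + 1) + 2 * bias_log l * potential ?e / ?e\<^sup>2"
    by (simp add: c_def)
  have "(\<Sum>x\<in>X. real (bias_counts l s x) * ?e) \<le> 2 * real (d + 1) + c * potential ?e"
    by (rule general) (use eps_pos[of l] eps_le_2[OF l] inv in \<open>auto simp: gaps_inv_def less_imp_le\<close>)
  then show "?e * real (sum (bias_counts l s) X) \<le> 2 * real (d + 1) + 2 * bias_log l * potential ?e / ?e\<^sup>2"
    by (simp add: c_def sum_distrib_left mult_ac)
qed

subsection \<open>Logarithms and powers\<close>

definition log_kT :: real where "log_kT = ln (real (card X) * real T)"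
definition sqrt_term :: real where "sqrt_term = sqrt (real (d + 1) * log_kT * real T)"
definition main_term :: real where
  "main_term = kappa_star powr (1/3) * real T powr (2/3) * ln (real T) powr (1/3)"

lemma ln_T_ge: "2 / 3 \<le> ln (real T)"
proof -
  have "ln 2 \<le> ln (real T)" using T_ge_2 by (subst ln_le_cancel_iff) auto
  then show ?thesis using ln2_ge_two_thirds by linarith
qed

lemma log_kT_ge: "1 \<le> log_kT"
proof -
  have "2 * 2 \<le> card X * T" using card_X_ge_2 T_ge_2 by (rule mult_mono) auto
  then have "real (2 * 2) \<le> real (card X * T)" by (simp only: of_nat_le_iff)
  then have 1: "4 \<le> real (card X) * real T" by simp
  then have "exp 1 \<le> real (card X) * real T" using exp_le by linarith
  then show ?thesis unfolding log_kT_def using 1 by (subst ln_ge_iff) auto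
qed

lemma sqrt_term_nonneg: "0 \<le> sqrt_term"
  unfolding sqrt_term_def using log_kT_ge by simp

lemma main_term_nonneg: "0 \<le> main_term"
  by (simp add: main_term_def)

lemma support_bound_nonneg: "0 \<le> support_bound"
  by (simp add: support_bound_def)

lemma eps_eq: "A.eps l = 4 / 2 ^ l"
  unfolding A.eps_def by (subst powr_diff) (simp add: powr_realpow)

lemma twice_le_power: "1 \<le> l \<Longrightarrow> 2 * l \<le> 2 ^ l"
proof (induction l rule: dec_induct)
  case (step n)
  then have "2 * Suc n \<le> 2 * (2 * n)" by simp
  also have "\<dots> \<le> 2 * 2 ^ n" using step by simp
  finally show ?case by simp
qed simp

text \<open>
  Only order \<open>log T\<close> phases have \<open>(eps l)\<^sup>2 * T \<ge> 1\<close>, so that the factors \<open>l * (l + 1)\<close> of the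
  union bound are absorbed by powers of \<open>T\<close>.
\<close>

lemma started_phase_logs:
  assumes l: "1 \<le> l" and e: "1 \<le> (A.eps l)\<^sup>2 * real T"
  shows "bias_log l \<le> 5 * ln (real T)" "group_log l \<le> 5 * log_kT" "real l \<le> 4 * ln (real T)"
proof -
  have T: "2 \<le> real T" using T_ge_2 by simp
  have p: "(2 ^ l)\<^sup>2 \<le> 16 * real T" using e by (simp add: eps_eq power_divide field_simps)
  have "real (2 * l) \<le> real (2 ^ l)" using twice_le_power[OF l] by (simp only: of_nat_le_iff)
  then have "(2 * real l)\<^sup>2 \<le> (2 ^ l)\<^sup>2" by (intro power_mono) simp_all
  then have l2: "(real l)\<^sup>2 \<le> 4 * real T" using p by (simp add: power_mult_distrib)
  \<comment> \<open>\<open>l * (l + 1) \<le> 8 * T \<le> T^4\<close>, so one more factor \<open>T\<close> gives the power \<open>5\<close>.\<close>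
  have "real l * real (l + 1) \<le> 2 * (real l)\<^sup>2" using l by (simp add: power2_eq_square algebra_simps)
  also have "\<dots> \<le> 2 ^ 3 * real T" using l2 by simp
  also have "\<dots> \<le> real T ^ 3 * real T" using T by (intro mult_right_mono power_mono) auto
  finally have "real l * real (l + 1) * real T \<le> real T ^ 3 * real T * real T"
    by (rule mult_right_mono) simp
  then have b: "real l * real (l + 1) * real T \<le> real T ^ 5" by (simp add: eval_nat_numeral mult_ac)
  have pos: "0 < real l * real (l + 1) * real T" using log_argument_ge(1)[OF l] by simp
  have "bias_log l \<le> ln (real T ^ 5)" unfolding bias_log_def using b pos T by (subst ln_le_cancel_iff) auto
  also have "\<dots> = 5 * ln (real T)" using T by (simp add: ln_realpow)
  finally show "bias_log l \<le> 5 * ln (real T)" .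
  have k: "2 \<le> real (card X)" using card_X_ge_2 by simp
  have "real (card X) * real l * real (l + 1) * real T \<le> real (card X) * real T ^ 5"
    using b k by (simp add: mult.assoc)
  also have "\<dots> \<le> real (card X) ^ 5 * real T ^ 5"
    using k self_le_power[of "real (card X)" 5] by (intro mult_right_mono) auto
  finally have g: "real (card X) * real l * real (l + 1) * real T \<le> (real (card X) * real T) ^ 5"
    by (simp add: power_mult_distrib)
  have "group_log l \<le> ln ((real (card X) * real T) ^ 5)"
    unfolding group_log_def using g log_argument_ge(2)[OF l] T k by (subst ln_le_cancel_iff) auto
  also have "\<dots> = 5 * log_kT" using T k by (simp add: ln_realpow log_kT_def)
  finally show "group_log l \<le> 5 * log_kT" .
  have "(4::real) ^ l = (2 ^ l)\<^sup>2" by (simp add: power_mult[symmetric] mult.commute[of l] power_mult)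
  then have "(4::real) ^ l \<le> 16 * real T" using p by simp
  then have "ln ((4::real) ^ l) \<le> ln (16 * real T)" using T by (subst ln_le_cancel_iff) auto
  also have "\<dots> = 2 * ln 4 + ln (real T)"
  proof -
    have "ln (16 :: real) = ln (4 ^ 2)" by simp
    also have "\<dots> = 2 * ln 4" by (subst ln_realpow) auto
    finally show ?thesis using T by (subst ln_mult) auto
  qed
  finally have "real l * ln 4 \<le> 2 * ln 4 + ln (real T)" by (simp add: ln_realpow)
  moreover have ln4: "1 \<le> ln (4::real)"
  proof -
    have "ln (4 :: real) = ln (2 ^ 2)" by simp
    also have "\<dots> = 2 * ln 2" by (subst ln_realpow) auto
    finally show ?thesis using ln2_ge_two_thirds by simp
  qed
  ultimately have *: "(real l - 2) * ln 4 \<le> ln (real T)" by (simp add: algebra_simps)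
  have "real l - 2 \<le> ln (real T)"
  proof (cases "2 \<le> real l")
    case True
    then have "(real l - 2) * 1 \<le> (real l - 2) * ln 4" using ln4 by (intro mult_left_mono) auto
    then show ?thesis using * by simp
  next
    case False
    then show ?thesis using ln_T_ge by simp
  qed
  then show "real l \<le> 4 * ln (real T)" using ln_T_ge by simp
qed

text \<open>
  The minimum of budget and horizon is at most their geometric mean, in which \<open>eps l\<close> cancels.
\<close>

lemma group_cost_bound:
  assumes l: "1 \<le> l" and e: "1 \<le> (A.eps l)\<^sup>2 * real T"
  shows "2 * group_cost l \<le> 104 * support_bound + 208 * sqrt_term"
proof -
  have e0: "0 < A.eps l" and e2: "A.eps l \<le> 2" using eps_pos eps_le_2[OF l] by auto
  have b0: "0 \<le> group_budget l" by (rule group_budget_nonneg[OF l])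
  have "A.eps l * min (group_budget l) (real T) \<le> 4 * sqrt_term"
  proof (rule power2_le_imp_le)
    have "(A.eps l * min (group_budget l) (real T))\<^sup>2 = (A.eps l)\<^sup>2 * (min (group_budget l) (real T) * min (group_budget l) (real T))"
      by (simp add: power2_eq_square)
    also have "\<dots> \<le> (A.eps l)\<^sup>2 * (group_budget l * real T)"
      using b0 by (intro mult_left_mono mult_mono) auto
    also have "\<dots> = 2 * real (d + 1) * group_log l * real T"
      unfolding group_budget_def using e0 by (simp add: field_simps)
    also have "\<dots> \<le> 2 * real (d + 1) * (5 * log_kT) * real T"
      by (intro mult_right_mono mult_left_mono started_phase_logs(2)[OF l e]) auto
    also have "\<dots> = 10 * (real (d + 1) * log_kT * real T)" by simp
    also have "\<dots> \<le> 16 * (real (d + 1) * log_kT * real T)"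
      using log_kT_ge by (intro mult_right_mono) simp_all
    also have "\<dots> = (4 * sqrt_term)\<^sup>2"
      unfolding sqrt_term_def power_mult_distrib using log_kT_ge by simp
    finally show "(A.eps l * min (group_budget l) (real T))\<^sup>2 \<le> (4 * sqrt_term)\<^sup>2" .
  qed (use sqrt_term_nonneg in simp)
  moreover have "A.eps l * support_bound \<le> 2 * support_bound"
    using e2 support_bound_nonneg by (intro mult_right_mono) auto
  ultimately show ?thesis unfolding group_cost_def by (simp add: algebra_simps)
qed

text \<open>
  An upper bound for \<open>potential e / e\<^sup>2\<close> in all phases in which bias exploration is allowed:
  \<open>potential e\<close> is split into its powers \<open>1/3\<close> and \<open>2/3\<close>, the first of which is bounded
  by \<open>kappa_star\<close> and the second, divided by \<open>e\<^sup>2\<close>, by the recovery rule.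
\<close>

definition bias_budget :: real where
  "bias_budget = (66 * kappa_star) powr (1/3) * (33 * real T / ln (real T)) powr (2/3)"

lemma bias_budget_nonneg: "0 \<le> bias_budget"
  by (simp add: bias_budget_def)

lemma powr_third_cube: "0 \<le> y \<Longrightarrow> (y powr (1/3)) ^ 3 = (y :: real)"
  by (cases "y = 0") (simp_all add: powr_realpow[symmetric] powr_powr)

lemma potential_le_bias_budget:
  assumes l: "1 \<le> l" and inv: "gaps_inv (A.eps l) s"
    and y: "(kappa (gaps s) * ln (real T) / real T) powr (1/3) < A.eps l"
  shows "potential (A.eps l) / (A.eps l)\<^sup>2 \<le> bias_budget"
proof -
  let ?e = "A.eps l" and ?F = "kappa (gaps s)"
  have e: "0 < ?e" "?e \<le> 2" using eps_pos eps_le_2[OF l] by auto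
  have T: "0 < real T" and lT: "0 < ln (real T)" using T_ge_2 ln_T_ge by auto
  have K0: "0 \<le> potential ?e" using potential_nonneg e by simp
  have F0: "0 \<le> ?F" using gaps_kappa(2)[OF inv e(1)] K0 by simp
  have "?F * ln (real T) / real T = ((?F * ln (real T) / real T) powr (1/3)) ^ 3"
    using F0 T lT by (intro powr_third_cube[symmetric]) simp
  also have "\<dots> \<le> ?e ^ 3" using y by (intro power_mono) auto
  finally have "?F * ln (real T) \<le> ?e ^ 3 * real T" using T by (simp add: field_simps)
  moreover have "potential ?e * ln (real T) \<le> 33 * ?F * ln (real T)"
    using gaps_kappa(2)[OF inv e(1)] lT by (intro mult_right_mono) auto
  ultimately have "potential ?e * ln (real T) \<le> 33 * (?e ^ 3 * real T)"
    unfolding mult.assoc[of 33] by linarith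
  then have ratio: "potential ?e / ?e ^ 3 \<le> 33 * real T / ln (real T)" using e lT by (simp add: divide_simps mult_ac)
  show ?thesis
  proof (cases "potential ?e = 0")
    case True
    then show ?thesis using bias_budget_nonneg by simp
  next
    case False
    then have Kp: "0 < potential ?e" using K0 by simp
    \<comment> \<open>Interpolation between the bound by \<open>kappa_star\<close> and the bound on \<open>ratio\<close> from the recovery rule.\<close>
    have "potential ?e / ?e\<^sup>2 = potential ?e powr (1/3) * (potential ?e / ?e ^ 3) powr (2/3)"
    proof -
      have "?e ^ 3 = ?e powr 3" "?e\<^sup>2 = ?e powr 2" using e by simp_all
      then have "(?e ^ 3) powr (2/3) = ?e\<^sup>2" by (simp only: powr_powr) simp
      moreover have "potential ?e powr (1/3) * potential ?e powr (2/3) = potential ?e"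
        using Kp by (simp add: powr_add[symmetric])
      ultimately show ?thesis using Kp e by (simp add: powr_divide)
    qed
    also have "\<dots> \<le> bias_budget"
      unfolding bias_budget_def using K0 ratio potential_le_kappa_star[OF e] e
      by (intro mult_mono powr_mono2) auto
    finally show ?thesis .
  qed
qed

lemma bias_budget_main: "ln (real T) * bias_budget \<le> 66 * main_term"
proof -
  have T: "0 < real T" and lT: "0 < ln (real T)" using T_ge_2 ln_T_ge by auto
  have k: "0 < kappa_star" using kappa_star_ge_1 by simp
  have lnq: "ln (real T) / ln (real T) powr (2/3) = ln (real T) powr (1/3)"
  proof -
    have "ln (real T) = ln (real T) powr (1/3) * ln (real T) powr (2/3)"
      using lT by (simp add: powr_add[symmetric])
    then show ?thesis using lT by (simp add: field_simps)
  qed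
  have "bias_budget = (66 powr (1/3) * 33 powr (2/3)) * (kappa_star powr (1/3) * (real T powr (2/3) / ln (real T) powr (2/3)))"
    unfolding bias_budget_def using T lT k by (simp add: powr_mult powr_divide)
  then have "ln (real T) * bias_budget = (66 powr (1/3) * 33 powr (2/3)) *
      (kappa_star powr (1/3) * real T powr (2/3) * (ln (real T) / ln (real T) powr (2/3)))"
    by simp
  also have "\<dots> = (66 powr (1/3) * 33 powr (2/3)) * main_term"
    unfolding lnq main_term_def ..
  also have "\<dots> \<le> (66 powr (1/3) * 66 powr (2/3)) * main_term"
    by (intro mult_right_mono mult_left_mono powr_mono2 main_term_nonneg) auto
  also have "\<dots> = 66 * main_term" by (simp add: powr_add[symmetric])
  finally show ?thesis .
qed

text \<open>
  The regret of playing \<open>T\<close> rounds with gaps at the recovery threshold.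
\<close>

lemma recovery_main:
  assumes e: "0 < e" "e \<le> 2" and F: "0 \<le> F" "F \<le> potential e"
  shows "real T * (F * ln (real T) / real T) powr (1/3) \<le> 66 * main_term"
proof -
  have T: "0 < real T" and lT: "0 < ln (real T)" using T_ge_2 ln_T_ge by auto
  have k: "0 < kappa_star" using kappa_star_ge_1 by simp
  have "F \<le> 66 * kappa_star" using F potential_le_kappa_star[OF e] by simp
  then have "(F * ln (real T) / real T) powr (1/3) \<le> (66 * kappa_star * ln (real T) / real T) powr (1/3)"
    using F T lT by (intro powr_mono2 divide_right_mono mult_right_mono) auto
  also have "\<dots> = 66 powr (1/3) * (kappa_star powr (1/3) * ln (real T) powr (1/3)) / real T powr (1/3)"
    using T lT k by (simp add: powr_mult powr_divide)
  finally have "real T * (F * ln (real T) / real T) powr (1/3) \<le>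
      66 powr (1/3) * (kappa_star powr (1/3) * ln (real T) powr (1/3)) * (real T / real T powr (1/3))"
    using T by (simp add: field_simps)
  also have "real T / real T powr (1/3) = real T powr (2/3)"
  proof -
    have "real T = real T powr (1/3) * real T powr (2/3)" using T by (simp add: powr_add[symmetric])
    then show ?thesis using T by (simp add: field_simps)
  qed
  also have "66 powr (1/3) * (kappa_star powr (1/3) * ln (real T) powr (1/3)) * real T powr (2/3) = 66 powr (1/3) * main_term"
    by (simp add: main_term_def mult_ac)
  also have "\<dots> \<le> 66 powr 1 * main_term" by (intro mult_right_mono powr_mono main_term_nonneg) auto
  finally show ?thesis by simp
qed

subsection \<open>One phase\<close>

lemma group_inv_cong: "active s g = active s' g \<Longrightarrow> group_inv r g s = group_inv r g s'"
  by (simp add: group_inv_def)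

lemma group_step_length:
  assumes "wf_state s" "\<not> group_completes l g s" shows "length (hist (A.group_step p l g s)) = T"
  using wf_stateD(1)[OF assms(1)] by (simp add: group_step_incomplete[OF assms(2)] length_spend_all)

lemma group_step_length_mono: "length (hist s) \<le> length (hist (A.group_step p l g s))"
  by (rule causal_stepD(1)[OF causal_group_step])

lemma active_group_step_subset: "active (A.group_step p l g s) g' \<subseteq> active s g'"
  by (auto simp: group_step_fields survivors_def)

lemma group_phase_fields:
  "best_group (group_phase p l s) = best_group s" "gaps (group_phase p l s) = gaps s"
  "active (group_phase p l s) g \<subseteq> active s g"
  using active_group_step_subset by (auto simp: group_phase_def Let_def group_step_fields(4,5)) blast+

text \<open>
  Both group stages of a phase together, or the single one if the best group is known. The two stages
  act on disjoint parts of the state, so the conclusions of the first one survive the second one.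
\<close>

lemma group_phase_analysis:
  assumes wf: "wf_state s" and l: "1 \<le> l" and acc: "accurate_phase p l s"
    and inv: "\<And>g. g \<in> {-1, 1} \<Longrightarrow> g \<noteq> - best_group s \<Longrightarrow> group_inv r g s"
    and gap: "\<And>g x. g \<in> {-1, 1} \<Longrightarrow> g \<noteq> - best_group s \<Longrightarrow> x \<in> active s g \<Longrightarrow> gap x \<le> 26 * A.eps l"
  shows "history_regret (hist (group_phase p l s)) \<le> history_regret (hist s) + 2 * group_cost l"
    "length (hist (group_phase p l s)) < T \<Longrightarrow> group_budget l \<le> real T"
    "length (hist (group_phase p l s)) < T \<Longrightarrow> g \<in> {-1, 1} \<Longrightarrow> g \<noteq> - best_group s \<Longrightarrow>
      group_inv (5 * A.eps l) g (group_phase p l s) \<and>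
      (\<forall>x. x \<in> active s g \<longrightarrow> x \<notin> active (group_phase p l s) g \<longrightarrow> A.eps l \<le> gap x) \<and>
      (\<forall>x\<in>active (group_phase p l s) g. \<bar>avec x \<bullet> theta (group_phase p l s) g - avec x \<bullet> theta_star\<bar> \<le> A.eps l)"
proof -
  let ?e = "A.eps l"
  have cost0: "0 \<le> group_cost l"
    unfolding group_cost_def using eps_pos[of l] support_bound_nonneg group_budget_nonneg[OF l] by simp
  have goal: "history_regret (hist (group_phase p l s)) \<le> history_regret (hist s) + 2 * group_cost l \<and>
    (length (hist (group_phase p l s)) < T \<longrightarrow> group_budget l \<le> real T \<and>
      (\<forall>g\<in>{-1, 1}. g \<noteq> - best_group s \<longrightarrow> group_inv (5 * ?e) g (group_phase p l s) \<and>
        (\<forall>x. x \<in> active s g \<longrightarrow> x \<notin> active (group_phase p l s) g \<longrightarrow> ?e \<le> gap x) \<and>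
        (\<forall>x\<in>active (group_phase p l s) g. \<bar>avec x \<bullet> theta (group_phase p l s) g - avec x \<bullet> theta_star\<bar> \<le> ?e)))"
  proof (cases "best_group s = 0")
    case True
    let ?f = "first_group R (hist s)"
    define s1 where "s1 = A.group_step p l ?f s"
    define s2 where "s2 = A.group_step p l (- ?f) s1"
    have s2: "group_phase p l s = s2" using True by (simp add: group_phase_def Let_def s1_def s2_def)
    have f: "?f \<in> {-1, 1}" "- ?f \<in> {-1, 1}" "?f \<noteq> - ?f" "- ?f \<noteq> ?f" using first_group[of "hist s"] by auto
    have fb: "?f \<noteq> - best_group s" "- ?f \<noteq> - best_group s" using True f by auto
    have wf1: "wf_state s1" unfolding s1_def by (rule wf_group_step[OF wf f(1)])
    have a1: "accurate_group p l ?f s" "accurate_group p l (- ?f) s1"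
      using acc True by (simp_all add: accurate_phase_def s1_def)
    have act1: "active s1 (- ?f) = active s (- ?f)" using f by (simp add: s1_def group_step_fields)
    have i2: "group_inv r (- ?f) s1" using inv[OF f(2) fb(2)] group_inv_cong[OF act1] by simp
    have g2: "gap x \<le> 26 * ?e" if "x \<in> active s1 (- ?f)" for x
      using gap[OF f(2) fb(2)] that act1 by simp
    have r1: "history_regret (hist s1) \<le> history_regret (hist s) + group_cost l"
      unfolding s1_def by (rule group_step_regret[OF wf f(1) l gap[OF f(1) fb(1)]])
    have r2: "history_regret (hist s2) \<le> history_regret (hist s1) + group_cost l"
      unfolding s2_def by (rule group_step_regret[OF wf1 f(2) l g2])
    have "group_budget l \<le> real T \<and>
      (\<forall>g\<in>{-1, 1}. g \<noteq> - best_group s \<longrightarrow> group_inv (5 * ?e) g s2 \<and>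
        (\<forall>x. x \<in> active s g \<longrightarrow> x \<notin> active s2 g \<longrightarrow> ?e \<le> gap x) \<and>
        (\<forall>x\<in>active s2 g. \<bar>avec x \<bullet> theta s2 g - avec x \<bullet> theta_star\<bar> \<le> ?e))" if len: "length (hist s2) < T"
    proof -
      have len1: "length (hist s1) < T" using len group_step_length_mono[of s1 p l "- ?f"] by (simp add: s2_def)
      have c1: "group_completes l ?f s"
        using len1 group_step_length[OF wf, of l ?f p] by (auto simp: s1_def)
      have c2: "group_completes l (- ?f) s1"
        using len group_step_length[OF wf1, of l "- ?f" p] by (auto simp: s2_def)
      have act2: "active s2 ?f = active s1 ?f" using f by (simp add: s2_def group_step_fields)
      have th2: "theta s2 ?f = group_estimate p l ?f s" "theta s2 (- ?f) = group_estimate p l (- ?f) s1"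
        using f c1 c2 by (simp_all add: s2_def s1_def group_step_fields)
      have sub1: "active s1 ?f \<subseteq> active s ?f" and sub2: "active s2 (- ?f) \<subseteq> active s1 (- ?f)"
        unfolding s1_def s2_def by (rule active_group_step_subset)+
      note st1 = group_step_survivors[OF wf f(1) inv[OF f(1) fb(1)] a1(1) c1, folded s1_def]
      note st2 = group_step_survivors[OF wf1 f(2) i2 a1(2) c2, folded s2_def]
      have F: "group_inv (5 * ?e) ?f s2 \<and>
        (\<forall>x. x \<in> active s ?f \<longrightarrow> x \<notin> active s2 ?f \<longrightarrow> ?e \<le> gap x) \<and>
        (\<forall>x\<in>active s2 ?f. \<bar>avec x \<bullet> theta s2 ?f - avec x \<bullet> theta_star\<bar> \<le> ?e)"
      proof (intro conjI allI impI ballI)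
        show "group_inv (5 * ?e) ?f s2" using st1(1) group_inv_cong[OF act2] by simp
        show "?e \<le> gap x" if "x \<in> active s ?f" "x \<notin> active s2 ?f" for x
          by (rule st1(2)[OF that(1)]) (use that act2 in simp)
        show "\<bar>avec x \<bullet> theta s2 ?f - avec x \<bullet> theta_star\<bar> \<le> ?e" if "x \<in> active s2 ?f" for x
          unfolding th2 using a1(1) c1 that sub1 act2 by (auto simp: accurate_group_def)
      qed
      have F': "group_inv (5 * ?e) (- ?f) s2 \<and>
        (\<forall>x. x \<in> active s (- ?f) \<longrightarrow> x \<notin> active s2 (- ?f) \<longrightarrow> ?e \<le> gap x) \<and>
        (\<forall>x\<in>active s2 (- ?f). \<bar>avec x \<bullet> theta s2 (- ?f) - avec x \<bullet> theta_star\<bar> \<le> ?e)"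
      proof (intro conjI allI impI ballI)
        show "group_inv (5 * ?e) (- ?f) s2" by (rule st2(1))
        show "?e \<le> gap x" if "x \<in> active s (- ?f)" "x \<notin> active s2 (- ?f)" for x
          by (rule st2(2)) (use that act1 in simp_all)
        show "\<bar>avec x \<bullet> theta s2 (- ?f) - avec x \<bullet> theta_star\<bar> \<le> ?e" if "x \<in> active s2 (- ?f)" for x
          unfolding th2 using a1(2) c2 that sub2 by (auto simp: accurate_group_def)
      qed
      have "g = ?f \<or> g = - ?f" if "g \<in> {-1, 1}" for g using that f by auto
      then show ?thesis using F F' group_completes_budget[OF wf f(1) l c1] by metis
    qed
    then show ?thesis using r1 r2 unfolding s2 by auto
  next
    case False
    let ?b = "best_group s"
    have b: "?b \<in> {-1, 1}" "?b \<noteq> - ?b" using wf_stateD(7)[OF wf] False by auto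
    define s1 where "s1 = A.group_step p l ?b s"
    have s1: "group_phase p l s = s1" using False by (simp add: group_phase_def Let_def s1_def)
    have a1: "accurate_group p l ?b s" using acc False by (simp add: accurate_phase_def)
    have r1: "history_regret (hist s1) \<le> history_regret (hist s) + group_cost l"
      unfolding s1_def by (rule group_step_regret[OF wf b(1) l gap[OF b(1) b(2)]])
    have "group_budget l \<le> real T \<and>
      (\<forall>g\<in>{-1, 1}. g \<noteq> - best_group s \<longrightarrow> group_inv (5 * ?e) g s1 \<and>
        (\<forall>x. x \<in> active s g \<longrightarrow> x \<notin> active s1 g \<longrightarrow> ?e \<le> gap x) \<and>
        (\<forall>x\<in>active s1 g. \<bar>avec x \<bullet> theta s1 g - avec x \<bullet> theta_star\<bar> \<le> ?e))" if len: "length (hist s1) < T"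
    proof -
      have c1: "group_completes l ?b s"
        using len group_step_length[OF wf, of l ?b p] by (auto simp: s1_def)
      have sub1: "active s1 ?b \<subseteq> active s ?b" unfolding s1_def by (rule active_group_step_subset)
      have th1: "theta s1 ?b = group_estimate p l ?b s" using c1 by (simp add: s1_def group_step_fields)
      note st1 = group_step_survivors[OF wf b(1) inv[OF b(1) b(2)] a1 c1, folded s1_def]
      have F: "group_inv (5 * ?e) ?b s1 \<and>
        (\<forall>x. x \<in> active s ?b \<longrightarrow> x \<notin> active s1 ?b \<longrightarrow> ?e \<le> gap x) \<and>
        (\<forall>x\<in>active s1 ?b. \<bar>avec x \<bullet> theta s1 ?b - avec x \<bullet> theta_star\<bar> \<le> ?e)"
        unfolding th1 using st1 a1 c1 sub1 by (auto simp: accurate_group_def)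
      have "g = ?b" if "g \<in> {-1, 1}" "g \<noteq> - ?b" for g using that b by auto
      then show ?thesis using F group_completes_budget[OF wf b(1) l c1] by metis
    qed
    then show ?thesis using r1 cost0 unfolding s1 by auto
  qed
  then show "history_regret (hist (group_phase p l s)) \<le> history_regret (hist s) + 2 * group_cost l" ..
  show "group_budget l \<le> real T" if "length (hist (group_phase p l s)) < T" using goal that by simp
  show "group_inv (5 * ?e) g (group_phase p l s) \<and>
      (\<forall>x. x \<in> active s g \<longrightarrow> x \<notin> active (group_phase p l s) g \<longrightarrow> ?e \<le> gap x) \<and>
      (\<forall>x\<in>active (group_phase p l s) g. \<bar>avec x \<bullet> theta (group_phase p l s) g - avec x \<bullet> theta_star\<bar> \<le> ?e)"
    if "length (hist (group_phase p l s)) < T" "g \<in> {-1, 1}" "g \<noteq> - best_group s"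
    using conjunct2[OF mp[OF conjunct2[OF goal] that(1)]] that(2,3) by blast
qed

subsection \<open>The invariant of the phases\<close>

text \<open>
  The state before phase \<open>l\<close>, with \<open>e = eps l\<close>. The number \<open>\<beta>\<close> stands for the sum of
  \<open>potential (eps j) / (eps j)\<^sup>2\<close> over the bias stages already made. The bounds \<open>10 * e\<close> and
  \<open>16 * e\<close> are the results \<open>5 * eps (l - 1)\<close> and \<open>8 * eps (l - 1)\<close> of the previous phase, and they are trivial for
  \<open>l = 1\<close>. The last
  conjunct adds up the regret of the phases \<open>j < l\<close>: the sum of \<open>eps j\<close> is \<open>4 - 2 * e\<close>, the sum of
  \<open>1 / eps j\<close> is \<open>1 / e - 1 / 2\<close>, and each bias stage contributes \<open>2 * (d + 1)\<close> for rounding. The factor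
  \<open>52 = 2 * 26\<close> counts two group stages, and \<open>520\<close> has another factor \<open>10\<close> from
  \<open>2 * group_log j \<le> 10 * log_kT\<close>.
\<close>

definition phase_inv :: "nat \<Rightarrow> fpe_state \<Rightarrow> real \<Rightarrow> bool" where
  "phase_inv l s \<beta> \<longleftrightarrow> wf_state s \<and> 1 \<le> l \<and> 1 \<le> (A.eps l)\<^sup>2 * real T \<and>
     real (d + 1) * log_kT * (1 / A.eps l - 1 / 2) \<le> 2 * sqrt_term \<and>
     (\<forall>g\<in>{-1, 1}. g \<noteq> - best_group s \<longrightarrow> group_inv (10 * A.eps l) g s) \<and>
     (best_group s = 0 \<longrightarrow> gaps_inv (A.eps l) s \<and> \<bar>best_val 1 - best_val (-1)\<bar> \<le> 16 * A.eps l \<and>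
        \<beta> \<le> potential (A.eps l) / (A.eps l)\<^sup>2) \<and>
     (best_group s \<noteq> 0 \<longrightarrow> best_val (- best_group s) \<le> best_val (best_group s)) \<and>
     0 \<le> \<beta> \<and> \<beta> \<le> 2 * bias_budget \<and>
     history_regret (hist s) \<le> 52 * support_bound * (4 - 2 * A.eps l)
       + 520 * (real (d + 1) * log_kT * (1 / A.eps l - 1 / 2))
       + 2 * real (d + 1) * (real l - 1) + 10 * ln (real T) * \<beta>"

text \<open>
  The start of the last phase and the last phase itself, see \<open>start_regret\<close> and \<open>phase_regret\<close>.
\<close>

definition final_bound :: real where
  "final_bound = 400 * support_bound + 1300 * sqrt_term + 100 * (real (d + 1) * ln (real T)) + 20000 * main_term"

text \<open>
  As long as the best group is unknown, an active action of either group loses at most \<open>10 * eps l\<close>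
  inside its group and \<open>16 * eps l\<close> between the groups.
\<close>

lemma phase_inv_gap:
  assumes inv: "phase_inv l s \<beta>" and g: "g \<in> {-1, 1}" "g \<noteq> - best_group s" and x: "x \<in> active s g"
  shows "gap x \<le> 26 * A.eps l"
proof -
  have wf: "wf_state s" using inv by (simp add: phase_inv_def)
  have v: "best_val g - val x \<le> 10 * A.eps l" using inv g x by (auto simp: phase_inv_def group_inv_def)
  show ?thesis
  proof (cases "best_group s = 0")
    case True
    then have "\<bar>best_val 1 - best_val (-1)\<bar> \<le> 16 * A.eps l" using inv by (simp add: phase_inv_def)
    then show ?thesis using v g(1) by (auto simp: gap_eq max_def abs_le_iff)
  next
    case False
    have "g = best_group s" using False g wf_stateD(7)[OF wf] by auto
    then have "best_val (- g) \<le> best_val g" using inv False by (simp add: phase_inv_def)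
    then have "gap x = best_val g - val x" using g(1) by (auto simp: gap_eq max_def)
    then show ?thesis using v eps_pos[of l] by simp
  qed
qed

text \<open>
  Eliminating an action with \<open>gap x \<ge> e\<close> turns the additive error of its estimated gap into a
  multiplicative one.
\<close>

lemma gaps_inv_fewer_candidates:
  assumes inv: "gaps_inv e s" and same: "gaps s' = gaps s" and sub: "candidates s' \<subseteq> candidates s"
    and elim: "\<And>x. x \<in> candidates s \<Longrightarrow> x \<notin> candidates s' \<Longrightarrow> e \<le> gap x"
  shows "gaps_inv e s'"
  unfolding gaps_inv_def same
proof (intro ballI conjI impI)
  fix x assume x: "x \<in> X"
  have i: "gap x \<le> gaps s x" "e \<le> gaps s x" "x \<in> candidates s \<Longrightarrow> gaps s x \<le> gap x + 16 * e"
    "x \<notin> candidates s \<Longrightarrow> gaps s x \<le> 17 * gap x" using inv x by (auto simp: gaps_inv_def)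
  show "gap x \<le> gaps s x" "e \<le> gaps s x" by (rule i)+
  show "gaps s x \<le> gap x + 16 * e" if "x \<in> candidates s'" using i(3) that sub by blast
  show "gaps s x \<le> 17 * gap x" if "x \<notin> candidates s'"
  proof (cases "x \<in> candidates s")
    case True
    then show ?thesis using i(3) elim[OF True that] by simp
  qed (rule i(4))
qed

lemma gaps_inv_after_group_phase:
  assumes wf: "wf_state s" and b: "best_group s = 0" and l: "1 \<le> l" and acc: "accurate_phase p l s"
    and inv: "\<And>g. g \<in> {-1, 1} \<Longrightarrow> g \<noteq> - best_group s \<Longrightarrow> group_inv r g s"
    and gap: "\<And>g x. g \<in> {-1, 1} \<Longrightarrow> g \<noteq> - best_group s \<Longrightarrow> x \<in> active s g \<Longrightarrow> gap x \<le> 26 * A.eps l"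
    and len: "length (hist (group_phase p l s)) < T" and gi: "gaps_inv (A.eps l) s"
  shows "gaps_inv (A.eps l) (group_phase p l s)"
proof (rule gaps_inv_fewer_candidates[OF gi])
  show "gaps (group_phase p l s) = gaps s" by (rule group_phase_fields)
  show "candidates (group_phase p l s) \<subseteq> candidates s"
    unfolding candidates_def using group_phase_fields(3)[of p l s] by blast
  fix x assume x: "x \<in> candidates s" "x \<notin> candidates (group_phase p l s)"
  then obtain g where g: "g \<in> {-1, 1}" "x \<in> active s g" "x \<notin> active (group_phase p l s) g"
    by (auto simp: candidates_def)
  have "g \<noteq> - best_group s" using g(1) b by auto
  then have "\<forall>x. x \<in> active s g \<longrightarrow> x \<notin> active (group_phase p l s) g \<longrightarrow> A.eps l \<le> gap x"
    by (intro conjunct1[OF conjunct2[OF group_phase_analysis(3)[OF wf l acc _ _ len g(1)]]])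
      (assumption | rule inv gap; assumption)+
  then show "A.eps l \<le> gap x" using g(2,3) by simp
qed

lemma start_regret:
  assumes "phase_inv l s \<beta>"
  shows "history_regret (hist s) \<le> 208 * support_bound + 1040 * sqrt_term
    + 8 * (real (d + 1) * ln (real T)) + 1320 * main_term"
proof -
  have l: "1 \<le> l" and e: "1 \<le> (A.eps l)\<^sup>2 * real T"
    and r: "history_regret (hist s) \<le> 52 * support_bound * (4 - 2 * A.eps l)
       + 520 * (real (d + 1) * log_kT * (1 / A.eps l - 1 / 2))
       + 2 * real (d + 1) * (real l - 1) + 10 * ln (real T) * \<beta>"
    and q: "real (d + 1) * log_kT * (1 / A.eps l - 1 / 2) \<le> 2 * sqrt_term" and b: "\<beta> \<le> 2 * bias_budget"
    using assms by (simp_all add: phase_inv_def)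
  have "52 * support_bound * (4 - 2 * A.eps l) \<le> 52 * support_bound * 4"
    using support_bound_nonneg eps_pos[of l] by (intro mult_left_mono) auto
  moreover have "2 * real (d + 1) * (real l - 1) \<le> 2 * real (d + 1) * (4 * ln (real T))"
    using started_phase_logs(3)[OF l e] by (intro mult_left_mono) auto
  moreover have "10 * ln (real T) * \<beta> \<le> 10 * ln (real T) * (2 * bias_budget)"
    using b ln_T_ge by (intro mult_left_mono) auto
  moreover have "10 * ln (real T) * (2 * bias_budget) \<le> 1320 * main_term"
    using bias_budget_main by simp
  ultimately show ?thesis using r q by linarith
qed

lemma bias_stage_cost:
  assumes l: "1 \<le> l" and e: "1 \<le> (A.eps l)\<^sup>2 * real T"
  shows "2 * bias_log l * potential (A.eps l) / (A.eps l)\<^sup>2 \<le> 10 * ln (real T) * (potential (A.eps l) / (A.eps l)\<^sup>2)"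
proof -
  have "0 \<le> potential (A.eps l) / (A.eps l)\<^sup>2" using potential_nonneg[of "A.eps l"] eps_pos[of l] by simp
  then have "(2 * bias_log l) * (potential (A.eps l) / (A.eps l)\<^sup>2) \<le> (10 * ln (real T)) * (potential (A.eps l) / (A.eps l)\<^sup>2)"
    using started_phase_logs(1)[OF l e] by (intro mult_right_mono) auto
  then show ?thesis by simp
qed

lemma bias_step_regret_complete:
  assumes wf: "wf_state s" and l: "1 \<le> l" and inv: "gaps_inv (A.eps l) s" and c: "bias_completes l s"
  shows "history_regret (hist (A.bias_step p l s)) \<le>
    history_regret (hist s) + (2 * real (d + 1) + 2 * bias_log l * potential (A.eps l) / (A.eps l)\<^sup>2)"
proof -
  note sch = schedule_props[of "bias_counts l s", OF bias_counts_outside[OF wf]]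
  have "history_regret (hist (A.bias_step p l s)) =
      history_regret (hist s) + (\<Sum>x\<in>X. real (bias_counts l s x) * gap x)"
    unfolding bias_step_complete[OF c]
    using history_regret_sample[of "bias_schedule l s" "bias_counts l s"] sch(1,2)
    by (simp add: bias_schedule_def)
  then show ?thesis using bias_counts_regret(1)[OF wf l inv] by simp
qed

text \<open>
  All three outcomes of a bias stage cost at most order \<open>d\<close> plus the main term: it completes, it is cut
  off by the horizon, or recovery starts.
\<close>

lemma bias_step_regret:
  assumes wf: "wf_state s" and l: "1 \<le> l" and e: "1 \<le> (A.eps l)\<^sup>2 * real T"
    and inv: "gaps_inv (A.eps l) s" and gap: "\<And>x. x \<in> candidates s \<Longrightarrow> gap x \<le> 26 * A.eps l"
  shows "history_regret (hist (A.bias_step p l s)) \<le>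
    history_regret (hist s) + (52 * real (d + 1) + 17160 * main_term)"
proof -
  let ?e = "A.eps l" and ?F = "kappa (gaps s)"
  have e0: "0 < ?e" "?e \<le> 2" using eps_pos eps_le_2[OF l] by auto
  define W where "W = 2 * bias_log l * potential ?e / ?e\<^sup>2"
  have W: "W \<le> 660 * main_term" if "(?F * ln (real T) / real T) powr (1/3) < ?e"
  proof -
    have "W \<le> 10 * ln (real T) * (potential ?e / ?e\<^sup>2)" unfolding W_def by (rule bias_stage_cost[OF l e])
    also have "\<dots> \<le> 10 * ln (real T) * bias_budget"
      using potential_le_bias_budget[OF l inv that] ln_T_ge by (intro mult_left_mono) auto
    also have "\<dots> \<le> 660 * main_term" using bias_budget_main by simp
    finally show ?thesis .
  qed
  show ?thesis
  proof (cases "bias_completes l s")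
    case True
    have "W \<le> 660 * main_term" using W True by (simp add: bias_completes_def)
    then show ?thesis
      using bias_step_regret_complete[OF wf l inv True, of p] main_term_nonneg unfolding W_def by simp
  next
    case False
    let ?b = "best_action R (hist s) (candidates s)"
    have b: "?b \<in> candidates s" by (rule best_action[OF candidates_props(1,2)[OF wf]])
    have r: "history_regret (hist (A.bias_step p l s)) = history_regret (hist s) + real (T - length (hist s)) * gap ?b"
      by (simp add: bias_step_incomplete[OF False] history_regret_spend_all)
    have gb: "real (T - length (hist s)) * gap ?b \<le> real (T - length (hist s)) * (26 * ?e)"
      by (intro mult_left_mono gap[OF b]) simp
    have "real (T - length (hist s)) * (26 * ?e) \<le> 52 * real (d + 1) + 17160 * main_term"
    proof (cases "(?F * ln (real T) / real T) powr (1/3) < ?e")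
      case True
      have "T - length (hist s) \<le> sum (bias_counts l s) X"
        using False True by (simp add: bias_completes_def)
      then have "real (T - length (hist s)) \<le> real (sum (bias_counts l s) X)" by (rule of_nat_mono)
      then have "real (T - length (hist s)) * (26 * ?e) \<le> real (sum (bias_counts l s) X) * (26 * ?e)"
        using e0 by (intro mult_right_mono) auto
      also have "\<dots> = 26 * (?e * real (sum (bias_counts l s) X))" by simp
      also have "\<dots> \<le> 26 * (2 * real (d + 1) + W)"
        unfolding W_def by (intro mult_left_mono bias_counts_regret(2)[OF wf l inv]) simp
      finally show ?thesis using W[OF True] by simp
    next
      case F: False
      have "real (T - length (hist s)) * (26 * ?e) \<le> real T * (26 * ?e)"
        using e0 by (intro mult_right_mono) auto
      also have "\<dots> \<le> 26 * (real T * (?F * ln (real T) / real T) powr (1/3))"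
      proof -
        have "real T * (26 * ?e) \<le> real T * (26 * (?F * ln (real T) / real T) powr (1/3))"
          using F by (intro mult_left_mono) auto
        then show ?thesis by simp
      qed
      also have "\<dots> \<le> 26 * (66 * main_term)"
        using recovery_main[OF e0 _ gaps_kappa(1)[OF inv e0(1)]] gaps_kappa(2)[OF inv e0(1)] potential_nonneg[of ?e] e0
        by (intro mult_left_mono) auto
      finally show ?thesis using main_term_nonneg by (simp add: add_increasing)
    qed
    then show ?thesis using r gb by simp
  qed
qed

text \<open>
  The bound for the phase in which the horizon is reached.
\<close>

lemma phase_regret:
  assumes inv: "phase_inv l s \<beta>" and acc: "accurate_phase p l s"
  shows "history_regret (hist (A.phase p l s)) \<le> final_bound"
proof -
  have wf: "wf_state s" and l: "1 \<le> l" and e: "1 \<le> (A.eps l)\<^sup>2 * real T"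
    and gi: "\<And>g. g \<in> {-1, 1} \<Longrightarrow> g \<noteq> - best_group s \<Longrightarrow> group_inv (10 * A.eps l) g s"
    using inv by (auto simp: phase_inv_def)
  note gap = phase_inv_gap[OF inv]
  let ?s = "group_phase p l s"
  have start: "history_regret (hist s) \<le> 208 * support_bound + 1040 * sqrt_term
    + 8 * (real (d + 1) * ln (real T)) + 1320 * main_term" by (rule start_regret[OF inv])
  have grp: "history_regret (hist ?s) \<le> history_regret (hist s) + (104 * support_bound + 208 * sqrt_term)"
  proof -
    have "history_regret (hist ?s) \<le> history_regret (hist s) + 2 * group_cost l"
      by (rule group_phase_analysis(1)[OF wf l acc]) (rule gi gap; assumption)+
    then show ?thesis using group_cost_bound[OF l e] by linarith
  qed
  have N: "52 * real (d + 1) \<le> 78 * (real (d + 1) * ln (real T))"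
    using mult_left_mono[OF ln_T_ge, of "78 * real (d + 1)"] by (simp add: algebra_simps)
  have final: "history_regret (hist s) + (104 * support_bound + 208 * sqrt_term) +
      (52 * real (d + 1) + 17160 * main_term) \<le> final_bound"
    unfolding final_bound_def
    using start N support_bound_nonneg sqrt_term_nonneg main_term_nonneg
      mult_nonneg_nonneg[of "real (d + 1)" "ln (real T)"] ln_T_ge by linarith
  have pos: "0 \<le> 52 * real (d + 1) + 17160 * main_term" using main_term_nonneg by simp
  have pos2: "0 \<le> 104 * support_bound + 208 * sqrt_term" using support_bound_nonneg sqrt_term_nonneg by simp
  consider "T \<le> length (hist s)" | "length (hist s) < T" "best_group s \<noteq> 0 \<or> T \<le> length (hist ?s)"
    | "length (hist s) < T" "best_group s = 0" "length (hist ?s) < T" by linarith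
  then show ?thesis
  proof cases
    case 1
    then have "A.phase p l s = s" by (simp add: phase_eq[OF wf])
    then show ?thesis using final pos pos2 by simp
  next
    case 2
    then have "A.phase p l s = ?s" by (simp add: phase_eq[OF wf])
    then show ?thesis using final pos grp by simp
  next
    case 3
    then have ph: "A.phase p l s = A.bias_step p l ?s" by (simp add: phase_eq[OF wf])
    have gaps: "gaps_inv (A.eps l) ?s"
      proof (rule gaps_inv_after_group_phase[OF wf 3(2) l acc _ _ 3(3)])
      show "gaps_inv (A.eps l) s" using inv 3(2) by (simp add: phase_inv_def)
    qed (rule gi gap; assumption)+
    have gap': "gap x \<le> 26 * A.eps l" if "x \<in> candidates ?s" for x
    proof -
      have "x \<in> active s 1 \<or> x \<in> active s (-1)"
        using that group_phase_fields(3)[of p l s 1] group_phase_fields(3)[of p l s "-1"]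
        by (auto simp: candidates_def)
      then show ?thesis using gap[of 1 x] gap[of "-1" x] 3(2) by auto
    qed
    have "history_regret (hist (A.phase p l s)) \<le> history_regret (hist ?s) + (52 * real (d + 1) + 17160 * main_term)"
      unfolding ph by (rule bias_step_regret[OF wf_group_phase[OF wf] l e gaps gap'])
    then show ?thesis using final grp by linarith
  qed
qed

text \<open>
  A completed group stage has played \<open>group_budget l \<le> T\<close> rounds. This keeps \<open>eps\<close> above
  order \<open>1 / sqrt T\<close>, and it bounds the accumulated cost of the group stages, which is of the order of the
  last summand, by \<open>sqrt_term\<close>.
\<close>

lemma next_phase_scale:
  assumes l: "1 \<le> l" and b: "group_budget l \<le> real T"
  shows "1 \<le> (A.eps (Suc l))\<^sup>2 * real T"
    "real (d + 1) * log_kT * (1 / A.eps (Suc l) - 1 / 2) \<le> 2 * sqrt_term"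
proof -
  let ?e = "A.eps l"
  have e: "0 < ?e" by (rule eps_pos)
  have e': "A.eps (Suc l) = ?e / 2" using eps_Suc[of l] by simp
  have gl: "1 \<le> group_log l" by (rule group_log_ge_1[OF l])
  have b': "2 * real (d + 1) * group_log l \<le> ?e\<^sup>2 * real T"
    using b e by (simp add: group_budget_def field_simps)
  have "2 * 2 * 1 \<le> 2 * real (d + 1) * group_log l"
    using dim_pos gl by (intro mult_mono) auto
  then have "4 \<le> ?e\<^sup>2 * real T" using b' by simp
  then show "1 \<le> (A.eps (Suc l))\<^sup>2 * real T" by (simp add: e' power_divide)
  have "log_kT \<le> group_log l"
  proof -
    have k: "0 < real (card X) * real T" using card_X_ge_2 T_ge_2 by simp
    have "1 * 1 \<le> real l * real (l + 1)" using l by (intro mult_mono) auto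
    then have "real (card X) * real T * 1 \<le> real (card X) * real T * (real l * real (l + 1))"
      using k by (intro mult_left_mono) auto
    then show ?thesis unfolding log_kT_def group_log_def
      using k log_argument_ge(2)[OF l] by (subst ln_le_cancel_iff) (auto simp: mult_ac)
  qed
  then have "real (d + 1) * log_kT \<le> 2 * real (d + 1) * group_log l"
    using gl log_kT_ge by (intro mult_mono) auto
  then have q: "real (d + 1) * log_kT \<le> ?e\<^sup>2 * real T" using b' by linarith
  have "real (d + 1) * log_kT / ?e \<le> sqrt_term"
    unfolding sqrt_term_def
  proof (rule real_le_rsqrt)
    have "(real (d + 1) * log_kT / ?e)\<^sup>2 = (real (d + 1) * log_kT) * (real (d + 1) * log_kT) / ?e\<^sup>2"
      by (simp add: power2_eq_square)
    also have "\<dots> \<le> (real (d + 1) * log_kT) * (?e\<^sup>2 * real T) / ?e\<^sup>2"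
      using q log_kT_ge by (intro divide_right_mono mult_left_mono) auto
    also have "\<dots> = real (d + 1) * log_kT * real T" using e by simp
    finally show "(real (d + 1) * log_kT / ?e)\<^sup>2 \<le> real (d + 1) * log_kT * real T" .
  qed
  moreover have "real (d + 1) * log_kT * (1 / A.eps (Suc l) - 1 / 2) \<le> 2 * (real (d + 1) * log_kT / ?e)"
  proof -
    have "real (d + 1) * log_kT * (1 / A.eps (Suc l) - 1 / 2) \<le> real (d + 1) * log_kT * (2 / ?e)"
      unfolding e' using log_kT_ge by (intro mult_left_mono) auto
    also have "a * (2 / b) = 2 * (a / b)" for a b :: real by simp
    finally show ?thesis .
  qed
  ultimately show "real (d + 1) * log_kT * (1 / A.eps (Suc l) - 1 / 2) \<le> 2 * sqrt_term" by linarith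
qed

lemma group_cost_increment:
  assumes l: "1 \<le> l" and e: "1 \<le> (A.eps l)\<^sup>2 * real T"
  shows "52 * support_bound * (4 - 2 * A.eps l) + 520 * (real (d + 1) * log_kT * (1 / A.eps l - 1 / 2)) + 2 * group_cost l
    \<le> 52 * support_bound * (4 - 2 * A.eps (Suc l)) + 520 * (real (d + 1) * log_kT * (1 / A.eps (Suc l) - 1 / 2))"
proof -
  let ?e = "A.eps l"
  have e0: "0 < ?e" by (rule eps_pos)
  have e': "A.eps (Suc l) = ?e / 2" using eps_Suc[of l] by simp
  have "?e * min (group_budget l) (real T) \<le> ?e * group_budget l" using e0 by (intro mult_left_mono) auto
  also have "\<dots> = 2 * real (d + 1) * group_log l / ?e"
    unfolding group_budget_def using e0 by (simp add: power2_eq_square field_simps)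
  also have "\<dots> \<le> 2 * real (d + 1) * (5 * log_kT) / ?e"
    using e0 by (intro divide_right_mono mult_left_mono started_phase_logs(2)[OF l e]) auto
  also have "\<dots> = 10 * (real (d + 1) * log_kT * (1 / ?e))" by simp
  finally have "52 * (?e * min (group_budget l) (real T)) \<le> 520 * (real (d + 1) * log_kT * (1 / ?e))" by linarith
  moreover have "2 * group_cost l = 52 * support_bound * ?e + 52 * (?e * min (group_budget l) (real T))"
    by (simp add: group_cost_def algebra_simps)
  moreover have "1 / A.eps (Suc l) = 1 / ?e + 1 / ?e" using e0 by (simp add: e')
  moreover have "real (d + 1) * log_kT * (1 / ?e + 1 / ?e - 1 / 2) =
      real (d + 1) * log_kT * (1 / ?e - 1 / 2) + real (d + 1) * log_kT * (1 / ?e)"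
  proof -
    have "a * (b + b - c) = a * (b - c) + a * b" for a b c :: real by (simp add: algebra_simps)
    then show ?thesis .
  qed
  moreover have "52 * support_bound * (4 - 2 * A.eps (Suc l)) = 52 * support_bound * (4 - 2 * ?e) + 52 * support_bound * ?e"
    by (simp add: e' algebra_simps)
  ultimately show ?thesis by simp
qed

text \<open>
  With estimates correct up to \<open>2 * e\<close>, the new estimated gaps are upper bounds for the true ones
  and too large by at most \<open>8 * e\<close>, that is \<open>16\<close> times the accuracy \<open>e / 2\<close> of the next phase.
\<close>

lemma new_gaps:
  assumes S: "finite S" "S \<subseteq> X" and m: "\<And>x. x \<in> S \<Longrightarrow> \<bar>m x - val x\<bar> \<le> 2 * e"
    and best: "\<And>g. g \<in> {-1, 1} \<Longrightarrow> \<exists>b\<in>S. val b = best_val g" and e: "0 < e" "e \<le> 2" and x: "x \<in> S"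
  shows "gap x \<le> min 2 ((MAX y\<in>S. m y) - m x + 4 * e)"
    "min 2 ((MAX y\<in>S. m y) - m x + 4 * e) \<le> gap x + 8 * e"
    "e / 2 \<le> min 2 ((MAX y\<in>S. m y) - m x + 4 * e)"
proof -
  let ?M = "max (best_val 1) (best_val (-1))"
  have low: "?M - 2 * e \<le> (MAX y\<in>S. m y)"
  proof -
    have "\<exists>b\<in>S. val b = ?M"
    proof (cases "best_val 1 \<le> best_val (-1)")
      case True
      then show ?thesis using best[of "-1"] by simp
    next
      case False
      then show ?thesis using best[of 1] by simp
    qed
    then obtain b where b: "b \<in> S" "val b = ?M" by blast
    have "m b \<le> (MAX y\<in>S. m y)" using S b by (intro Max_ge) auto
    then show ?thesis using m[OF b(1)] b(2) by (simp add: abs_le_iff)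
  qed
  have high: "(MAX y\<in>S. m y) \<le> ?M + 2 * e"
  proof (subst Max_le_iff)
    show "\<forall>a\<in>m ` S. a \<le> ?M + 2 * e"
    proof clarify
      fix y assume y: "y \<in> S"
      have "val y \<le> ?M" using gap_nonneg[of y] y S by (auto simp: gap_eq)
      then show "m y \<le> ?M + 2 * e" using m[OF y] by (simp add: abs_le_iff)
    qed
  qed (use S x in auto)
  have mx: "m x \<le> (MAX y\<in>S. m y)" using S x by (intro Max_ge) auto
  have xX: "x \<in> X" using x S by auto
  show "gap x \<le> min 2 ((MAX y\<in>S. m y) - m x + 4 * e)"
    using low m[OF x] gap_le_2[OF xX] by (simp add: gap_eq abs_le_iff)
  show "min 2 ((MAX y\<in>S. m y) - m x + 4 * e) \<le> gap x + 8 * e"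
    using high m[OF x] by (simp add: gap_eq abs_le_iff min_le_iff_disj)
  show "e / 2 \<le> min 2 ((MAX y\<in>S. m y) - m x + 4 * e)" using mx e by simp
qed

lemma group_max_estimate:
  assumes S: "finite S" "\<And>x. x \<in> S \<Longrightarrow> x \<in> X \<and> z x = g" and m: "\<And>x. x \<in> S \<Longrightarrow> \<bar>m x - val x\<bar> \<le> 2 * e"
    and best: "\<exists>b\<in>S. val b = best_val g"
  shows "\<bar>(MAX x\<in>S. m x) - best_val g\<bar> \<le> 2 * e"
proof -
  obtain b where b: "b \<in> S" "val b = best_val g" using best by auto
  have "m b \<le> (MAX y\<in>S. m y)" using S b by (intro Max_ge) auto
  then have low: "best_val g - 2 * e \<le> (MAX y\<in>S. m y)" using m[OF b(1)] b(2) by (simp add: abs_le_iff)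
  have "(MAX y\<in>S. m y) \<le> best_val g + 2 * e"
  proof (subst Max_le_iff)
    show "\<forall>a\<in>m ` S. a \<le> best_val g + 2 * e"
    proof clarify
      fix y assume y: "y \<in> S"
      have "val y \<le> best_val g" using val_le_best_val[of y g] S(2)[OF y] by simp
      then show "m y \<le> best_val g + 2 * e" using m[OF y] by (simp add: abs_le_iff)
    qed
  qed (use S b in auto)
  then show ?thesis using low by (simp add: abs_le_iff)
qed

text \<open>
  A phase that does not reach the horizon has completed all of its stages. The mean estimates have error
  \<open>2 * eps l\<close>, one half from the group estimate and one half from the bias. If neither group leads by
  \<open>4 * eps l\<close>, the best values differ by at most \<open>8 * eps l\<close>; if one does, it is the better one.
\<close>

lemma phase_inv_next:
  assumes inv: "phase_inv l s \<beta>" and len: "length (hist (A.phase p l s)) < T" and acc: "accurate_phase p l s"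
    and len0: "length (hist s) < T"
  shows "\<exists>\<beta>'. phase_inv (Suc l) (A.phase p l s) \<beta>'"
proof -
  let ?e = "A.eps l" and ?s = "group_phase p l s"
  have wf: "wf_state s" and l: "1 \<le> l" and e: "1 \<le> ?e\<^sup>2 * real T"
    and gi: "\<And>g. g \<in> {-1, 1} \<Longrightarrow> g \<noteq> - best_group s \<Longrightarrow> group_inv (10 * ?e) g s"
    and \<beta>: "0 \<le> \<beta>" "\<beta> \<le> 2 * bias_budget"
    and reg: "history_regret (hist s) \<le> 52 * support_bound * (4 - 2 * ?e)
       + 520 * (real (d + 1) * log_kT * (1 / ?e - 1 / 2))
       + 2 * real (d + 1) * (real l - 1) + 10 * ln (real T) * \<beta>"
    using inv by (auto simp: phase_inv_def)
  have e0: "0 < ?e" "?e \<le> 2" using eps_pos eps_le_2[OF l] by auto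
  have e': "A.eps (Suc l) = ?e / 2" using eps_Suc[of l] by simp
  note gap = phase_inv_gap[OF inv]
  have wfs: "wf_state ?s" by (rule wf_group_phase[OF wf])
  have lens: "length (hist ?s) < T"
  proof (rule ccontr)
    assume "\<not> length (hist ?s) < T"
    then have "A.phase p l s = ?s" using len0 by (simp add: phase_eq[OF wf])
    then show False using len \<open>\<not> length (hist ?s) < T\<close> by simp
  qed
  have ana1: "history_regret (hist ?s) \<le> history_regret (hist s) + 2 * group_cost l"
    by (rule group_phase_analysis(1)[OF wf l acc]) (rule gi gap; assumption)+
  have budget: "group_budget l \<le> real T"
    by (rule group_phase_analysis(2)[OF wf l acc _ _ lens]) (rule gi gap; assumption)+
  have ana3: "group_inv (5 * ?e) g ?s \<and>
      (\<forall>x. x \<in> active s g \<longrightarrow> x \<notin> active ?s g \<longrightarrow> ?e \<le> gap x) \<and>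
      (\<forall>x\<in>active ?s g. \<bar>avec x \<bullet> theta ?s g - avec x \<bullet> theta_star\<bar> \<le> ?e)"
    if "g \<in> {-1, 1}" "g \<noteq> - best_group s" for g
    by (rule group_phase_analysis(3)[OF wf l acc _ _ lens that]) (rule gi gap; assumption)+
  note scale = next_phase_scale[OF l budget]
  have r1: "history_regret (hist ?s) \<le> 52 * support_bound * (4 - 2 * A.eps (Suc l))
       + 520 * (real (d + 1) * log_kT * (1 / A.eps (Suc l) - 1 / 2))
       + 2 * real (d + 1) * (real l - 1) + 10 * ln (real T) * \<beta>"
    using ana1 reg group_cost_increment[OF l e] by linarith
  have gi': "group_inv (10 * A.eps (Suc l)) g ?s" if "g \<in> {-1, 1}" "g \<noteq> - best_group s" for g
    using ana3[OF that] by (simp add: e')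
  show ?thesis
  proof (cases "best_group s = 0")
    case False
    have ph: "A.phase p l s = ?s" using False len0 by (simp add: phase_eq[OF wf])
    have "2 * real (d + 1) * (real l - 1) \<le> 2 * real (d + 1) * (real (Suc l) - 1)" by (intro mult_left_mono) auto
    then have r2: "history_regret (hist ?s) \<le> 52 * support_bound * (4 - 2 * A.eps (Suc l))
       + 520 * (real (d + 1) * log_kT * (1 / A.eps (Suc l) - 1 / 2))
       + 2 * real (d + 1) * (real (Suc l) - 1) + 10 * ln (real T) * \<beta>"
      using r1 by linarith
    have "best_val (- best_group s) \<le> best_val (best_group s)" using inv False by (simp add: phase_inv_def)
    then have "phase_inv (Suc l) ?s \<beta>"
      unfolding phase_inv_def group_phase_fields(1)
      using wfs scale gi' False \<beta> r2 by (intro conjI ballI impI) simp_all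
    then show ?thesis unfolding ph by blast
  next
    case True
    have ph: "A.phase p l s = A.bias_step p l ?s" using True len0 lens by (simp add: phase_eq[OF wf])
    have c: "bias_completes l ?s"
    proof (rule ccontr)
      assume "\<not> bias_completes l ?s"
      then have "length (hist (A.bias_step p l ?s)) = T"
        using wf_stateD(1)[OF wfs] by (simp add: bias_step_incomplete length_spend_all)
      then show False using len ph by simp
    qed
    have gaps: "gaps_inv ?e ?s"
    proof (rule gaps_inv_after_group_phase[OF wf True l acc _ _ lens])
      show "gaps_inv (A.eps l) s" using inv True by (simp add: phase_inv_def)
    qed (rule gi gap; assumption)+
    let ?m = "mean_estimate p l ?s" and ?S = "candidates ?s"
    have gb: "g \<noteq> - best_group s" if "g \<in> {-1, 1}" for g using that True by auto
    have mean: "\<bar>?m x - val x\<bar> \<le> 2 * ?e" if x: "x \<in> ?S" for x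
    proof -
      have xX: "x \<in> X" using x candidates_props(2)[OF wfs] by blast
      have zx: "z x \<in> {-1, 1}" by (rule groups[OF xX])
      have "x \<in> active ?s (z x)"
        using x wf_stateD(4)[OF wfs, of 1] wf_stateD(4)[OF wfs, of "-1"] by (auto simp: candidates_def)
      then have 1: "\<bar>avec x \<bullet> theta ?s (z x) - (val x + real_of_int (z x) * \<omega>)\<bar> \<le> ?e"
        using ana3[OF zx gb[OF zx]] avec_prod[OF xX] by auto
      have 2: "\<bar>bias_estimate p l ?s - \<omega>\<bar> \<le> ?e" using acc True lens c by (simp add: accurate_phase_def)
      have "z x = 1 \<or> z x = -1" using zx by auto
      then show ?thesis unfolding mean_estimate_def using 1 2 by (elim disjE) (auto simp: abs_le_iff)
    qed
    have best: "\<exists>b\<in>?S. val b = best_val g" if g: "g \<in> {-1, 1}" for g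
    proof -
      have "\<exists>x\<in>active ?s g. val x = best_val g" using ana3[OF g gb[OF g]] by (simp add: group_inv_def)
      then show ?thesis using g by (auto simp: candidates_def)
    qed
    have maxest: "\<bar>(MAX x\<in>active ?s g. ?m x) - best_val g\<bar> \<le> 2 * ?e" if g: "g \<in> {-1, 1}" for g
    proof (rule group_max_estimate)
      show "finite (active ?s g)" by (rule wf_stateD(6)[OF wfs g])
      show "x \<in> X \<and> z x = g" if "x \<in> active ?s g" for x using wf_stateD(4)[OF wfs g] that by auto
      show "\<bar>?m x - val x\<bar> \<le> 2 * ?e" if "x \<in> active ?s g" for x
        by (rule mean) (use that g in \<open>auto simp: candidates_def\<close>)
      show "\<exists>x\<in>active ?s g. val x = best_val g" using ana3[OF g gb[OF g]] by (simp add: group_inv_def)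
    qed
    let ?t = "A.bias_step p l ?s"
    have t_best: "best_group ?t = (if leads l ?s ?m 1 then 1 else if leads l ?s ?m (-1) then -1 else 0)"
      and t_act: "active ?t = active ?s"
      and t_gaps: "gaps ?t = (\<lambda>x\<in>X. if x \<in> ?S then min 2 ((MAX x'\<in>?S. ?m x') - ?m x + 4 * ?e) else gaps ?s x)"
      by (simp_all add: bias_step_complete[OF c])
    have t_cand: "candidates ?t = ?S" by (simp add: candidates_def t_act)
    have gaps': "gaps_inv (?e / 2) ?t"
      unfolding gaps_inv_def t_cand
    proof (intro ballI)
      fix x assume x: "x \<in> X"
      show "gap x \<le> gaps ?t x \<and> ?e / 2 \<le> gaps ?t x \<and> (x \<in> ?S \<longrightarrow> gaps ?t x \<le> gap x + 16 * (?e / 2)) \<and>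
        (x \<notin> ?S \<longrightarrow> gaps ?t x \<le> 17 * gap x)"
      proof (cases "x \<in> ?S")
        case S: True
        then have "gaps ?t x = min 2 ((MAX x'\<in>?S. ?m x') - ?m x + 4 * ?e)" using x by (simp add: t_gaps)
        then show ?thesis
          using new_gaps[OF candidates_props(3,2)[OF wfs] mean best e0 S] S by simp
      next
        case S: False
        then have "gaps ?t x = gaps ?s x" using x by (simp add: t_gaps)
        moreover have "gap x \<le> gaps ?s x" "?e \<le> gaps ?s x" "gaps ?s x \<le> 17 * gap x"
          using gaps x S by (auto simp: gaps_inv_def)
        ultimately show ?thesis using S e0 by auto
      qed
    qed
    have lead: "leads l ?s ?m g \<longleftrightarrow> (MAX x\<in>active ?s (- g). ?m x) + 4 * ?e \<le> (MAX x\<in>active ?s g. ?m x)" for g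
      by (auto simp: leads_def)
    have m1: "\<bar>(MAX x\<in>active ?s 1. ?m x) - best_val 1\<bar> \<le> 2 * ?e"
      and m2: "\<bar>(MAX x\<in>active ?s (-1). ?m x) - best_val (-1)\<bar> \<le> 2 * ?e" using maxest by simp_all
    have lead0: "\<bar>best_val 1 - best_val (-1)\<bar> \<le> 16 * (?e / 2)" if "best_group ?t = 0"
    proof -
      have "\<not> leads l ?s ?m 1" "\<not> leads l ?s ?m (-1)" using that unfolding t_best by (auto split: if_splits)
      then show ?thesis using m1 m2 unfolding lead by (auto simp: abs_le_iff)
    qed
    have lead1: "best_val (- best_group ?t) \<le> best_val (best_group ?t)" if "best_group ?t \<noteq> 0"
    proof (cases "leads l ?s ?m 1")
      case L: True
      then have "best_group ?t = 1" by (simp add: t_best)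
      then show ?thesis using L m1 m2 unfolding lead by (auto simp: abs_le_iff)
    next
      case L: False
      then have "leads l ?s ?m (-1)" "best_group ?t = -1" using that unfolding t_best by (auto split: if_splits)
      then show ?thesis using m1 m2 unfolding lead by (auto simp: abs_le_iff)
    qed
    \<comment> \<open>The new summand is at least as large as the sum of all earlier ones, and so is the next one.\<close>
    define \<beta>' where "\<beta>' = \<beta> + potential ?e / ?e\<^sup>2"
    have Kpos: "0 \<le> potential ?e / ?e\<^sup>2" using potential_nonneg[of ?e] e0 by simp
    have \<beta>potential: "\<beta> \<le> potential ?e / ?e\<^sup>2" using inv True by (simp add: phase_inv_def)
    have Kb: "potential ?e / ?e\<^sup>2 \<le> bias_budget"
      by (rule potential_le_bias_budget[OF l gaps]) (use c in \<open>simp add: bias_completes_def\<close>)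
    have K2: "\<beta>' \<le> potential (?e / 2) / (?e / 2)\<^sup>2"
    proof -
      have "potential ?e \<le> 2 * potential (?e / 2)" using potential_double[of "?e / 2"] e0 by simp
      then have "2 * potential ?e / ?e\<^sup>2 \<le> 4 * potential (?e / 2) / ?e\<^sup>2" by (intro divide_right_mono) auto
      then have "2 * (potential ?e / ?e\<^sup>2) \<le> potential (?e / 2) / (?e / 2)\<^sup>2" by (simp add: power_divide mult.commute)
      then show ?thesis using \<beta>potential unfolding \<beta>'_def by linarith
    qed
    have reg': "history_regret (hist ?t) \<le> 52 * support_bound * (4 - 2 * A.eps (Suc l))
       + 520 * (real (d + 1) * log_kT * (1 / A.eps (Suc l) - 1 / 2))
       + 2 * real (d + 1) * (real (Suc l) - 1) + 10 * ln (real T) * \<beta>'"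
    proof -
      have "history_regret (hist ?t) \<le> history_regret (hist ?s) + (2 * real (d + 1) + 10 * ln (real T) * (potential ?e / ?e\<^sup>2))"
        using bias_step_regret_complete[OF wfs l gaps c, of p] bias_stage_cost[OF l e] by linarith
      moreover have "10 * ln (real T) * \<beta>' = 10 * ln (real T) * \<beta> + 10 * ln (real T) * (potential ?e / ?e\<^sup>2)"
        by (simp add: \<beta>'_def distrib_left)
      moreover have "2 * real (d + 1) * (real (Suc l) - 1) = 2 * real (d + 1) * (real l - 1) + 2 * real (d + 1)"
        by (simp add: algebra_simps)
      ultimately show ?thesis using r1 by linarith
    qed
    have gi'': "group_inv (10 * A.eps (Suc l)) g ?t" if "g \<in> {-1, 1}" for g
      using gi'[OF that gb[OF that]] group_inv_cong[of ?t g ?s] by (simp add: t_act)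
    have "phase_inv (Suc l) ?t \<beta>'"
      unfolding phase_inv_def
    proof (intro conjI ballI impI)
      show "wf_state ?t" by (rule wf_bias_step[OF wfs])
      show "\<beta>' \<le> 2 * bias_budget" "0 \<le> \<beta>'" unfolding \<beta>'_def using \<beta>(1) \<beta>potential Kb Kpos by linarith+
      show "gaps_inv (A.eps (Suc l)) ?t" "\<beta>' \<le> potential (A.eps (Suc l)) / (A.eps (Suc l))\<^sup>2"
        unfolding e' by (rule gaps' K2)+
      show "\<bar>best_val 1 - best_val (-1)\<bar> \<le> 16 * A.eps (Suc l)" if "best_group ?t = 0"
        unfolding e' by (rule lead0[OF that])
    qed (use scale gi'' lead1 reg' in simp_all)
    then show ?thesis unfolding ph by blast
  qed
qed

lemma phase_inv_init: "phase_inv 1 A.init 0"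
proof -
  have T: "2 \<le> real T" using T_ge_2 by simp
  have cand: "candidates A.init = X" using groups by (auto simp: candidates_def A.init_def)
  have g: "group_inv (10 * A.eps 1) g A.init" if g: "g \<in> {-1, 1}" for g
  proof -
    obtain x where x: "x \<in> X" "z x = g" "val x = best_val g" using best_val_attained[OF g] .
    moreover have "best_val g - val y \<le> 20" if "y \<in> X" for y
      using best_val_le(1)[OF g] abs_val_le_1[OF that] by linarith
    ultimately show ?thesis unfolding group_inv_def eps_1 by (auto simp: A.init_def)
  qed
  have gaps: "gaps_inv 2 A.init"
    unfolding gaps_inv_def cand using gap_le_2 gap_nonneg by (auto simp: A.init_def)
  have diff: "\<bar>best_val 1 - best_val (-1)\<bar> \<le> 16 * 2"
    using best_val_le[of 1] best_val_le[of "-1"] by (simp add: abs_le_iff)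
  have b0: "best_group A.init = 0" "history_regret (hist A.init) = 0"
    by (simp_all add: A.init_def history_regret_def)
  have "0 \<le> potential 2" by (rule potential_nonneg) simp
  then show ?thesis
    unfolding phase_inv_def b0 using g gaps diff wf_init T sqrt_term_nonneg bias_budget_nonneg
    unfolding eps_1 by (auto simp: b0)
qed

subsection \<open>The whole run\<close>

lemma group_step_progress:
  assumes wf: "wf_state s" and g: "g \<in> {-1, 1}" and l: "1 \<le> l" and len: "length (hist s) < T"
  shows "length (hist s) < length (hist (A.group_step p l g s))"
proof (cases "group_completes l g s")
  case True
  have "0 < group_budget l" unfolding group_budget_def using group_log_ge_1[OF l] eps_pos[of l] by simp
  then have "0 < real (sum (group_counts l g s) (active s g))" using group_counts_total(1)[OF wf g l] by linarith
  then have "0 < sum (group_counts l g s) X"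
    unfolding group_counts_sum[OF wf g] by (simp only: of_nat_0_less_iff)
  moreover have "length (group_schedule l g s) = sum (group_counts l g s) X"
    unfolding group_schedule_def
    by (rule schedule_props(3)) (use group_counts_outside[OF wf g] wf_stateD(5)[OF wf g] in blast)
  ultimately show ?thesis by (simp add: group_step_complete[OF True])
next
  case False
  then show ?thesis using group_step_length[OF wf False] len by simp
qed

text \<open>
  Each phase plays a round because a group stage has a positive budget. Hence \<open>T\<close> phases exhaust the
  horizon.
\<close>

lemma phase_progress:
  assumes wf: "wf_state s" and l: "1 \<le> l" and len: "length (hist s) < T"
  shows "length (hist s) < length (hist (A.phase p l s))"
proof -
  have grp: "length (hist s) < length (hist (group_phase p l s))"
  proof (cases "best_group s = 0")
    case True
    let ?s = "A.group_step p l (first_group R (hist s)) s"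
    have "length (hist s) < length (hist ?s)" by (rule group_step_progress[OF wf first_group l len])
    also have "\<dots> \<le> length (hist (A.group_step p l (- first_group R (hist s)) ?s))"
      by (rule group_step_length_mono)
    finally show ?thesis using True by (simp add: group_phase_def Let_def)
  next
    case False
    then have "best_group s \<in> {-1, 1}" using wf_stateD(7)[OF wf] by auto
    then show ?thesis using False group_step_progress[OF wf _ l len] by (simp add: group_phase_def Let_def)
  qed
  then show ?thesis
    using len causal_stepD(1)[OF causal_bias_step, of "group_phase p l s" p l]
    by (auto simp: phase_eq[OF wf])
qed

lemma length_run: "min n T \<le> length (hist (A.run p n))"
proof (induction n)
  case (Suc n)
  show ?case
  proof (cases "length (hist (A.run p n)) < T")
    case True
    have "length (hist (A.run p n)) < length (hist (A.phase p (Suc n) (A.run p n)))"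
      by (rule phase_progress[OF wf_run _ True]) simp
    then show ?thesis using Suc by simp
  next
    case False
    then have "A.phase p (Suc n) (A.run p n) = A.run p n" by (simp add: phase_eq[OF wf_run])
    then show ?thesis using False by simp
  qed
qed simp

lemma length_final_run: "length (hist (A.run p T)) = T"
  using length_run[of T p] wf_stateD(1)[OF wf_run, of p T] by simp

text \<open>
  The invariant is kept until the horizon is reached, and the phase that reaches it costs at most
  \<open>final_bound\<close> in total; later phases do nothing.
\<close>

lemma accurate_run_regret:
  assumes acc: "\<And>l. 1 \<le> l \<Longrightarrow> l \<le> T \<Longrightarrow> length (hist (A.run p (l - 1))) < T \<Longrightarrow> accurate_phase p l (A.run p (l - 1))"
  shows "history_regret (hist (A.run p T)) \<le> final_bound"
proof -
  have acc': "accurate_phase p (Suc n) (A.run p n)" if "length (hist (A.run p n)) < T" for n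
  proof -
    have "n < T" using that length_run[of n p] by simp
    then show ?thesis using acc[of "Suc n"] that by simp
  qed
  have inv: "length (hist (A.run p n)) < T \<longrightarrow> (\<exists>\<beta>. phase_inv (Suc n) (A.run p n) \<beta>)" for n
  proof (induction n)
    case 0
    then show ?case using phase_inv_init by auto
  next
    case (Suc n)
    show ?case
    proof
      assume len: "length (hist (A.run p (Suc n))) < T"
      have len0: "length (hist (A.run p n)) < T"
      proof (rule ccontr)
        assume n: "\<not> length (hist (A.run p n)) < T"
        then have "A.phase p (Suc n) (A.run p n) = A.run p n" by (simp add: phase_eq[OF wf_run])
        then show False using n len by simp
      qed
      then obtain \<beta> where "phase_inv (Suc n) (A.run p n) \<beta>" using Suc by auto
      from phase_inv_next[OF this _ acc'[OF len0] len0] len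
      show "\<exists>\<beta>. phase_inv (Suc (Suc n)) (A.run p (Suc n)) \<beta>" by simp
    qed
  qed
  have "0 \<le> final_bound"
    unfolding final_bound_def using support_bound_nonneg sqrt_term_nonneg main_term_nonneg ln_T_ge by simp
  then have "history_regret (hist (A.run p n)) \<le> final_bound" for n
  proof (induction n)
    case 0
    then show ?case by (simp add: A.init_def history_regret_def)
  next
    case (Suc n)
    show ?case
    proof (cases "length (hist (A.run p n)) < T")
      case True
      then obtain \<beta> where "phase_inv (Suc n) (A.run p n) \<beta>" using inv by auto
      from phase_regret[OF this acc'[OF True]] show ?thesis by simp
    next
      case False
      then have "A.phase p (Suc n) (A.run p n) = A.run p n" by (simp add: phase_eq[OF wf_run])
      then show ?thesis using Suc by simp
    qed
  qed
  then show ?thesis .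
qed

end

section \<open>Deviations of predictable sums of Gaussian noise\<close>

abbreviation std_normal :: "real measure" where
  "std_normal \<equiv> density lborel (\<lambda>x. ennreal (std_normal_density x))"

lemma prob_space_std_normal: "prob_space std_normal"
  using prob_space_normal_density[of 1 0] by simp

lemma sets_noise: "sets (noise T) = sets (Pi\<^sub>M {..<T} (\<lambda>_. borel :: real measure))"
  unfolding noise_def by (rule sets_PiM_cong) auto

lemma space_noise: "space (noise T) = ({..<T} \<rightarrow>\<^sub>E UNIV)"
  by (simp add: noise_def space_PiM)

lemma prob_space_noise: "prob_space (noise T)"
  unfolding noise_def by (rule prob_space_PiM) (rule prob_space_std_normal)

lemma noise_component_measurable:
  "t < T \<Longrightarrow> (\<lambda>\<xi>. \<xi> t) \<in> borel_measurable (noise T)"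
proof -
  assume "t < T"
  then have "(\<lambda>\<xi>. \<xi> t) \<in> Pi\<^sub>M {..<T} (\<lambda>_. borel :: real measure) \<rightarrow>\<^sub>M borel"
    by (intro measurable_component_singleton) auto
  then show ?thesis using measurable_cong_sets[OF sets_noise refl] by blast
qed

text \<open>
  Completing the square: tilting the standard normal density by \<open>exp (c * y - c\<^sup>2 / 2)\<close> shifts its mean to \<open>c\<close>.
\<close>

lemma std_normal_exponential_martingale:
  "(\<integral>\<^sup>+y. ennreal (exp (c * y - c\<^sup>2 / 2)) \<partial>std_normal) = 1"
proof -
  have "(\<integral>\<^sup>+y. ennreal (exp (c * y - c\<^sup>2 / 2)) \<partial>std_normal)
      = (\<integral>\<^sup>+y. ennreal (std_normal_density y) * ennreal (exp (c * y - c\<^sup>2 / 2)) \<partial>lborel)"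
    by (rule nn_integral_density) auto
  also have "\<dots> = (\<integral>\<^sup>+y. ennreal (normal_density c 1 y) \<partial>lborel)"
  proof (rule nn_integral_cong)
    fix y :: real
    have "- y\<^sup>2 / 2 + (c * y - c\<^sup>2 / 2) = - (y - c)\<^sup>2 / 2"
      by (simp add: power2_eq_square field_simps)
    then have "std_normal_density y * exp (c * y - c\<^sup>2 / 2) = normal_density c 1 y"
      by (simp add: normal_density_def exp_add[symmetric] mult.assoc)
    then show "ennreal (std_normal_density y) * ennreal (exp (c * y - c\<^sup>2 / 2)) = ennreal (normal_density c 1 y)"
      by (simp add: ennreal_mult'[symmetric])
  qed
  also have "\<dots> = emeasure (density lborel (\<lambda>y. ennreal (normal_density c 1 y))) UNIV"
    by (subst emeasure_density) auto
  also have "\<dots> = 1"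
    using prob_space.emeasure_space_1[OF prob_space_normal_density[of 1 c]] by simp
  finally show ?thesis .
qed

text \<open>
  The coefficient of \<open>\<xi> t\<close> may depend on the earlier components. Predictability is stated for points
  rather than with a filtration, because this is the form in which causality of the algorithm provides it.
\<close>

locale predictable_coefficients =
  fixes T :: nat and c :: "nat \<Rightarrow> (nat \<Rightarrow> real) \<Rightarrow> real"
  assumes c_measurable: "\<And>t. t < T \<Longrightarrow> c t \<in> borel_measurable (noise T)"
    and c_predictable: "\<And>t \<xi> \<xi>'. t < T \<Longrightarrow> \<xi> \<in> space (noise T) \<Longrightarrow> \<xi>' \<in> space (noise T) \<Longrightarrow>
      (\<forall>i<t. \<xi> i = \<xi>' i) \<Longrightarrow> c t \<xi> = c t \<xi>'"
begin

lemma scaled_predictable: "predictable_coefficients T (\<lambda>t \<xi>. a * c t \<xi>)"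
proof
  show "(\<lambda>\<xi>. a * c t \<xi>) \<in> borel_measurable (noise T)" if "t < T" for t
    using c_measurable[OF that] by (rule borel_measurable_times[OF borel_measurable_const])
  show "a * c t \<xi> = a * c t \<xi>'" if "t < T" "\<xi> \<in> space (noise T)" "\<xi>' \<in> space (noise T)"
    "\<forall>i<t. \<xi> i = \<xi>' i" for t \<xi> \<xi>'
    using c_predictable[OF that] by simp
qed

text \<open>
  Integrating over the last component first, with the others held fixed, removes the last factor by
  \<open>std_normal_exponential_martingale\<close>, since the coefficient of that component is then a constant.
\<close>

lemma exponential_martingale:
  assumes "m \<le> T"
  shows "(\<integral>\<^sup>+\<xi>. ennreal (exp (\<Sum>t<m. c t \<xi> * \<xi> t - (c t \<xi>)\<^sup>2 / 2)) \<partial>noise T) = 1"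
  using assms
proof (induction m)
  case 0
  then show ?case using prob_space.emeasure_space_1[OF prob_space_noise] by simp
next
  case (Suc m)
  interpret product_prob_space "\<lambda>_::nat. std_normal"
    by (intro product_prob_spaceI prob_space_std_normal)
  define I where "I = {..<T} - {m}"
  define Z where "Z = (\<lambda>m \<xi>. \<Sum>t<m. c t \<xi> * \<xi> t - (c t \<xi>)\<^sup>2 / 2)"
  have I: "finite I" "m \<notin> I" and ins: "insert m I = {..<T}" using Suc.prems by (auto simp: I_def)
  have noise: "noise T = Pi\<^sub>M (insert m I) (\<lambda>_. std_normal)" by (simp add: noise_def ins)
  have meas: "(\<lambda>\<xi>. ennreal (exp (Z k \<xi>))) \<in> borel_measurable (Pi\<^sub>M (insert m I) (\<lambda>_. std_normal))"
    if "k \<le> T" for k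
    unfolding noise[symmetric] Z_def using that
    by (intro measurable_compose[OF _ measurable_ennreal] measurable_compose[OF _ borel_measurable_exp]
      borel_measurable_sum borel_measurable_diff borel_measurable_times borel_measurable_divide
      borel_measurable_power borel_measurable_const c_measurable noise_component_measurable) auto
  have upd: "x(m := y) \<in> space (noise T)" if "x \<in> space (Pi\<^sub>M I (\<lambda>_. std_normal))" for x and y :: real
    using that unfolding noise space_PiM by (auto simp: PiE_def extensional_def)
  \<comment> \<open>The exponent up to \<open>m\<close> does not involve the component \<open>m\<close>, which may be set to \<open>0\<close>.\<close>
  have Zm: "Z m (x(m := y)) = Z m (x(m := 0))" if "x \<in> space (Pi\<^sub>M I (\<lambda>_. std_normal))" for x y
    unfolding Z_def
  proof (intro sum.cong refl)
    fix t assume t: "t \<in> {..<m}"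
    then have "c t (x(m := y)) = c t (x(m := 0))"
      by (intro c_predictable upd that) (use Suc.prems in auto)
    then show "c t (x(m := y)) * (x(m := y)) t - (c t (x(m := y)))\<^sup>2 / 2 =
      c t (x(m := 0)) * (x(m := 0)) t - (c t (x(m := 0)))\<^sup>2 / 2" using t by simp
  qed
  have cm: "c m (x(m := y)) = c m (x(m := 0))" if "x \<in> space (Pi\<^sub>M I (\<lambda>_. std_normal))" for x y
    by (intro c_predictable upd that) (use Suc.prems in auto)
  have inner: "(\<integral>\<^sup>+y. ennreal (exp (Z (Suc m) (x(m := y)))) \<partial>std_normal) =
      (\<integral>\<^sup>+y. ennreal (exp (Z m (x(m := y)))) \<partial>std_normal)"
    if x: "x \<in> space (Pi\<^sub>M I (\<lambda>_. std_normal))" for x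
  proof -
    define a where "a = c m (x(m := 0))"
    define w where "w = Z m (x(m := 0))"
    have "Z (Suc m) (x(m := y)) = w + (a * y - a\<^sup>2 / 2)" for y
    proof -
      have "Z (Suc m) (x(m := y)) = Z m (x(m := y)) + (c m (x(m := y)) * y - (c m (x(m := y)))\<^sup>2 / 2)"
        unfolding Z_def by simp
      then show ?thesis using Zm[OF x, of y] cm[OF x, of y] by (simp only: a_def w_def)
    qed
    then have "(\<integral>\<^sup>+y. ennreal (exp (Z (Suc m) (x(m := y)))) \<partial>std_normal) =
        (\<integral>\<^sup>+y. ennreal (exp w) * ennreal (exp (a * y - a\<^sup>2 / 2)) \<partial>std_normal)"
      by (simp add: exp_add ennreal_mult')
    also have "\<dots> = ennreal (exp w) * (\<integral>\<^sup>+y. ennreal (exp (a * y - a\<^sup>2 / 2)) \<partial>std_normal)"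
      by (rule nn_integral_cmult) measurable
    also have "\<dots> = ennreal (exp w)" by (simp add: std_normal_exponential_martingale)
    also have "\<dots> = (\<integral>\<^sup>+y. ennreal (exp (Z m (x(m := y)))) \<partial>std_normal)"
    proof -
      have "Z m (x(m := y)) = w" for y unfolding w_def by (rule Zm[OF x])
      then show ?thesis using prob_space.emeasure_space_1[OF prob_space_std_normal] by simp
    qed
    finally show ?thesis .
  qed
  have "(\<integral>\<^sup>+\<xi>. ennreal (exp (Z (Suc m) \<xi>)) \<partial>noise T) =
      (\<integral>\<^sup>+x. (\<integral>\<^sup>+y. ennreal (exp (Z (Suc m) (x(m := y)))) \<partial>std_normal) \<partial>Pi\<^sub>M I (\<lambda>_. std_normal))"
    unfolding noise by (rule product_nn_integral_insert[OF I meas]) (use Suc.prems in auto)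
  also have "\<dots> = (\<integral>\<^sup>+x. (\<integral>\<^sup>+y. ennreal (exp (Z m (x(m := y)))) \<partial>std_normal) \<partial>Pi\<^sub>M I (\<lambda>_. std_normal))"
    by (rule nn_integral_cong) (rule inner)
  also have "\<dots> = (\<integral>\<^sup>+\<xi>. ennreal (exp (Z m \<xi>)) \<partial>noise T)"
    unfolding noise by (rule product_nn_integral_insert[OF I meas, symmetric]) (use Suc.prems in auto)
  also have "\<dots> = 1" using Suc by (simp add: Z_def)
  finally show ?case by (simp only: Z_def)
qed

text \<open>
  Markov's inequality for the exponential martingale of \<open>(\<epsilon> / s) * c\<close>, the scaling that minimises the
  exponent.
\<close>

lemma upper_tail:
  assumes var: "\<And>\<xi>. \<xi> \<in> space (noise T) \<Longrightarrow> (\<Sum>t<T. (c t \<xi>)\<^sup>2) \<le> s" and s: "0 < s" and \<epsilon>: "0 < \<epsilon>"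
  shows "measure (noise T) {\<xi> \<in> space (noise T). \<epsilon> \<le> (\<Sum>t<T. c t \<xi> * \<xi> t)} \<le> exp (- \<epsilon>\<^sup>2 / (2 * s))"
proof -
  interpret P: prob_space "noise T" by (rule prob_space_noise)
  define a where "a = \<epsilon> / s"
  have a: "0 < a" using s \<epsilon> by (simp add: a_def)
  interpret S: predictable_coefficients T "\<lambda>t \<xi>. a * c t \<xi>" by (rule scaled_predictable)
  define f where "f = (\<lambda>\<xi>. ennreal (exp (\<Sum>t<T. a * c t \<xi> * \<xi> t - (a * c t \<xi>)\<^sup>2 / 2)))"
  have f: "f \<in> borel_measurable (noise T)"
    unfolding f_def
    by (intro measurable_compose[OF _ measurable_ennreal] measurable_compose[OF _ borel_measurable_exp]
      borel_measurable_sum borel_measurable_diff borel_measurable_times borel_measurable_divide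
      borel_measurable_power borel_measurable_const c_measurable noise_component_measurable) auto
  have int: "(\<integral>\<^sup>+\<xi>. f \<xi> \<partial>noise T) = 1"
    using S.exponential_martingale[of T] by (simp add: f_def)
  define u where "u = ennreal (exp (- \<epsilon>\<^sup>2 / (2 * s)))"
  have sub: "{\<xi> \<in> space (noise T). \<epsilon> \<le> (\<Sum>t<T. c t \<xi> * \<xi> t)} \<subseteq> {\<xi> \<in> space (noise T). 1 \<le> u * f \<xi>}"
  proof safe
    fix \<xi> assume \<xi>: "\<xi> \<in> space (noise T)" and le: "\<epsilon> \<le> (\<Sum>t<T. c t \<xi> * \<xi> t)"
    have "(\<Sum>t<T. a * c t \<xi> * \<xi> t - (a * c t \<xi>)\<^sup>2 / 2) = a * (\<Sum>t<T. c t \<xi> * \<xi> t) - a\<^sup>2 / 2 * (\<Sum>t<T. (c t \<xi>)\<^sup>2)"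
      by (simp add: sum_subtractf sum_distrib_left power_mult_distrib mult_ac)
    also have "\<dots> \<ge> a * \<epsilon> - a\<^sup>2 / 2 * s"
      using le var[OF \<xi>] a by (intro diff_mono mult_left_mono) auto
    also have "a * \<epsilon> - a\<^sup>2 / 2 * s = \<epsilon>\<^sup>2 / (2 * s)"
      using s by (simp add: a_def power2_eq_square field_simps)
    finally have "0 \<le> - \<epsilon>\<^sup>2 / (2 * s) + (\<Sum>t<T. a * c t \<xi> * \<xi> t - (a * c t \<xi>)\<^sup>2 / 2)" by simp
    then have "1 \<le> exp (- \<epsilon>\<^sup>2 / (2 * s)) * exp (\<Sum>t<T. a * c t \<xi> * \<xi> t - (a * c t \<xi>)\<^sup>2 / 2)"
      unfolding exp_add[symmetric] by simp
    then show "1 \<le> u * f \<xi>"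
      unfolding u_def f_def ennreal_mult'[symmetric, OF exp_ge_zero] by (simp add: ennreal_leI flip: ennreal_1)
  qed
  have "emeasure (noise T) {\<xi> \<in> space (noise T). \<epsilon> \<le> (\<Sum>t<T. c t \<xi> * \<xi> t)}
      \<le> emeasure (noise T) {\<xi> \<in> space (noise T). 1 \<le> u * f \<xi>}"
    by (rule emeasure_mono[OF sub]) (use f in measurable)
  also have "\<dots> \<le> u * (\<integral>\<^sup>+\<xi>. f \<xi> \<partial>noise T)"
  proof -
    have "emeasure (noise T) {\<xi> \<in> space (noise T). 1 \<le> u * f \<xi>}
        \<le> u * (\<integral>\<^sup>+\<xi>. f \<xi> * indicator (space (noise T)) \<xi> \<partial>noise T)"
      by (rule nn_integral_Markov_inequality) (use f in \<open>auto intro: borel_measurable_times_ennreal\<close>)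
    also have "(\<integral>\<^sup>+\<xi>. f \<xi> * indicator (space (noise T)) \<xi> \<partial>noise T) = (\<integral>\<^sup>+\<xi>. f \<xi> \<partial>noise T)"
      by (rule nn_integral_cong) simp
    finally show ?thesis .
  qed
  finally have "emeasure (noise T) {\<xi> \<in> space (noise T). \<epsilon> \<le> (\<Sum>t<T. c t \<xi> * \<xi> t)} \<le> u"
    by (simp add: int)
  then show ?thesis unfolding u_def P.emeasure_eq_measure by simp
qed

lemma two_sided_tail:
  assumes var: "\<And>\<xi>. \<xi> \<in> space (noise T) \<Longrightarrow> (\<Sum>t<T. (c t \<xi>)\<^sup>2) \<le> s" and s: "0 < s" and \<epsilon>: "0 < \<epsilon>"
  shows "{\<xi> \<in> space (noise T). \<epsilon> \<le> \<bar>\<Sum>t<T. c t \<xi> * \<xi> t\<bar>} \<in> sets (noise T)"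
    and "measure (noise T) {\<xi> \<in> space (noise T). \<epsilon> \<le> \<bar>\<Sum>t<T. c t \<xi> * \<xi> t\<bar>} \<le> 2 * exp (- \<epsilon>\<^sup>2 / (2 * s))"
proof -
  interpret P: prob_space "noise T" by (rule prob_space_noise)
  have m: "(\<lambda>\<xi>. \<Sum>t<T. c t \<xi> * \<xi> t) \<in> borel_measurable (noise T)"
    by (intro borel_measurable_sum borel_measurable_times c_measurable noise_component_measurable) auto
  show "{\<xi> \<in> space (noise T). \<epsilon> \<le> \<bar>\<Sum>t<T. c t \<xi> * \<xi> t\<bar>} \<in> sets (noise T)"
    using m by measurable
  interpret S: predictable_coefficients T "\<lambda>t \<xi>. - 1 * c t \<xi>" by (rule scaled_predictable)
  let ?A = "{\<xi> \<in> space (noise T). \<epsilon> \<le> (\<Sum>t<T. c t \<xi> * \<xi> t)}"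
  let ?B = "{\<xi> \<in> space (noise T). \<epsilon> \<le> (\<Sum>t<T. - 1 * c t \<xi> * \<xi> t)}"
  have B: "?B = {\<xi> \<in> space (noise T). \<epsilon> \<le> - (\<Sum>t<T. c t \<xi> * \<xi> t)}"
    by (simp add: sum_negf)
  have sets: "?A \<in> sets (noise T)" "?B \<in> sets (noise T)" unfolding B using m by measurable
  have "{\<xi> \<in> space (noise T). \<epsilon> \<le> \<bar>\<Sum>t<T. c t \<xi> * \<xi> t\<bar>} = ?A \<union> ?B" unfolding B by auto
  then have "measure (noise T) {\<xi> \<in> space (noise T). \<epsilon> \<le> \<bar>\<Sum>t<T. c t \<xi> * \<xi> t\<bar>}
      \<le> measure (noise T) ?A + measure (noise T) ?B"
    using measure_Un_le[OF sets] by simp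
  also have "\<dots> \<le> exp (- \<epsilon>\<^sup>2 / (2 * s)) + exp (- \<epsilon>\<^sup>2 / (2 * s))"
    by (intro add_mono upper_tail[OF _ s \<epsilon>] S.upper_tail[OF _ s \<epsilon>]) (use var in auto)
  finally show "measure (noise T) {\<xi> \<in> space (noise T). \<epsilon> \<le> \<bar>\<Sum>t<T. c t \<xi> * \<xi> t\<bar>}
      \<le> 2 * exp (- \<epsilon>\<^sup>2 / (2 * s))" by simp
qed

end

section \<open>Measurability of the run\<close>

text \<open>
  The discrete parts of a state (played actions, active sets, best group) live in types without a
  \<open>\<sigma>\<close>-algebra and take only countably many values. Measurability of the level sets is then all that is
  needed, and it is closed under arbitrary functions of finitely many arguments.
\<close>

definition discrete_rv :: "'a measure \<Rightarrow> ('a \<Rightarrow> 'b) \<Rightarrow> bool" where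
  "discrete_rv M f \<longleftrightarrow> countable (f ` space M) \<and> (\<forall>y. {\<xi>\<in>space M. f \<xi> = y} \<in> sets M)"

lemma discrete_rv_cong:
  assumes "\<And>\<xi>. \<xi> \<in> space M \<Longrightarrow> f \<xi> = g \<xi>"
  shows "discrete_rv M f \<longleftrightarrow> discrete_rv M g"
proof -
  have "f ` space M = g ` space M" using assms by (intro image_cong) auto
  moreover have "{\<xi>\<in>space M. f \<xi> = y} = {\<xi>\<in>space M. g \<xi> = y}" for y using assms by auto
  ultimately show ?thesis by (simp add: discrete_rv_def)
qed

lemma discrete_rv_const: "discrete_rv M (\<lambda>_. c)"
proof -
  have "{\<xi>\<in>space M. c = y} \<in> sets M" for y by (cases "c = y") auto
  moreover have "countable ((\<lambda>_. c) ` space M)"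
    by (rule countable_subset[of _ "{c}"]) auto
  ultimately show ?thesis by (simp add: discrete_rv_def)
qed

lemma discrete_rv_count_space:
  assumes "discrete_rv M f" shows "f \<in> M \<rightarrow>\<^sub>M count_space (f ` space M)"
proof -
  have c: "countable (f ` space M)" using assms by (simp add: discrete_rv_def)
  have "f -` {y} \<inter> space M = {\<xi>\<in>space M. f \<xi> = y}" for y by auto
  then show ?thesis using assms
    unfolding measurable_count_space_eq_countable[OF c] by (auto simp: discrete_rv_def)
qed

lemma discrete_rvI:
  assumes "f \<in> M \<rightarrow>\<^sub>M count_space UNIV" "countable (f ` space M)"
  shows "discrete_rv M f"
  unfolding discrete_rv_def
proof (intro conjI allI assms(2))
  fix y
  have "f -` {y} \<inter> space M \<in> sets M" by (rule measurable_sets[OF assms(1)]) simp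
  moreover have "f -` {y} \<inter> space M = {\<xi>\<in>space M. f \<xi> = y}" by auto
  ultimately show "{\<xi>\<in>space M. f \<xi> = y} \<in> sets M" by simp
qed

text \<open>
  Splitting the space along the countably many values of \<open>f\<close> reduces a random index to a fixed one. All
  dependence of the algorithm on its own past choices is removed in this way.
\<close>

lemma measurable_discrete_choice:
  assumes "discrete_rv M f" "\<And>y. y \<in> f ` space M \<Longrightarrow> h y \<in> M \<rightarrow>\<^sub>M N"
  shows "(\<lambda>\<xi>. h (f \<xi>) \<xi>) \<in> M \<rightarrow>\<^sub>M N"
  by (rule measurable_compose_countable'[OF _ discrete_rv_count_space[OF assms(1)]])
     (use assms in \<open>auto simp: discrete_rv_def\<close>)

lemma discrete_rv_choice:
  assumes f: "discrete_rv M f" and h: "\<And>y. y \<in> f ` space M \<Longrightarrow> discrete_rv M (h y)"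
  shows "discrete_rv M (\<lambda>\<xi>. h (f \<xi>) \<xi>)"
  unfolding discrete_rv_def
proof (intro conjI allI)
  have c: "countable (f ` space M)" using f by (simp add: discrete_rv_def)
  show "countable ((\<lambda>\<xi>. h (f \<xi>) \<xi>) ` space M)"
  proof (rule countable_subset)
    show "(\<lambda>\<xi>. h (f \<xi>) \<xi>) ` space M \<subseteq> (\<Union>y\<in>f ` space M. h y ` space M)" by auto
    show "countable (\<Union>y\<in>f ` space M. h y ` space M)"
      by (rule countable_UN[OF c]) (use h in \<open>simp add: discrete_rv_def\<close>)
  qed
  fix w
  have "{\<xi>\<in>space M. h (f \<xi>) \<xi> = w} =
      (\<Union>y\<in>f ` space M. {\<xi>\<in>space M. f \<xi> = y} \<inter> {\<xi>\<in>space M. h y \<xi> = w})" by auto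
  also have "\<dots> \<in> sets M"
    by (intro sets.countable_UN'' c sets.Int) (use f h in \<open>auto simp: discrete_rv_def\<close>)
  finally show "{\<xi>\<in>space M. h (f \<xi>) \<xi> = w} \<in> sets M" .
qed

lemma discrete_rv_map: "discrete_rv M f \<Longrightarrow> discrete_rv M (\<lambda>\<xi>. G (f \<xi>))"
  by (rule discrete_rv_choice[of M f "\<lambda>y _. G y"]) (auto intro: discrete_rv_const)

lemma discrete_rv_map2:
  "discrete_rv M f \<Longrightarrow> discrete_rv M g \<Longrightarrow> discrete_rv M (\<lambda>\<xi>. G (f \<xi>) (g \<xi>))"
  by (rule discrete_rv_choice[of M f "\<lambda>y \<xi>. G y (g \<xi>)"]) (auto intro: discrete_rv_map)

lemma discrete_rv_map3:
  "discrete_rv M f \<Longrightarrow> discrete_rv M g \<Longrightarrow> discrete_rv M h \<Longrightarrow>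
    discrete_rv M (\<lambda>\<xi>. G (f \<xi>) (g \<xi>) (h \<xi>))"
  by (rule discrete_rv_choice[of M f "\<lambda>y \<xi>. G y (g \<xi>) (h \<xi>)"]) (auto intro: discrete_rv_map2)

lemma discrete_rv_If:
  "discrete_rv M P \<Longrightarrow> discrete_rv M f \<Longrightarrow> discrete_rv M g \<Longrightarrow>
    discrete_rv M (\<lambda>\<xi>. if P \<xi> then f \<xi> else g \<xi>)"
  by (rule discrete_rv_map3[of M P f g "\<lambda>b x y. if b then x else y"])

lemma measurable_discrete_If:
  assumes "discrete_rv M P" "f \<in> M \<rightarrow>\<^sub>M N" "g \<in> M \<rightarrow>\<^sub>M N"
  shows "(\<lambda>\<xi>. if P \<xi> then f \<xi> else g \<xi>) \<in> M \<rightarrow>\<^sub>M N"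
proof (rule measurable_discrete_choice[OF assms(1), of "\<lambda>b \<xi>. if b then f \<xi> else g \<xi>"])
  fix b show "(\<lambda>\<xi>. if b then f \<xi> else g \<xi>) \<in> M \<rightarrow>\<^sub>M N" by (cases b) (use assms in auto)
qed

lemma discrete_rv_measurable:
  fixes f :: "'a \<Rightarrow> real" shows "discrete_rv M f \<Longrightarrow> f \<in> borel_measurable M"
  by (rule measurable_discrete_choice[of M f "\<lambda>y _. y"]) auto

lemma discrete_rv_le:
  fixes f g :: "'a \<Rightarrow> real"
  assumes [measurable]: "f \<in> borel_measurable M" "g \<in> borel_measurable M"
  shows "discrete_rv M (\<lambda>\<xi>. f \<xi> \<le> g \<xi>)"
  by (rule discrete_rvI) auto

lemma discrete_rv_nat_ceiling:
  fixes f :: "'a \<Rightarrow> real"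
  assumes [measurable]: "f \<in> borel_measurable M"
  shows "discrete_rv M (\<lambda>\<xi>. nat \<lceil>f \<xi>\<rceil>)"
  by (rule discrete_rvI) auto

lemma discrete_rv_Collect:
  assumes "finite S" "\<And>x. x \<in> S \<Longrightarrow> discrete_rv M (P x)"
  shows "discrete_rv M (\<lambda>\<xi>. {x\<in>S. P x \<xi>})"
  using assms
proof (induction S rule: finite_induct)
  case empty
  then show ?case by (simp add: discrete_rv_const)
next
  case (insert a S)
  have "{x\<in>insert a S. P x \<xi>} = (if P a \<xi> then insert a {x\<in>S. P x \<xi>} else {x\<in>S. P x \<xi>})" for \<xi>
    by auto
  moreover have "discrete_rv M (\<lambda>\<xi>. if P a \<xi> then insert a {x\<in>S. P x \<xi>} else {x\<in>S. P x \<xi>})"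
    using insert by (intro discrete_rv_If discrete_rv_map[of M _ "insert a"]) auto
  ultimately show ?case by simp
qed

lemma discrete_rv_finite_support:
  fixes f :: "'a \<Rightarrow> 'i \<Rightarrow> 'b"
  assumes "finite S" "\<And>x. x \<in> S \<Longrightarrow> discrete_rv M (\<lambda>\<xi>. f \<xi> x)"
    and "\<And>\<xi> x. \<xi> \<in> space M \<Longrightarrow> x \<notin> S \<Longrightarrow> f \<xi> x = c"
  shows "discrete_rv M f"
proof -
  have "discrete_rv M (\<lambda>\<xi> x. if x \<in> S then f \<xi> x else c)"
    using assms(1,2)
  proof (induction S rule: finite_induct)
    case empty
    then show ?case by (simp add: discrete_rv_const)
  next
    case (insert a S)
    have "(\<lambda>x. if x \<in> insert a S then f \<xi> x else c) = (\<lambda>x. if x \<in> S then f \<xi> x else c)(a := f \<xi> a)" for \<xi>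
      by auto
    moreover have "discrete_rv M (\<lambda>\<xi>. (\<lambda>x. if x \<in> S then f \<xi> x else c)(a := f \<xi> a))"
      using insert by (intro discrete_rv_map2[of M _ _ "\<lambda>h y. h(a := y)"]) auto
    ultimately show ?case by simp
  qed
  moreover have "f \<xi> = (\<lambda>x. if x \<in> S then f \<xi> x else c)" if "\<xi> \<in> space M" for \<xi>
    using assms(3)[OF that] by auto
  ultimately show ?thesis by (subst discrete_rv_cong) auto
qed

lemma discrete_rv_finite_range:
  assumes "f \<in> M \<rightarrow>\<^sub>M count_space UNIV" "\<And>\<xi>. \<xi> \<in> space M \<Longrightarrow> f \<xi> \<in> A" "countable A"
  shows "discrete_rv M f"
  by (rule discrete_rvI[OF assms(1) countable_subset[OF image_subsetI[OF assms(2)] assms(3)]])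

locale fpe_measurable = fpe_setting +
  assumes choices_measurable: "measurable_choices R"
begin

abbreviation \<Omega> :: "(nat \<Rightarrow> real) measure" where "\<Omega> \<equiv> noise T"

lemma noise_coordinate: "(\<lambda>\<xi>. \<xi> t) \<in> borel_measurable \<Omega>"
proof (cases "t < T")
  case True
  then show ?thesis by (rule noise_component_measurable)
next
  case False
  have "(\<lambda>\<xi>. \<xi> t) \<in> borel_measurable \<Omega> \<longleftrightarrow> (\<lambda>\<xi>. undefined :: real) \<in> borel_measurable \<Omega>"
    by (rule measurable_cong) (use False in \<open>auto simp: space_noise PiE_def extensional_def\<close>)
  then show ?thesis by simp
qed

lemma pull_measurable: "(\<lambda>\<xi>. pull \<xi> t x) \<in> borel_measurable \<Omega>"
  unfolding reward_def by (intro borel_measurable_add borel_measurable_const noise_coordinate)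

text \<open>
  A history is redundant: its rewards can be recovered from the noise and the played actions. So it is a
  measurable function of a discrete variable and the noise, although \<open>history\<close> is a list type.
\<close>

definition recorded :: "(nat \<Rightarrow> real) \<Rightarrow> history \<Rightarrow> bool" where
  "recorded \<xi> h \<longleftrightarrow> h = zip (map fst h) (map (\<lambda>i. pull \<xi> i (map fst h ! i)) [0..<length h])"

lemma recorded_sample:
  assumes "recorded \<xi> h" shows "recorded \<xi> (A.sample (pull \<xi>) h xs)"
proof -
  have r: "h ! i = (fst (h ! i), pull \<xi> i (fst (h ! i)))" if "i < length h" for i
  proof -
    have "h ! i = zip (map fst h) (map (\<lambda>i. pull \<xi> i (map fst h ! i)) [0..<length h]) ! i"
      using assms unfolding recorded_def by (rule arg_cong)
    then show ?thesis using that by simp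
  qed
  show ?thesis
    unfolding recorded_def
  proof (rule nth_equalityI)
    fix i assume "i < length (A.sample (pull \<xi>) h xs)"
    then have i: "i < length h + length xs" by simp
    have "A.sample (pull \<xi>) h xs ! i = (map fst (A.sample (pull \<xi>) h xs) ! i, pull \<xi> i (map fst (A.sample (pull \<xi>) h xs) ! i))"
      unfolding map_fst_sample using i r[of i]
      by (cases "i < length h") (auto simp: sample_eq nth_append)
    then show "A.sample (pull \<xi>) h xs ! i = zip (map fst (A.sample (pull \<xi>) h xs))
       (map (\<lambda>i. pull \<xi> i (map fst (A.sample (pull \<xi>) h xs) ! i)) [0..<length (A.sample (pull \<xi>) h xs)]) ! i"
      using i by simp
  qed simp
qed

text \<open>
  The estimator \<open>theta\<close> only enters through the products \<open>avec x \<bullet> theta s (z x)\<close>; requiring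
  measurability of these avoids a \<open>\<sigma>\<close>-algebra on vectors of varying dimension.
\<close>

definition meas_state :: "((nat \<Rightarrow> real) \<Rightarrow> fpe_state) \<Rightarrow> bool" where
  "meas_state f \<longleftrightarrow> (\<forall>\<xi>\<in>space \<Omega>. wf_state (f \<xi>)) \<and> (\<forall>\<xi>\<in>space \<Omega>. recorded \<xi> (hist (f \<xi>))) \<and>
     discrete_rv \<Omega> (\<lambda>\<xi>. map fst (hist (f \<xi>))) \<and>
     (\<forall>g\<in>{-1, 1}. discrete_rv \<Omega> (\<lambda>\<xi>. active (f \<xi>) g)) \<and>
     (\<forall>x\<in>X. (\<lambda>\<xi>. avec x \<bullet> theta (f \<xi>) (z x)) \<in> borel_measurable \<Omega>) \<and>
     discrete_rv \<Omega> (\<lambda>\<xi>. best_group (f \<xi>)) \<and>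
     (\<forall>x\<in>X. (\<lambda>\<xi>. gaps (f \<xi>) x) \<in> borel_measurable \<Omega>)"

lemma meas_stateD:
  assumes "meas_state f"
  shows "\<xi> \<in> space \<Omega> \<Longrightarrow> wf_state (f \<xi>)" "\<xi> \<in> space \<Omega> \<Longrightarrow> recorded \<xi> (hist (f \<xi>))"
    "discrete_rv \<Omega> (\<lambda>\<xi>. map fst (hist (f \<xi>)))"
    "g \<in> {-1, 1} \<Longrightarrow> discrete_rv \<Omega> (\<lambda>\<xi>. active (f \<xi>) g)"
    "x \<in> X \<Longrightarrow> (\<lambda>\<xi>. avec x \<bullet> theta (f \<xi>) (z x)) \<in> borel_measurable \<Omega>"
    "discrete_rv \<Omega> (\<lambda>\<xi>. best_group (f \<xi>))"
    "x \<in> X \<Longrightarrow> (\<lambda>\<xi>. gaps (f \<xi>) x) \<in> borel_measurable \<Omega>"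
  using assms unfolding meas_state_def by auto

lemma length_hist_discrete:
  assumes "meas_state f" shows "discrete_rv \<Omega> (\<lambda>\<xi>. length (hist (f \<xi>)))"
  using discrete_rv_map[OF meas_stateD(3)[OF assms], of length] by simp

definition rewards_of :: "real vec list \<Rightarrow> (nat \<Rightarrow> real) \<Rightarrow> nat \<Rightarrow> real" where
  "rewards_of as \<xi> = (\<lambda>i\<in>{..<length as}. pull \<xi> i (as ! i))"

definition history_of :: "real vec list \<Rightarrow> (nat \<Rightarrow> real) \<Rightarrow> history" where
  "history_of as y = zip as (map y [0..<length as])"

lemma rewards_of_measurable:
  "rewards_of as \<in> \<Omega> \<rightarrow>\<^sub>M Pi\<^sub>M {..<length as} (\<lambda>_. borel)"
  unfolding rewards_of_def by (rule measurable_restrict) (rule pull_measurable)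

lemma recorded_eq:
  assumes "recorded \<xi> h" shows "h = history_of (map fst h) (rewards_of (map fst h) \<xi>)"
proof -
  have "map (\<lambda>i. pull \<xi> i (map fst h ! i)) [0..<length h] = map (rewards_of (map fst h) \<xi>) [0..<length (map fst h)]"
    by (auto simp: rewards_of_def)
  note * = this
  show ?thesis unfolding history_of_def *[symmetric] using assms unfolding recorded_def .
qed

lemma actions_in_range:
  assumes "meas_state f" "as \<in> (\<lambda>\<xi>. map fst (hist (f \<xi>))) ` space \<Omega>"
  shows "set as \<subseteq> X"
proof -
  obtain \<xi> where "\<xi> \<in> space \<Omega>" and as: "as = map fst (hist (f \<xi>))" using assms(2) by blast
  from wf_stateD(2)[OF meas_stateD(1)[OF assms(1) this(1)]] show ?thesis by (simp add: as)
qed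

text \<open>
  The measurability of the choice rules is given for each fixed sequence of actions; this transfers it to
  the random history.
\<close>

lemma hist_measurable:
  assumes f: "meas_state f"
    and F: "\<And>as. set as \<subseteq> X \<Longrightarrow> (\<lambda>y. F (history_of as y)) \<in> Pi\<^sub>M {..<length as} (\<lambda>_. borel) \<rightarrow>\<^sub>M N"
  shows "(\<lambda>\<xi>. F (hist (f \<xi>))) \<in> \<Omega> \<rightarrow>\<^sub>M N"
proof -
  have "(\<lambda>\<xi>. F (history_of (map fst (hist (f \<xi>))) (rewards_of (map fst (hist (f \<xi>))) \<xi>))) \<in> \<Omega> \<rightarrow>\<^sub>M N"
  proof (rule measurable_discrete_choice[OF meas_stateD(3)[OF f], of "\<lambda>as \<xi>. F (history_of as (rewards_of as \<xi>))"])
    fix as assume "as \<in> (\<lambda>\<xi>. map fst (hist (f \<xi>))) ` space \<Omega>"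
    then have "set as \<subseteq> X" by (rule actions_in_range[OF f])
    from measurable_compose[OF rewards_of_measurable F[OF this]]
    show "(\<lambda>\<xi>. F (history_of as (rewards_of as \<xi>))) \<in> \<Omega> \<rightarrow>\<^sub>M N" .
  qed
  moreover have "(\<lambda>\<xi>. F (hist (f \<xi>))) \<in> \<Omega> \<rightarrow>\<^sub>M N \<longleftrightarrow>
      (\<lambda>\<xi>. F (history_of (map fst (hist (f \<xi>))) (rewards_of (map fst (hist (f \<xi>))) \<xi>))) \<in> \<Omega> \<rightarrow>\<^sub>M N"
    by (rule measurable_cong, rule arg_cong[where f = F], rule recorded_eq[OF meas_stateD(2)[OF f]])
  ultimately show ?thesis by simp
qed

lemma choice_rules_measurable:
  assumes "set as \<subseteq> X"
  shows "(\<lambda>y. first_group R (history_of as y)) \<in> Pi\<^sub>M {..<length as} (\<lambda>_. borel) \<rightarrow>\<^sub>M count_space UNIV"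
    "S \<subseteq> X \<Longrightarrow> x \<in> X \<Longrightarrow> (\<lambda>y. G_design R (history_of as y) S x) \<in> borel_measurable (Pi\<^sub>M {..<length as} (\<lambda>_. borel))"
    "x \<in> X \<Longrightarrow> (\<lambda>(y, \<Delta>). Delta_design R (history_of as y) \<Delta> x) \<in>
      borel_measurable (Pi\<^sub>M {..<length as} (\<lambda>_. borel) \<Otimes>\<^sub>M Pi\<^sub>M X (\<lambda>_. restrict_space borel {0<..}))"
    "(\<lambda>y. schedule R (history_of as y) \<mu>) \<in> Pi\<^sub>M {..<length as} (\<lambda>_. borel) \<rightarrow>\<^sub>M count_space UNIV"
    "S \<subseteq> X \<Longrightarrow> (\<lambda>y. best_action R (history_of as y) S) \<in> Pi\<^sub>M {..<length as} (\<lambda>_. borel) \<rightarrow>\<^sub>M count_space UNIV"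
proof -
  let ?P = "Pi\<^sub>M {..<length as} (\<lambda>_. borel :: real measure)"
  have c: "(\<lambda>y. first_group R (history_of as y)) \<in> ?P \<rightarrow>\<^sub>M count_space UNIV \<and>
      (\<forall>S\<subseteq>X. \<forall>x\<in>X. (\<lambda>y. G_design R (history_of as y) S x) \<in> borel_measurable ?P) \<and>
      (\<forall>x\<in>X. (\<lambda>(y, \<Delta>). Delta_design R (history_of as y) \<Delta> x) \<in>
        borel_measurable (?P \<Otimes>\<^sub>M Pi\<^sub>M X (\<lambda>_. restrict_space borel {0<..}))) \<and>
      (\<forall>\<mu>. (\<lambda>y. schedule R (history_of as y) \<mu>) \<in> ?P \<rightarrow>\<^sub>M count_space UNIV) \<and>
      (\<forall>S\<subseteq>X. (\<lambda>y. best_action R (history_of as y) S) \<in> ?P \<rightarrow>\<^sub>M count_space UNIV)"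
    using choices_measurable assms unfolding measurable_choices_def Let_def history_of_def by (elim allE[of _ as] impE)
  note c1 = c[THEN conjunct1] and c2 = c[THEN conjunct2, THEN conjunct1]
    and c3 = c[THEN conjunct2, THEN conjunct2, THEN conjunct1]
    and c4 = c[THEN conjunct2, THEN conjunct2, THEN conjunct2, THEN conjunct1]
    and c5 = c[THEN conjunct2, THEN conjunct2, THEN conjunct2, THEN conjunct2]
  show "(\<lambda>y. first_group R (history_of as y)) \<in> ?P \<rightarrow>\<^sub>M count_space UNIV" by (rule c1)
  show "(\<lambda>y. G_design R (history_of as y) S x) \<in> borel_measurable ?P" if "S \<subseteq> X" "x \<in> X"
    by (rule c2[rule_format, OF that])
  show "(\<lambda>(y, \<Delta>). Delta_design R (history_of as y) \<Delta> x) \<in>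
      borel_measurable (?P \<Otimes>\<^sub>M Pi\<^sub>M X (\<lambda>_. restrict_space borel {0<..}))" if "x \<in> X"
    by (rule bspec[OF c3 that])
  show "(\<lambda>y. schedule R (history_of as y) \<mu>) \<in> ?P \<rightarrow>\<^sub>M count_space UNIV" by (rule spec[OF c4])
  show "(\<lambda>y. best_action R (history_of as y) S) \<in> ?P \<rightarrow>\<^sub>M count_space UNIV" if "S \<subseteq> X"
    by (rule c5[rule_format, OF that])
qed

lemma first_group_discrete:
  assumes "meas_state f" shows "discrete_rv \<Omega> (\<lambda>\<xi>. first_group R (hist (f \<xi>)))"
  by (rule discrete_rv_finite_range[OF hist_measurable[OF assms choice_rules_measurable(1)], of "{-1, 1}"])
     (use first_group in auto)

lemma schedule_discrete:
  assumes f: "meas_state f" and \<mu>: "discrete_rv \<Omega> \<mu>"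
    and out: "\<And>\<xi> x. \<xi> \<in> space \<Omega> \<Longrightarrow> x \<notin> X \<Longrightarrow> \<mu> \<xi> x = (0 :: nat)"
  shows "discrete_rv \<Omega> (\<lambda>\<xi>. schedule R (hist (f \<xi>)) (\<mu> \<xi>))"
proof (rule discrete_rv_choice[OF \<mu>, of "\<lambda>m \<xi>. schedule R (hist (f \<xi>)) m"])
  fix m assume "m \<in> \<mu> ` space \<Omega>"
  then have m: "m x = 0" if "x \<notin> X" for x using out that by auto
  show "discrete_rv \<Omega> (\<lambda>\<xi>. schedule R (hist (f \<xi>)) m)"
  proof (rule discrete_rv_finite_range[of _ _ "lists X"])
    show "(\<lambda>\<xi>. schedule R (hist (f \<xi>)) m) \<in> \<Omega> \<rightarrow>\<^sub>M count_space UNIV"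
      by (rule hist_measurable[OF f choice_rules_measurable(4)])
    show "schedule R (hist (f \<xi>)) m \<in> lists X" for \<xi>
      using schedule_props(2)[of m "hist (f \<xi>)", OF m] by auto
    show "countable (lists X)" using finite_X by (intro countable_lists countable_finite)
  qed
qed

lemma best_action_discrete:
  assumes f: "meas_state f" and S: "discrete_rv \<Omega> S"
    and S': "\<And>\<xi>. \<xi> \<in> space \<Omega> \<Longrightarrow> S \<xi> \<noteq> {} \<and> S \<xi> \<subseteq> X"
  shows "discrete_rv \<Omega> (\<lambda>\<xi>. best_action R (hist (f \<xi>)) (S \<xi>))"
proof (rule discrete_rv_choice[OF S, of "\<lambda>A \<xi>. best_action R (hist (f \<xi>)) A"])
  fix A assume "A \<in> S ` space \<Omega>"
  then have A: "A \<noteq> {}" "A \<subseteq> X" using S' by auto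
  show "discrete_rv \<Omega> (\<lambda>\<xi>. best_action R (hist (f \<xi>)) A)"
    by (rule discrete_rv_finite_range[OF hist_measurable[OF f choice_rules_measurable(5)[OF _ A(2)]], of A])
       (use best_action[OF A] countable_finite[OF finite_subset[OF A(2) finite_X]] in auto)
qed

lemma group_counts_discrete:
  assumes f: "meas_state f" and g: "g \<in> {-1, 1}"
  shows "discrete_rv \<Omega> (\<lambda>\<xi>. group_counts l g (f \<xi>))"
proof (rule discrete_rv_finite_support[OF finite_X])
  show "group_counts l g (f \<xi>) x = 0" if "\<xi> \<in> space \<Omega>" "x \<notin> X" for \<xi> x
    using group_counts_outside[OF meas_stateD(1)[OF f that(1)] g] wf_stateD(5)[OF meas_stateD(1)[OF f that(1)] g] that(2)
    by blast
  fix x assume x: "x \<in> X"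
  have "(\<lambda>\<xi>. G_design R (hist (f \<xi>)) (active (f \<xi>) g) x) \<in> borel_measurable \<Omega>"
  proof (rule measurable_discrete_choice[OF meas_stateD(4)[OF f g], of "\<lambda>S \<xi>. G_design R (hist (f \<xi>)) S x"])
    fix S assume "S \<in> (\<lambda>\<xi>. active (f \<xi>) g) ` space \<Omega>"
    then have S: "S \<subseteq> X" using wf_stateD(5)[OF meas_stateD(1)[OF f] g] by auto
    show "(\<lambda>\<xi>. G_design R (hist (f \<xi>)) S x) \<in> borel_measurable \<Omega>"
      by (rule hist_measurable[OF f choice_rules_measurable(2)[OF _ S x]])
  qed
  then show "discrete_rv \<Omega> (\<lambda>\<xi>. group_counts l g (f \<xi>) x)"
    unfolding group_counts_eq
    by (intro discrete_rv_nat_ceiling borel_measurable_times borel_measurable_divide borel_measurable_const)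
qed

lemma group_schedule_discrete:
  assumes f: "meas_state f" and g: "g \<in> {-1, 1}"
  shows "discrete_rv \<Omega> (\<lambda>\<xi>. group_schedule l g (f \<xi>))"
  unfolding group_schedule_def
proof (rule schedule_discrete[OF f group_counts_discrete[OF f g]])
  show "group_counts l g (f \<xi>) x = 0" if "\<xi> \<in> space \<Omega>" "x \<notin> X" for \<xi> x
    using group_counts_outside[OF meas_stateD(1)[OF f that(1)] g] wf_stateD(5)[OF meas_stateD(1)[OF f that(1)] g] that(2)
    by blast
qed

lemma group_completes_discrete:
  assumes f: "meas_state f" and g: "g \<in> {-1, 1}"
  shows "discrete_rv \<Omega> (\<lambda>\<xi>. group_completes l g (f \<xi>))"
  unfolding group_completes_def
  by (rule discrete_rv_map3[OF length_hist_discrete[OF f] group_counts_discrete[OF f g] meas_stateD(4)[OF f g],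
        of "\<lambda>n m S. n + sum m S \<le> T"])

lemma least_squares_measurable:
  assumes f: "meas_state f" and \<mu>: "discrete_rv \<Omega> \<mu>" and xs: "discrete_rv \<Omega> xs"
    and xs': "\<And>\<xi>. \<xi> \<in> space \<Omega> \<Longrightarrow> set (xs \<xi>) \<subseteq> X" and u: "u \<in> carrier_vec (d + 1)"
  shows "(\<lambda>\<xi>. u \<bullet> A.least_squares (\<mu> \<xi>) (observe (pull \<xi>) (length (hist (f \<xi>))) (xs \<xi>))) \<in> borel_measurable \<Omega>"
proof -
  have "discrete_rv \<Omega> (\<lambda>\<xi>. (length (hist (f \<xi>)), xs \<xi>, \<mu> \<xi>))"
    by (rule discrete_rv_map3[OF length_hist_discrete[OF f] xs \<mu>, of "\<lambda>n x m. (n, x, m)"])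
  then have "(\<lambda>\<xi>. (\<lambda>(n, x, m) \<xi>. \<Sum>i<length x. pull \<xi> (n + i) (x ! i) * coef m u (x ! i))
      (length (hist (f \<xi>)), xs \<xi>, \<mu> \<xi>) \<xi>) \<in> borel_measurable \<Omega>"
  proof (rule measurable_discrete_choice)
    fix y
    show "(\<lambda>(n, x, m) \<xi>. \<Sum>i<length x. pull \<xi> (n + i) (x ! i) * coef m u (x ! i)) y \<in> borel_measurable \<Omega>"
      by (cases y) (auto intro!: borel_measurable_sum borel_measurable_times pull_measurable)
  qed
  then have *: "(\<lambda>\<xi>. \<Sum>i<length (xs \<xi>). pull \<xi> (length (hist (f \<xi>)) + i) (xs \<xi> ! i) * coef (\<mu> \<xi>) u (xs \<xi> ! i))
      \<in> borel_measurable \<Omega>" by simp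
  have "(\<lambda>\<xi>. u \<bullet> A.least_squares (\<mu> \<xi>) (observe (pull \<xi>) (length (hist (f \<xi>))) (xs \<xi>))) \<in> borel_measurable \<Omega> \<longleftrightarrow>
    (\<lambda>\<xi>. \<Sum>i<length (xs \<xi>). pull \<xi> (length (hist (f \<xi>)) + i) (xs \<xi> ! i) * coef (\<mu> \<xi>) u (xs \<xi> ! i))
      \<in> borel_measurable \<Omega>"
    by (rule measurable_cong) (rule least_squares_prod[OF xs' u])
  then show ?thesis using * by simp
qed

lemma group_schedule_subset:
  assumes "wf_state s" "g \<in> {-1, 1}" shows "set (group_schedule l g s) \<subseteq> X"
  unfolding group_schedule_def
  by (rule schedule_props(2)) (use group_counts_outside[OF assms] wf_stateD(5)[OF assms] in blast)

lemma group_estimate_measurable: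
  assumes f: "meas_state f" and g: "g \<in> {-1, 1}" and x: "x \<in> X"
  shows "(\<lambda>\<xi>. avec x \<bullet> group_estimate (pull \<xi>) l g (f \<xi>)) \<in> borel_measurable \<Omega>"
  unfolding group_estimate_def
  by (rule least_squares_measurable[OF f group_counts_discrete[OF f g] group_schedule_discrete[OF f g] _ avec_carrier[OF x]])
     (rule group_schedule_subset[OF meas_stateD(1)[OF f] g])

lemma Max_measurable:
  assumes "finite S" "\<And>x. x \<in> S \<Longrightarrow> (\<lambda>\<xi>. m \<xi> x) \<in> borel_measurable M"
  shows "(\<lambda>\<xi>. MAX x\<in>S. (m \<xi> x :: real)) \<in> borel_measurable M"
  using borel_measurable_Max[of S "\<lambda>x \<xi>. m \<xi> x" M] assms by simp

lemma survivors_discrete: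
  assumes f: "meas_state f" and g: "g \<in> {-1, 1}"
  shows "discrete_rv \<Omega> (\<lambda>\<xi>. survivors l (active (f \<xi>) g) (group_estimate (pull \<xi>) l g (f \<xi>)))"
proof (rule discrete_rv_choice[OF meas_stateD(4)[OF f g],
      of "\<lambda>S \<xi>. survivors l S (group_estimate (pull \<xi>) l g (f \<xi>))"])
  fix S assume "S \<in> (\<lambda>\<xi>. active (f \<xi>) g) ` space \<Omega>"
  then have SX: "S \<subseteq> X" and S: "finite S"
    using wf_stateD(5,6)[OF meas_stateD(1)[OF f] g] by auto
  have est: "group_estimate (pull \<xi>) l g (f \<xi>) \<in> carrier_vec (d + 1)" for \<xi>
    unfolding group_estimate_def by (rule carrier_vecI) (rule dim_least_squares)
  have diff: "(avec x' - avec x) \<bullet> group_estimate (pull \<xi>) l g (f \<xi>) =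
      avec x' \<bullet> group_estimate (pull \<xi>) l g (f \<xi>) - avec x \<bullet> group_estimate (pull \<xi>) l g (f \<xi>)"
    if "x \<in> S" "x' \<in> S" for x x' \<xi>
    by (rule minus_scalar_prod_distrib[OF avec_carrier avec_carrier est]) (use that SX in auto)
  show "discrete_rv \<Omega> (\<lambda>\<xi>. survivors l S (group_estimate (pull \<xi>) l g (f \<xi>)))"
    unfolding survivors_def
  proof (rule discrete_rv_Collect[OF S])
    fix x assume x: "x \<in> S"
    have "(\<lambda>\<xi>. MAX x'\<in>S. avec x' \<bullet> group_estimate (pull \<xi>) l g (f \<xi>) - avec x \<bullet> group_estimate (pull \<xi>) l g (f \<xi>))
        \<in> borel_measurable \<Omega>"
      by (intro Max_measurable[OF S] borel_measurable_diff group_estimate_measurable[OF f g]) (use x SX in auto)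
    then show "discrete_rv \<Omega> (\<lambda>\<xi>. (MAX x'\<in>S. (avec x' - avec x) \<bullet> group_estimate (pull \<xi>) l g (f \<xi>)) \<le> 3 * A.eps l)"
      using x by (intro discrete_rv_le borel_measurable_const) (simp add: diff cong: image_cong_simp)
  qed
qed

lemma recorded_group_step: "recorded \<xi> (hist s) \<Longrightarrow> recorded \<xi> (hist (A.group_step (pull \<xi>) l g s))"
  by (cases "group_completes l g s")
     (simp_all add: group_step_complete group_step_incomplete recorded_sample A.spend_all_def)

lemma recorded_bias_step: "recorded \<xi> (hist s) \<Longrightarrow> recorded \<xi> (hist (A.bias_step (pull \<xi>) l s))"
  by (cases "bias_completes l s")
     (simp_all add: bias_step_complete bias_step_incomplete recorded_sample A.spend_all_def)

lemma meas_group_step: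
  assumes f: "meas_state f" and g: "g \<in> {-1, 1}"
  shows "meas_state (\<lambda>\<xi>. A.group_step (pull \<xi>) l g (f \<xi>))"
proof -
  note c = group_completes_discrete[OF f g, of l]
  have best: "discrete_rv \<Omega> (\<lambda>\<xi>. best_action R (hist (f \<xi>)) (active (f \<xi>) g))"
    by (rule best_action_discrete[OF f meas_stateD(4)[OF f g]])
       (use wf_stateD(3,5)[OF meas_stateD(1)[OF f] g] in auto)
  have "discrete_rv \<Omega> (\<lambda>\<xi>. if group_completes l g (f \<xi>) then map fst (hist (f \<xi>)) @ group_schedule l g (f \<xi>)
     else map fst (hist (f \<xi>)) @ replicate (T - length (hist (f \<xi>))) (best_action R (hist (f \<xi>)) (active (f \<xi>) g)))"
    by (intro discrete_rv_If c
        discrete_rv_map2[OF meas_stateD(3)[OF f] group_schedule_discrete[OF f g], of "(@)"]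
        discrete_rv_map3[OF meas_stateD(3)[OF f] length_hist_discrete[OF f] best, of "\<lambda>as n b. as @ replicate (T - n) b"])
  moreover have "discrete_rv \<Omega> (\<lambda>\<xi>. if g' = g \<and> group_completes l g (f \<xi>)
     then survivors l (active (f \<xi>) g) (group_estimate (pull \<xi>) l g (f \<xi>)) else active (f \<xi>) g')"
    if "g' \<in> {-1, 1}" for g'
    by (intro discrete_rv_If discrete_rv_map[OF c, of "\<lambda>b. g' = g \<and> b"] survivors_discrete[OF f g] meas_stateD(4)[OF f that])
  moreover have "(\<lambda>\<xi>. avec x \<bullet> (if z x = g \<and> group_completes l g (f \<xi>)
     then group_estimate (pull \<xi>) l g (f \<xi>) else theta (f \<xi>) (z x))) \<in> borel_measurable \<Omega>" if x: "x \<in> X" for x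
    unfolding if_distrib[of "\<lambda>v. avec x \<bullet> v"]
    by (intro measurable_discrete_If discrete_rv_map[OF c, of "\<lambda>b. z x = g \<and> b"] group_estimate_measurable[OF f g x]
        meas_stateD(5)[OF f x])
  ultimately show ?thesis
    unfolding meas_state_def group_step_fields
    using meas_stateD[OF f] wf_group_step[OF _ g] recorded_group_step by auto
qed

lemma bias_step_fields:
  "map fst (hist (A.bias_step p l s)) = (if bias_completes l s then map fst (hist s) @ bias_schedule l s
     else map fst (hist s) @ replicate (T - length (hist s)) (best_action R (hist s) (candidates s)))"
  "active (A.bias_step p l s) = active s" "theta (A.bias_step p l s) = theta s"
  "best_group (A.bias_step p l s) = (if bias_completes l s then
     (if leads l s (mean_estimate p l s) 1 then 1 else if leads l s (mean_estimate p l s) (-1) then -1 else 0)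
     else best_group s)"
  "x \<in> X \<Longrightarrow> gaps (A.bias_step p l s) x = (if bias_completes l s then (if x \<in> candidates s
        then min 2 ((MAX x'\<in>candidates s. mean_estimate p l s x') - mean_estimate p l s x + 4 * A.eps l)
        else gaps s x) else gaps s x)"
  by (cases "bias_completes l s"; simp add: bias_step_complete bias_step_incomplete)+

lemma Delta_design_measurable:
  assumes f: "meas_state f" and x: "x \<in> X"
  shows "(\<lambda>\<xi>. Delta_design R (hist (f \<xi>)) (gaps (f \<xi>)) x) \<in> borel_measurable \<Omega>"
proof -
  let ?P = "Pi\<^sub>M X (\<lambda>_. restrict_space borel {0<..}) :: (real vec \<Rightarrow> real) measure"
  have ext: "gaps (f \<xi>) = (\<lambda>x\<in>X. gaps (f \<xi>) x)" if "\<xi> \<in> space \<Omega>" for \<xi>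
    using wf_stateD(8)[OF meas_stateD(1)[OF f that]] by (auto simp: PiE_def extensional_def)
  have "(\<lambda>\<xi>. \<lambda>x\<in>X. gaps (f \<xi>) x) \<in> \<Omega> \<rightarrow>\<^sub>M ?P"
  proof (rule measurable_restrict)
    fix i assume i: "i \<in> X"
    have "(\<lambda>\<xi>. gaps (f \<xi>) i) \<in> space \<Omega> \<rightarrow> {0<..}"
      using wf_stateD(8)[OF meas_stateD(1)[OF f]] i by (auto simp: PiE_iff)
    then show "(\<lambda>\<xi>. gaps (f \<xi>) i) \<in> \<Omega> \<rightarrow>\<^sub>M restrict_space borel {0<..}"
      by (rule measurable_restrict_space2) (rule meas_stateD(7)[OF f i])
  qed
  then have g: "(\<lambda>\<xi>. gaps (f \<xi>)) \<in> \<Omega> \<rightarrow>\<^sub>M ?P"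
    by (subst measurable_cong[OF ext])
  have "(\<lambda>\<xi>. Delta_design R (history_of (map fst (hist (f \<xi>))) (rewards_of (map fst (hist (f \<xi>))) \<xi>)) (gaps (f \<xi>)) x)
      \<in> borel_measurable \<Omega>"
  proof (rule measurable_discrete_choice[OF meas_stateD(3)[OF f],
        of "\<lambda>as \<xi>. Delta_design R (history_of as (rewards_of as \<xi>)) (gaps (f \<xi>)) x"])
    fix as assume "as \<in> (\<lambda>\<xi>. map fst (hist (f \<xi>))) ` space \<Omega>"
    then have "set as \<subseteq> X" by (rule actions_in_range[OF f])
    from measurable_compose[OF measurable_Pair[OF rewards_of_measurable g] choice_rules_measurable(3)[OF this x]]
    show "(\<lambda>\<xi>. Delta_design R (history_of as (rewards_of as \<xi>)) (gaps (f \<xi>)) x) \<in> borel_measurable \<Omega>"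
      by simp
  qed
  moreover have "(\<lambda>\<xi>. Delta_design R (hist (f \<xi>)) (gaps (f \<xi>)) x) \<in> borel_measurable \<Omega> \<longleftrightarrow>
      (\<lambda>\<xi>. Delta_design R (history_of (map fst (hist (f \<xi>))) (rewards_of (map fst (hist (f \<xi>))) \<xi>)) (gaps (f \<xi>)) x)
      \<in> borel_measurable \<Omega>"
    by (rule measurable_cong, rule arg_cong[where f = "\<lambda>h. Delta_design R h _ x"],
        rule recorded_eq[OF meas_stateD(2)[OF f]])
  ultimately show ?thesis by simp
qed

text \<open>
  \<open>kappa\<close> is an infimum over an uncountable set. Measurability of \<open>kappa (gaps s)\<close> follows because
  the infimum is attained at the design chosen by the algorithm, which is measurable.
\<close>

lemma kappa_gaps:
  assumes "wf_state s"
  shows "kappa (gaps s) = cost (gaps s) (Delta_design R (hist s) (gaps s))"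
  by (rule Delta_optimal_cost[OF Delta_design_props(1)[OF assms], symmetric])
     (use wf_stateD(8)[OF assms] in \<open>auto simp: PiE_iff less_imp_le\<close>)

lemma bias_counts_discrete:
  assumes f: "meas_state f" shows "discrete_rv \<Omega> (\<lambda>\<xi>. bias_counts l (f \<xi>))"
proof (rule discrete_rv_finite_support[OF finite_X])
  show "bias_counts l (f \<xi>) x = 0" if "\<xi> \<in> space \<Omega>" "x \<notin> X" for \<xi> x
    by (rule bias_counts_outside[OF meas_stateD(1)[OF f that(1)] that(2)])
  show "discrete_rv \<Omega> (\<lambda>\<xi>. bias_counts l (f \<xi>) x)" if "x \<in> X" for x
    unfolding bias_counts_eq
    by (intro discrete_rv_nat_ceiling borel_measurable_times borel_measurable_divide borel_measurable_const
        Delta_design_measurable[OF f that])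
qed

lemma bias_schedule_discrete:
  assumes f: "meas_state f" shows "discrete_rv \<Omega> (\<lambda>\<xi>. bias_schedule l (f \<xi>))"
  unfolding bias_schedule_def
  by (rule schedule_discrete[OF f bias_counts_discrete[OF f]])
     (rule bias_counts_outside[OF meas_stateD(1)[OF f]])

lemma bias_completes_discrete:
  assumes f: "meas_state f" shows "discrete_rv \<Omega> (\<lambda>\<xi>. bias_completes l (f \<xi>))"
proof -
  have "(\<lambda>\<xi>. cost (gaps (f \<xi>)) (Delta_design R (hist (f \<xi>)) (gaps (f \<xi>)))) \<in> borel_measurable \<Omega>"
    unfolding cost_def
    by (intro borel_measurable_sum borel_measurable_times Delta_design_measurable[OF f] meas_stateD(7)[OF f])
  moreover have "(\<lambda>\<xi>. kappa (gaps (f \<xi>))) \<in> borel_measurable \<Omega> \<longleftrightarrow>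
      (\<lambda>\<xi>. cost (gaps (f \<xi>)) (Delta_design R (hist (f \<xi>)) (gaps (f \<xi>)))) \<in> borel_measurable \<Omega>"
    by (rule measurable_cong) (rule kappa_gaps[OF meas_stateD(1)[OF f]])
  ultimately have k: "(\<lambda>\<xi>. kappa (gaps (f \<xi>))) \<in> borel_measurable \<Omega>" by simp
  have "discrete_rv \<Omega> (\<lambda>\<xi>. A.eps l \<le> (kappa (gaps (f \<xi>)) * ln (real T) / real T) powr (1/3))"
    by (intro discrete_rv_le borel_measurable_const powr_real_measurable borel_measurable_divide borel_measurable_times k)
  from discrete_rv_map3[OF this length_hist_discrete[OF f] bias_counts_discrete[OF f, of l],
      of "\<lambda>b n m. \<not> b \<and> n + sum m X \<le> T"]
  show ?thesis unfolding bias_completes_def not_le .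
qed

lemma bias_schedule_subset:
  assumes "wf_state s" shows "set (bias_schedule l s) \<subseteq> X"
  unfolding bias_schedule_def by (rule schedule_props(2)) (rule bias_counts_outside[OF assms])

lemma mean_estimate_measurable:
  assumes f: "meas_state f" and x: "x \<in> X"
  shows "(\<lambda>\<xi>. mean_estimate (pull \<xi>) l (f \<xi>) x) \<in> borel_measurable \<Omega>"
proof -
  have "(\<lambda>\<xi>. bias_estimate (pull \<xi>) l (f \<xi>)) \<in> borel_measurable \<Omega>"
    unfolding bias_estimate_def
    by (rule least_squares_measurable[OF f bias_counts_discrete[OF f] bias_schedule_discrete[OF f]])
       (use bias_schedule_subset[OF meas_stateD(1)[OF f]] in auto)
  then show ?thesis unfolding mean_estimate_def
    by (intro borel_measurable_diff borel_measurable_times borel_measurable_const meas_stateD(5)[OF f x])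
qed

lemma leads_discrete:
  assumes f: "meas_state f" and g: "g \<in> {-1, 1}"
  shows "discrete_rv \<Omega> (\<lambda>\<xi>. leads l (f \<xi>) (mean_estimate (pull \<xi>) l (f \<xi>)) g)"
proof -
  have g': "- g \<in> {-1, 1}" using g by auto
  let ?h = "\<lambda>(S, S') \<xi>. (MAX x\<in>S'. mean_estimate (pull \<xi>) l (f \<xi>) x) + 2 * A.eps l
      \<le> (MAX x\<in>S. mean_estimate (pull \<xi>) l (f \<xi>) x) - 2 * A.eps l"
  have "discrete_rv \<Omega> (\<lambda>\<xi>. (active (f \<xi>) g, active (f \<xi>) (- g)))"
    by (rule discrete_rv_map2[OF meas_stateD(4)[OF f g] meas_stateD(4)[OF f g'], of Pair])
  then have "discrete_rv \<Omega> (\<lambda>\<xi>. ?h (active (f \<xi>) g, active (f \<xi>) (- g)) \<xi>)"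
  proof (rule discrete_rv_choice)
    fix y assume "y \<in> (\<lambda>\<xi>. (active (f \<xi>) g, active (f \<xi>) (- g))) ` space \<Omega>"
    then obtain S S' where y: "y = (S, S')" and S: "S \<subseteq> X" "S' \<subseteq> X" "finite S" "finite S'"
      using wf_stateD(5,6)[OF meas_stateD(1)[OF f] g] wf_stateD(5,6)[OF meas_stateD(1)[OF f] g'] by auto
    show "discrete_rv \<Omega> (?h y)" unfolding y prod.case
      by (intro discrete_rv_le borel_measurable_add borel_measurable_diff borel_measurable_const Max_measurable
          mean_estimate_measurable[OF f]) (use S in auto)
  qed
  then show ?thesis by (simp add: leads_def)
qed

lemma meas_bias_step:
  assumes f: "meas_state f"
  shows "meas_state (\<lambda>\<xi>. A.bias_step (pull \<xi>) l (f \<xi>))"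
proof -
  note c = bias_completes_discrete[OF f, of l]
  have cand: "discrete_rv \<Omega> (\<lambda>\<xi>. candidates (f \<xi>))" unfolding candidates_def
    by (rule discrete_rv_map2[OF meas_stateD(4)[OF f] meas_stateD(4)[OF f], of _ _ "(\<union>)"]) auto
  have best: "discrete_rv \<Omega> (\<lambda>\<xi>. best_action R (hist (f \<xi>)) (candidates (f \<xi>)))"
    by (rule best_action_discrete[OF f cand]) (use candidates_props[OF meas_stateD(1)[OF f]] in auto)
  have "discrete_rv \<Omega> (\<lambda>\<xi>. if bias_completes l (f \<xi>) then map fst (hist (f \<xi>)) @ bias_schedule l (f \<xi>)
     else map fst (hist (f \<xi>)) @ replicate (T - length (hist (f \<xi>))) (best_action R (hist (f \<xi>)) (candidates (f \<xi>))))"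
    by (intro discrete_rv_If c
        discrete_rv_map2[OF meas_stateD(3)[OF f] bias_schedule_discrete[OF f], of "(@)"]
        discrete_rv_map3[OF meas_stateD(3)[OF f] length_hist_discrete[OF f] best, of "\<lambda>as n b. as @ replicate (T - n) b"])
  moreover have "discrete_rv \<Omega> (\<lambda>\<xi>. if bias_completes l (f \<xi>) then
     (if leads l (f \<xi>) (mean_estimate (pull \<xi>) l (f \<xi>)) 1 then 1
      else if leads l (f \<xi>) (mean_estimate (pull \<xi>) l (f \<xi>)) (-1) then -1 else 0)
     else best_group (f \<xi>))"
    by (intro discrete_rv_If c leads_discrete[OF f] discrete_rv_const meas_stateD(6)[OF f]) auto
  moreover have "(\<lambda>\<xi>. if bias_completes l (f \<xi>) then (if x \<in> candidates (f \<xi>)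
        then min 2 ((MAX x'\<in>candidates (f \<xi>). mean_estimate (pull \<xi>) l (f \<xi>) x') -
          mean_estimate (pull \<xi>) l (f \<xi>) x + 4 * A.eps l)
        else gaps (f \<xi>) x) else gaps (f \<xi>) x) \<in> borel_measurable \<Omega>" if x: "x \<in> X" for x
  proof -
    have "(\<lambda>\<xi>. MAX x'\<in>candidates (f \<xi>). mean_estimate (pull \<xi>) l (f \<xi>) x') \<in> borel_measurable \<Omega>"
    proof (rule measurable_discrete_choice[OF cand, of "\<lambda>S \<xi>. MAX x'\<in>S. mean_estimate (pull \<xi>) l (f \<xi>) x'"])
      fix S assume "S \<in> (\<lambda>\<xi>. candidates (f \<xi>)) ` space \<Omega>"
      then have "S \<subseteq> X" "finite S" using candidates_props[OF meas_stateD(1)[OF f]] by auto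
      then show "(\<lambda>\<xi>. MAX x'\<in>S. mean_estimate (pull \<xi>) l (f \<xi>) x') \<in> borel_measurable \<Omega>"
        by (intro Max_measurable mean_estimate_measurable[OF f]) auto
    qed
    then show ?thesis
      by (intro measurable_discrete_If c discrete_rv_map[OF cand, of "\<lambda>S. x \<in> S"] borel_measurable_min
          borel_measurable_add borel_measurable_diff borel_measurable_const mean_estimate_measurable[OF f x]
          meas_stateD(7)[OF f x])
  qed
  ultimately show ?thesis
    unfolding meas_state_def
    using meas_stateD[OF f] wf_bias_step recorded_bias_step by (auto simp: bias_step_fields)
qed

lemma meas_state_cong:
  assumes "\<And>\<xi>. \<xi> \<in> space \<Omega> \<Longrightarrow> f \<xi> = g \<xi>" "meas_state g"
  shows "meas_state f"
proof -
  have d: "discrete_rv \<Omega> (\<lambda>\<xi>. G (f \<xi>)) \<longleftrightarrow> discrete_rv \<Omega> (\<lambda>\<xi>. G (g \<xi>))" for G :: "fpe_state \<Rightarrow> 'b"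
    by (rule discrete_rv_cong) (use assms in simp)
  have m: "(\<lambda>\<xi>. G (f \<xi>)) \<in> borel_measurable \<Omega> \<longleftrightarrow> (\<lambda>\<xi>. G (g \<xi>)) \<in> borel_measurable \<Omega>" for G :: "fpe_state \<Rightarrow> real"
    by (rule measurable_cong) (use assms in simp)
  have d1: "discrete_rv \<Omega> (\<lambda>\<xi>. map fst (hist (f \<xi>))) \<longleftrightarrow> discrete_rv \<Omega> (\<lambda>\<xi>. map fst (hist (g \<xi>)))"
    by (rule discrete_rv_cong) (use assms in simp)
  have d2: "discrete_rv \<Omega> (\<lambda>\<xi>. active (f \<xi>) i) \<longleftrightarrow> discrete_rv \<Omega> (\<lambda>\<xi>. active (g \<xi>) i)" for i
    by (rule discrete_rv_cong) (use assms in simp)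
  have d3: "discrete_rv \<Omega> (\<lambda>\<xi>. best_group (f \<xi>)) \<longleftrightarrow> discrete_rv \<Omega> (\<lambda>\<xi>. best_group (g \<xi>))"
    by (rule discrete_rv_cong) (use assms in simp)
  show ?thesis using assms(2) unfolding meas_state_def d1 d2 d3
    m[of "\<lambda>s. avec _ \<bullet> theta s (z _)"] m[of "\<lambda>s. gaps s _"] using assms(1) by simp
qed

lemma meas_state_If:
  assumes P: "discrete_rv \<Omega> P" and f: "meas_state f" and g: "meas_state g"
  shows "meas_state (\<lambda>\<xi>. if P \<xi> then f \<xi> else g \<xi>)"
proof -
  have "discrete_rv \<Omega> (\<lambda>\<xi>. if P \<xi> then map fst (hist (f \<xi>)) else map fst (hist (g \<xi>)))"
    by (intro discrete_rv_If P meas_stateD(3) f g)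
  moreover have "discrete_rv \<Omega> (\<lambda>\<xi>. if P \<xi> then active (f \<xi>) i else active (g \<xi>) i)" if "i \<in> {-1, 1}" for i
    by (intro discrete_rv_If P meas_stateD(4) f g that)
  moreover have "(\<lambda>\<xi>. if P \<xi> then avec x \<bullet> theta (f \<xi>) (z x) else avec x \<bullet> theta (g \<xi>) (z x)) \<in> borel_measurable \<Omega>"
    if "x \<in> X" for x
    by (intro measurable_discrete_If P meas_stateD(5) f g that)
  moreover have "discrete_rv \<Omega> (\<lambda>\<xi>. if P \<xi> then best_group (f \<xi>) else best_group (g \<xi>))"
    by (intro discrete_rv_If P meas_stateD(6) f g)
  moreover have "(\<lambda>\<xi>. if P \<xi> then gaps (f \<xi>) x else gaps (g \<xi>) x) \<in> borel_measurable \<Omega>" if "x \<in> X" for x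
    by (intro measurable_discrete_If P meas_stateD(7) f g that)
  ultimately show ?thesis
    unfolding meas_state_def if_distrib[of hist] if_distrib[of active] if_distrib[of theta]
      if_distrib[of best_group] if_distrib[of gaps] if_distrib[of "map fst"]
      if_distribR if_distrib[of "\<lambda>v. avec _ \<bullet> v"]
    using meas_stateD(1,2)[OF f] meas_stateD(1,2)[OF g] by auto
qed

text \<open>
  A random group index is split into its two values.
\<close>

lemma meas_group_step_dependent:
  assumes f: "meas_state f" and F: "discrete_rv \<Omega> F" and F': "\<And>\<xi>. \<xi> \<in> space \<Omega> \<Longrightarrow> F \<xi> \<in> {-1, 1}"
  shows "meas_state (\<lambda>\<xi>. A.group_step (pull \<xi>) l (F \<xi>) (f \<xi>))"
proof (rule meas_state_cong)
  show "meas_state (\<lambda>\<xi>. if F \<xi> = 1 then A.group_step (pull \<xi>) l 1 (f \<xi>) else A.group_step (pull \<xi>) l (-1) (f \<xi>))"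
    by (intro meas_state_If meas_group_step f discrete_rv_map[OF F, of "\<lambda>i. i = 1"]) auto
qed (use F' in force)

lemma meas_group_phase:
  assumes f: "meas_state f" shows "meas_state (\<lambda>\<xi>. group_phase (pull \<xi>) l (f \<xi>))"
proof -
  note F = first_group_discrete[OF f]
  have 1: "meas_state (\<lambda>\<xi>. A.group_step (pull \<xi>) l (first_group R (hist (f \<xi>))) (f \<xi>))"
    by (rule meas_group_step_dependent[OF f F first_group])
  have 2: "meas_state (\<lambda>\<xi>. A.group_step (pull \<xi>) l (- first_group R (hist (f \<xi>)))
      (A.group_step (pull \<xi>) l (first_group R (hist (f \<xi>))) (f \<xi>)))"
    by (rule meas_group_step_dependent[OF 1 discrete_rv_map[OF F, of uminus]])
       (use first_group in force)
  \<comment> \<open>The value \<open>1\<close> is a placeholder for runs in which this branch is not taken.\<close>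
  have b: "discrete_rv \<Omega> (\<lambda>\<xi>. if best_group (f \<xi>) = 0 then 1 else best_group (f \<xi>))"
    by (rule discrete_rv_map[OF meas_stateD(6)[OF f], of "\<lambda>b. if b = 0 then 1 else b"])
  have 3: "meas_state (\<lambda>\<xi>. A.group_step (pull \<xi>) l (if best_group (f \<xi>) = 0 then 1 else best_group (f \<xi>)) (f \<xi>))"
    by (rule meas_group_step_dependent[OF f b]) (use wf_stateD(7)[OF meas_stateD(1)[OF f]] in auto)
  have "meas_state (\<lambda>\<xi>. if best_group (f \<xi>) = 0 then A.group_step (pull \<xi>) l (- first_group R (hist (f \<xi>)))
      (A.group_step (pull \<xi>) l (first_group R (hist (f \<xi>))) (f \<xi>))
     else A.group_step (pull \<xi>) l (if best_group (f \<xi>) = 0 then 1 else best_group (f \<xi>)) (f \<xi>))"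
    by (intro meas_state_If 2 3 discrete_rv_map[OF meas_stateD(6)[OF f], of "\<lambda>b. b = 0"])
  then show ?thesis by (rule meas_state_cong[rotated]) (simp add: group_phase_def Let_def)
qed

lemma meas_phase:
  assumes f: "meas_state f" shows "meas_state (\<lambda>\<xi>. A.phase (pull \<xi>) l (f \<xi>))"
proof (rule meas_state_cong)
  note g = meas_group_phase[OF f, of l]
  show "meas_state (\<lambda>\<xi>. if T \<le> length (hist (f \<xi>)) then f \<xi>
    else if best_group (f \<xi>) \<noteq> 0 \<or> T \<le> length (hist (group_phase (pull \<xi>) l (f \<xi>)))
      then group_phase (pull \<xi>) l (f \<xi>)
    else A.bias_step (pull \<xi>) l (group_phase (pull \<xi>) l (f \<xi>)))"
    by (intro meas_state_If f g meas_bias_step discrete_rv_map[OF length_hist_discrete[OF f], of "\<lambda>n. T \<le> n"]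
        discrete_rv_map2[OF meas_stateD(6)[OF f] length_hist_discrete[OF g], of "\<lambda>b n. b \<noteq> 0 \<or> T \<le> n"])
qed (rule phase_eq[OF meas_stateD(1)[OF f]])

lemma meas_init: "meas_state (\<lambda>_. A.init)"
proof -
  have "recorded \<xi> (hist A.init)" for \<xi> by (simp add: recorded_def A.init_def)
  then show ?thesis unfolding meas_state_def using wf_init by (auto intro: discrete_rv_const)
qed

lemma meas_run: "meas_state (\<lambda>\<xi>. A.run (pull \<xi>) n)"
  by (induction n) (auto intro: meas_init meas_phase)

end

section \<open>All estimates are accurate with high probability\<close>

context fpe_setting
begin

text \<open>
  The state in which phase \<open>l\<close> computes the estimate for group \<open>g\<close>; for the group processed second,
  this is the state after the first group stage.
\<close>

definition group_entry :: "(nat \<Rightarrow> real vec \<Rightarrow> real) \<Rightarrow> nat \<Rightarrow> int \<Rightarrow> fpe_state" where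
  "group_entry p l g = (let s = A.run p (l - 1); f = first_group R (hist s) in
     if best_group s = 0 \<and> g \<noteq> f then A.group_step p l f s else s)"

definition bias_entry :: "(nat \<Rightarrow> real vec \<Rightarrow> real) \<Rightarrow> nat \<Rightarrow> fpe_state" where
  "bias_entry p l = group_phase p l (A.run p (l - 1))"

definition stage_coef :: "nat \<Rightarrow> real vec list \<Rightarrow> (real vec \<Rightarrow> nat) \<Rightarrow> real vec \<Rightarrow> nat \<Rightarrow> real" where
  "stage_coef n xs \<mu> u t = (if n \<le> t \<and> t < n + length xs then coef \<mu> u (xs ! (t - n)) else 0)"

text \<open>
  The coefficients of the noise in the error of the estimate for \<open>x\<close>, as a function of the states \<open>r\<close> at
  the start of the phase and \<open>s\<close> at the start of the stage. They are set to \<open>0\<close> if the estimate is not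
  computed, so that the sum of their squares is bounded on the whole space.
\<close>

definition group_coef :: "nat \<Rightarrow> real vec \<Rightarrow> nat \<Rightarrow> fpe_state \<Rightarrow> fpe_state \<Rightarrow> real" where
  "group_coef l x t r s = (if (length (hist r) < T \<and> z x \<noteq> - best_group r) \<and> group_completes l (z x) s \<and> x \<in> active s (z x)
     then stage_coef (length (hist s)) (group_schedule l (z x) s) (group_counts l (z x) s) (avec x) t else 0)"

definition bias_coef :: "nat \<Rightarrow> nat \<Rightarrow> fpe_state \<Rightarrow> fpe_state \<Rightarrow> real" where
  "bias_coef l t r s = (if (length (hist r) < T \<and> best_group r = 0 \<and> length (hist s) < T) \<and> bias_completes l s
     then stage_coef (length (hist s)) (bias_schedule l s) (bias_counts l s) e_last t else 0)"

lemma sum_shifted_window: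
  fixes F :: "nat \<Rightarrow> nat \<Rightarrow> real"
  assumes "n + m \<le> T"
  shows "(\<Sum>t<T. if n \<le> t \<and> t < n + m then F (t - n) t else 0) = (\<Sum>i<m. F i (n + i))"
proof -
  have "(\<Sum>t<T. if n \<le> t \<and> t < n + m then F (t - n) t else 0) = (\<Sum>t\<in>{n..<n + m}. F (t - n) t)"
    using assms by (intro sum.mono_neutral_cong_right) auto
  also have "\<dots> = (\<Sum>i<m. F i (n + i))"
    by (rule sum.reindex_bij_witness[of _ "\<lambda>i. n + i" "\<lambda>t. t - n"]) auto
  finally show ?thesis .
qed

lemma sum_stage_coef:
  assumes "n + length xs \<le> T"
  shows "(\<Sum>t<T. stage_coef n xs \<mu> u t * \<xi> t) = (\<Sum>i<length xs. coef \<mu> u (xs ! i) * \<xi> (n + i))"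
    "(\<Sum>t<T. (stage_coef n xs \<mu> u t)\<^sup>2) = (\<Sum>i<length xs. (coef \<mu> u (xs ! i))\<^sup>2)"
proof -
  have "(\<Sum>t<T. stage_coef n xs \<mu> u t * \<xi> t) =
      (\<Sum>t<T. if n \<le> t \<and> t < n + length xs then coef \<mu> u (xs ! (t - n)) * \<xi> t else 0)"
    by (intro sum.cong) (auto simp: stage_coef_def)
  then show "(\<Sum>t<T. stage_coef n xs \<mu> u t * \<xi> t) = (\<Sum>i<length xs. coef \<mu> u (xs ! i) * \<xi> (n + i))"
    using sum_shifted_window[OF assms, of "\<lambda>i t. coef \<mu> u (xs ! i) * \<xi> t"] by simp
  have "(\<Sum>t<T. (stage_coef n xs \<mu> u t)\<^sup>2) =
      (\<Sum>t<T. if n \<le> t \<and> t < n + length xs then (coef \<mu> u (xs ! (t - n)))\<^sup>2 else 0)"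
    by (intro sum.cong) (auto simp: stage_coef_def)
  then show "(\<Sum>t<T. (stage_coef n xs \<mu> u t)\<^sup>2) = (\<Sum>i<length xs. (coef \<mu> u (xs ! i))\<^sup>2)"
    using sum_shifted_window[OF assms, of "\<lambda>i t. (coef \<mu> u (xs ! i))\<^sup>2"] by simp
qed

lemma group_stage_props:
  assumes wf: "wf_state s" and g: "g \<in> {-1, 1}" and c: "group_completes l g s"
  shows "length (hist s) + length (group_schedule l g s) \<le> T" "set (group_schedule l g s) \<subseteq> X"
    "count_list (group_schedule l g s) x = group_counts l g s x"
proof -
  have out: "group_counts l g s x = 0" if "x \<notin> X" for x
    using group_counts_outside[OF wf g] wf_stateD(5)[OF wf g] that by blast
  note sch = schedule_props[of "group_counts l g s", OF out]
  show "length (hist s) + length (group_schedule l g s) \<le> T" "set (group_schedule l g s) \<subseteq> X"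
    "count_list (group_schedule l g s) x = group_counts l g s x"
    using c sch group_counts_sum[OF wf g] by (simp_all add: group_completes_def group_schedule_def)
qed

lemma bias_stage_props:
  assumes wf: "wf_state s" and c: "bias_completes l s"
  shows "length (hist s) + length (bias_schedule l s) \<le> T" "set (bias_schedule l s) \<subseteq> X"
    "count_list (bias_schedule l s) x = bias_counts l s x"
proof -
  note sch = schedule_props[of "bias_counts l s", OF bias_counts_outside[OF wf]]
  show "length (hist s) + length (bias_schedule l s) \<le> T" "set (bias_schedule l s) \<subseteq> X"
    "count_list (bias_schedule l s) x = bias_counts l s x"
    using c sch by (simp_all add: bias_completes_def bias_schedule_def)
qed

lemma wf_group_entry: "wf_state (group_entry p l g)"
  using wf_run first_group by (auto simp: group_entry_def Let_def intro!: wf_group_step)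

lemma wf_bias_entry: "wf_state (bias_entry p l)"
  unfolding bias_entry_def by (rule wf_group_phase[OF wf_run])

lemma group_coef_error:
  assumes x: "x \<in> X" and wf: "wf_state s" and c: "group_completes l (z x) s" "x \<in> active s (z x)"
    and r: "length (hist r) < T" "z x \<noteq> - best_group r" and l: "1 \<le> l"
  shows "(\<Sum>t<T. group_coef l x t r s * \<xi> t) = avec x \<bullet> group_estimate (pull \<xi>) l (z x) s - avec x \<bullet> theta_star"
proof -
  have g: "z x \<in> {-1, 1}" by (rule groups[OF x])
  note st = group_stage_props[OF wf g c(1)]
  have "(\<Sum>t<T. group_coef l x t r s * \<xi> t) =
      (\<Sum>i<length (group_schedule l (z x) s). coef (group_counts l (z x) s) (avec x) (group_schedule l (z x) s ! i) * \<xi> (length (hist s) + i))"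
    using c r sum_stage_coef(1)[OF st(1)] by (simp add: group_coef_def)
  also have "\<dots> = avec x \<bullet> group_estimate (pull \<xi>) l (z x) s - avec x \<bullet> theta_star"
    unfolding group_estimate_def
    by (rule least_squares_error[OF st(2) st(3) avec_carrier[OF x] group_variance(1)[OF wf g l c(2)], symmetric])
  finally show ?thesis .
qed

lemma bias_coef_error:
  assumes wf: "wf_state s" and c: "bias_completes l s"
    and r: "length (hist r) < T" "best_group r = 0" "length (hist s) < T" and l: "1 \<le> l"
  shows "(\<Sum>t<T. bias_coef l t r s * \<xi> t) = bias_estimate (pull \<xi>) l s - \<omega>"
proof -
  note st = bias_stage_props[OF wf c]
  have e: "e_last \<in> carrier_vec (d + 1)" by simp
  have "(\<Sum>t<T. bias_coef l t r s * \<xi> t) =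
      (\<Sum>i<length (bias_schedule l s). coef (bias_counts l s) e_last (bias_schedule l s ! i) * \<xi> (length (hist s) + i))"
    using c r sum_stage_coef(1)[OF st(1)] by (simp add: bias_coef_def)
  also have "\<dots> = bias_estimate (pull \<xi>) l s - e_last \<bullet> theta_star"
    unfolding bias_estimate_def
    by (rule least_squares_error[OF st(2) st(3) e bias_variance(1)[OF wf l], symmetric])
  also have "e_last \<bullet> theta_star = \<omega>"
    using gamma_dim theta_star_carrier by (simp add: theta_star_def)
  finally show ?thesis .
qed

lemma group_coef_square:
  assumes x: "x \<in> X" and wf: "wf_state s" and l: "1 \<le> l"
  shows "(\<Sum>t<T. (group_coef l x t r s)\<^sup>2) \<le> (A.eps l)\<^sup>2 / (2 * group_log l)"
proof (cases "(length (hist r) < T \<and> z x \<noteq> - best_group r) \<and> group_completes l (z x) s \<and> x \<in> active s (z x)")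
  case True
  have g: "z x \<in> {-1, 1}" by (rule groups[OF x])
  have c: "group_completes l (z x) s" "x \<in> active s (z x)" using True by auto
  note st = group_stage_props[OF wf g c(1)]
  have "(\<Sum>t<T. (group_coef l x t r s)\<^sup>2) =
      (\<Sum>i<length (group_schedule l (z x) s). (coef (group_counts l (z x) s) (avec x) (group_schedule l (z x) s ! i))\<^sup>2)"
    using True sum_stage_coef(2)[OF st(1)] by (simp add: group_coef_def)
  also have "\<dots> = variance (\<lambda>y. real (group_counts l (z x) s y)) (avec x)"
    by (rule sum_coef_square[where \<mu> = "group_counts l (z x) s", OF st(2) st(3) group_variance(1)[OF wf g l c(2)]])
  also have "\<dots> \<le> (A.eps l)\<^sup>2 / (2 * group_log l)" by (rule group_variance(2)[OF wf g l c(2)])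
  finally show ?thesis .
next
  case False
  then have "group_coef l x t r s = 0" for t by (simp only: group_coef_def if_False)
  then show ?thesis using group_log_ge_1[OF l] by simp
qed

lemma bias_coef_square:
  assumes wf: "wf_state s" and l: "1 \<le> l"
  shows "(\<Sum>t<T. (bias_coef l t r s)\<^sup>2) \<le> (A.eps l)\<^sup>2 / (2 * bias_log l)"
proof (cases "(length (hist r) < T \<and> best_group r = 0 \<and> length (hist s) < T) \<and> bias_completes l s")
  case True
  have c: "bias_completes l s" using True by auto
  note st = bias_stage_props[OF wf c]
  have "(\<Sum>t<T. (bias_coef l t r s)\<^sup>2) =
      (\<Sum>i<length (bias_schedule l s). (coef (bias_counts l s) e_last (bias_schedule l s ! i))\<^sup>2)"
    using True sum_stage_coef(2)[OF st(1)] by (simp add: bias_coef_def)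
  also have "\<dots> = variance (\<lambda>x. real (bias_counts l s x)) e_last"
    by (rule sum_coef_square[where \<mu> = "bias_counts l s", OF st(2) st(3) bias_variance(1)[OF wf l]])
  also have "\<dots> \<le> (A.eps l)\<^sup>2 / (2 * bias_log l)" by (rule bias_variance(2)[OF wf l])
  finally show ?thesis .
next
  case False
  then have "bias_coef l t r s = 0" for t by (simp only: bias_coef_def if_False)
  then show ?thesis using bias_log_pos[OF l] by simp
qed

lemma length_run_le_entry:
  "length (hist (A.run p (l - 1))) \<le> length (hist (group_entry p l g))"
  "length (hist (A.run p (l - 1))) \<le> length (hist (bias_entry p l))"
  using causal_stepD(1)[OF causal_group_step] causal_stepD(1)[OF causal_group_phase]
  by (auto simp: group_entry_def bias_entry_def Let_def)

lemma causal_group_entry: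
  assumes a: "agree t p p'" and t: "length (hist (group_entry p l g)) \<le> t"
  shows "A.run p' (l - 1) = A.run p (l - 1)" "group_entry p' l g = group_entry p l g"
proof -
  have "length (hist (A.run p (l - 1))) \<le> t" using t length_run_le_entry(1)[of p l g] by linarith
  then show run: "A.run p' (l - 1) = A.run p (l - 1)" by (rule causal_run[OF a])
  show "group_entry p' l g = group_entry p l g"
    using t unfolding group_entry_def run Let_def
    by (auto intro!: causal_stepD(2)[OF causal_group_step a] split: if_splits)
qed

lemma causal_bias_entry:
  assumes a: "agree t p p'" and t: "length (hist (bias_entry p l)) \<le> t"
  shows "A.run p' (l - 1) = A.run p (l - 1)" "bias_entry p' l = bias_entry p l"
proof -
  have "length (hist (A.run p (l - 1))) \<le> t" using t length_run_le_entry(2)[of p l] by linarith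
  then show run: "A.run p' (l - 1) = A.run p (l - 1)" by (rule causal_run[OF a])
  show "bias_entry p' l = bias_entry p l"
    using t unfolding bias_entry_def run by (rule causal_stepD(2)[OF causal_group_phase a])
qed

lemma group_coef_early: "t < length (hist s) \<Longrightarrow> group_coef l x t r s = 0"
  by (simp add: group_coef_def stage_coef_def)

lemma bias_coef_early: "t < length (hist s) \<Longrightarrow> bias_coef l t r s = 0"
  by (simp add: bias_coef_def stage_coef_def)

text \<open>
  The coefficient of \<open>\<xi> t\<close> vanishes unless the stage starts at or before round \<open>t\<close>. In that case the
  state at its start, and with it the schedule and all coefficients, is determined by the noise before
  round \<open>t\<close>. If the stage starts at or before \<open>t\<close> for one of two noise vectors that agree before \<open>t\<close>,
  causality carries its start over to the other one.
\<close>

lemma group_coef_predictable: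
  assumes a: "agree t p p'"
  shows "group_coef l x t (A.run p (l - 1)) (group_entry p l (z x)) =
    group_coef l x t (A.run p' (l - 1)) (group_entry p' l (z x))"
proof (cases "length (hist (group_entry p l (z x))) \<le> t \<or> length (hist (group_entry p' l (z x))) \<le> t")
  case True
  then show ?thesis
    using causal_group_entry[OF a] causal_group_entry[OF agree_sym[OF a]] by metis
next
  case False
  then show ?thesis by (simp add: group_coef_early)
qed

lemma bias_coef_predictable:
  assumes a: "agree t p p'"
  shows "bias_coef l t (A.run p (l - 1)) (bias_entry p l) = bias_coef l t (A.run p' (l - 1)) (bias_entry p' l)"
proof (cases "length (hist (bias_entry p l)) \<le> t \<or> length (hist (bias_entry p' l)) \<le> t")
  case True
  then show ?thesis
    using causal_bias_entry[OF a] causal_bias_entry[OF agree_sym[OF a]] by metis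
next
  case False
  then show ?thesis by (simp add: bias_coef_early)
qed

lemma pull_agree: "\<forall>i<t. \<xi> i = \<xi>' i \<Longrightarrow> agree t (pull \<xi>) (pull \<xi>')"
  by (auto simp: agree_def reward_def fun_eq_iff)

end

context fpe_measurable
begin

lemma meas_group_entry:
  assumes g: "g \<in> {-1, 1}" shows "meas_state (\<lambda>\<xi>. group_entry (pull \<xi>) l g)"
proof -
  note r = meas_run[of "l - 1"]
  note F = first_group_discrete[OF r]
  have "meas_state (\<lambda>\<xi>. A.group_step (pull \<xi>) l (first_group R (hist (A.run (pull \<xi>) (l - 1)))) (A.run (pull \<xi>) (l - 1)))"
    by (rule meas_group_step_dependent[OF r F first_group])
  then have "meas_state (\<lambda>\<xi>. if best_group (A.run (pull \<xi>) (l - 1)) = 0 \<and> g \<noteq> first_group R (hist (A.run (pull \<xi>) (l - 1)))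
      then A.group_step (pull \<xi>) l (first_group R (hist (A.run (pull \<xi>) (l - 1)))) (A.run (pull \<xi>) (l - 1))
      else A.run (pull \<xi>) (l - 1))"
    by (intro meas_state_If r discrete_rv_map2[OF meas_stateD(6)[OF r] F, of "\<lambda>b f. b = 0 \<and> g \<noteq> f"])
  then show ?thesis by (simp only: group_entry_def Let_def)
qed

lemma meas_bias_entry: "meas_state (\<lambda>\<xi>. bias_entry (pull \<xi>) l)"
  unfolding bias_entry_def by (rule meas_group_phase[OF meas_run])

lemma group_coef_measurable:
  assumes x: "x \<in> X"
  shows "(\<lambda>\<xi>. group_coef l x t (A.run (pull \<xi>) (l - 1)) (group_entry (pull \<xi>) l (z x))) \<in> borel_measurable \<Omega>"
proof -
  have g: "z x \<in> {-1, 1}" by (rule groups[OF x])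
  note r = meas_run[of "l - 1"] and s = meas_group_entry[OF g, of l]
  have c1: "discrete_rv \<Omega> (\<lambda>\<xi>. length (hist (A.run (pull \<xi>) (l - 1))) < T \<and> z x \<noteq> - best_group (A.run (pull \<xi>) (l - 1)))"
    by (rule discrete_rv_map2[OF length_hist_discrete[OF r] meas_stateD(6)[OF r], of "\<lambda>n b. n < T \<and> z x \<noteq> - b"])
  have c2: "discrete_rv \<Omega> (\<lambda>\<xi>. group_completes l (z x) (group_entry (pull \<xi>) l (z x)) \<and> x \<in> active (group_entry (pull \<xi>) l (z x)) (z x))"
    by (rule discrete_rv_map2[OF group_completes_discrete[OF s g] meas_stateD(4)[OF s g], of "\<lambda>b S. b \<and> x \<in> S"])
  have v: "discrete_rv \<Omega> (\<lambda>\<xi>. stage_coef (length (hist (group_entry (pull \<xi>) l (z x)))) (group_schedule l (z x) (group_entry (pull \<xi>) l (z x)))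
      (group_counts l (z x) (group_entry (pull \<xi>) l (z x))) (avec x) t)"
    by (rule discrete_rv_map3[OF length_hist_discrete[OF s] group_schedule_discrete[OF s g] group_counts_discrete[OF s g],
          of "\<lambda>n xs m. stage_coef n xs m (avec x) t"])
  show ?thesis
    unfolding group_coef_def
    by (rule discrete_rv_measurable)
       (rule discrete_rv_If[OF discrete_rv_map2[OF c1 c2, of "(\<and>)"] v discrete_rv_const])
qed

lemma bias_coef_measurable:
  "(\<lambda>\<xi>. bias_coef l t (A.run (pull \<xi>) (l - 1)) (bias_entry (pull \<xi>) l)) \<in> borel_measurable \<Omega>"
proof -
  note r = meas_run[of "l - 1"] and s = meas_bias_entry[of l]
  have c1: "discrete_rv \<Omega> (\<lambda>\<xi>. length (hist (A.run (pull \<xi>) (l - 1))) < T \<and> best_group (A.run (pull \<xi>) (l - 1)) = 0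
      \<and> length (hist (bias_entry (pull \<xi>) l)) < T)"
    by (rule discrete_rv_map3[OF length_hist_discrete[OF r] meas_stateD(6)[OF r] length_hist_discrete[OF s],
          of "\<lambda>n b m. n < T \<and> b = 0 \<and> m < T"])
  have v: "discrete_rv \<Omega> (\<lambda>\<xi>. stage_coef (length (hist (bias_entry (pull \<xi>) l))) (bias_schedule l (bias_entry (pull \<xi>) l))
      (bias_counts l (bias_entry (pull \<xi>) l)) e_last t)"
    by (rule discrete_rv_map3[OF length_hist_discrete[OF s] bias_schedule_discrete[OF s] bias_counts_discrete[OF s],
          of "\<lambda>n xs m. stage_coef n xs m e_last t"])
  show ?thesis
    unfolding bias_coef_def
    by (rule discrete_rv_measurable)
       (rule discrete_rv_If[OF discrete_rv_map2[OF c1 bias_completes_discrete[OF s], of "(\<and>)"] v discrete_rv_const])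
qed

definition group_failure :: "nat \<Rightarrow> real vec \<Rightarrow> (nat \<Rightarrow> real) set" where
  "group_failure l x = {\<xi> \<in> space \<Omega>. A.eps l \<le>
     \<bar>\<Sum>t<T. group_coef l x t (A.run (pull \<xi>) (l - 1)) (group_entry (pull \<xi>) l (z x)) * \<xi> t\<bar>}"

definition bias_failure :: "nat \<Rightarrow> (nat \<Rightarrow> real) set" where
  "bias_failure l = {\<xi> \<in> space \<Omega>. A.eps l \<le>
     \<bar>\<Sum>t<T. bias_coef l t (A.run (pull \<xi>) (l - 1)) (bias_entry (pull \<xi>) l) * \<xi> t\<bar>}"

text \<open>
  With variance at most \<open>(eps l)\<^sup>2 / (2 * group_log l)\<close>, the tail at \<open>eps l\<close> is
  \<open>2 * exp (- group_log l)\<close>.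
\<close>

lemma group_failure_prob:
  assumes x: "x \<in> X" and l: "1 \<le> l"
  shows "group_failure l x \<in> sets \<Omega>"
    "measure \<Omega> (group_failure l x) \<le> 2 / (real (card X) * real l * real (l + 1) * real T)"
proof -
  interpret predictable_coefficients T
    "\<lambda>t \<xi>. group_coef l x t (A.run (pull \<xi>) (l - 1)) (group_entry (pull \<xi>) l (z x))"
    by standard (rule group_coef_measurable[OF x], rule group_coef_predictable, rule pull_agree)
  let ?s = "(A.eps l)\<^sup>2 / (2 * group_log l)"
  have s: "0 < ?s" using eps_pos[of l] group_log_ge_1[OF l] by simp
  note t = two_sided_tail[OF group_coef_square[OF x wf_group_entry l] s eps_pos[of l]]
  show "group_failure l x \<in> sets \<Omega>" unfolding group_failure_def by (rule t(1))
  have "measure \<Omega> (group_failure l x) \<le> 2 * exp (- (A.eps l)\<^sup>2 / (2 * ?s))"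
    unfolding group_failure_def by (rule t(2))
  also have "- (A.eps l)\<^sup>2 / (2 * ?s) = - group_log l"
    using eps_pos[of l] group_log_ge_1[OF l] by (simp add: field_simps)
  also have "exp (- group_log l) = 1 / (real (card X) * real l * real (l + 1) * real T)"
    using log_argument_ge(2)[OF l] unfolding exp_minus group_log_def by (subst exp_ln) (simp_all add: inverse_eq_divide)
  finally show "measure \<Omega> (group_failure l x) \<le> 2 / (real (card X) * real l * real (l + 1) * real T)"
    by simp
qed

lemma bias_failure_prob:
  assumes l: "1 \<le> l"
  shows "bias_failure l \<in> sets \<Omega>" "measure \<Omega> (bias_failure l) \<le> 2 / (real l * real (l + 1) * real T)"
proof -
  interpret predictable_coefficients T
    "\<lambda>t \<xi>. bias_coef l t (A.run (pull \<xi>) (l - 1)) (bias_entry (pull \<xi>) l)"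
    by standard (rule bias_coef_measurable, rule bias_coef_predictable, rule pull_agree)
  let ?s = "(A.eps l)\<^sup>2 / (2 * bias_log l)"
  have s: "0 < ?s" using eps_pos[of l] bias_log_pos[OF l] by simp
  note t = two_sided_tail[OF bias_coef_square[OF wf_bias_entry l] s eps_pos[of l]]
  show "bias_failure l \<in> sets \<Omega>" unfolding bias_failure_def by (rule t(1))
  have "measure \<Omega> (bias_failure l) \<le> 2 * exp (- (A.eps l)\<^sup>2 / (2 * ?s))"
    unfolding bias_failure_def by (rule t(2))
  also have "- (A.eps l)\<^sup>2 / (2 * ?s) = - bias_log l"
    using eps_pos[of l] bias_log_pos[OF l] by (simp add: field_simps)
  also have "exp (- bias_log l) = 1 / (real l * real (l + 1) * real T)"
    using log_argument_ge(1)[OF l] unfolding exp_minus bias_log_def by (subst exp_ln) (simp_all add: inverse_eq_divide)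
  finally show "measure \<Omega> (bias_failure l) \<le> 2 / (real l * real (l + 1) * real T)" by simp
qed

definition failure :: "(nat \<Rightarrow> real) set" where
  "failure = (\<Union>l\<in>{1..T}. (\<Union>x\<in>X. group_failure l x) \<union> bias_failure l)"

lemma sum_telescope: "(\<Sum>l=1..n. 1 / (real l * real (l + 1))) = 1 - 1 / real (n + 1)"
proof (induction n)
  case (Suc n)
  have "1 / (real (Suc n) * real (Suc n + 1)) = 1 / real (n + 1) - 1 / real (Suc n + 1)"
    by (simp add: field_simps)
  then show ?case using Suc by simp
qed simp

text \<open>
  The sum over \<open>x\<close> cancels the factor \<open>k\<close>, and the sum of \<open>1 / (l * (l + 1))\<close> telescopes. Only the
  phases up to \<open>T\<close> matter.
\<close>

lemma failure_prob:
  shows "failure \<in> sets \<Omega>" "measure \<Omega> failure \<le> 4 / real T"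
proof -
  interpret P: prob_space \<Omega> by (rule prob_space_noise)
  have T0: "0 < real T" using T_ge_2 by simp
  have k0: "0 < real (card X)" using card_X_ge_2 by simp
  have s1: "(\<Union>x\<in>X. group_failure l x) \<in> sets \<Omega>" if "1 \<le> l" for l
    by (rule sets.finite_UN[OF finite_X group_failure_prob(1)]) (use that in auto)
  have s2: "(\<Union>x\<in>X. group_failure l x) \<union> bias_failure l \<in> sets \<Omega>" if "1 \<le> l" for l
    by (rule sets.Un[OF s1[OF that] bias_failure_prob(1)[OF that]])
  show "failure \<in> sets \<Omega>" unfolding failure_def by (rule sets.finite_UN) (use s2 in auto)
  have m: "measure \<Omega> ((\<Union>x\<in>X. group_failure l x) \<union> bias_failure l) \<le> 4 / real T * (1 / (real l * real (l + 1)))"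
    if l: "1 \<le> l" for l
  proof -
    have "measure \<Omega> (\<Union>x\<in>X. group_failure l x) \<le> (\<Sum>x\<in>X. measure \<Omega> (group_failure l x))"
      by (rule measure_UNION_le[OF finite_X group_failure_prob(1)[OF _ l]])
    also have "\<dots> \<le> (\<Sum>x\<in>X. 2 / (real (card X) * real l * real (l + 1) * real T))"
      by (rule sum_mono) (rule group_failure_prob(2)[OF _ l])
    also have "\<dots> = 2 / (real l * real (l + 1) * real T)" using k0 by simp
    finally have "measure \<Omega> (\<Union>x\<in>X. group_failure l x) \<le> 2 / (real l * real (l + 1) * real T)" .
    then have "measure \<Omega> ((\<Union>x\<in>X. group_failure l x) \<union> bias_failure l) \<le>
        2 / (real l * real (l + 1) * real T) + 2 / (real l * real (l + 1) * real T)"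
      using measure_Un_le[OF s1[OF l] bias_failure_prob(1)[OF l]] bias_failure_prob(2)[OF l] by linarith
    then show ?thesis by (simp add: mult_ac)
  qed
  have "measure \<Omega> failure \<le> (\<Sum>l\<in>{1..T}. measure \<Omega> ((\<Union>x\<in>X. group_failure l x) \<union> bias_failure l))"
    unfolding failure_def by (rule measure_UNION_le) (use s2 in auto)
  also have "\<dots> \<le> (\<Sum>l=1..T. 4 / real T * (1 / (real l * real (l + 1))))"
    by (rule sum_mono) (use m in auto)
  also have "\<dots> = 4 / real T * (1 - 1 / real (T + 1))"
    unfolding sum_distrib_left[symmetric] sum_telescope ..
  also have "\<dots> \<le> 4 / real T * 1" using T0 by (intro mult_left_mono) auto
  finally show "measure \<Omega> failure \<le> 4 / real T" by simp
qed

lemma accurate_outside_failure: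
  assumes \<xi>: "\<xi> \<in> space \<Omega>" "\<xi> \<notin> failure" and l: "1 \<le> l" "l \<le> T"
    and len: "length (hist (A.run (pull \<xi>) (l - 1))) < T"
  shows "accurate_phase (pull \<xi>) l (A.run (pull \<xi>) (l - 1))"
proof -
  let ?r = "A.run (pull \<xi>) (l - 1)"
  have grp: "accurate_group (pull \<xi>) l g (group_entry (pull \<xi>) l g)"
    if g: "g \<in> {-1, 1}" "g \<noteq> - best_group ?r" for g
    unfolding accurate_group_def
  proof (intro impI ballI)
    fix x assume c: "group_completes l g (group_entry (pull \<xi>) l g)" and x: "x \<in> active (group_entry (pull \<xi>) l g) g"
    have xX: "x \<in> X" and zx: "z x = g" using wf_stateD(4)[OF wf_group_entry g(1)] x by auto
    have "\<xi> \<notin> group_failure l x" using \<xi> l xX by (auto simp: failure_def)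
    then have "\<bar>\<Sum>t<T. group_coef l x t ?r (group_entry (pull \<xi>) l (z x)) * \<xi> t\<bar> < A.eps l"
      using \<xi> by (simp add: group_failure_def not_le)
    moreover have "(\<Sum>t<T. group_coef l x t ?r (group_entry (pull \<xi>) l (z x)) * \<xi> t) =
        avec x \<bullet> group_estimate (pull \<xi>) l (z x) (group_entry (pull \<xi>) l (z x)) - avec x \<bullet> theta_star"
      by (rule group_coef_error[OF xX wf_group_entry]) (use c x zx len g(2) l(1) in simp_all)
    ultimately show "\<bar>avec x \<bullet> group_estimate (pull \<xi>) l g (group_entry (pull \<xi>) l g) - avec x \<bullet> theta_star\<bar> \<le> A.eps l"
      using zx by simp
  qed
  have bias: "\<bar>bias_estimate (pull \<xi>) l (bias_entry (pull \<xi>) l) - \<omega>\<bar> \<le> A.eps l"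
    if "best_group ?r = 0" "length (hist (bias_entry (pull \<xi>) l)) < T" "bias_completes l (bias_entry (pull \<xi>) l)"
  proof -
    have "\<xi> \<notin> bias_failure l" using \<xi> l by (auto simp: failure_def)
    then have "\<bar>\<Sum>t<T. bias_coef l t ?r (bias_entry (pull \<xi>) l) * \<xi> t\<bar> < A.eps l"
      using \<xi> by (simp add: bias_failure_def not_le)
    then show ?thesis
      unfolding bias_coef_error[OF wf_bias_entry that(3) len that(1,2) l(1)] by simp
  qed
  let ?f = "first_group R (hist ?r)"
  have f: "?f \<in> {-1, 1}" "- ?f \<in> {-1, 1}" "?f \<noteq> 0" "- ?f \<noteq> ?f" using first_group[of "hist ?r"] by auto
  show ?thesis
  proof (cases "best_group ?r = 0")
    case True
    have "group_entry (pull \<xi>) l ?f = ?r" "group_entry (pull \<xi>) l (- ?f) = A.group_step (pull \<xi>) l ?f ?r"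
      using True f by (simp_all add: group_entry_def Let_def)
    then show ?thesis
      using True grp[of ?f] grp[of "- ?f"] f bias by (simp add: accurate_phase_def bias_entry_def)
  next
    case False
    then have b: "best_group ?r \<in> {-1, 1}" using wf_stateD(7)[OF wf_run, of "pull \<xi>" "l - 1"] by auto
    have "group_entry (pull \<xi>) l (best_group ?r) = ?r" using False by (simp add: group_entry_def Let_def)
    then show ?thesis using False grp[OF b] b by (auto simp: accurate_phase_def)
  qed
qed

section \<open>The expected regret\<close>

lemma sum_actions_eq_history_regret:
  "(\<Sum>t<T. (MAX x\<in>X. x \<bullet> \<gamma>) - A.action p t \<bullet> \<gamma>) = history_regret (hist (A.run p T))"
proof -
  have "history_regret (hist (A.run p T)) = (\<Sum>t<T. gap (map fst (hist (A.run p T)) ! t))"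
    unfolding history_regret_def by (simp add: sum_list_sum_nth lessThan_atLeast0 length_final_run)
  also have "\<dots> = (\<Sum>t<T. (MAX x\<in>X. x \<bullet> \<gamma>) - A.action p t \<bullet> \<gamma>)"
    by (intro sum.cong refl) (simp add: gap_def A.action_def length_final_run)
  finally show ?thesis by simp
qed

lemma history_regret_run_le: "history_regret (hist (A.run p T)) \<le> 2 * real T"
proof -
  have sub: "fst ` set (hist (A.run p T)) \<subseteq> X" by (rule wf_stateD(2)[OF wf_run])
  have "history_regret h \<le> 2 * real (length h)" if "fst ` set h \<subseteq> X" for h :: history
    using that
  proof (induction h)
    case (Cons a h)
    then have "gap (fst a) \<le> 2" by (intro gap_le_2) auto
    then show ?case using Cons by (simp add: history_regret_def)
  qed (simp add: history_regret_def)
  from this[OF sub] show ?thesis by (simp add: length_final_run)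
qed

lemma final_bound_nonneg: "0 \<le> final_bound"
  unfolding final_bound_def using support_bound_nonneg sqrt_term_nonneg main_term_nonneg ln_T_ge by simp

text \<open>
  The regret is at most \<open>2 * T\<close> on the failure event of probability \<open>4 / T\<close>, which adds the constant
  \<open>8\<close>.
\<close>

lemma regret_le: "regret d X z \<gamma> \<omega> (1 / real T) T R \<le> final_bound + 8"
proof -
  interpret P: prob_space \<Omega> by (rule prob_space_noise)
  define f where "f = (\<lambda>\<xi>. history_regret (hist (A.run (pull \<xi>) T)))"
  have reg: "regret d X z \<gamma> \<omega> (1 / real T) T R = (LINT \<xi>|\<Omega>. f \<xi>)"
    unfolding regret_def f_def sum_actions_eq_history_regret ..
  show ?thesis
  \<comment> \<open>The integral of a function that is not integrable is \<open>0\<close> by convention.\<close>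
  proof (cases "integrable \<Omega> f")
    case False
    then show ?thesis using reg final_bound_nonneg by (simp add: not_integrable_integral_eq)
  next
    case True
    have "(LINT \<xi>|\<Omega>. f \<xi>) \<le> (LINT \<xi>|\<Omega>. final_bound + 2 * real T * indicator failure \<xi>)"
    proof (rule integral_mono[OF True])
      show "integrable \<Omega> (\<lambda>\<xi>. final_bound + 2 * real T * indicator failure \<xi>)"
        using failure_prob(1) by (intro Bochner_Integration.integrable_add integrable_mult_right integrable_real_indicator) (auto simp: P.emeasure_eq_measure)
      fix \<xi> assume \<xi>: "\<xi> \<in> space \<Omega>"
      show "f \<xi> \<le> final_bound + 2 * real T * indicator failure \<xi>"
      proof (cases "\<xi> \<in> failure")
        case True
        then show ?thesis using history_regret_run_le[of "pull \<xi>"] final_bound_nonneg by (simp add: f_def)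
      next
        case False
        have "f \<xi> \<le> final_bound" unfolding f_def
          by (rule accurate_run_regret) (rule accurate_outside_failure[OF \<xi> False])
        then show ?thesis using False by simp
      qed
    qed
    also have "\<dots> = final_bound + 2 * real T * measure \<Omega> failure"
      using failure_prob(1) sets.sets_into_space[OF failure_prob(1)] P.prob_space
      by (subst Bochner_Integration.integral_add)
         (auto simp: P.emeasure_eq_measure Int_absorb2 intro!: integrable_mult_right integrable_real_indicator)
    also have "\<dots> \<le> final_bound + 2 * real T * (4 / real T)"
      using failure_prob(2) by (intro add_left_mono mult_left_mono) auto
    also have "\<dots> = final_bound + 8" using T_ge_2 by simp
    finally show ?thesis unfolding reg .
  qed
qed

definition action_term :: real where
  "action_term = real d * kappa_star powr (-1/3) * real T powr (1/3) * log_kT * ln (real T) powr (-1/3)"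

lemma action_term_nonneg: "0 \<le> action_term"
  unfolding action_term_def using log_kT_ge by simp

lemma powr_minus_third: "0 < y \<Longrightarrow> y powr (-1/3) = 1 / y powr (1/3)" for y :: real
proof -
  have "(-1/3 :: real) = - (1/3)" by simp
  then show "y powr (-1/3) = 1 / y powr (1/3)" by (simp only: powr_minus_divide)
qed

lemma main_times_action: "main_term * action_term = real d * log_kT * real T"
proof -
  have pos: "0 < kappa_star" "0 < real T" "0 < ln (real T)" using kappa_star_ge_1 T_ge_2 ln_T_ge by auto
  have "real T powr (2/3) * real T powr (1/3) = real T" using pos by (simp add: powr_add[symmetric])
  moreover have "main_term * action_term = (kappa_star powr (1/3) / kappa_star powr (1/3)) *
      (ln (real T) powr (1/3) / ln (real T) powr (1/3)) * (real T powr (2/3) * real T powr (1/3)) * (real d * log_kT)"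
    unfolding main_term_def action_term_def powr_minus_third[OF pos(1)] powr_minus_third[OF pos(3)]
    by (simp add: field_simps)
  ultimately show ?thesis using pos by simp
qed

text \<open>
  The inequality of the arithmetic and the geometric mean for the two factors in \<open>main_times_action\<close>.
\<close>

lemma sqrt_term_le: "sqrt_term \<le> main_term + action_term"
  unfolding sqrt_term_def
proof (rule real_le_lsqrt)
  have "real (d + 1) \<le> 2 * real d" using dim_pos by simp
  then have "real (d + 1) * (log_kT * real T) \<le> 2 * real d * (log_kT * real T)"
    using log_kT_ge by (intro mult_right_mono) auto
  also have "\<dots> = 2 * (main_term * action_term)" unfolding main_times_action by simp
  also have "\<dots> \<le> (main_term + action_term)\<^sup>2" by (simp add: power2_sum)
  finally show "real (d + 1) * log_kT * real T \<le> (main_term + action_term)\<^sup>2" by (simp add: mult.assoc)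
qed (use main_term_nonneg action_term_nonneg log_kT_ge in auto)

lemma main_term_cube: "main_term ^ 3 = kappa_star * (real T)\<^sup>2 * ln (real T)"
proof -
  have pos: "0 < kappa_star" "0 < real T" "0 < ln (real T)" using kappa_star_ge_1 T_ge_2 ln_T_ge by auto
  have "real T powr (2/3) = real T powr (1/3) * real T powr (1/3)" by (simp add: powr_add[symmetric])
  then have "(real T powr (2/3)) ^ 3 = (real T powr (1/3)) ^ 3 * (real T powr (1/3)) ^ 3"
    by (simp add: power_mult_distrib)
  then have "(real T powr (2/3)) ^ 3 = (real T)\<^sup>2"
    using powr_third_cube[of "real T"] by (simp add: power2_eq_square)
  then show ?thesis unfolding main_term_def power_mult_distrib
    using powr_third_cube[of kappa_star] powr_third_cube[of "ln (real T)"] pos by simp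
qed

lemma le_by_cubes: "x ^ 3 \<le> y ^ 3 \<Longrightarrow> 0 \<le> y \<Longrightarrow> x \<le> (y :: real)"
  by (rule power_le_imp_le_base[of x 2 y]) (simp_all add: eval_nat_numeral)

text \<open>
  The constant \<open>8\<close> from the failure event is absorbed by the main term, which is at least \<open>2 / 3\<close> because
  \<open>T \<ge> 2\<close> and \<open>kappa_star \<ge> 1\<close>.
\<close>

lemma eight_le_main_term: "8 \<le> 12 * main_term"
proof -
  have "(2 / 3) ^ 3 \<le> main_term ^ 3"
  proof -
    have "1 * 1 \<le> kappa_star * (real T)\<^sup>2"
      using kappa_star_ge_1 T_ge_2 by (intro mult_mono) (auto simp: one_le_power)
    then have "1 * (2 / 3) \<le> kappa_star * (real T)\<^sup>2 * ln (real T)"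
      using ln_T_ge by (intro mult_mono) auto
    then show ?thesis unfolding main_term_cube by (simp add: power3_eq_cube)
  qed
  then have "2 / 3 \<le> main_term" by (rule le_by_cubes[OF _ main_term_nonneg])
  then show ?thesis by simp
qed

definition log_term :: real where "log_term = max (real d) kappa_star * ln (real T)"

lemma regret_general:
  "regret d X z \<gamma> \<omega> (1 / real T) T R \<le> 22000 * (main_term + log_term + (real d)\<^sup>2 + action_term)"
proof -
  have d: "1 \<le> real d" using dim_pos by simp
  have "support_bound \<le> 3 * (real d)\<^sup>2"
  proof -
    have "real (d + 1) * real (d + 2) \<le> (2 * real d) * (3 * real d)" using d by (intro mult_mono) auto
    then show ?thesis by (simp add: support_bound_def power2_eq_square)
  qed
  moreover have "real (d + 1) * ln (real T) \<le> 2 * log_term"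
  proof -
    have "real (d + 1) \<le> 2 * max (real d) kappa_star" using d by (simp add: max_def)
    then have "real (d + 1) * ln (real T) \<le> 2 * max (real d) kappa_star * ln (real T)"
      using ln_T_ge by (intro mult_right_mono) auto
    then show ?thesis by (simp add: log_term_def)
  qed
  moreover have "0 \<le> log_term" unfolding log_term_def using ln_T_ge by (intro mult_nonneg_nonneg) auto
  ultimately show ?thesis
    using regret_le sqrt_term_le eight_le_main_term main_term_nonneg action_term_nonneg zero_le_power2[of "real d"]
    unfolding final_bound_def distrib_left by linarith
qed

text \<open>
  Each part of the condition on \<open>T\<close> compares one term of the general bound with the main term; all
  comparisons are made after taking cubes.
\<close>

lemma regret_large_horizon:
  assumes T: "max (max (max (real d) kappa_star powr (3/2) * ln (real T)) (real d ^ 3) / sqrt kappa_star)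
      ((real d * log_kT) ^ 3 / (kappa_star * ln (real T))\<^sup>2) \<le> real T"
  shows "regret d X z \<gamma> \<omega> (1 / real T) T R \<le> 110000 * main_term"
proof -
  let ?D = "max (real d) kappa_star" and ?\<kappa> = kappa_star and ?L = "ln (real T)"
  have pos: "0 < ?\<kappa>" "0 < real T" "0 < ?L" using kappa_star_ge_1 T_ge_2 ln_T_ge by auto
  have D: "0 < ?D" using pos by (simp add: less_max_iff_disj)
  have sq: "0 < sqrt ?\<kappa>" using pos by simp
  have T1: "?D powr (3/2) * ?L \<le> real T * sqrt ?\<kappa>" and T2: "real d ^ 3 \<le> real T * sqrt ?\<kappa>"
    using T sq by (simp_all add: divide_le_eq)
  have T3: "(real d * log_kT) ^ 3 / (?\<kappa> * ?L)\<^sup>2 \<le> real T" using T by simp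
  \<comment> \<open>In this form the first part of the condition on \<open>T\<close> can be inserted directly.\<close>
  have cube: "main_term ^ 3 = (real T * sqrt ?\<kappa>)\<^sup>2 * ?L"
    unfolding main_term_cube using pos by (simp add: power_mult_distrib)
  have "log_term \<le> main_term"
  proof (rule le_by_cubes)
    have "(?D powr (3/2))\<^sup>2 = ?D ^ 3"
    proof -
      have "(?D powr (3/2))\<^sup>2 = ?D powr (3/2) * ?D powr (3/2)" by (rule power2_eq_square)
      also have "\<dots> = ?D powr 3" by (simp add: powr_add[symmetric])
      also have "\<dots> = ?D ^ 3" using D by simp
      finally show ?thesis .
    qed
    then have "log_term ^ 3 = (?D powr (3/2) * ?L)\<^sup>2 * ?L"
      by (simp add: log_term_def power_mult_distrib power2_eq_square power3_eq_cube)
    also have "\<dots> \<le> main_term ^ 3" unfolding cube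
      using T1 pos by (intro mult_right_mono power_mono) auto
    finally show "log_term ^ 3 \<le> main_term ^ 3" .
  qed (rule main_term_nonneg)
  moreover have "(real d)\<^sup>2 \<le> 2 * main_term"
  proof (rule le_by_cubes)
    have "((real d)\<^sup>2) ^ 3 = (real d ^ 3)\<^sup>2" by (simp add: power_mult[symmetric])
    also have "\<dots> \<le> (real T * sqrt ?\<kappa>)\<^sup>2" using T2 by (intro power_mono) auto
    also have "\<dots> \<le> (real T * sqrt ?\<kappa>)\<^sup>2 * (8 * ?L)"
    proof -
      have "1 \<le> 8 * ?L" using ln_T_ge by simp
      from mult_left_mono[OF this, of "(real T * sqrt ?\<kappa>)\<^sup>2"] show ?thesis by simp
    qed
    also have "\<dots> = (2 * main_term) ^ 3" unfolding power_mult_distrib cube by simp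
    finally show "((real d)\<^sup>2) ^ 3 \<le> (2 * main_term) ^ 3" .
  qed (use main_term_nonneg in simp)
  moreover have "action_term \<le> main_term"
  proof -
    have m: "0 < main_term" unfolding main_term_def using pos by simp
    have "action_term = real d * log_kT * real T / main_term"
      using main_times_action m by (simp add: field_simps)
    moreover have "real d * log_kT * real T \<le> main_term\<^sup>2"
    proof (rule le_by_cubes)
      have "(real d * log_kT) ^ 3 \<le> real T * (?\<kappa> * ?L)\<^sup>2"
        using T3 pos by (simp add: divide_le_eq)
      then have "(real d * log_kT) ^ 3 * real T ^ 3 \<le> real T * (?\<kappa> * ?L)\<^sup>2 * real T ^ 3"
        by (rule mult_right_mono) simp
      also have "\<dots> = (main_term ^ 3)\<^sup>2"
        unfolding main_term_cube by (simp add: power_mult_distrib eval_nat_numeral mult_ac)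
      also have "\<dots> = (main_term\<^sup>2) ^ 3" by (simp add: power_mult[symmetric])
      finally show "(real d * log_kT * real T) ^ 3 \<le> (main_term\<^sup>2) ^ 3"
        by (simp add: power_mult_distrib)
    qed simp
    ultimately show ?thesis using m by (simp add: divide_le_eq power2_eq_square)
  qed
  ultimately have "22000 * (main_term + log_term + (real d)\<^sup>2 + action_term) \<le> 110000 * main_term"
  proof -
    have "22000 * (m + a + b + c) \<le> 110000 * m" if "a \<le> m" "b \<le> 2 * m" "c \<le> m" for m a b c :: real
      using that by simp
    then show "log_term \<le> main_term \<Longrightarrow> (real d)\<^sup>2 \<le> 2 * main_term \<Longrightarrow> action_term \<le> main_term \<Longrightarrow> ?thesis" .
  qed
  with regret_general show ?thesis by (rule order_trans)
qed

end

theorem theorem1: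
  "\<exists>C C' :: real. C > 0 \<and> C' > 0 \<and>
     (\<forall>(d :: nat) (X :: real vec set) (z :: real vec \<Rightarrow> int) (\<gamma> :: real vec) (\<omega> :: real)
        (T :: nat) (R :: choice_rules).
        biased_bandit d X z \<gamma> \<longrightarrow> T \<ge> 2 \<longrightarrow>
        action_set.valid_choices d X z R \<longrightarrow> action_set.measurable_choices X R \<longrightarrow>
        (let \<kappa> = action_set.kappa_star d X z;
             k = real (card X);
             R\<^sub>T = regret d X z \<gamma> \<omega> (1 / real T) T R
         in R\<^sub>T \<le> C * (\<kappa> powr (1/3) * real T powr (2/3) * ln (real T) powr (1/3)
                      + max (real d) \<kappa> * ln (real T)
                      + (real d)\<^sup>2
                      + real d * \<kappa> powr (-1/3) * real T powr (1/3) * ln (k * real T)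
                          * ln (real T) powr (-1/3)) \<and>
            (real T \<ge> max (max (max (real d) \<kappa> powr (3/2) * ln (real T)) (real d ^ 3) / sqrt \<kappa>)
                           ((real d * ln (k * real T)) ^ 3 / (\<kappa> * ln (real T))\<^sup>2) \<longrightarrow>
             R\<^sub>T \<le> C' * (\<kappa> powr (1/3) * real T powr (2/3) * ln (real T) powr (1/3)))))"
proof -
  have main: "regret d X z \<gamma> \<omega> (1 / real T) T R \<le> 22000 * (action_set.kappa_star d X z powr (1/3) * real T powr (2/3) * ln (real T) powr (1/3)
                      + max (real d) (action_set.kappa_star d X z) * ln (real T)
                      + (real d)\<^sup>2
                      + real d * action_set.kappa_star d X z powr (-1/3) * real T powr (1/3) * ln (real (card X) * real T)
                          * ln (real T) powr (-1/3)) \<and>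
      (real T \<ge> max (max (max (real d) (action_set.kappa_star d X z) powr (3/2) * ln (real T)) (real d ^ 3) / sqrt (action_set.kappa_star d X z))
                           ((real d * ln (real (card X) * real T)) ^ 3 / (action_set.kappa_star d X z * ln (real T))\<^sup>2) \<longrightarrow>
       regret d X z \<gamma> \<omega> (1 / real T) T R \<le> 110000 * (action_set.kappa_star d X z powr (1/3) * real T powr (2/3) * ln (real T) powr (1/3)))"
    if "biased_bandit d X z \<gamma>" "2 \<le> T" "action_set.valid_choices d X z R" "action_set.measurable_choices X R"
    for d :: nat and X :: "real vec set" and z :: "real vec \<Rightarrow> int" and \<gamma> :: "real vec" and \<omega> :: real
      and T :: nat and R :: choice_rules
  proof -
    interpret fpe_measurable d X z \<gamma> \<omega> T R
      using that by (intro fpe_measurable.intro fpe_setting.intro fpe_setting_axioms.intro fpe_measurable_axioms.intro)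
    show ?thesis
      using regret_general regret_large_horizon
      unfolding main_term_def log_term_def action_term_def log_kT_def by blast
  qed
  show ?thesis
    unfolding Let_def
    by (rule exI[of _ 22000], rule exI[of _ 110000], intro conjI allI impI)
       (simp, simp, (rule conjunct1[OF main]; assumption), (rule mp[OF conjunct2[OF main]]; assumption))
qed

end
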